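(* Let $L$ be an algebraically closed field of characteristic zero. Let $C\subset P^{2}(L)$ be a plane projective algebraic curve of order (degree) $n$ and class $m$, having $d$ nodes and no other singularities. Then $$n+m+2d=n^{2}.$$
   Context: A plane projective algebraic curve is an irreducible closed subvariety of dimension $1$ of $P^{2}(L)$. The class of $C$ is the number of its tangent lines passing through a generic point $Q\in P^{2}$. A branch of $C$ centred at $p$ is a point, lying over $p$, of a nonsingular projective model $C^{ns}\to C$; it is nonsingular if some line through $p$ meets the branch with multiplicity $1$. A node is a point of $C$ which is the origin of exactly two nonsingular branches with distinct tangent directions. *)

theory Defs
  imports
    "HOL-Analysis.Cartesian_Space"
    "HOL-Library.Poly_Mapping"
    "HOL-Library.Extended_Nat"
    "HOL-Computational_Algebra.Polynomial"
begin

section \<open>Projective space\<close>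

text \<open>
  The index type of the coordinates carries the dimension: \<open>('a, 'n) proj\<close> is the
  projective space of dimension \<open>CARD('n) - 1\<close> over \<open>'a\<close>.  In particular
  \<open>('a, 3) proj\<close> is the plane.
\<close>

definition proj_rel :: "'a::field ^ 'n \<Rightarrow> 'a ^ 'n \<Rightarrow> bool" where
  "proj_rel v w \<longleftrightarrow> v \<noteq> 0 \<and> w \<noteq> 0 \<and> (\<exists>c. c \<noteq> 0 \<and> w = c *s v)"

lemma part_equivp_proj_rel: "part_equivp (proj_rel :: 'a::field ^ 'n \<Rightarrow> 'a ^ 'n \<Rightarrow> bool)"
proof (rule part_equivpI)
  have "(1::'a^'n) \<noteq> 0"
    by (simp add: vec_eq_iff)
  then show "\<exists>v::'a^'n. proj_rel v v"
    unfolding proj_rel_def by (metis vec.scale_one zero_neq_one)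
  show "symp (proj_rel :: 'a ^ 'n \<Rightarrow> 'a ^ 'n \<Rightarrow> bool)"
  proof (rule sympI)
    fix v w :: "'a ^ 'n"
    assume "proj_rel v w"
    then obtain c where c: "v \<noteq> 0" "w \<noteq> 0" "c \<noteq> 0" "w = c *s v"
      unfolding proj_rel_def by blast
    then have "v = inverse c *s w" by simp
    with c show "proj_rel w v"
      unfolding proj_rel_def by (metis inverse_nonzero_iff_nonzero)
  qed
  show "transp (proj_rel :: 'a ^ 'n \<Rightarrow> 'a ^ 'n \<Rightarrow> bool)"
    unfolding proj_rel_def
    by (rule transpI) (metis vec.scale_scale no_zero_divisors)
qed

quotient_type (overloaded) ('a, 'n) proj = "('a::field) ^ ('n::finite)" / partial: proj_rel
  by (rule part_equivp_proj_rel)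

definition hcoords :: "'a::field ^ 'n \<Rightarrow> ('a, 'n::finite) proj \<Rightarrow> bool" where
  "hcoords v x \<longleftrightarrow> v \<noteq> 0 \<and> abs_proj v = x"

section \<open>Polynomials and closed sets\<close>

type_synonym ('a, 'n) mpoly = "('n \<Rightarrow>\<^sub>0 nat) \<Rightarrow>\<^sub>0 'a"

definition mconst :: "'a::zero \<Rightarrow> ('a, 'n) mpoly" where
  "mconst c = Poly_Mapping.single 0 c"

definition meval :: "('a::comm_ring_1, 'n::finite) mpoly \<Rightarrow> 'a ^ 'n \<Rightarrow> 'a" where
  "meval f v = (\<Sum>m\<in>Poly_Mapping.keys f.
     Poly_Mapping.lookup f m * (\<Prod>i\<in>UNIV. (v $ i) ^ Poly_Mapping.lookup m i))"

definition mderiv :: "'n::finite \<Rightarrow> ('a::comm_ring_1, 'n) mpoly \<Rightarrow> ('a, 'n) mpoly" where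
  "mderiv i f = (\<Sum>m\<in>Poly_Mapping.keys f.
     Poly_Mapping.single (m - Poly_Mapping.single i 1)
       (of_nat (Poly_Mapping.lookup m i) * Poly_Mapping.lookup f m))"

text \<open>The zero polynomial is homogeneous of every degree.\<close>

definition homogeneous :: "nat \<Rightarrow> ('a::comm_ring_1, 'n::finite) mpoly \<Rightarrow> bool" where
  "homogeneous e f \<longleftrightarrow>
     (\<forall>m\<in>Poly_Mapping.keys f. (\<Sum>i\<in>UNIV. Poly_Mapping.lookup m i) = e)"

definition vanishes_at :: "('a::field, 'n::finite) mpoly \<Rightarrow> ('a, 'n) proj \<Rightarrow> bool" where
  "vanishes_at f x \<longleftrightarrow> (\<forall>v. hcoords v x \<longrightarrow> meval f v = 0)"

text \<open>
  Since vanishing is required on all homogeneous coordinates, over an infinite field every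
  homogeneous component of a member of the following ideal again belongs to it; this is the
  usual homogeneous ideal of a nonempty set.
\<close>

definition vanishing_ideal :: "('a::field, 'n::finite) proj set \<Rightarrow> ('a, 'n) mpoly set" where
  "vanishing_ideal X = {f. \<forall>x\<in>X. vanishes_at f x}"

definition zclosed :: "('a::field, 'n::finite) proj set \<Rightarrow> bool" where
  "zclosed X \<longleftrightarrow>
     (\<exists>S. (\<forall>f\<in>S. \<exists>e. homogeneous e f) \<and> X = {x. \<forall>f\<in>S. vanishes_at f x})"

definition zopen :: "('a::field, 'n::finite) proj set \<Rightarrow> bool" where
  "zopen U \<longleftrightarrow> zclosed (- U)"

definition irreducible_closed :: "('a::field, 'n::finite) proj set \<Rightarrow> bool" where
  "irreducible_closed X \<longleftrightarrow> zclosed X \<and> X \<noteq> {} \<and>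
     (\<forall>A B. zclosed A \<and> zclosed B \<and> X = A \<union> B \<longrightarrow> X = A \<or> X = B)"

definition zdim :: "('a::field, 'n::finite) proj set \<Rightarrow> enat" where
  "zdim X = Sup {enat k |k. \<exists>Z :: nat \<Rightarrow> ('a, 'n) proj set.
     (\<forall>i\<le>k. irreducible_closed (Z i) \<and> Z i \<subseteq> X) \<and> (\<forall>i<k. Z i \<subset> Z (Suc i))}"

section \<open>Projective curves and their nonsingular models\<close>

definition projective_curve :: "('a::field, 'n::finite) proj set \<Rightarrow> bool" where
  "projective_curve X \<longleftrightarrow> irreducible_closed X \<and> zdim X = 1"

definition curve_order :: "('a::field, 3) proj set \<Rightarrow> nat \<Rightarrow> bool" where
  "curve_order C n \<longleftrightarrow>
     (\<exists>F. F \<noteq> 0 \<and> homogeneous n F \<and> vanishing_ideal C = {G. F dvd G})"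

text \<open>
  Jacobian criterion.  The space below is the tangent space to the affine cone over the curve,
  whose dimension exceeds that of the projective tangent space by one.
\<close>

definition nonsingular_at :: "('a::field, 'n::finite) proj set \<Rightarrow> ('a, 'n) proj \<Rightarrow> bool" where
  "nonsingular_at X x \<longleftrightarrow> (\<forall>v. hcoords v x \<longrightarrow>
     vec.dim {w :: 'a ^ 'n. \<forall>f\<in>vanishing_ideal X.
                (\<Sum>i\<in>UNIV. meval (mderiv i f) v * w $ i) = 0} = 2)"

text \<open>
  \<open>represents e G f A\<close>: on \<open>A\<close> the map \<open>f\<close> is given by the forms \<open>G i\<close> of degree \<open>e\<close>, which
  have no common zero there (\<open>hcoords\<close> includes being nonzero).
\<close>

definition represents :: "nat \<Rightarrow> ('k \<Rightarrow> ('a::field, 'n) mpoly) \<Rightarrow>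
    (('a, 'n::finite) proj \<Rightarrow> ('a, 'k::finite) proj) \<Rightarrow> ('a, 'n) proj set \<Rightarrow> bool" where
  "represents e G f A \<longleftrightarrow> (\<forall>i. homogeneous e (G i)) \<and>
     (\<forall>y\<in>A. \<forall>v. hcoords v y \<longrightarrow> hcoords (\<chi> i. meval (G i) v) (f y))"

definition regular_on :: "('a::field, 'n::finite) proj set \<Rightarrow>
    (('a, 'n) proj \<Rightarrow> ('a, 'k::finite) proj) \<Rightarrow> bool" where
  "regular_on A f \<longleftrightarrow>
     (\<forall>x\<in>A. \<exists>U e G. zopen U \<and> x \<in> U \<and> represents e G f (A \<inter> U))"

definition birational_morphism :: "('a::field, 'n::finite) proj set \<Rightarrow>
    (('a, 'n) proj \<Rightarrow> ('a, 'k::finite) proj) \<Rightarrow> ('a, 'k) proj set \<Rightarrow> bool" where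
  "birational_morphism D \<phi> C \<longleftrightarrow> regular_on D \<phi> \<and> \<phi> ` D \<subseteq> C \<and>
     (\<exists>U V \<psi>. zopen U \<and> zopen V \<and> D \<inter> U \<noteq> {} \<and> \<phi> ` (D \<inter> U) = C \<inter> V \<and>
        regular_on (C \<inter> V) \<psi> \<and> (\<forall>x\<in>D \<inter> U. \<psi> (\<phi> x) = x))"

definition nonsingular_model :: "('a::field, 'n::finite) proj set \<Rightarrow>
    (('a, 'n) proj \<Rightarrow> ('a, 'k::finite) proj) \<Rightarrow> ('a, 'k) proj set \<Rightarrow> bool" where
  "nonsingular_model D \<phi> C \<longleftrightarrow>
     projective_curve D \<and> (\<forall>x\<in>D. nonsingular_at D x) \<and> birational_morphism D \<phi> C"

section \<open>Branches\<close>

text \<open>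
  Throughout, \<open>\<phi>\<close> maps a nonsingular model \<open>D\<close> onto a plane curve \<open>C\<close>; the branches of \<open>C\<close>
  centred at \<open>p\<close> are the points \<open>q\<close> of \<open>D\<close> with \<open>\<phi> q = p\<close>.
\<close>

interpretation ideal: module "(*) :: 'r::comm_ring_1 \<Rightarrow> 'r \<Rightarrow> 'r"
  by standard (simp_all add: algebra_simps)

fun ideal_power :: "'r::comm_ring_1 set \<Rightarrow> nat \<Rightarrow> 'r set" where
  "ideal_power I 0 = UNIV"
| "ideal_power I (Suc k) = ideal.span {a * b |a b. a \<in> I \<and> b \<in> ideal_power I k}"

text \<open>
  Let \<open>\<mm>\<close> be the maximal ideal of the local ring of \<open>D\<close> at \<open>q\<close>, and let \<open>H\<close> and \<open>g\<close> be forms of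
  the same degree with \<open>g q \<noteq> 0\<close>.  Clearing denominators, \<open>H / g \<in> \<mm> ^ k\<close> means
  that \<open>s * H\<close> lies in \<open>I(q) ^ k + I(D)\<close> for some form \<open>s\<close> not vanishing at \<open>q\<close>;
  this does not depend on \<open>g\<close>.
\<close>

definition order_ge :: "('a::field, 'n::finite) proj set \<Rightarrow> ('a, 'n) proj \<Rightarrow>
    ('a, 'n) mpoly \<Rightarrow> nat \<Rightarrow> bool" where
  "order_ge D q H k \<longleftrightarrow> (\<exists>s e. homogeneous e s \<and> \<not> vanishes_at s q \<and>
     s * H \<in> {a + b |a b. a \<in> ideal_power (vanishing_ideal {q}) k \<and> b \<in> vanishing_ideal D})"

definition pline :: "'a::field ^ 3 \<Rightarrow> ('a, 3) proj set" where
  "pline a = {x. \<forall>v. hcoords v x \<longrightarrow> (\<Sum>i\<in>UNIV. a $ i * v $ i) = 0}"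

definition is_line :: "('a::field, 3) proj set \<Rightarrow> bool" where
  "is_line l \<longleftrightarrow> (\<exists>a. a \<noteq> 0 \<and> l = pline a)"

text \<open>
  The multiplicity with which the branch \<open>q\<close> meets \<open>l\<close> is the order at \<open>q\<close> of the pullback to \<open>D\<close>
  of the equation of \<open>l\<close>; it is infinite if \<open>C\<close> is \<open>l\<close> itself.
\<close>

definition branch_mult :: "('a::field, 'n::finite) proj set \<Rightarrow>
    (('a, 'n) proj \<Rightarrow> ('a, 3) proj) \<Rightarrow> ('a, 'n) proj \<Rightarrow> ('a, 3) proj set \<Rightarrow> enat" where
  "branch_mult D \<phi> q l = Sup {enat k |k. \<exists>a U e G.
     a \<noteq> 0 \<and> l = pline a \<and> zopen U \<and> q \<in> U \<and> represents e G \<phi> (D \<inter> U) \<and>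
     order_ge D q (\<Sum>i\<in>UNIV. mconst (a $ i) * G i) k}"

definition nonsingular_branch :: "('a::field, 'n::finite) proj set \<Rightarrow>
    (('a, 'n) proj \<Rightarrow> ('a, 3) proj) \<Rightarrow> ('a, 'n) proj \<Rightarrow> bool" where
  "nonsingular_branch D \<phi> q \<longleftrightarrow> (\<exists>l. is_line l \<and> \<phi> q \<in> l \<and> branch_mult D \<phi> q l = 1)"

text \<open>
  The tangent line of a branch, singular or not, is the line through its origin which meets it
  with more than the minimal multiplicity.
\<close>

definition branch_tangent :: "('a::field, 'n::finite) proj set \<Rightarrow>
    (('a, 'n) proj \<Rightarrow> ('a, 3) proj) \<Rightarrow> ('a, 'n) proj \<Rightarrow> ('a, 3) proj set \<Rightarrow> bool" where
  "branch_tangent D \<phi> q l \<longleftrightarrow> is_line l \<and> \<phi> q \<in> l \<and>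
     (\<exists>l'. is_line l' \<and> \<phi> q \<in> l' \<and> branch_mult D \<phi> q l' < branch_mult D \<phi> q l)"

definition node :: "('a::field, 'n::finite) proj set \<Rightarrow>
    (('a, 'n) proj \<Rightarrow> ('a, 3) proj) \<Rightarrow> ('a, 3) proj \<Rightarrow> bool" where
  "node D \<phi> p \<longleftrightarrow> (\<exists>q1 q2. q1 \<noteq> q2 \<and> {q \<in> D. \<phi> q = p} = {q1, q2} \<and>
     nonsingular_branch D \<phi> q1 \<and> nonsingular_branch D \<phi> q2 \<and>
     (\<exists>l1 l2. branch_tangent D \<phi> q1 l1 \<and> branch_tangent D \<phi> q2 l2 \<and> l1 \<noteq> l2))"

text \<open>Generic means: in some nonempty Zariski open subset of the plane.\<close>

definition curve_class :: "('a::field, 'n::finite) proj set \<Rightarrow>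
    (('a, 'n) proj \<Rightarrow> ('a, 3) proj) \<Rightarrow> nat \<Rightarrow> bool" where
  "curve_class D \<phi> m \<longleftrightarrow> (\<exists>U. zopen U \<and> U \<noteq> {} \<and>
     (\<forall>Q\<in>U. finite {l. Q \<in> l \<and> (\<exists>q\<in>D. branch_tangent D \<phi> q l)} \<and>
             card {l. Q \<in> l \<and> (\<exists>q\<in>D. branch_tangent D \<phi> q l)} = m))"

end

theory Submission
  imports
    "HOL-Algebra.Algebraic_Closure_Type"
    Defs
    "HOL-Computational_Algebra.Computational_Algebra"
    "HOL-Analysis.Determinants"
begin

text \<open>
  Project the curve from a generic point \<open>Q\<close>.  In affine coordinates \<open>t\<close>, \<open>z\<close> with \<open>Q\<close> as the point at
  infinity of the \<open>z\<close>-axis, the equation of the curve becomes a monic polynomial \<open>f\<close> of degree \<open>n\<close> in \<open>z\<close>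
  over the polynomials in \<open>t\<close>.  Let \<open>Z\<close> be the set of its roots in an algebraic closure of the field of
  rational functions.  The discriminant, the product of the derivatives \<open>f'(z)\<close> over \<open>z \<in> Z\<close>, is a
  polynomial in \<open>t\<close>.  Its degree is \<open>n (n - 1)\<close>, as the line at infinity meets the curve in \<open>n\<close> distinct
  points.  Its order at \<open>t0\<close> is read off from a place of the closure centred at \<open>t0\<close>: it is \<open>1\<close> if the line
  \<open>t = t0\<close> is tangent to the curve at a smooth point, which is then not a flex, it is \<open>2\<close> if this line passes
  through a node, where the two roots involved differ by a local parameter at \<open>t0\<close> times a unit, and \<open>0\<close>
  otherwise.  As \<open>Q\<close> is generic, at most one of these things happens on every line, and counting zeros gives
  \<open>n (n - 1) = m + 2 d\<close>.

  Flexes are zeros of the Hessian, which does not vanish identically on the curve since \<open>n \<ge> 2\<close>.  That only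
  finitely many lines are tangent at two points follows from biduality.  Branches enter through the points
  of the nonsingular model with coordinates in the closure, which specialise along the place.
\<close>

text \<open>As a simp rule, the associativity law coming from the interpretation of modules loops with
  the usual ordered rewriting rules for products.\<close>

declare ideal.scale_scale [simp del]

text \<open>The branches are points of an abstract nonsingular curve, while the discriminant sees
  only roots of an equation. The bridge is that a root \<open>z\<close> gives a generic point of the
  plane curve with coordinates in the closure. The inverse of the birational map turns it into a
  generic point of the model, and dividing by a coordinate of least value makes it specialise along
  the place, as in the valuative criterion of properness. A place of an algebraically closed field
  has a divisible value group, so there is no uniformiser to compute with. Local statements are
  therefore phrased as divisibility in the valuation ring, with \<open>t - t0\<close> as yardstick.
  Two tools carry the weight: a Nakayama argument, and the fact that an element divisible by all
  powers of a non-unit is 0. Nonsingularity of the model enters where the roots over a node must be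
  told apart: a branch transversal to the vertical line carries at most one root, so two roots over
  a node lie on different branches, and the different tangents then fix the order of their
  difference.\<close>

locale rhom =
  fixes h :: "'a::comm_ring_1 \<Rightarrow> 'b::comm_ring_1"
  assumes add: "h (x + y) = h x + h y"
    and mult: "h (x * y) = h x * h y"
    and one: "h 1 = 1"
begin

lemma zero: "h 0 = 0"
  using add[of 0 0] by simp

lemma uminus: "h (- x) = - h x"
  using add[of x "- x"] zero by (simp add: eq_neg_iff_add_eq_0 add.commute)

lemma diff: "h (x - y) = h x - h y"
  using add[of x "- y"] uminus by simp

lemma sum: "h (sum f S) = (\<Sum>x\<in>S. h (f x))"
  by (induction S rule: infinite_finite_induct) (simp_all add: zero add)

lemma prod: "h (prod f S) = (\<Prod>x\<in>S. h (f x))"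
  by (induction S rule: infinite_finite_induct) (simp_all add: one mult)

lemma power: "h (x ^ k) = h x ^ k"
  by (induction k) (simp_all add: one mult)

lemma of_nat: "h (of_nat k) = of_nat k"
  by (induction k) (simp_all add: zero one add)

lemma coeff_map: "coeff (map_poly h p) i = h (coeff p i)"
  by (simp add: coeff_map_poly zero)

lemma map_poly_rhom: "rhom (map_poly h)"
  by standard (auto intro!: poly_eqI simp: coeff_map add mult one coeff_mult sum zero coeff_pCons
      one_pCons split: nat.split)

lemma poly_map_poly_rhom: "rhom (\<lambda>p. poly (map_poly h p) x)"
proof -
  interpret m: rhom "map_poly h" by (rule map_poly_rhom)
  show ?thesis by standard (simp_all add: m.add m.mult m.one)
qed

lemma map_poly_pCons: "map_poly h (pCons c p) = pCons (h c) (map_poly h p)"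
  by (rule poly_eqI) (simp add: coeff_map coeff_pCons split: nat.split)

end

lemma rhom_comp: "rhom g \<Longrightarrow> rhom h \<Longrightarrow> rhom (\<lambda>x. g (h x))"
  unfolding rhom_def by simp

lemma rhom_ident: "rhom (\<lambda>x. x)"
  by standard auto

lemma rhom_poly: "rhom (\<lambda>p. poly p x)"
  by standard auto

lemma rhom_pconst: "rhom (\<lambda>c. [:c:])"
  by standard (auto simp: one_pCons)

section \<open>Polynomials in several variables\<close>

definition mvar :: "'n \<Rightarrow> ('a::comm_ring_1, 'n) mpoly" where
  "mvar i = Poly_Mapping.single (Poly_Mapping.single i 1) 1"

abbreviation mdeg :: "('n::finite \<Rightarrow>\<^sub>0 nat) \<Rightarrow> nat" where
  "mdeg m \<equiv> \<Sum>i\<in>UNIV. Poly_Mapping.lookup m i"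

text \<open>Coefficients are moved by \<open>h\<close>, variables go to \<open>v\<close>. One
  function thus covers values (\<open>h\<close> the identity), substitution of polynomials
  (\<open>h = mconst\<close>), restriction to an affine plane, and values at points over the
  closure.\<close>

definition evalh :: "('a::comm_ring_1 \<Rightarrow> 'b::comm_ring_1) \<Rightarrow> ('a, 'n::finite) mpoly \<Rightarrow> ('n \<Rightarrow> 'b) \<Rightarrow> 'b" where
  "evalh h f v = (\<Sum>m\<in>Poly_Mapping.keys f.
     h (Poly_Mapping.lookup f m) * (\<Prod>i\<in>UNIV. v i ^ Poly_Mapping.lookup m i))"

lemma meval_evalh: "meval f v = evalh (\<lambda>x. x) f (\<lambda>i. v $ i)"
  by (simp add: meval_def evalh_def)

lemma mpoly_sum_monomials:
  "f = (\<Sum>m\<in>Poly_Mapping.keys f. Poly_Mapping.single m (Poly_Mapping.lookup f m))"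
proof (rule poly_mapping_eqI)
  fix k
  have "Poly_Mapping.lookup (\<Sum>m\<in>Poly_Mapping.keys f. Poly_Mapping.single m (Poly_Mapping.lookup f m)) k
      = (\<Sum>m\<in>Poly_Mapping.keys f. if m = k then Poly_Mapping.lookup f m else 0)"
    unfolding lookup_sum by (rule sum.cong) (auto simp: lookup_single when_def)
  also have "\<dots> = Poly_Mapping.lookup f k"
    by (simp add: in_keys_iff)
  finally show "Poly_Mapping.lookup f k = Poly_Mapping.lookup
      (\<Sum>m\<in>Poly_Mapping.keys f. Poly_Mapping.single m (Poly_Mapping.lookup f m)) k" by simp
qed

lemma mpoly_monomial_induct [case_names single add]:
  fixes f :: "('a::comm_ring_1, 'n::finite) mpoly"
  assumes s: "\<And>m c. P (Poly_Mapping.single m c)" and a: "\<And>f g. P f \<Longrightarrow> P g \<Longrightarrow> P (f + g)"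
  shows "P f"
proof -
  have P0: "P 0" using s[of 0 0] by simp
  have "P (\<Sum>m\<in>S. Poly_Mapping.single m (Poly_Mapping.lookup f m))" for S
    by (induction S rule: infinite_finite_induct) (auto simp: P0 s a)
  from this[of "Poly_Mapping.keys f"] show ?thesis using mpoly_sum_monomials[of f] by simp
qed

lemma homogeneous_induct [consumes 1, case_names zero single add]:
  assumes hom: "homogeneous e f"
    and z: "P 0"
    and s: "\<And>m c. mdeg m = e \<Longrightarrow> P (Poly_Mapping.single m c)"
    and a: "\<And>f g. P f \<Longrightarrow> P g \<Longrightarrow> P (f + g)"
  shows "P f"
proof -
  have "S \<subseteq> Poly_Mapping.keys f \<Longrightarrow> P (\<Sum>m\<in>S. Poly_Mapping.single m (Poly_Mapping.lookup f m))" for S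
    using hom
    by (induction S rule: infinite_finite_induct) (auto simp: z homogeneous_def intro!: a s)
  from this[of "Poly_Mapping.keys f"] show ?thesis using mpoly_sum_monomials[of f] by simp
qed

lemma mdeg_decompose:
  assumes "mdeg (m::'n::finite \<Rightarrow>\<^sub>0 nat) = Suc k"
  obtains m' i where "m = m' + Poly_Mapping.single i 1" "mdeg m' = k"
proof -
  have "\<exists>i. Poly_Mapping.lookup m i \<noteq> 0"
    using assms by (metis (mono_tags, lifting) nat.distinct(1) sum.neutral)
  then obtain i where i: "Poly_Mapping.lookup m i \<noteq> 0" by blast
  define m' where "m' = m - Poly_Mapping.single i 1"
  have m: "m = m' + Poly_Mapping.single i 1"
    unfolding m'_def using i
    by (intro poly_mapping_eqI) (auto simp: lookup_add lookup_minus lookup_single when_def)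
  have "mdeg m = mdeg m' + (\<Sum>j\<in>UNIV. Poly_Mapping.lookup (Poly_Mapping.single i (1::nat)) j)"
    by (subst m) (simp add: lookup_add sum.distrib)
  also have "(\<Sum>j\<in>UNIV. Poly_Mapping.lookup (Poly_Mapping.single i (1::nat)) j) = 1"
    by (simp add: lookup_single when_def)
  finally show ?thesis using m assms that[of m' i] by simp
qed

lemma mpoly_induct [case_names const var add mult]:
  fixes f :: "('a::comm_ring_1, 'n::finite) mpoly"
  assumes c: "\<And>c. P (mconst c)" and v: "\<And>i. P (mvar i)"
    and a: "\<And>f g. P f \<Longrightarrow> P g \<Longrightarrow> P (f + g)" and m: "\<And>f g. P f \<Longrightarrow> P g \<Longrightarrow> P (f * g)"
  shows "P f"
proof (induction f rule: mpoly_monomial_induct)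
  case (single mm cc)
  show ?case
  proof (induction "mdeg mm" arbitrary: mm)
    case 0
    then have "mm = 0" by (intro poly_mapping_eqI) simp
    then show ?case using c[of cc] by (simp add: mconst_def)
  next
    case (Suc k)
    from Suc(2)[symmetric] obtain m' i where *: "mm = m' + Poly_Mapping.single i 1" "mdeg m' = k"
      by (rule mdeg_decompose)
    have "Poly_Mapping.single mm cc = Poly_Mapping.single m' cc * mvar i"
      by (simp add: * mvar_def mult_single)
    then show ?case using m v Suc(1)[OF *(2)[symmetric]] by simp
  qed
qed (rule a)

lemma mconst_simps: "mconst (x + y) = mconst x + mconst y" "mconst (x * y) = mconst x * mconst y"
    "mconst 1 = 1" "mconst 0 = 0" "mconst (- x) = - mconst x"
  for x y :: "'a::comm_ring_1"
  by (simp_all add: mconst_def single_add mult_single single_uminus)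

lemma rhom_mconst: "rhom (mconst :: 'a::comm_ring_1 \<Rightarrow> ('a,'n) mpoly)"
  by standard (simp_all add: mconst_simps)

context rhom
begin

lemma evalh_superset:
  assumes "finite S" "Poly_Mapping.keys f \<subseteq> S"
  shows "evalh h f v = (\<Sum>m\<in>S.
     h (Poly_Mapping.lookup f m) * (\<Prod>i\<in>UNIV. v i ^ Poly_Mapping.lookup m i))"
  unfolding evalh_def
  by (rule sum.mono_neutral_left) (use assms zero in \<open>auto simp: in_keys_iff\<close>)

lemma evalh_add: "evalh h (f + g) v = evalh h f v + evalh h g v"
proof -
  let ?S = "Poly_Mapping.keys f \<union> Poly_Mapping.keys g"
  have "Poly_Mapping.keys (f + g) \<subseteq> ?S" by (rule keys_add)
  then show ?thesis
    by (simp add: evalh_superset[of ?S] lookup_add add algebra_simps sum.distrib)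
qed

lemma evalh_single: "evalh h (Poly_Mapping.single m c) v = h c * (\<Prod>i\<in>UNIV. v i ^ Poly_Mapping.lookup m i)"
  by (subst evalh_superset[of "{m}"]) auto

lemma evalh_mult: "evalh h (f * g) v = evalh h f v * evalh h g v"
proof (induction f rule: mpoly_monomial_induct)
  case (single m c)
  show ?case
  proof (induction g rule: mpoly_monomial_induct)
    case (single m' c')
    show ?case
      unfolding mult_single evalh_single mult lookup_add power_add prod.distrib by (simp only: mult_ac)
  next
    case (add g g')
    then show ?case by (simp only: distrib_left evalh_add)
  qed
next
  case (add f f')
  then show ?case by (simp only: distrib_right evalh_add)
qed

lemma evalh_mconst: "evalh h (mconst c) v = h c"
  by (simp add: mconst_def evalh_single)

lemma evalh_mvar: "evalh h (mvar i) v = v i"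
proof -
  have "(\<Prod>j\<in>UNIV. v j ^ Poly_Mapping.lookup (Poly_Mapping.single i (1::nat)) j) = (\<Prod>j\<in>UNIV. if j = i then v i else 1)"
    by (rule prod.cong) (auto simp: lookup_single when_def)
  then show ?thesis by (simp add: mvar_def evalh_single one)
qed

lemma rhom_evalh: "rhom (\<lambda>f. evalh h f v)"
  by standard (auto simp: evalh_add evalh_mult evalh_mconst[of 1, unfolded mconst_simps] one)

lemma evalh_comp:
  assumes "rhom g"
  shows "g (evalh h f v) = evalh (\<lambda>x. g (h x)) f (\<lambda>i. g (v i))"
proof -
  interpret g: rhom g by fact
  show ?thesis unfolding evalh_def by (simp add: g.sum g.mult g.prod g.power)
qed

end

lemma evalh_subst:
  assumes "rhom h"
  shows "evalh h (evalh mconst f u) v = evalh h f (\<lambda>i. evalh h (u i) v)"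
proof -
  interpret rhom h by fact
  have "evalh h (evalh mconst f u) v = evalh (\<lambda>x. evalh h (mconst x) v) f (\<lambda>i. evalh h (u i) v)"
    by (rule rhom.evalh_comp[OF rhom_mconst rhom_evalh])
  then show ?thesis by (simp add: evalh_mconst)
qed

interpretation ev_id: rhom "\<lambda>x::'a::comm_ring_1. x" by (rule rhom_ident)

lemma rhom_meval: "rhom (\<lambda>f. meval f v)"
  unfolding meval_evalh by (rule ev_id.rhom_evalh)

interpretation mev: rhom "\<lambda>f. meval f v" for v :: "'a::comm_ring_1 ^ 'n::finite"
  by (rule rhom_meval)

lemma meval_mconst [simp]: "meval (mconst c) v = c"
  by (simp add: meval_evalh ev_id.evalh_mconst)

lemma meval_mvar [simp]: "meval (mvar i) v = v $ i"
  by (simp add: meval_evalh ev_id.evalh_mvar)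

lemma mderiv_superset:
  assumes "finite S" "Poly_Mapping.keys f \<subseteq> S"
  shows "mderiv i f = (\<Sum>m\<in>S. Poly_Mapping.single (m - Poly_Mapping.single i 1)
       (of_nat (Poly_Mapping.lookup m i) * Poly_Mapping.lookup f m))"
  unfolding mderiv_def
  by (rule sum.mono_neutral_left) (use assms in \<open>auto simp: in_keys_iff\<close>)

lemma mderiv_add: "mderiv i (f + g) = mderiv i f + mderiv i g"
proof -
  let ?S = "Poly_Mapping.keys f \<union> Poly_Mapping.keys g"
  have "Poly_Mapping.keys (f + g) \<subseteq> ?S" by (rule keys_add)
  then show ?thesis
    by (simp add: mderiv_superset[of ?S] lookup_add algebra_simps sum.distrib single_add)
qed

lemma mderiv_single: "mderiv i (Poly_Mapping.single m c) =
   Poly_Mapping.single (m - Poly_Mapping.single i 1) (of_nat (Poly_Mapping.lookup m i) * c)"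
  by (subst mderiv_superset[of "{m}"]) auto

lemma mderiv_mconst [simp]: "mderiv i (mconst c) = 0"
  by (simp add: mconst_def mderiv_single)

lemma mderiv_0 [simp]: "mderiv i 0 = 0"
  using mderiv_mconst[of i 0] by (simp add: mconst_simps)

lemma mderiv_mvar: "mderiv i (mvar j) = (if i = j then 1 else 0)"
  by (auto simp: mvar_def mderiv_single lookup_single)

lemma mderiv_mult: "mderiv i (f * g) = mderiv i f * g + f * mderiv i g"
proof (induction f rule: mpoly_monomial_induct)
  case (single m c)
  show ?case
  proof (induction g rule: mpoly_monomial_induct)
    case (single m' c')
    let ?e = "Poly_Mapping.single i (1::nat)"
    have 1: "Poly_Mapping.single (m - ?e + m') (of_nat (Poly_Mapping.lookup m i) * c * c')
        = Poly_Mapping.single (m + m' - ?e) (of_nat (Poly_Mapping.lookup m i) * c * c')"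
    proof (cases "Poly_Mapping.lookup m i = 0")
      case False
      have "m - ?e + m' = m + m' - ?e"
        by (rule poly_mapping_eqI) (use False in \<open>auto simp: lookup_add lookup_minus lookup_single when_def\<close>)
      then show ?thesis by simp
    qed simp
    have 2: "Poly_Mapping.single (m + (m' - ?e)) (c * (of_nat (Poly_Mapping.lookup m' i) * c'))
        = Poly_Mapping.single (m + m' - ?e) (c * (of_nat (Poly_Mapping.lookup m' i) * c'))"
    proof (cases "Poly_Mapping.lookup m' i = 0")
      case False
      have "m + (m' - ?e) = m + m' - ?e"
        by (rule poly_mapping_eqI) (use False in \<open>auto simp: lookup_add lookup_minus lookup_single when_def\<close>)
      then show ?thesis by simp
    qed simp
    show ?case
      unfolding mderiv_single mult_single 1 2 single_add[symmetric] lookup_add of_nat_add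
      by (simp only: distrib_left distrib_right mult_ac)
  next
    case (add g g')
    then show ?case by (simp only: distrib_left mderiv_add add_ac)
  qed
next
  case (add f f')
  then show ?case by (simp only: distrib_right mderiv_add add_ac)
qed

lemma mderiv_commute: "mderiv i (mderiv j f) = mderiv j (mderiv i f)"
proof (induction f rule: mpoly_monomial_induct)
  case (single m c)
  show ?case
  proof (cases "i = j")
    case False
    have e: "m - Poly_Mapping.single i (1::nat) - Poly_Mapping.single j 1
        = m - Poly_Mapping.single j 1 - Poly_Mapping.single i 1"
      by (rule poly_mapping_eqI) (simp only: lookup_minus)
    have l: "Poly_Mapping.lookup (m - Poly_Mapping.single i (1::nat)) j = Poly_Mapping.lookup m j"
        "Poly_Mapping.lookup (m - Poly_Mapping.single j (1::nat)) i = Poly_Mapping.lookup m i"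
      using False by (auto simp: lookup_minus lookup_single when_def)
    show ?thesis
      unfolding mderiv_single l e by (simp only: mult_ac)
  qed simp
qed (simp add: mderiv_add)

lemma mderiv_sum: "mderiv i (sum f S) = (\<Sum>x\<in>S. mderiv i (f x))"
  by (induction S rule: infinite_finite_induct) (simp_all add: mderiv_add)

text \<open>\<open>\<delta>\<close> is any derivation that kills the coefficients. It is applied to
  partial derivatives and to the derivatives in \<open>t\<close> and in \<open>z\<close> of affine
  equations.\<close>

lemma (in rhom) chain_rule:
  assumes da: "\<And>x y. \<delta> (x + y) = \<delta> x + \<delta> y"
    and dm: "\<And>x y. \<delta> (x * y) = \<delta> x * y + x * \<delta> y"
    and dc: "\<And>c. \<delta> (h c) = 0"
  shows "\<delta> (evalh h f v) = (\<Sum>i\<in>UNIV. evalh h (mderiv i f) v * \<delta> (v i))"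
proof (induction f rule: mpoly_induct)
  case (const c)
  show ?case by (simp add: evalh_mconst dc evalh_mconst[of 0, unfolded mconst_simps] zero)
next
  case (var i)
  have "(\<Sum>j\<in>UNIV. evalh h (mderiv j (mvar i)) v * \<delta> (v j)) = (\<Sum>j\<in>UNIV. if j = i then \<delta> (v i) else 0)"
    by (rule sum.cong) (auto simp: mderiv_mvar evalh_mconst[of 0, unfolded mconst_simps]
        evalh_mconst[of 1, unfolded mconst_simps] zero one)
  then show ?case by (simp add: evalh_mvar)
next
  case (add f g)
  then show ?case by (simp only: evalh_add mderiv_add da distrib_right sum.distrib)
next
  case (mult f g)
  have "(\<Sum>i\<in>UNIV. evalh h (mderiv i (f * g)) v * \<delta> (v i))
     = (\<Sum>i\<in>UNIV. evalh h (mderiv i f) v * \<delta> (v i)) * evalh h g v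
       + evalh h f v * (\<Sum>i\<in>UNIV. evalh h (mderiv i g) v * \<delta> (v i))"
    unfolding sum_distrib_left sum_distrib_right sum.distrib[symmetric]
    by (intro sum.cong refl) (simp only: mderiv_mult evalh_add evalh_mult distrib_right distrib_left mult_ac add_ac)
  then show ?case
    by (simp only: mult evalh_mult dm)
qed

lemma homogeneous_0 [simp]: "homogeneous e 0"
  by (simp add: homogeneous_def)

lemma homogeneous_single: "mdeg m = e \<Longrightarrow> homogeneous e (Poly_Mapping.single m c)"
  by (simp add: homogeneous_def)

lemma homogeneous_mconst: "homogeneous 0 (mconst c)"
  unfolding mconst_def by (rule homogeneous_single) simp

lemma homogeneous_1: "homogeneous 0 1"
  using homogeneous_mconst[of 1] by (simp add: mconst_simps)

lemma homogeneous_mvar: "homogeneous 1 (mvar i)"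
  unfolding mvar_def by (rule homogeneous_single) (simp add: lookup_single when_def)

lemma homogeneous_add: "homogeneous e f \<Longrightarrow> homogeneous e g \<Longrightarrow> homogeneous e (f + g)"
  unfolding homogeneous_def using keys_add[of f g] by blast

lemma homogeneous_sum: "(\<And>x. x \<in> S \<Longrightarrow> homogeneous e (f x)) \<Longrightarrow> homogeneous e (sum f S)"
  by (induction S rule: infinite_finite_induct) (auto intro: homogeneous_add)

lemma homogeneous_uminus: "homogeneous e f \<Longrightarrow> homogeneous e (- f)"
  by (simp add: homogeneous_def in_keys_iff)

lemma homogeneous_diff: "homogeneous e f \<Longrightarrow> homogeneous e g \<Longrightarrow> homogeneous e (f - g)"
  using homogeneous_add[of e f "- g"] homogeneous_uminus[of e g] by simp

lemma homogeneous_mult: "homogeneous e f \<Longrightarrow> homogeneous e' g \<Longrightarrow> homogeneous (e + e') (f * g)"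
  unfolding homogeneous_def using keys_mult[of f g]
  by (fastforce simp: lookup_add sum.distrib)

lemma homogeneous_const_mult: "homogeneous e f \<Longrightarrow> homogeneous e (mconst c * f)"
  using homogeneous_mult[OF homogeneous_mconst] by fastforce

lemma homogeneous_power: "homogeneous e f \<Longrightarrow> homogeneous (k * e) (f ^ k)"
proof (induction k)
  case (Suc k)
  then show ?case using homogeneous_mult[of e f "k * e" "f ^ k"] by simp
qed (simp add: homogeneous_1)

lemma homogeneous_prod:
  "finite S \<Longrightarrow> (\<And>x. x \<in> S \<Longrightarrow> homogeneous (e x) (f x)) \<Longrightarrow> homogeneous (sum e S) (prod f S)"
  by (induction S rule: finite_induct) (auto simp: homogeneous_1 intro: homogeneous_mult)

lemma homogeneous_mderiv: "homogeneous e f \<Longrightarrow> homogeneous (e - 1) (mderiv i f)"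
proof (induction rule: homogeneous_induct)
  case (single m c)
  show ?case
  proof (cases "Poly_Mapping.lookup m i = 0")
    case True
    then show ?thesis by (simp add: mderiv_single)
  next
    case False
    have m: "m = (m - Poly_Mapping.single i 1) + Poly_Mapping.single i (1::nat)"
      by (rule poly_mapping_eqI) (use False in \<open>auto simp: lookup_add lookup_minus lookup_single when_def\<close>)
    have "mdeg m = mdeg (m - Poly_Mapping.single i 1) + 1"
      by (subst m) (simp add: lookup_add sum.distrib lookup_single when_def)
    then show ?thesis unfolding mderiv_single using single by (intro homogeneous_single) simp
  qed
qed (auto simp: mderiv_add intro: homogeneous_add)

lemma single_sum: "Poly_Mapping.single m (\<Sum>x\<in>S. f x) = (\<Sum>x\<in>S. Poly_Mapping.single m (f x))"
  by (induction S rule: infinite_finite_induct) (simp_all add: single_add)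

lemma euler: "homogeneous e f \<Longrightarrow> (\<Sum>i\<in>UNIV. mvar i * mderiv i f) = of_nat e * f"
proof (induction rule: homogeneous_induct)
  case (single m c)
  have "(\<Sum>i\<in>UNIV. mvar i * mderiv i (Poly_Mapping.single m c))
      = (\<Sum>i\<in>UNIV. Poly_Mapping.single m (of_nat (Poly_Mapping.lookup m i) * c))"
  proof (rule sum.cong[OF refl])
    fix i
    show "mvar i * mderiv i (Poly_Mapping.single m c) = Poly_Mapping.single m (of_nat (Poly_Mapping.lookup m i) * c)"
    proof (cases "Poly_Mapping.lookup m i = 0")
      case False
      have "Poly_Mapping.single i 1 + (m - Poly_Mapping.single i (1::nat)) = m"
        by (rule poly_mapping_eqI) (use False in \<open>auto simp: lookup_add lookup_minus lookup_single when_def\<close>)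
      then show ?thesis by (simp add: mderiv_single mvar_def mult_single)
    qed (simp add: mderiv_single)
  qed
  also have "\<dots> = Poly_Mapping.single m (of_nat (mdeg m) * c)"
    by (simp add: single_sum sum_distrib_right)
  also have "\<dots> = of_nat e * Poly_Mapping.single m c"
    unfolding single single_of_nat[symmetric] mult_single by simp
  finally show ?case .
qed (simp_all add: mderiv_add distrib_left sum.distrib)

context rhom
begin

lemma evalh_scale: "homogeneous e f \<Longrightarrow> evalh h f (\<lambda>i. c * v i) = c ^ e * evalh h f v"
proof (induction rule: homogeneous_induct)
  case zero
  show ?case by (simp add: evalh_def)
next
  case (single m x)
  show ?case
    unfolding evalh_single power_mult_distrib prod.distrib power_sum[symmetric] single
    by (simp only: mult_ac)
next
  case (add f g)
  then show ?case by (simp only: evalh_add distrib_left)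
qed

lemma euler_evalh:
  "homogeneous e f \<Longrightarrow> (\<Sum>i\<in>UNIV. v i * evalh h (mderiv i f) v) = of_nat e * evalh h f v"
proof -
  assume "homogeneous e f"
  interpret e: rhom "\<lambda>f. evalh h f v" by (rule rhom_evalh)
  have "evalh h (\<Sum>i\<in>UNIV. mvar i * mderiv i f) v = evalh h (of_nat e * f) v"
    using euler[OF \<open>homogeneous e f\<close>] by simp
  then show ?thesis by (simp add: e.sum e.mult evalh_mvar e.of_nat)
qed

end

lemma homogeneous_0_const: "homogeneous 0 f \<Longrightarrow> \<exists>c. f = mconst c"
proof (induction rule: homogeneous_induct)
  case zero
  show ?case by (metis mconst_simps(4))
next
  case (single m c)
  then have "m = 0" by (intro poly_mapping_eqI) simp
  then show ?case by (auto simp: mconst_def)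
next
  case (add f g)
  then show ?case by (metis mconst_simps(1))
qed

lemma homogeneous_subst:
  assumes "homogeneous e f" "\<And>i. homogeneous d (u i)"
  shows "homogeneous (e * d) (evalh mconst f u)"
  using assms(1)
proof (induction rule: homogeneous_induct)
  case zero
  show ?case by (simp add: evalh_def)
next
  case (single m c)
  have "homogeneous (\<Sum>i\<in>UNIV. Poly_Mapping.lookup m i * d) (\<Prod>i\<in>UNIV. u i ^ Poly_Mapping.lookup m i)"
    by (rule homogeneous_prod) (auto intro: homogeneous_power assms)
  then show ?case
    unfolding rhom.evalh_single[OF rhom_mconst]
    using single by (auto intro: homogeneous_const_mult simp: sum_distrib_right)
qed (auto simp: rhom.evalh_add[OF rhom_mconst] intro: homogeneous_add)

lemma evalh_mconst_mvar: "evalh mconst f mvar = f"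
proof (induction f rule: mpoly_induct)
qed (simp_all add: rhom.evalh_mconst[OF rhom_mconst] rhom.evalh_mvar[OF rhom_mconst]
    rhom.evalh_add[OF rhom_mconst] rhom.evalh_mult[OF rhom_mconst])

text \<open>Congruent points have congruent values; \<open>S\<close> is a subring and
  \<open>J\<close> an ideal of it. The instance that matters is the valuation ring with the
  multiples of a fixed element.\<close>

lemma (in rhom) evalh_difference:
  assumes Sa: "\<And>x y. x \<in> S \<Longrightarrow> y \<in> S \<Longrightarrow> x + y \<in> S" and Sm: "\<And>x y. x \<in> S \<Longrightarrow> y \<in> S \<Longrightarrow> x * y \<in> S"
    and Sc: "\<And>c. h c \<in> S"
    and J0: "0 \<in> J" and Ja: "\<And>x y. x \<in> J \<Longrightarrow> y \<in> J \<Longrightarrow> x + y \<in> J" and Jm: "\<And>x y. x \<in> S \<Longrightarrow> y \<in> J \<Longrightarrow> x * y \<in> J"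
    and v: "\<And>i. v i \<in> S" and w: "\<And>i. w i \<in> S" and d: "\<And>i. v i - w i \<in> J"
  shows "evalh h f v \<in> S" "evalh h f v - evalh h f w \<in> J"
proof -
  have "evalh h f v \<in> S \<and> evalh h f w \<in> S \<and> evalh h f v - evalh h f w \<in> J"
  proof (induction f rule: mpoly_induct)
    case (add f g)
    have e: "evalh h (f + g) v - evalh h (f + g) w = (evalh h f v - evalh h f w) + (evalh h g v - evalh h g w)"
      by (simp add: evalh_add)
    have "evalh h (f + g) v - evalh h (f + g) w \<in> J"
      unfolding e using add Ja by blast
    moreover have "evalh h (f + g) v \<in> S" "evalh h (f + g) w \<in> S"
      unfolding evalh_add using add Sa by blast+
    ultimately show ?case by blast
  next
    case (mult f g)
    have "evalh h (f * g) v - evalh h (f * g) w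
        = evalh h g v * (evalh h f v - evalh h f w) + evalh h f w * (evalh h g v - evalh h g w)"
      by (simp add: evalh_mult algebra_simps)
    then show ?case using mult Sm Ja Jm by (metis evalh_mult)
  qed (simp_all add: evalh_mconst evalh_mvar Sc J0 v w d)
  then show "evalh h f v \<in> S" "evalh h f v - evalh h f w \<in> J" by auto
qed

lemma ideal_span_mult: "x \<in> ideal.span S \<Longrightarrow> c * x \<in> ideal.span S"
  by (rule ideal.span_scale)

lemma add_diff_add_diff: "x + y - (p + q) - (r + s) = (x - p - r) + (y - q - s)"
  for x y p q r s :: "'a::ab_group_add"
  by simp

text \<open>The remainder stays in the ideal spanned by products of two increments, so neither
  second derivatives nor division are needed. In the product case the only term that is not a
  multiple of the old remainders is the product of the two linear parts, which lies in that
  ideal.\<close>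

lemma (in rhom) taylor:
  fixes a l :: "'n::finite \<Rightarrow> 'b"
  defines "Z \<equiv> ideal.span {l r * l s |r s. True}"
  shows "evalh h f (\<lambda>i. a i + l i) - evalh h f a - (\<Sum>i\<in>UNIV. evalh h (mderiv i f) a * l i) \<in> Z"
proof (induction f rule: mpoly_induct)
  case (const c)
  show ?case by (simp add: evalh_mconst evalh_mconst[of 0, unfolded mconst_simps] zero Z_def ideal.span_zero)
next
  case (var i)
  have "(\<Sum>j\<in>UNIV. evalh h (mderiv j (mvar i)) a * l j) = (\<Sum>j\<in>UNIV. if j = i then l i else 0)"
    by (rule sum.cong) (auto simp: mderiv_mvar evalh_mconst[of 0, unfolded mconst_simps]
        evalh_mconst[of 1, unfolded mconst_simps] zero one)
  then show ?case by (simp add: evalh_mvar Z_def ideal.span_zero)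
next
  case (add f g)
  have e: "evalh h (f + g) (\<lambda>i. a i + l i) - evalh h (f + g) a - (\<Sum>i\<in>UNIV. evalh h (mderiv i (f + g)) a * l i)
    = (evalh h f (\<lambda>i. a i + l i) - evalh h f a - (\<Sum>i\<in>UNIV. evalh h (mderiv i f) a * l i))
    + (evalh h g (\<lambda>i. a i + l i) - evalh h g a - (\<Sum>i\<in>UNIV. evalh h (mderiv i g) a * l i))"
    unfolding evalh_add mderiv_add distrib_right sum.distrib by (rule add_diff_add_diff)
  have "(evalh h f (\<lambda>i. a i + l i) - evalh h f a - (\<Sum>i\<in>UNIV. evalh h (mderiv i f) a * l i))
    + (evalh h g (\<lambda>i. a i + l i) - evalh h g a - (\<Sum>i\<in>UNIV. evalh h (mderiv i g) a * l i)) \<in> Z"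
    unfolding Z_def by (rule ideal.span_add[OF add(1)[unfolded Z_def] add(2)[unfolded Z_def]])
  then show ?case by (simp only: e)
next
  case (mult f g)
  define df dg where "df = (\<Sum>i\<in>UNIV. evalh h (mderiv i f) a * l i)"
    and "dg = (\<Sum>i\<in>UNIV. evalh h (mderiv i g) a * l i)"
  have "df * dg = (\<Sum>i\<in>UNIV. \<Sum>j\<in>UNIV. (evalh h (mderiv i f) a * evalh h (mderiv j g) a) * (l i * l j))"
    unfolding df_def dg_def sum_product by (intro sum.cong refl) (simp only: mult_ac)
  also have "\<dots> \<in> Z"
    unfolding Z_def by (intro ideal.span_sum ideal_span_mult ideal.span_base) auto
  finally have dd: "df * dg \<in> Z" .
  define u v where "u = evalh h f (\<lambda>i. a i + l i) - evalh h f a - df"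
    and "v = evalh h g (\<lambda>i. a i + l i) - evalh h g a - dg"
  have uv: "u \<in> Z" "v \<in> Z" using mult unfolding u_def v_def df_def dg_def by auto
  have s: "(\<Sum>i\<in>UNIV. evalh h (mderiv i (f * g)) a * l i) = evalh h g a * df + evalh h f a * dg"
    unfolding df_def dg_def sum_distrib_left sum.distrib[symmetric]
    by (intro sum.cong refl) (simp only: mderiv_mult evalh_add evalh_mult distrib_right distrib_left mult_ac add_ac)
  have "evalh h (f * g) (\<lambda>i. a i + l i) - evalh h (f * g) a - (\<Sum>i\<in>UNIV. evalh h (mderiv i (f * g)) a * l i)
     = df * dg + (evalh h g a + dg + v) * u + (evalh h f a + df) * v"
    unfolding s evalh_mult by (simp add: u_def v_def algebra_simps)
  also have "\<dots> \<in> Z"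
    using dd uv unfolding Z_def
    by (rule ideal.span_add[OF ideal.span_add[OF _ ideal_span_mult] ideal_span_mult])
  finally show ?case .
qed

lemma poly_eq_0_on_infinite:
  fixes p :: "'a::idom poly"
  assumes "infinite S" "\<And>x. x \<in> S \<Longrightarrow> poly p x = 0"
  shows "p = 0"
  using poly_roots_finite[of p] assms finite_subset[of S "{x. poly p x = 0}"] by auto

lemma prod_UNIV_3: "(\<Prod>i\<in>(UNIV::3 set). f i) = f 1 * f 2 * f 3" for f :: "3 \<Rightarrow> 'a::comm_monoid_mult"
  unfolding UNIV_3 by (simp add: ac_simps)

lemma coeff_monom_power: "[:0, 1::'a::comm_ring_1:] ^ k = monom 1 k"
  by (simp add: monom_altdef)

text \<open>Read as a polynomial in the third variable over polynomials in the second over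
  polynomials in the first; at each level the constants already supply infinitely many
  roots.\<close>

lemma mpoly3_eq_0:
  fixes f :: "('a::field_char_0, 3) mpoly"
  assumes "\<And>v. meval f v = 0"
  shows "f = 0"
proof -
  define c where "c = (\<lambda>c::'a. [:[:[:c:]:]:])"
  define Xs :: "3 \<Rightarrow> 'a poly poly poly" where
    "Xs = (\<lambda>i. if i = 1 then [:[:[:0,1:]:]:] else if i = 2 then [:[:0,1:]:] else [:0,1:])"
  have rc: "rhom c" unfolding c_def by standard (auto simp: one_pCons)
  interpret c: rhom c by fact
  define P where "P = evalh c f Xs"
  have ev: "poly (poly (poly P [:[:z:]:]) [:y:]) x = 0" for x y z
  proof -
    have r: "rhom (\<lambda>p::'a poly poly poly. poly (poly (poly p [:[:z:]:]) [:y:]) x)" by standard auto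
    have "poly (poly (poly P [:[:z:]:]) [:y:]) x
      = evalh (\<lambda>w. w) f (\<lambda>i. poly (poly (poly (Xs i) [:[:z:]:]) [:y:]) x)"
      unfolding P_def using c.evalh_comp[OF r, of f Xs] by (simp add: c_def)
    also have "\<dots> = meval f (\<chi> i. poly (poly (poly (Xs i) [:[:z:]:]) [:y:]) x)"
      by (simp add: meval_evalh)
    finally show ?thesis using assms by simp
  qed
  have inf: "infinite (UNIV::'a set)" by (rule infinite_UNIV_char_0)
  have i1: "infinite (range (\<lambda>y::'a. [:y:]))"
    by (subst finite_image_iff) (auto simp: inj_on_def inf)
  have i2: "infinite (range (\<lambda>y::'a. [:[:y:]:]))"
    by (subst finite_image_iff) (auto simp: inj_on_def inf)
  have "poly (poly P [:[:z:]:]) [:y:] = 0" for y z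
    by (rule poly_eq_0_on_infinite[OF inf]) (rule ev)
  then have "poly P [:[:z:]:] = 0" for z
    by (intro poly_eq_0_on_infinite[OF i1]) auto
  then have P0: "P = 0"
    by (intro poly_eq_0_on_infinite[OF i2]) auto
  show "f = 0"
  proof (rule poly_mapping_eqI)
    fix m :: "3 \<Rightarrow>\<^sub>0 nat"
    let ?l = "Poly_Mapping.lookup"
    have mon: "c a * (\<Prod>i\<in>UNIV. Xs i ^ ?l k i) = monom (monom (monom a (?l k 1)) (?l k 2)) (?l k 3)" for a k
    proof -
      have "[:[:[:0,1::'a:]:]:] ^ r = [:[:monom 1 r:]:]" for r
        using rhom.power[OF rhom_pconst, of "[:[:0,1::'a:]:]" r] rhom.power[OF rhom_pconst, of "[:0,1::'a:]" r]
        by (simp only: coeff_monom_power)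
      moreover have "[:[:0,1::'a poly:]:] ^ r = [:monom 1 r:]" for r
        using rhom.power[OF rhom_pconst, of "[:0,1::'a poly:]" r] by (simp only: coeff_monom_power)
      ultimately show ?thesis
        by (simp add: prod_UNIV_3 Xs_def c_def coeff_monom_power smult_monom)
    qed
    have "0 = coeff (coeff (coeff P (?l m 3)) (?l m 2)) (?l m 1)" by (simp add: P0)
    also have "\<dots> = (\<Sum>k\<in>Poly_Mapping.keys f. if k = m then ?l f k else 0)"
      unfolding P_def evalh_def mon coeff_sum
    proof (rule sum.cong[OF refl])
      fix k
      have "k = m \<longleftrightarrow> ?l k 1 = ?l m 1 \<and> ?l k 2 = ?l m 2 \<and> ?l k 3 = ?l m 3"
        by (auto simp: poly_mapping_eq_iff fun_eq_iff forall_3)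
      then show "coeff (coeff (coeff (monom (monom (monom (?l f k) (?l k 1)) (?l k 2)) (?l k 3)) (?l m 3)) (?l m 2)) (?l m 1)
        = (if k = m then ?l f k else 0)" by auto
    qed
    also have "\<dots> = ?l f m" by (simp add: in_keys_iff)
    finally show "?l f m = ?l 0 m" by simp
  qed
qed

section \<open>Places\<close>

text \<open>The Nullstellensatz in one variable. An element of least degree divides all others, and
  a root of it would be a common zero, so it is a nonzero constant.\<close>

lemma poly_ideal_common_root:
  fixes I :: "'a::alg_closed_field poly set"
  assumes z: "0 \<in> I" and a: "\<And>p q. p \<in> I \<Longrightarrow> q \<in> I \<Longrightarrow> p + q \<in> I"
    and m: "\<And>p q. p \<in> I \<Longrightarrow> q * p \<in> I"
    and n: "\<And>c. \<exists>p\<in>I. poly p c \<noteq> 0"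
  shows "1 \<in> I"
proof -
  obtain p0 where "p0 \<in> I" "poly p0 0 \<noteq> 0" using n by blast
  then have ex: "\<exists>p. p \<in> I \<and> p \<noteq> 0" by auto
  define p where "p = (ARG_MIN degree p. p \<in> I \<and> p \<noteq> 0)"
  have p: "p \<in> I" "p \<noteq> 0" using arg_min_natI[of "\<lambda>p. p \<in> I \<and> p \<noteq> 0" _ degree] ex unfolding p_def by blast+
  have le: "degree p \<le> degree q" if "q \<in> I" "q \<noteq> 0" for q
    unfolding p_def by (rule arg_min_nat_le) (use that in auto)
  have dv: "p dvd q" if "q \<in> I" for q
  proof -
    have "q mod p = q + (- (q div p)) * p" by (simp add: minus_div_mult_eq_mod[symmetric])
    then have "q mod p \<in> I" using a[OF that m[OF p(1)]] by metis
    then have "q mod p = 0" using le[of "q mod p"] degree_mod_less[OF p(2), of q] by fastforce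
    then show ?thesis by auto
  qed
  have "degree p = 0"
  proof (rule ccontr)
    assume "degree p \<noteq> 0"
    then obtain c where "poly p c = 0" using alg_closed_imp_poly_has_root by blast
    then have "\<forall>q\<in>I. poly q c = 0" using dv by (metis dvd_def mult_zero_left poly_mult)
    then show False using n by blast
  qed
  then obtain c where c: "p = [:c:]" "c \<noteq> 0" using p(2) degree_eq_zeroE by (metis pCons_0_0)
  then have "[:inverse c:] * p = 1" by (simp add: one_pCons)
  then show ?thesis using m[OF p(1)] by metis
qed

text \<open>A ring homomorphism from a subring of \<open>'b\<close> to \<open>'a\<close>, represented by its graph, so that
  extension is inclusion of graphs.\<close>

locale phom =
  fixes G :: "('b::field \<times> 'a::field) set" and cst :: "'a \<Rightarrow> 'b"
  assumes one: "(1, 1) \<in> G"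
    and add: "(x, a) \<in> G \<Longrightarrow> (y, b) \<in> G \<Longrightarrow> (x + y, a + b) \<in> G"
    and mult: "(x, a) \<in> G \<Longrightarrow> (y, b) \<in> G \<Longrightarrow> (x * y, a * b) \<in> G"
    and uminus: "(x, a) \<in> G \<Longrightarrow> (- x, - a) \<in> G"
    and uniq: "(0, a) \<in> G \<Longrightarrow> a = 0"
    and const: "(cst c, c) \<in> G"
begin

lemma zero: "(0, 0) \<in> G"
  using add[OF one uminus[OF one]] by simp

lemma diff: "(x, a) \<in> G \<Longrightarrow> (y, b) \<in> G \<Longrightarrow> (x - y, a - b) \<in> G"
  using add[OF _ uminus, of x a y b] by simp

lemma det: "(x, a) \<in> G \<Longrightarrow> (x, b) \<in> G \<Longrightarrow> a = b"
  using diff[of x a x b] uniq[of "a - b"] by simp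

lemma sum: "(\<And>i. i \<in> S \<Longrightarrow> (f i, g i) \<in> G) \<Longrightarrow> (sum f S, sum g S) \<in> G"
  by (induction S rule: infinite_finite_induct) (auto intro: zero add)

lemma prod: "(\<And>i. i \<in> S \<Longrightarrow> (f i, g i) \<in> G) \<Longrightarrow> (prod f S, prod g S) \<in> G"
  by (induction S rule: infinite_finite_induct) (auto intro: one mult)

lemma power: "(x, a) \<in> G \<Longrightarrow> (x ^ k, a ^ k) \<in> G"
  by (induction k) (auto intro: one mult)

definition rel_poly :: "'b poly \<Rightarrow> 'a poly \<Rightarrow> bool" where
  "rel_poly p q \<longleftrightarrow> (\<forall>i. (coeff p i, coeff q i) \<in> G)"

lemma rel_poly_add: "rel_poly p q \<Longrightarrow> rel_poly p' q' \<Longrightarrow> rel_poly (p + p') (q + q')"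
  by (auto simp: rel_poly_def intro: add)

lemma rel_poly_mult: "rel_poly p q \<Longrightarrow> rel_poly p' q' \<Longrightarrow> rel_poly (p * p') (q * q')"
  by (auto simp: rel_poly_def coeff_mult intro!: sum mult)

lemma rel_poly_uminus: "rel_poly p q \<Longrightarrow> rel_poly (- p) (- q)"
  by (auto simp: rel_poly_def intro: uminus)

lemma rel_poly_pCons: "(x, a) \<in> G \<Longrightarrow> rel_poly p q \<Longrightarrow> rel_poly (pCons x p) (pCons a q)"
  by (auto simp: rel_poly_def coeff_pCons split: nat.split)

lemma rel_poly_0: "rel_poly 0 0"
  by (simp add: rel_poly_def zero)

lemma rel_poly_const_exists: "\<exists>p. rel_poly p q"
proof (induction q)
  case 0
  show ?case using rel_poly_0 by blast
next
  case (pCons a q)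
  then show ?case using rel_poly_pCons const by blast
qed

lemma poly_rel:
  assumes "rel_poly p q" "(x, a) \<in> G"
  shows "(poly p x, poly q a) \<in> G"
proof -
  let ?N = "max (degree p) (degree q)"
  have "poly p x = (\<Sum>i\<le>?N. coeff p i * x ^ i)" "poly q a = (\<Sum>i\<le>?N. coeff q i * a ^ i)"
    unfolding poly_altdef
    by (rule sum.mono_neutral_left; auto intro: coeff_eq_0)+
  then show ?thesis using assms by (auto simp: rel_poly_def intro!: sum mult power)
qed

lemma evalh_rel:
  assumes "rhom cst" "\<And>i. (v i, a i) \<in> G"
  shows "(evalh cst f v, evalh (\<lambda>x. x) f a) \<in> G"
  unfolding evalh_def by (intro sum mult const prod power assms(2))

definition adjoin :: "'b \<Rightarrow> 'a \<Rightarrow> ('b \<times> 'a) set" where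
  "adjoin x c = {(poly p x, poly q c) |p q. rel_poly p q}"

text \<open>The hypothesis says that every polynomial relation satisfied by \<open>x\<close>
  specialises to one satisfied by \<open>c\<close>; this is what makes the extended graph
  single-valued.\<close>

lemma adjoin_phom:
  assumes "\<forall>p q. rel_poly p q \<longrightarrow> poly p x = 0 \<longrightarrow> poly q c = 0"
  shows "phom (adjoin x c) cst" "G \<subseteq> adjoin x c" "(x, c) \<in> adjoin x c"
proof -
  have sub: "(y, b) \<in> adjoin x c" if "(y, b) \<in> G" for y b
    unfolding adjoin_def using rel_poly_pCons[OF that rel_poly_0]
    by (auto intro!: exI[of _ "[:y:]"] exI[of _ "[:b:]"])
  then show "G \<subseteq> adjoin x c" by auto
  have "rel_poly [:0, 1:] [:0, 1:]" by (intro rel_poly_pCons zero one rel_poly_0)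
  then show "(x, c) \<in> adjoin x c" unfolding adjoin_def
    by (auto intro!: exI[of _ "[:0, 1:]"])
  show "phom (adjoin x c) cst"
  proof
    show "(1, 1) \<in> adjoin x c" by (rule sub[OF one])
    show "(cst c', c') \<in> adjoin x c" for c' by (rule sub[OF const])
    show "a = 0" if "(0, a) \<in> adjoin x c" for a using that assms unfolding adjoin_def by auto
    show "(y + y', a + b) \<in> adjoin x c" if ab: "(y, a) \<in> adjoin x c" "(y', b) \<in> adjoin x c" for y y' a b
    proof -
      from ab obtain p q p' q' where "y = poly p x" "a = poly q c" "rel_poly p q"
        "y' = poly p' x" "b = poly q' c" "rel_poly p' q'" unfolding adjoin_def by blast
      then show ?thesis unfolding adjoin_def using rel_poly_add[of p q p' q']
        by (auto intro!: exI[of _ "p + p'"] exI[of _ "q + q'"])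
    qed
    show "(y * y', a * b) \<in> adjoin x c" if ab: "(y, a) \<in> adjoin x c" "(y', b) \<in> adjoin x c" for y y' a b
    proof -
      from ab obtain p q p' q' where "y = poly p x" "a = poly q c" "rel_poly p q"
        "y' = poly p' x" "b = poly q' c" "rel_poly p' q'" unfolding adjoin_def by blast
      then show ?thesis unfolding adjoin_def using rel_poly_mult[of p q p' q']
        by (auto intro!: exI[of _ "p * p'"] exI[of _ "q * q'"])
    qed
    show "(- y, - a) \<in> adjoin x c" if ab: "(y, a) \<in> adjoin x c" for y a
    proof -
      from ab obtain p q where "y = poly p x" "a = poly q c" "rel_poly p q" unfolding adjoin_def by blast
      then show ?thesis unfolding adjoin_def using rel_poly_uminus[of p q]
        by (auto intro!: exI[of _ "- p"] exI[of _ "- q"])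
    qed
  qed
qed

end

text \<open>\<open>inv\<close> makes the domain a local ring whose maximal ideal is the preimage of
  0, and \<open>val\<close> makes it a valuation ring.\<close>

locale place = phom G cst for G :: "('b::field \<times> 'a::field) set" and cst +
  assumes inv: "(x, a) \<in> G \<Longrightarrow> a \<noteq> 0 \<Longrightarrow> (inverse x, inverse a) \<in> G"
    and val: "x \<in> Domain G \<or> inverse x \<in> Domain G"

text \<open>Chevalley's extension theorem by Zorn's lemma: if \<open>x\<close> cannot be added to
  the domain of a maximal homomorphism, then no value \<open>c\<close> is admissible for it, and
  this forces a strong relation on \<open>x\<close>.\<close>

lemma place_exists:
  fixes G0 :: "('b::field \<times> 'a::alg_closed_field) set"
  assumes "phom G0 cst"
  shows "\<exists>G. G0 \<subseteq> G \<and> place G cst"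
proof -
  define \<A> where "\<A> = {G. phom G cst \<and> G0 \<subseteq> G}"
  have "G0 \<in> \<A>" using assms by (simp add: \<A>_def)
  moreover have "\<Union>\<C> \<in> \<A>" if ne: "\<C> \<noteq> {}" and ch: "subset.chain \<A> \<C>" for \<C>
  proof -
    have sub: "phom G cst" "G0 \<subseteq> G" if "G \<in> \<C>" for G
      using ch that unfolding subset.chain_def \<A>_def by auto
    have common: "\<exists>G\<in>\<C>. p \<in> G \<and> q \<in> G" if "p \<in> \<Union>\<C>" "q \<in> \<Union>\<C>" for p q
      using ch that unfolding subset.chain_def by blast
    obtain G1 where G1: "G1 \<in> \<C>" using ne by blast
    have "phom (\<Union>\<C>) cst"
    proof
      show "(1, 1) \<in> \<Union>\<C>" using G1 phom.one[OF sub(1)[OF G1]] by blast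
      show "(cst c', c') \<in> \<Union>\<C>" for c' using G1 phom.const[OF sub(1)[OF G1]] by blast
      show "a = 0" if "(0, a) \<in> \<Union>\<C>" for a using that phom.uniq[OF sub(1)] by blast
      show "(- y, - a) \<in> \<Union>\<C>" if "(y, a) \<in> \<Union>\<C>" for y a using that phom.uminus[OF sub(1)] by blast
      show "(y + y', a + b) \<in> \<Union>\<C>" if "(y, a) \<in> \<Union>\<C>" "(y', b) \<in> \<Union>\<C>" for y y' a b
        using common[OF that] phom.add[OF sub(1)] by blast
      show "(y * y', a * b) \<in> \<Union>\<C>" if "(y, a) \<in> \<Union>\<C>" "(y', b) \<in> \<Union>\<C>" for y y' a b
        using common[OF that] phom.mult[OF sub(1)] by blast
    qed
    then show ?thesis unfolding \<A>_def using G1 sub by blast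
  qed
  ultimately obtain M where M: "M \<in> \<A>" and mx: "\<And>Xs. Xs \<in> \<A> \<Longrightarrow> M \<subseteq> Xs \<Longrightarrow> Xs = M"
    using subset_Zorn_nonempty[of \<A>] by blast
  interpret phom M cst using M by (simp add: \<A>_def)
  \<comment> \<open>The images of the relations of \<open>x\<close> form an ideal without common
    root, since a common root would allow \<open>x\<close> to be adjoined. So some relation of
    \<open>x\<close> has a constant term specialising to 1 and all other coefficients specialising
    to 0.\<close>
  have key: "\<exists>p. rel_poly p 1 \<and> poly p x = 0" if x: "x \<notin> Domain M" for x
  proof -
    define I where "I = {q. \<exists>p. rel_poly p q \<and> poly p x = 0}"
    have "1 \<in> I"
    proof (rule poly_ideal_common_root)
      show "0 \<in> I" unfolding I_def using rel_poly_0 by (auto intro!: exI[of _ 0])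
      show "p + q \<in> I" if pq: "p \<in> I" "q \<in> I" for p q
      proof -
        from pq obtain p' q' where "rel_poly p' p" "poly p' x = 0" "rel_poly q' q" "poly q' x = 0"
          unfolding I_def by blast
        then show ?thesis unfolding I_def using rel_poly_add[of p' p q' q]
          by (auto intro!: exI[of _ "p' + q'"])
      qed
      show "q * p \<in> I" if pq: "p \<in> I" for p q
      proof -
        from pq obtain p' where "rel_poly p' p" "poly p' x = 0" unfolding I_def by blast
        moreover obtain q' where "rel_poly q' q" using rel_poly_const_exists by blast
        ultimately show ?thesis unfolding I_def using rel_poly_mult[of q' q p' p]
          by (auto intro!: exI[of _ "q' * p'"])
      qed
      show "\<exists>p\<in>I. poly p c \<noteq> 0" for c
      proof (rule ccontr)
        assume "\<not> (\<exists>p\<in>I. poly p c \<noteq> 0)"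
        then have *: "\<forall>p q. rel_poly p q \<longrightarrow> poly p x = 0 \<longrightarrow> poly q c = 0" unfolding I_def by blast
        have "adjoin x c \<in> \<A>"
          using adjoin_phom[OF *] M unfolding \<A>_def by blast
        then have "adjoin x c = M" using mx adjoin_phom(2)[OF *] by blast
        then show False using adjoin_phom(3)[OF *] x by blast
      qed
    qed
    then show ?thesis unfolding I_def by blast
  qed
  \<comment> \<open>Multiplied by a power of \<open>a\<close>, the relation for
    \<open>inverse a\<close> becomes a polynomial identity in \<open>a\<close>, which specialises to
    the vanishing of a power of \<open>b\<close>.\<close>
  have inv': "(inverse a, inverse b) \<in> M" if ab: "(a, b) \<in> M" "b \<noteq> 0" for a b
  proof -
    have a: "a \<noteq> 0" using ab uniq by blast
    have "inverse a \<in> Domain M"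
    proof (rule ccontr)
      assume "inverse a \<notin> Domain M"
      then obtain p where p: "rel_poly p 1" "poly p (inverse a) = 0" using key by blast
      have "(\<Sum>i\<le>degree p. coeff p i * a ^ (degree p - i)) = a ^ degree p * poly p (inverse a)"
        unfolding poly_altdef sum_distrib_left using a
        by (intro sum.cong refl) (simp add: power_diff field_simps)
      then have 0: "(\<Sum>i\<le>degree p. coeff p i * a ^ (degree p - i)) = 0" using p by simp
      have "(\<Sum>i\<le>degree p. coeff (1::'a poly) i * b ^ (degree p - i)) = (\<Sum>i\<le>degree p. if i = 0 then b ^ degree p else 0)"
        by (intro sum.cong refl) (auto simp: coeff_1)
      then have 1: "(\<Sum>i\<le>degree p. coeff (1::'a poly) i * b ^ (degree p - i)) = b ^ degree p" by simp
      have "(\<Sum>i\<le>degree p. coeff p i * a ^ (degree p - i), \<Sum>i\<le>degree p. coeff (1::'a poly) i * b ^ (degree p - i)) \<in> M"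
        using p(1) ab(1) unfolding rel_poly_def by (intro sum mult power) auto
      then have "(0, b ^ degree p) \<in> M" unfolding 0 1 .
      then show False using uniq[of "b ^ degree p"] ab by simp
    qed
    then obtain b' where b': "(inverse a, b') \<in> M" by blast
    have "(1, b * b') \<in> M" using mult[OF ab(1) b'] a by simp
    then have "b * b' = 1" using det[OF _ one] by blast
    then have "b' = inverse b" using ab(2) by (simp add: field_simps)
    then show ?thesis using b' by simp
  qed
  \<comment> \<open>Reversing the relation of \<open>inverse x\<close> gives one for
    \<open>x\<close> whose coefficient at \<open>x ^ n\<close> is a unit. Subtracting a multiple of
    it cancels the leading term of \<open>p\<close>; the multiplier \<open>s\<close> specialises to
    0, so the result still specialises to 1.\<close>
  have reduce: "\<exists>p''. rel_poly p'' 1 \<and> poly p'' x = 0 \<and> degree p'' < degree p"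
    if p: "rel_poly p 1" "poly p x = 0" and p': "rel_poly p' 1" "poly p' (inverse x) = 0"
      and le: "degree p' \<le> degree p" and x0: "x \<noteq> 0" for p p' x
  proof -
    define n where "n = degree p"
    have n0: "n > 0"
    proof (rule ccontr)
      assume "\<not> n > 0"
      then obtain c where c: "p = [:c:]" using degree_eq_zeroE[of p] unfolding n_def by auto
      then have "c = 0" using p by simp
      moreover have "(coeff p 0, coeff (1::'a poly) 0) \<in> M" using p(1) unfolding rel_poly_def by blast
      ultimately have "(0, 1) \<in> M" using c by simp
      then show False using uniq by fastforce
    qed
    define r where "r = (\<Sum>j\<le>n. monom (coeff p' (n - j)) j)"
    have cr: "coeff r j = (if j \<le> n then coeff p' (n - j) else 0)" for j
      unfolding r_def coeff_sum by simp
    have "poly r x = (\<Sum>j\<le>n. coeff p' (n - j) * x ^ j)"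
      unfolding r_def poly_sum by (simp add: poly_monom)
    also have "\<dots> = (\<Sum>i\<le>n. coeff p' i * x ^ (n - i))"
      by (rule sum.reindex_bij_witness[of _ "\<lambda>i. n - i" "\<lambda>i. n - i"]) auto
    also have "\<dots> = x ^ n * (\<Sum>i\<le>n. coeff p' i * inverse x ^ i)"
      unfolding sum_distrib_left using x0
      by (intro sum.cong refl) (simp add: power_diff field_simps)
    also have "(\<Sum>i\<le>n. coeff p' i * inverse x ^ i) = poly p' (inverse x)"
      unfolding poly_altdef by (rule sum.mono_neutral_right) (use le in \<open>auto simp: n_def intro: coeff_eq_0\<close>)
    finally have r0: "poly r x = 0" using p' by simp
    have "(coeff p' 0, coeff (1::'a poly) 0) \<in> M" using p'(1) unfolding rel_poly_def by blast
    then have p'0: "(coeff p' 0, 1) \<in> M" by simp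
    then have i0: "(inverse (coeff p' 0), 1) \<in> M" using inv'[of "coeff p' 0" 1] by simp
    have c0: "coeff p' 0 \<noteq> 0" using p'0 uniq by fastforce
    have "(coeff p n, coeff (1::'a poly) n) \<in> M" using p(1) unfolding rel_poly_def by blast
    then have pn: "(coeff p n, 0) \<in> M" using n0 by (simp add: coeff_1)
    define s where "s = coeff p n * inverse (coeff p' 0)"
    have s: "(s, 0) \<in> M" using mult[OF pn i0] by (simp add: s_def)
    define p'' where "p'' = p - smult s r"
    have "(coeff r j, if j \<le> n then coeff 1 (n - j) else 0) \<in> M" for j
      using p'(1)[unfolded rel_poly_def, rule_format, of "n - j"] zero unfolding cr
      by (cases "j \<le> n") (simp_all only: if_True if_False)
    then have "(coeff p j - s * coeff r j, coeff 1 j - 0 * (if j \<le> n then coeff 1 (n - j) else 0)) \<in> M" for j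
      by (intro diff mult s) (use p(1) in \<open>auto simp: rel_poly_def\<close>)
    then have "rel_poly p'' 1" by (simp add: p''_def rel_poly_def)
    moreover have "poly p'' x = 0" by (simp add: p''_def r0 p)
    moreover have "degree p'' < n"
    proof (rule degree_lessI)
      show "p'' \<noteq> 0 \<or> 0 < n" using n0 by simp
      show "\<forall>k\<ge>n. coeff p'' k = 0"
        using c0 by (auto simp: p''_def cr s_def n_def coeff_eq_0 le_less)
    qed
    ultimately show ?thesis unfolding n_def by blast
  qed
  have val': "x \<in> Domain M \<or> inverse x \<in> Domain M" for x
  proof (rule ccontr)
    assume *: "\<not> ?thesis"
    then have x0: "x \<noteq> 0" using zero by auto
    let ?P = "\<lambda>y p. rel_poly p 1 \<and> poly p y = 0"
    define p where "p = (ARG_MIN degree p. ?P x p)"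
    define p' where "p' = (ARG_MIN degree p. ?P (inverse x) p)"
    have p: "?P x p" unfolding p_def using key[of x] * arg_min_natI[of "?P x" _ degree] by blast
    have p': "?P (inverse x) p'" unfolding p'_def using key[of "inverse x"] * arg_min_natI[of "?P (inverse x)" _ degree] by blast
    have pm: "degree p \<le> degree q" if "?P x q" for q unfolding p_def using that by (rule arg_min_nat_le)
    have pm': "degree p' \<le> degree q" if "?P (inverse x) q" for q unfolding p'_def using that by (rule arg_min_nat_le)
    show False
    proof (cases "degree p' \<le> degree p")
      case True
      then show False using reduce[of p x p'] p p' x0 pm by (meson not_le)
    next
      case False
      then show False using reduce[of p' "inverse x" p] p p' x0 pm' by (metis inverse_inverse_eq inverse_nonzero_iff_nonzero nat_le_linear not_le)
    qed
  qed
  have "place M cst"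
    by unfold_locales (use inv' val' in auto)
  then show ?thesis using M unfolding \<A>_def by blast
qed

context place
begin

text \<open>Divisibility in the valuation ring, for arbitrary elements of the field. It stands for
  comparing values, and no value group is constructed.\<close>

definition vdvd :: "'b \<Rightarrow> 'b \<Rightarrow> bool" where
  "vdvd b w \<longleftrightarrow> (\<exists>y\<in>Domain G. w = b * y)"

lemma vdvd_0: "vdvd b 0"
  unfolding vdvd_def using zero by force

lemma vdvd_refl: "vdvd b b"
  unfolding vdvd_def using one by force

lemma vdvd_add: "vdvd b x \<Longrightarrow> vdvd b y \<Longrightarrow> vdvd b (x + y)"
proof -
  assume "vdvd b x" "vdvd b y"
  then obtain u v a e where "(u, a) \<in> G" "(v, e) \<in> G" "x = b * u" "y = b * v"
    unfolding vdvd_def by blast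
  moreover have "x + y = b * (u + v)" using calculation by (simp only: distrib_left)
  ultimately show ?thesis unfolding vdvd_def using add by blast
qed

lemma vdvd_uminus: "vdvd b x \<Longrightarrow> vdvd b (- x)"
  unfolding vdvd_def using uminus by (metis Domain.simps minus_mult_right)

lemma vdvd_diff: "vdvd b x \<Longrightarrow> vdvd b y \<Longrightarrow> vdvd b (x - y)"
  using vdvd_add[of b x "- y"] vdvd_uminus[of b y] by simp

lemma vdvd_mult: "vdvd b x \<Longrightarrow> y \<in> Domain G \<Longrightarrow> vdvd b (y * x)"
proof -
  assume "vdvd b x" "y \<in> Domain G"
  then obtain u v a e where "(u, a) \<in> G" "(y, e) \<in> G" "x = b * u"
    unfolding vdvd_def by blast
  moreover have "y * x = b * (y * u)" using calculation by (simp only: mult_ac)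
  ultimately show ?thesis unfolding vdvd_def using mult by blast
qed

lemma vdvd_mult2: "vdvd b x \<Longrightarrow> vdvd c y \<Longrightarrow> vdvd (b * c) (x * y)"
proof -
  assume "vdvd b x" "vdvd c y"
  then obtain u v a e where "(u, a) \<in> G" "(v, e) \<in> G" "x = b * u" "y = c * v"
    unfolding vdvd_def by blast
  moreover have "x * y = b * c * (u * v)" using calculation by (simp only: mult_ac)
  ultimately show ?thesis unfolding vdvd_def using mult by blast
qed

lemma vdvd_trans: "vdvd a b \<Longrightarrow> vdvd b c \<Longrightarrow> vdvd a c"
proof -
  assume "vdvd a b" "vdvd b c"
  then obtain u v where "u \<in> Domain G" "v \<in> Domain G" "b = a * u" "c = b * v"
    unfolding vdvd_def by blast
  moreover have "c = a * (u * v)" using calculation by (simp only: mult_ac)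
  moreover have "u * v \<in> Domain G" using calculation mult by blast
  ultimately show ?thesis unfolding vdvd_def by blast
qed

lemma Domain_add: "x \<in> Domain G \<Longrightarrow> y \<in> Domain G \<Longrightarrow> x + y \<in> Domain G"
  using add by blast

lemma Domain_mult: "x \<in> Domain G \<Longrightarrow> y \<in> Domain G \<Longrightarrow> x * y \<in> Domain G"
  using mult by blast

lemma Domain_uminus: "x \<in> Domain G \<Longrightarrow> - x \<in> Domain G"
  using uminus by blast

lemma Domain_diff: "x \<in> Domain G \<Longrightarrow> y \<in> Domain G \<Longrightarrow> x - y \<in> Domain G"
  using diff by blast

lemma Domain_power: "x \<in> Domain G \<Longrightarrow> x ^ k \<in> Domain G"
  using power by blast

lemma vdvd_power: "vdvd b x \<Longrightarrow> vdvd (b ^ k) (x ^ k)"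
  unfolding vdvd_def using Domain_power by (metis power_mult_distrib)

lemma vdvd_total: "vdvd x y \<or> vdvd y x"
proof (cases "x = 0 \<or> y = 0")
  case True
  then show ?thesis using vdvd_0 by blast
next
  case False
  have "y / x \<in> Domain G \<or> inverse (y / x) \<in> Domain G" by (rule val)
  then show ?thesis
  proof
    assume "y / x \<in> Domain G"
    then have "vdvd x y" unfolding vdvd_def using False by (intro bexI[of _ "y / x"]) auto
    then show ?thesis ..
  next
    assume "inverse (y / x) \<in> Domain G"
    then have "vdvd y x" unfolding vdvd_def using False by (intro bexI[of _ "inverse (y / x)"]) auto
    then show ?thesis ..
  qed
qed

lemma vdvd_least:
  assumes "finite S" "S \<noteq> {}"
  shows "\<exists>x\<in>S. \<forall>y\<in>S. vdvd x y"
  using assms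
proof (induction S rule: finite_ne_induct)
  case (singleton x)
  then show ?case by (auto intro: vdvd_refl)
next
  case (insert x S)
  then obtain y where y: "y \<in> S" "\<forall>z\<in>S. vdvd y z" by blast
  show ?case
  proof (cases "vdvd x y")
    case True
    then show ?thesis using y vdvd_trans vdvd_refl by blast
  next
    case False
    then show ?thesis using y vdvd_total[of x y] vdvd_refl by blast
  qed
qed

lemma unit_eq_0: "(u, a) \<in> G \<Longrightarrow> a \<noteq> 0 \<Longrightarrow> u \<noteq> 0"
  using uniq by blast

lemma vdvd_unit_cancel:
  assumes "(u, a) \<in> G" "a \<noteq> 0" "vdvd b (u * x)"
  shows "vdvd b x"
proof -
  have "vdvd b (inverse u * (u * x))" using vdvd_mult[OF assms(3)] inv[OF assms(1,2)] by blast
  then show ?thesis using unit_eq_0[OF assms(1,2)] by (simp add: mult.assoc[symmetric])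
qed

text \<open>Multiplication by a non-unit raises every value strictly, except that of 0.\<close>

lemma vdvd_self_mult:
  assumes "(p, 0) \<in> G" "vdvd (p * e) e"
  shows "e = 0"
proof (rule ccontr)
  assume e: "e \<noteq> 0"
  obtain y a where y: "(y, a) \<in> G" "e = p * e * y" using assms(2) unfolding vdvd_def by auto
  have "e = e * (p * y)" using y(2) by (simp only: mult_ac)
  then have "p * y = 1" using e by simp
  then have "(1, 0) \<in> G" using mult[OF assms(1) y(1)] by simp
  then show False using det[OF one] by fastforce
qed

text \<open>Writing \<open>y = b ^ 2 * z\<close>, the equation becomes
  \<open>(1 - b * z) * b = x\<close>, and \<open>1 - b * z\<close> specialises to 1, so it is a
  unit.\<close>

lemma vdvd_nakayama:
  assumes "(b, 0) \<in> G" "vdvd p x" "vdvd (b ^ 2) y" "b = x + y"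
  shows "vdvd p b"
proof -
  obtain z a where z: "(z, a) \<in> G" "y = b ^ 2 * z" using assms(3) unfolding vdvd_def by auto
  have "(1 - b * z, 1 - 0 * a) \<in> G" by (intro diff one mult assms z)
  moreover have "x = b - b ^ 2 * z" using assms(4) z(2) by (metis add_diff_cancel_right')
  then have "(1 - b * z) * b = x" by (simp only: left_diff_distrib right_diff_distrib mult_1_left mult_1_right power2_eq_square mult_ac)
  ultimately show ?thesis using vdvd_unit_cancel[of "1 - b * z" 1 p b] assms(2) by simp
qed

end

section \<open>Symmetric functions of the roots of a polynomial\<close>

text \<open>Logarithmic differentiation: each linear factor contributes a geometric series in
  \<open>w i\<close>, and these add up to the generating function of the power sums.\<close>

lemma newton_identity:
  fixes w :: "'i \<Rightarrow> 'a::field_char_0"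
  assumes "finite S"
  defines "W \<equiv> \<Prod>i\<in>S. fps_of_poly [:1, - w i:]"
  shows "fps_deriv W = - W * Abs_fps (\<lambda>k. \<Sum>i\<in>S. w i ^ Suc k)"
  using assms(1) unfolding W_def
proof (induction S rule: finite_induct)
  case empty
  have "Abs_fps (\<lambda>k. \<Sum>i\<in>{}. w i ^ Suc k) = 0" unfolding sum.empty fps_zero_def ..
  then show ?case by (simp only: prod.empty fps_deriv_1 mult_zero_right)
next
  case (insert j S)
  define L where "L = fps_of_poly [:1, - w j:]"
  define U where "U = (\<Prod>i\<in>S. fps_of_poly [:1, - w i:])"
  define g where "g = Abs_fps (\<lambda>k. w j ^ Suc k)"
  define P where "P = Abs_fps (\<lambda>k. \<Sum>i\<in>S. w i ^ Suc k)"
  have L: "L = 1 - fps_const (w j) * fps_X"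
    unfolding L_def by (simp add: fps_of_poly_pCons fps_of_poly_const mult.commute fps_const_neg[symmetric] del: fps_const_neg)
  have dL: "fps_deriv L = - fps_const (w j)" unfolding L by simp
  have Lg: "L * g = fps_const (w j)"
  proof (rule fps_ext)
    fix n
    have "L * g = g - fps_const (w j) * (fps_X * g)" unfolding L by (simp only: left_diff_distrib mult_1_left mult.assoc)
    then have "(L * g) $ n = g $ n - w j * (if n = 0 then 0 else g $ (n - 1))"
      by (simp only: fps_sub_nth fps_mult_left_const_nth fps_X_mult_nth)
    then show "(L * g) $ n = fps_const (w j) $ n"
      by (cases n) (simp_all add: g_def)
  qed
  have sum: "Abs_fps (\<lambda>k. \<Sum>i\<in>insert j S. w i ^ Suc k) = g + P"
    unfolding g_def P_def using insert by (intro fps_ext) simp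
  have prod: "(\<Prod>i\<in>insert j S. fps_of_poly [:1, - w i:]) = L * U"
    unfolding L_def U_def using insert by simp
  have "fps_deriv (L * U) = L * fps_deriv U + fps_deriv L * U" by simp
  also have "\<dots> = L * (- U * P) - (L * g) * U"
    by (simp only: insert.IH[folded U_def P_def] dL Lg mult_minus_left diff_conv_add_uminus)
  also have "\<dots> = - (L * U) * (g + P)"
    by (simp only: distrib_left minus_mult_left[symmetric] minus_mult_right[symmetric] diff_conv_add_uminus minus_add_distrib mult_ac add_ac)
  finally show ?case unfolding sum prod .
qed

text \<open>Newton's recursion determines the coefficients from the power sums and conversely. Going
  to the coefficients divides by \<open>k + 1\<close>, hence the closure of \<open>R\<close> under
  division by positive integers.\<close>

lemma symmetric_in_subring:
  fixes w :: "'i \<Rightarrow> 'a::field_char_0"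
  assumes fin: "finite S"
    and R1: "1 \<in> R" and Ra: "\<And>x y. x \<in> R \<Longrightarrow> y \<in> R \<Longrightarrow> x + y \<in> R"
    and Rm: "\<And>x y. x \<in> R \<Longrightarrow> y \<in> R \<Longrightarrow> x * y \<in> R"
    and Rn: "\<And>x. x \<in> R \<Longrightarrow> - x \<in> R"
    and Rd: "\<And>x k. x \<in> R \<Longrightarrow> x / of_nat (Suc k) \<in> R"
  defines "W \<equiv> \<Prod>i\<in>S. [:1, - w i:]"
  shows "(\<forall>k. coeff W k \<in> R) \<longleftrightarrow> (\<forall>k. (\<Sum>i\<in>S. w i ^ Suc k) \<in> R)"
proof -
  define p where "p k = (\<Sum>i\<in>S. w i ^ Suc k)" for k
  have Rsum: "sum f A \<in> R" if "\<And>x. x \<in> A \<Longrightarrow> f x \<in> R" for f :: "nat \<Rightarrow> 'a" and A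
    using that
  proof (induction A rule: infinite_finite_induct)
    case (infinite A)
    show ?case using Ra[OF R1 Rn[OF R1]] infinite by simp
  next
    case empty
    show ?case using Ra[OF R1 Rn[OF R1]] by simp
  qed (auto intro: Ra)
  have "fps_of_poly W = (\<Prod>i\<in>S. fps_of_poly [:1, - w i:])"
    unfolding W_def by (simp add: fps_of_poly_prod)
  then have D: "fps_deriv (fps_of_poly W) = - fps_of_poly W * Abs_fps p"
    using newton_identity[OF fin, of w] unfolding p_def by simp
  have rec: "of_nat (Suc k) * coeff W (Suc k) = - (\<Sum>i\<le>k. coeff W i * p (k - i))" for k
  proof -
    have "fps_deriv (fps_of_poly W) $ k = (- fps_of_poly W * Abs_fps p) $ k" using D by simp
    then show ?thesis by (simp add: fps_mult_nth sum_negf atLeast0AtMost)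
  qed
  have W0: "coeff W 0 = 1"
    unfolding W_def using fin by (induction S rule: finite_induct) (auto simp: coeff_mult)
  show ?thesis unfolding p_def[symmetric]
  proof
    assume P: "\<forall>k. p k \<in> R"
    have "coeff W k \<in> R" for k
    proof (induction k rule: less_induct)
      case (less k)
      show ?case
      proof (cases k)
        case 0
        then show ?thesis using W0 R1 by simp
      next
        case (Suc k')
        have "coeff W k = (- (\<Sum>i\<le>k'. coeff W i * p (k' - i))) / of_nat (Suc k')"
          unfolding rec[symmetric] Suc using of_nat_neq_0[of k', where 'a='a] by (simp del: of_nat_Suc)
        also have "\<dots> \<in> R" by (intro Rd Rn Rsum Rm less P[rule_format]) (auto simp: Suc)
        finally show ?thesis .
      qed
    qed
    then show "\<forall>k. coeff W k \<in> R" by blast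
  next
    assume W: "\<forall>k. coeff W k \<in> R"
    have Rnat: "of_nat n \<in> R" for n
      by (induction n) (use Ra R1 Ra[OF R1 Rn[OF R1]] in auto)
    have "p k \<in> R" for k
    proof (induction k rule: less_induct)
      case (less k)
      have "(\<Sum>i\<le>k. coeff W i * p (k - i)) = p k + (\<Sum>i\<in>{1..k}. coeff W i * p (k - i))"
      proof -
        have "{..k} = insert 0 {1..k}" by auto
        then show ?thesis using W0 by simp
      qed
      then have "p k = - (of_nat (Suc k) * coeff W (Suc k)) + - (\<Sum>i\<in>{1..k}. coeff W i * p (k - i))"
        using rec[of k] by simp
      also have "\<dots> \<in> R"
        by (intro Ra Rn Rm Rsum Rnat W[rule_format] less) auto
      finally show ?case .
    qed
    then show "\<forall>k. p k \<in> R" by blast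
  qed
qed

lemma reflect_linear_prod:
  fixes w :: "'i \<Rightarrow> 'a::field"
  shows "reflect_poly (\<Prod>i\<in>S. [:- w i, 1:]) = (\<Prod>i\<in>S. [:1, - w i:])"
proof -
  have "reflect_poly [:- a, 1:] = [:1, - a:]" for a :: 'a
    by (simp add: reflect_poly_def)
  then show ?thesis by (simp add: reflect_poly_prod)
qed

lemma linear_prod_degree:
  "finite S \<Longrightarrow> degree (\<Prod>i\<in>S. [:- w i, 1:]) = card S \<and> lead_coeff (\<Prod>i\<in>S. [:- w i, 1:]) = (1::'a::field)"
proof -
  assume f: "finite S"
  have "lead_coeff (\<Prod>i\<in>S. [:- w i, 1:]) = 1" by (simp add: lead_coeff_prod)
  moreover have "degree (\<Prod>i\<in>S. [:- w i, 1:]) = (\<Sum>i\<in>S. degree [:- w i, 1:])"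
    by (rule degree_prod_eq_sum_degree) auto
  ultimately show ?thesis by simp
qed

text \<open>The coefficients of the monic polynomial give the power sums of its roots, these give
  the power sums of the values of \<open>g\<close>, and those give the coefficients of the
  polynomial with roots \<open>poly g z\<close>, whose constant term is the norm up to sign. This
  takes the place of a resultant.\<close>

lemma norm_in_subring:
  fixes Z :: "'a::field_char_0 set"
  assumes fin: "finite Z"
    and R1: "1 \<in> R" and Ra: "\<And>x y. x \<in> R \<Longrightarrow> y \<in> R \<Longrightarrow> x + y \<in> R"
    and Rm: "\<And>x y. x \<in> R \<Longrightarrow> y \<in> R \<Longrightarrow> x * y \<in> R"
    and Rn: "\<And>x. x \<in> R \<Longrightarrow> - x \<in> R"
    and Rd: "\<And>x k. x \<in> R \<Longrightarrow> x / of_nat (Suc k) \<in> R"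
    and f: "\<And>k. coeff (\<Prod>z\<in>Z. [:- z, 1:]) k \<in> R"
    and g: "\<And>k. coeff g k \<in> R"
  shows "(\<Prod>z\<in>Z. poly g z) \<in> R"
proof -
  have R0: "0 \<in> R" using Ra[OF R1 Rn[OF R1]] by simp
  have Rsum: "sum f A \<in> R" if "\<And>x. x \<in> A \<Longrightarrow> f x \<in> R" for f :: "'x \<Rightarrow> 'a" and A
    using that by (induction A rule: infinite_finite_induct) (auto intro: R0 Ra)
  have Rnat: "of_nat n \<in> R" for n
    by (induction n) (use Ra R1 R0 in auto)
  note sym = symmetric_in_subring[OF fin R1 Ra Rm Rn Rd]
  have "\<forall>k. coeff (\<Prod>z\<in>Z. [:1, - z:]) k \<in> R"
    unfolding reflect_linear_prod[symmetric] using f R0 by (auto simp: coeff_reflect_poly)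
  then have P: "(\<Sum>z\<in>Z. z ^ Suc k) \<in> R" for k using sym[of "\<lambda>z. z"] by blast
  have P': "(\<Sum>z\<in>Z. z ^ k) \<in> R" for k
    using P Rnat[of "card Z"] by (cases k) auto
  have gk: "coeff (g ^ k) j \<in> R" for k j
  proof (induction k arbitrary: j)
    case 0
    show ?case using R0 R1 by (simp add: coeff_1)
  next
    case (Suc k)
    show ?case unfolding power_Suc coeff_mult by (intro Rsum Rm g Suc)
  qed
  have "(\<Sum>z\<in>Z. poly g z ^ k) \<in> R" for k
  proof -
    have "(\<Sum>z\<in>Z. poly g z ^ k) = (\<Sum>z\<in>Z. \<Sum>j\<le>degree (g ^ k). coeff (g ^ k) j * z ^ j)"
      by (intro sum.cong refl) (simp only: poly_power[symmetric] poly_altdef[of "g ^ k"])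
    also have "\<dots> = (\<Sum>j\<le>degree (g ^ k). coeff (g ^ k) j * (\<Sum>z\<in>Z. z ^ j))"
      unfolding sum_distrib_left by (rule sum.swap)
    also have "\<dots> \<in> R" by (intro Rsum Rm gk P')
    finally show ?thesis .
  qed
  then have "\<forall>k. coeff (\<Prod>z\<in>Z. [:1, - poly g z:]) k \<in> R" using sym[of "poly g"] by blast
  then have "coeff (reflect_poly (\<Prod>z\<in>Z. [:- poly g z, 1:])) (card Z) \<in> R"
    unfolding reflect_linear_prod by blast
  moreover have "coeff (reflect_poly (\<Prod>z\<in>Z. [:- poly g z, 1:])) (card Z) = coeff (\<Prod>z\<in>Z. [:- poly g z, 1:]) 0"
    using linear_prod_degree[OF fin, of "poly g"] by (simp add: coeff_reflect_poly)
  moreover have "coeff (\<Prod>z\<in>Z. [:- poly g z, 1:]) 0 = (\<Prod>z\<in>Z. - poly g z)"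
    by (simp add: poly_0_coeff_0[symmetric] poly_prod)
  moreover have "(\<Prod>z\<in>Z. - poly g z) = (- 1) ^ card Z * (\<Prod>z\<in>Z. poly g z)"
    by (simp add: prod_uminus)
  ultimately have 1: "(- 1) ^ card Z * (\<Prod>z\<in>Z. poly g z) \<in> R" by simp
  have 2: "(- 1) ^ k \<in> R" for k :: nat by (induction k) (auto simp: R1 Rn)
  have "(- 1) ^ card Z * ((- 1) ^ card Z * (\<Prod>z\<in>Z. poly g z)) \<in> R" by (rule Rm[OF 2 1])
  then show ?thesis by (simp add: mult.assoc[symmetric] power_mult_distrib[symmetric])
qed

no_notation fps_nth (infixl \<open>$\<close> 75)

section \<open>Homogeneous coordinates\<close>

lemma hcoords_exists: "\<exists>v. hcoords v x"
proof -
  have "proj_rel (rep_proj x) (rep_proj x)" "abs_proj (rep_proj x) = x"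
    using Quotient_rep_reflp[OF Quotient_proj] Quotient_abs_rep[OF Quotient_proj] by blast+
  then show ?thesis unfolding hcoords_def proj_rel_def by blast
qed

lemma proj_rel_refl: "v \<noteq> 0 \<Longrightarrow> proj_rel v v"
  unfolding proj_rel_def by (metis vec.scale_one zero_neq_one)

lemma hcoords_scale:
  assumes "hcoords v x" "c \<noteq> 0"
  shows "hcoords (c *s v) x"
proof -
  have v: "v \<noteq> 0" "abs_proj v = x" using assms by (auto simp: hcoords_def)
  have cv: "c *s v \<noteq> 0" using v assms by simp
  then have "proj_rel v (c *s v)" using v assms unfolding proj_rel_def by blast
  then have "abs_proj v = abs_proj (c *s v)" by (rule Quotient_rel_abs[OF Quotient_proj])
  then show ?thesis using v cv by (simp add: hcoords_def)
qed

lemma hcoords_unique: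
  assumes "hcoords v x" "hcoords w x"
  shows "\<exists>c. c \<noteq> 0 \<and> w = c *s v"
proof -
  have "v \<noteq> 0" "w \<noteq> 0" "abs_proj v = abs_proj w" using assms by (auto simp: hcoords_def)
  then have "proj_rel v w" using Quotient_rel[OF Quotient_proj, of v w] proj_rel_refl by blast
  then show ?thesis unfolding proj_rel_def by blast
qed

lemma hcoords_same: "hcoords v x \<Longrightarrow> hcoords v y \<Longrightarrow> x = y"
  by (simp add: hcoords_def)

lemma hcoords_nz: "hcoords v x \<Longrightarrow> v \<noteq> 0"
  by (simp add: hcoords_def)

lemma hcoords_abs: "v \<noteq> 0 \<Longrightarrow> hcoords v (abs_proj v)"
  by (simp add: hcoords_def)

lemma hcoords_normalise:
  assumes "hcoords v x" "v $ j \<noteq> 0"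
  shows "hcoords (inverse (v $ j) *s v) x" "(inverse (v $ j) *s v) $ j = 1"
  using hcoords_scale[OF assms(1)] assms(2) by auto

lemma meval_scale: "homogeneous e f \<Longrightarrow> meval f (c *s v) = c ^ e * meval f v"
  unfolding meval_evalh vector_smult_component using ev_id.evalh_scale[of e f c "\<lambda>i. v $ i"] by simp

lemma vanishes_at_iff:
  assumes "homogeneous e f" "hcoords v x"
  shows "vanishes_at f x \<longleftrightarrow> meval f v = 0"
  unfolding vanishes_at_def
proof safe
  fix w
  assume "meval f v = 0" "hcoords w x"
  then show "meval f w = 0"
    using hcoords_unique[OF assms(2)] meval_scale[OF assms(1)] by fastforce
qed (use assms in blast)

lemma zclosed_insert_form:
  assumes "zclosed Xs" "homogeneous e f"
  shows "zclosed {x \<in> Xs. vanishes_at f x}"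
proof -
  obtain S where S: "\<forall>f\<in>S. \<exists>e. homogeneous e f" "Xs = {x. \<forall>f\<in>S. vanishes_at f x}"
    using assms(1) unfolding zclosed_def by blast
  show ?thesis unfolding zclosed_def
    by (rule exI[of _ "insert f S"]) (use S assms(2) in auto)
qed

lemma zopen_form:
  assumes "zopen U" "q \<in> U"
  obtains s e where "homogeneous e s" "\<not> vanishes_at s q" "\<And>x. x \<notin> U \<Longrightarrow> vanishes_at s x"
proof -
  obtain S where S: "\<forall>f\<in>S. \<exists>e. homogeneous e f" "- U = {x. \<forall>f\<in>S. vanishes_at f x}"
    using assms(1) unfolding zopen_def zclosed_def by blast
  then obtain s where s: "s \<in> S" "\<not> vanishes_at s q" using assms(2) by blast
  show ?thesis
  proof (rule that)
    show "homogeneous (SOME e. homogeneous e s) s" using S s by (metis someI_ex)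
    show "vanishes_at s x" if "x \<notin> U" for x using S s that by blast
  qed fact
qed

lemma vanishing_ideal_add: "f \<in> vanishing_ideal Xs \<Longrightarrow> g \<in> vanishing_ideal Xs \<Longrightarrow> f + g \<in> vanishing_ideal Xs"
  by (simp add: vanishing_ideal_def vanishes_at_def mev.add)

lemma vanishing_ideal_mult: "f \<in> vanishing_ideal Xs \<Longrightarrow> g * f \<in> vanishing_ideal Xs"
  by (simp add: vanishing_ideal_def vanishes_at_def mev.mult)

lemma vanishing_ideal_0: "0 \<in> vanishing_ideal Xs"
  by (simp add: vanishing_ideal_def vanishes_at_def mev.zero)

section \<open>Lines in the plane\<close>

definition dot :: "'a::comm_ring_1 ^ 'n \<Rightarrow> 'a ^ 'n \<Rightarrow> 'a" where
  "dot a v = (\<Sum>i\<in>UNIV. a $ i * v $ i)"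

definition cross :: "'a::comm_ring_1 ^ 3 \<Rightarrow> 'a ^ 3 \<Rightarrow> 'a ^ 3" where
  "cross a b = (\<chi> i. if i = 1 then a $ 2 * b $ 3 - a $ 3 * b $ 2
     else if i = 2 then a $ 3 * b $ 1 - a $ 1 * b $ 3 else a $ 1 * b $ 2 - a $ 2 * b $ 1)"

lemma cross_simps: "cross a b $ 1 = a $ 2 * b $ 3 - a $ 3 * b $ 2"
  "cross a b $ 2 = a $ 3 * b $ 1 - a $ 1 * b $ 3" "cross a b $ 3 = a $ 1 * b $ 2 - a $ 2 * b $ 1"
  by (simp_all add: cross_def)

lemma dot_3: "dot a b = a $ 1 * b $ 1 + a $ 2 * b $ 2 + a $ 3 * b $ 3" for a b :: "'a::comm_ring_1 ^ 3"
  by (simp add: dot_def sum_3)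

lemma dot_add: "dot (a + b) v = dot a v + dot b v" "dot v (a + b) = dot v a + dot v b"
  by (simp_all add: dot_def algebra_simps sum.distrib)

lemma dot_diff: "dot (a - b) v = dot a v - dot b v" "dot v (a - b) = dot v a - dot v b"
  by (simp_all add: dot_def algebra_simps sum_subtractf)

lemma dot_scale: "dot (c *s a) v = c * dot a v" "dot v (c *s a) = c * dot v a"
  unfolding dot_def sum_distrib_left by (auto intro!: sum.cong simp: mult_ac)

lemma dot_zero: "dot 0 v = 0" "dot v 0 = 0"
  by (simp_all add: dot_def)

lemma dot_commute: "dot a b = dot b a"
  unfolding dot_def by (simp only: mult.commute)

lemma vec3_eq_iff: "a = b \<longleftrightarrow> a $ 1 = b $ 1 \<and> a $ 2 = b $ 2 \<and> a $ 3 = b $ 3" for a b :: "'a ^ 3"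
  by (simp add: vec_eq_iff forall_3)

lemma dot_cross: "dot a (cross a b) = 0" "dot b (cross a b) = 0"
  by (simp_all add: dot_3 cross_simps algebra_simps)

lemma dot_cross_cyclic: "dot a (cross b c) = dot b (cross c a)"
  by (simp add: dot_3 cross_simps algebra_simps)

lemma cross_cross: "cross a (cross b c) = dot a c *s b - dot a b *s c"
  by (simp add: vec3_eq_iff dot_3 cross_simps algebra_simps)

lemma cross_skew: "cross a b = - cross b a"
  by (simp add: vec3_eq_iff cross_simps)

lemma cross_self [simp]: "cross a a = 0"
  by (simp add: vec3_eq_iff cross_simps)

lemma cross_scale: "cross (c *s a) b = c *s cross a b" "cross a (c *s b) = c *s cross a b"
  by (simp_all add: vec3_eq_iff cross_simps algebra_simps)

lemma cross_eq_0:
  fixes a b :: "'a::field ^ 3"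
  assumes "cross a b = 0" "a \<noteq> 0"
  shows "\<exists>c. b = c *s a"
proof -
  have e: "a $ 2 * b $ 3 = a $ 3 * b $ 2" "a $ 3 * b $ 1 = a $ 1 * b $ 3" "a $ 1 * b $ 2 = a $ 2 * b $ 1"
    using assms(1) by (simp_all add: vec3_eq_iff cross_simps)
  from assms(2) consider "a $ 1 \<noteq> 0" | "a $ 2 \<noteq> 0" | "a $ 3 \<noteq> 0" by (auto simp: vec3_eq_iff)
  then show ?thesis
  proof cases
    case 1
    then show ?thesis using e by (intro exI[of _ "b $ 1 / a $ 1"]) (auto simp: vec3_eq_iff field_simps)
  next
    case 2
    then show ?thesis using e by (intro exI[of _ "b $ 2 / a $ 2"]) (auto simp: vec3_eq_iff field_simps)
  next
    case 3
    then show ?thesis using e by (intro exI[of _ "b $ 3 / a $ 3"]) (auto simp: vec3_eq_iff field_simps)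
  qed
qed

text \<open>Cramer's rule. When the determinant of \<open>a\<close>, \<open>b\<close>,
  \<open>c\<close> vanishes, a nonzero entry of \<open>cross a b\<close> lets one solve for
  \<open>c\<close>.\<close>

lemma cross_cramer:
  "(dot (cross a b) c) *s axis k (1::'a::comm_ring_1)
     = cross a b $ k *s c - cross c b $ k *s a - cross a c $ k *s b"
proof -
  have "k = 1 \<or> k = 2 \<or> k = 3" using exhaust_3 by blast
  then show ?thesis
    by (elim disjE; simp add: vec3_eq_iff dot_3 cross_simps axis_def algebra_simps)
qed

text \<open>The lines through a point form a pencil spanned by any two of them:
  \<open>cross a b\<close> is a multiple of \<open>p\<close>, so the determinant of
  \<open>a\<close>, \<open>b\<close>, \<open>l\<close> is 0 and Cramer's rule solves for
  \<open>l\<close>.\<close>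

lemma dot_perp_span:
  fixes a b l p :: "'a::field ^ 3"
  assumes "cross a b \<noteq> 0" "p \<noteq> 0" "dot a p = 0" "dot b p = 0" "dot l p = 0"
  shows "\<exists>\<alpha> \<beta>. l = \<alpha> *s a + \<beta> *s b"
proof -
  have "cross p (cross a b) = 0"
    using assms by (simp add: cross_cross dot_commute[of p])
  then obtain c where "cross a b = c *s p" using cross_eq_0 assms by blast
  then have d: "dot (cross a b) l = 0" using assms by (simp add: dot_scale dot_commute[of p])
  obtain k where k: "cross a b $ k \<noteq> 0" using assms(1) by (auto simp: vec_eq_iff)
  have "cross a b $ k *s l = cross l b $ k *s a + cross a l $ k *s b"
    using cross_cramer[of a b l k] d by (simp add: algebra_simps)
  then have "inverse (cross a b $ k) *s (cross a b $ k *s l)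
     = (inverse (cross a b $ k) * cross l b $ k) *s a + (inverse (cross a b $ k) * cross a l $ k) *s b"
    by (simp add: vec.scale_right_distrib)
  then show ?thesis using k by auto
qed

lemma pline_iff: "hcoords v x \<Longrightarrow> x \<in> pline a \<longleftrightarrow> dot a v = 0"
proof
  assume v: "hcoords v x" and "dot a v = 0"
  then have "dot a w = 0" if "hcoords w x" for w
    using hcoords_unique[OF v that] by (auto simp: dot_scale)
  then show "x \<in> pline a" by (simp add: pline_def dot_def)
qed (simp add: pline_def dot_def)

lemma pline_scale: "c \<noteq> 0 \<Longrightarrow> pline (c *s a) = pline a"
  unfolding pline_def dot_def[symmetric] by (simp add: dot_scale)

lemma cross_axis_dot: "dot b (cross a (axis k 1)) = cross b a $ k"
proof -
  have "k = 1 \<or> k = 2 \<or> k = 3" using exhaust_3 by blast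
  then show ?thesis
    by (elim disjE; simp add: dot_3 cross_simps axis_def algebra_simps)
qed

lemma pline_eq:
  fixes a b :: "'a::field ^ 3"
  assumes "pline a = pline b" "a \<noteq> 0"
  shows "\<exists>c. b = c *s a"
proof (rule ccontr)
  assume "\<not> ?thesis"
  then have "cross b a \<noteq> 0" using cross_eq_0[of a b] assms(2) cross_skew[of a b] by auto
  then obtain k where k: "cross b a $ k \<noteq> 0" by (auto simp: vec_eq_iff)
  define v where "v = cross a (axis k 1)"
  have "dot b v \<noteq> 0" using k by (simp add: v_def cross_axis_dot)
  then have v: "v \<noteq> 0" by (auto simp: dot_zero)
  have "dot a v = 0" by (simp add: v_def dot_cross)
  then have "abs_proj v \<in> pline a" using pline_iff[OF hcoords_abs[OF v]] by blast
  then show False using assms(1) \<open>dot b v \<noteq> 0\<close> pline_iff[OF hcoords_abs[OF v]] by blast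
qed

lemma pline_eq_iff:
  fixes a b :: "'a::field ^ 3"
  assumes "a \<noteq> 0" "b \<noteq> 0"
  shows "pline a = pline b \<longleftrightarrow> cross a b = 0"
proof
  assume "pline a = pline b"
  then obtain c where "b = c *s a" using pline_eq assms(1) by blast
  then show "cross a b = 0" by (simp add: cross_scale)
next
  assume "cross a b = 0"
  then obtain c where c: "b = c *s a" using cross_eq_0 assms(1) by blast
  then have "c \<noteq> 0" using assms(2) by auto
  then show "pline a = pline b" using pline_scale[of c a] c by simp
qed

lemma dot_separates:
  fixes p q :: "'a::field ^ 'n"
  assumes "p \<noteq> 0"
  shows "\<exists>a. dot a p \<noteq> 0"
proof -
  obtain k where "p $ k \<noteq> 0" using assms by (auto simp: vec_eq_iff)
  moreover have "dot (axis k 1) p = p $ k"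
    unfolding dot_def axis_def by (simp add: if_distrib[of "\<lambda>x. x * _"] cong: if_cong)
  ultimately show ?thesis by metis
qed

section \<open>Orders of vanishing\<close>

lemma ideal_power_ideal:
  "0 \<in> ideal_power I k" "x \<in> ideal_power I k \<Longrightarrow> y \<in> ideal_power I k \<Longrightarrow> x + y \<in> ideal_power I k"
  "x \<in> ideal_power I k \<Longrightarrow> c * x \<in> ideal_power I k"
proof -
  show "0 \<in> ideal_power I k" by (cases k) (auto intro: ideal.span_zero)
  show "x \<in> ideal_power I k \<Longrightarrow> y \<in> ideal_power I k \<Longrightarrow> x + y \<in> ideal_power I k"
    by (cases k) (auto intro: ideal.span_add)
  show "x \<in> ideal_power I k \<Longrightarrow> c * x \<in> ideal_power I k"
    by (cases k) (auto intro: ideal.span_scale)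
qed

lemma ideal_power_subspace: "ideal.subspace (ideal_power I k)"
  unfolding ideal.subspace_def using ideal_power_ideal by blast

lemma ideal_power_Suc_subset: "ideal_power I (Suc k) \<subseteq> ideal_power I k"
proof -
  have "{a * b |a b. a \<in> I \<and> b \<in> ideal_power I k} \<subseteq> ideal_power I k"
    using ideal_power_ideal(3) by blast
  then show ?thesis using ideal.span_minimal[OF _ ideal_power_subspace] by simp
qed

lemma ideal_power_antimono: "j \<le> k \<Longrightarrow> ideal_power I k \<subseteq> ideal_power I j"
proof (induction k rule: dec_induct)
  case (step k)
  then show ?case using ideal_power_Suc_subset by blast
qed simp

lemma ideal_power_mult:
  "x \<in> ideal_power I j \<Longrightarrow> y \<in> ideal_power I k \<Longrightarrow> x * y \<in> ideal_power I (j + k)"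
proof (induction j arbitrary: x)
  case 0
  then show ?case using ideal_power_ideal(3) by simp
next
  case (Suc j)
  define T where "T = {x. x * y \<in> ideal_power I (Suc j + k)}"
  have "ideal.subspace T"
    unfolding ideal.subspace_def T_def
    using ideal_power_ideal[where I = I and k = "Suc j + k"] by (simp add: distrib_right mult.assoc del: ideal_power.simps add_Suc)
  moreover have "{a * b |a b. a \<in> I \<and> b \<in> ideal_power I j} \<subseteq> T"
  proof
    fix z
    assume "z \<in> {a * b |a b. a \<in> I \<and> b \<in> ideal_power I j}"
    then obtain a b where z: "z = a * b" "a \<in> I" "b \<in> ideal_power I j" by blast
    then have "a * (b * y) \<in> {a * b |a b. a \<in> I \<and> b \<in> ideal_power I (j + k)}" using Suc by blast
    then have "a * (b * y) \<in> ideal_power I (Suc j + k)" by (simp add: ideal.span_base)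
    then show "z \<in> T" unfolding T_def z by (simp only: mem_Collect_eq mult.assoc)
  qed
  ultimately have "ideal_power I (Suc j) \<subseteq> T" using ideal.span_minimal by simp
  then show ?case using Suc(2) unfolding T_def by blast
qed

lemma ideal_power_1:
  assumes "x \<in> I"
  shows "x \<in> ideal_power I 1"
proof -
  have "x * 1 \<in> {a * b |a b. a \<in> I \<and> b \<in> ideal_power I 0}" using assms by (intro CollectI exI[of _ x] exI[of _ 1]) simp
  then have "x * 1 \<in> ideal_power I (Suc 0)" unfolding ideal_power.simps(2) by (rule ideal.span_base)
  then show ?thesis by simp
qed

definition nonvan :: "('a::field, 'n::finite) proj \<Rightarrow> ('a, 'n) mpoly \<Rightarrow> bool" where
  "nonvan q s \<longleftrightarrow> (\<exists>e. homogeneous e s) \<and> \<not> vanishes_at s q"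

lemma nonvan_iff: "homogeneous e s \<Longrightarrow> hcoords v q \<Longrightarrow> nonvan q s \<longleftrightarrow> meval s v \<noteq> 0"
  unfolding nonvan_def using vanishes_at_iff by blast

lemma nonvan_1: "nonvan q 1"
proof -
  obtain v where "hcoords v q" using hcoords_exists by blast
  then show ?thesis using nonvan_iff[OF homogeneous_1, of v q] by (simp add: mev.one)
qed

lemma nonvan_mult: "nonvan q s \<Longrightarrow> nonvan q t \<Longrightarrow> nonvan q (s * t)"
proof -
  assume st: "nonvan q s" "nonvan q t"
  obtain v where v: "hcoords v q" using hcoords_exists by blast
  from st obtain e e' where h: "homogeneous e s" "homogeneous e' t" unfolding nonvan_def by blast
  show ?thesis
    using st nonvan_iff[OF h(1) v] nonvan_iff[OF h(2) v] nonvan_iff[OF homogeneous_mult[OF h] v]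
    by (simp add: mev.mult)
qed

lemma nonvan_power: "nonvan q s \<Longrightarrow> nonvan q (s ^ k)"
  by (induction k) (auto intro: nonvan_1 nonvan_mult)

lemma zopen_nonvan:
  assumes "zopen U" "q \<in> U"
  obtains s where "nonvan q s" "\<forall>x. x \<notin> U \<longrightarrow> vanishes_at s x"
  using zopen_form[OF assms] unfolding nonvan_def by metis

lemma order_ge_iff:
  "order_ge D q H k \<longleftrightarrow> (\<exists>s \<alpha> \<beta>. nonvan q s \<and> \<alpha> \<in> ideal_power (vanishing_ideal {q}) k
      \<and> \<beta> \<in> vanishing_ideal D \<and> s * H = \<alpha> + \<beta>)"
  unfolding order_ge_def nonvan_def by blast

lemma order_ge_0: "order_ge D q H 0"
  unfolding order_ge_iff using nonvan_1 vanishing_ideal_0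
  by (intro exI[of _ 1] exI[of _ H] exI[of _ 0]) auto

lemma order_ge_zero: "order_ge D q 0 k"
  unfolding order_ge_iff using nonvan_1 vanishing_ideal_0 ideal_power_ideal(1)
  by (intro exI[of _ 1] exI[of _ 0]) auto

lemma order_ge_antimono: "order_ge D q H k \<Longrightarrow> j \<le> k \<Longrightarrow> order_ge D q H j"
  unfolding order_ge_iff using ideal_power_antimono[of j k "vanishing_ideal {q}"] by blast

text \<open>In the local ring of the model the equation makes \<open>H\<close> a multiple of
  \<open>H'\<close>, since \<open>s\<close> becomes a unit and \<open>\<beta>\<close> becomes
  0.\<close>

lemma order_ge_cancel:
  assumes "order_ge D q H' k" "nonvan q s" "\<beta> \<in> vanishing_ideal D" "s * H = g * H' + \<beta>"
  shows "order_ge D q H k"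
proof -
  obtain t \<alpha> \<beta>' where t: "nonvan q t" "\<alpha> \<in> ideal_power (vanishing_ideal {q}) k" "\<beta>' \<in> vanishing_ideal D"
    "t * H' = \<alpha> + \<beta>'" using assms(1) unfolding order_ge_iff by blast
  have "(t * s) * H = g * (t * H') + t * \<beta>"
    unfolding mult.assoc assms(4) by (simp only: distrib_left mult_ac)
  also have "\<dots> = g * \<alpha> + (g * \<beta>' + t * \<beta>)" unfolding t by (simp only: distrib_left add_ac)
  finally have e: "(t * s) * H = g * \<alpha> + (g * \<beta>' + t * \<beta>)" .
  have "nonvan q (t * s)" using t assms nonvan_mult by blast
  moreover have "g * \<alpha> \<in> ideal_power (vanishing_ideal {q}) k" using t ideal_power_ideal(3) by blast
  moreover have "g * \<beta>' + t * \<beta> \<in> vanishing_ideal D"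
    using t assms vanishing_ideal_add vanishing_ideal_mult by blast
  ultimately show ?thesis unfolding order_ge_iff using e by blast
qed

lemma order_ge_mult_left: "order_ge D q H k \<Longrightarrow> order_ge D q (g * H) k"
  by (rule order_ge_cancel[of D q H k 1 0 "g * H" g]) (auto simp: nonvan_1 vanishing_ideal_0)

lemma order_ge_add:
  assumes "order_ge D q H k" "order_ge D q H' k"
  shows "order_ge D q (H + H') k"
proof -
  obtain t \<alpha> \<beta> where t: "nonvan q t" "\<alpha> \<in> ideal_power (vanishing_ideal {q}) k" "\<beta> \<in> vanishing_ideal D"
    "t * H = \<alpha> + \<beta>" using assms(1) unfolding order_ge_iff by blast
  obtain t' \<alpha>' \<beta>' where t': "nonvan q t'" "\<alpha>' \<in> ideal_power (vanishing_ideal {q}) k" "\<beta>' \<in> vanishing_ideal D"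
    "t' * H' = \<alpha>' + \<beta>'" using assms(2) unfolding order_ge_iff by blast
  have "(t * t') * (H + H') = t' * (t * H) + t * (t' * H')" by (simp only: distrib_left mult_ac)
  also have "\<dots> = (t' * \<alpha> + t * \<alpha>') + (t' * \<beta> + t * \<beta>')" unfolding t t' by (simp only: distrib_left add_ac)
  finally have e: "(t * t') * (H + H') = (t' * \<alpha> + t * \<alpha>') + (t' * \<beta> + t * \<beta>')" .
  show ?thesis unfolding order_ge_iff
    by (rule exI[of _ "t * t'"], rule exI[of _ "t' * \<alpha> + t * \<alpha>'"], rule exI[of _ "t' * \<beta> + t * \<beta>'"])
      (use t t' e in \<open>auto intro: nonvan_mult vanishing_ideal_add vanishing_ideal_mult ideal_power_ideal(2,3)\<close>)
qed

lemma order_ge_mult: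
  assumes "order_ge D q H j" "order_ge D q H' k"
  shows "order_ge D q (H * H') (j + k)"
proof -
  obtain t \<alpha> \<beta> where t: "nonvan q t" "\<alpha> \<in> ideal_power (vanishing_ideal {q}) j" "\<beta> \<in> vanishing_ideal D"
    "t * H = \<alpha> + \<beta>" using assms(1) unfolding order_ge_iff by blast
  obtain t' \<alpha>' \<beta>' where t': "nonvan q t'" "\<alpha>' \<in> ideal_power (vanishing_ideal {q}) k" "\<beta>' \<in> vanishing_ideal D"
    "t' * H' = \<alpha>' + \<beta>'" using assms(2) unfolding order_ge_iff by blast
  have "(t * t') * (H * H') = (t * H) * (t' * H')" by (simp only: mult_ac)
  also have "\<dots> = \<alpha> * \<alpha>' + (\<alpha>' * \<beta> + (\<alpha> + \<beta>) * \<beta>')" unfolding t t' by (simp only: distrib_left distrib_right mult_ac add_ac)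
  finally have e: "(t * t') * (H * H') = \<alpha> * \<alpha>' + (\<alpha>' * \<beta> + (\<alpha> + \<beta>) * \<beta>')" .
  show ?thesis unfolding order_ge_iff
    by (rule exI[of _ "t * t'"], rule exI[of _ "\<alpha> * \<alpha>'"], rule exI[of _ "\<alpha>' * \<beta> + (\<alpha> + \<beta>) * \<beta>'"])
      (use t t' e in \<open>auto intro: nonvan_mult vanishing_ideal_add vanishing_ideal_mult ideal_power_mult\<close>)
qed

text \<open>Besides the pullback of a line under a map, this also yields linear forms
  (\<open>G = mvar\<close>) and directional derivatives (\<open>G\<close> the partial
  derivatives).\<close>

definition pull :: "'a::comm_ring_1 ^ 'k \<Rightarrow> ('k \<Rightarrow> ('a, 'n::finite) mpoly) \<Rightarrow> ('a, 'n) mpoly" where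
  "pull a G = (\<Sum>i\<in>UNIV. mconst (a $ i) * G i)"

lemma pull_add: "pull (a + b) G = pull a G + pull b G"
  by (simp add: pull_def mconst_simps distrib_right sum.distrib)

lemma pull_diff: "pull (a - b) G = pull a G - pull b G"
  by (simp add: pull_def mconst_simps rhom.diff[OF rhom_mconst] left_diff_distrib sum_subtractf)

lemma pull_scale: "pull (c *s a) G = mconst c * pull a G"
  by (simp add: pull_def mconst_simps mult.assoc sum_distrib_left)

lemma pull_axis: "pull (axis k 1) G = G k"
proof -
  have "pull (axis k 1) G = (\<Sum>i\<in>UNIV. if i = k then G k else 0)"
    unfolding pull_def by (rule sum.cong) (auto simp: axis_def mconst_simps)
  then show ?thesis by simp
qed

lemma evalh_pull:
  assumes "rhom h"
  shows "evalh h (pull a G) v = (\<Sum>i\<in>UNIV. h (a $ i) * evalh h (G i) v)"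
proof -
  interpret h: rhom h by fact
  interpret e: rhom "\<lambda>f. evalh h f v" by (rule h.rhom_evalh)
  show ?thesis by (simp add: pull_def e.sum e.mult h.evalh_mconst)
qed

lemma vec_nth_lambda: "($) (\<chi> i. f i) = f"
  by (simp add: fun_eq_iff)

lemma meval_pull: "meval (pull a G) v = dot a (\<chi> i. meval (G i) v)"
  by (simp add: pull_def mev.sum mev.mult dot_def)

lemma homogeneous_pull: "(\<And>i. homogeneous e (G i)) \<Longrightarrow> homogeneous e (pull a G)"
  unfolding pull_def by (intro homogeneous_sum homogeneous_const_mult)

definition rep_at :: "('a::field, 'n::finite) proj set \<Rightarrow> (('a, 'n) proj \<Rightarrow> ('a, 'k::finite) proj) \<Rightarrow>
    ('a, 'n) proj \<Rightarrow> nat \<Rightarrow> ('k \<Rightarrow> ('a, 'n) mpoly) \<Rightarrow> bool" where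
  "rep_at D \<phi> q e G \<longleftrightarrow> (\<exists>U. zopen U \<and> q \<in> U \<and> represents e G \<phi> (D \<inter> U))"

lemma rep_at_homogeneous: "rep_at D \<phi> q e G \<Longrightarrow> homogeneous e (G i)"
  unfolding rep_at_def represents_def by blast

lemma rep_at_hcoords: "rep_at D \<phi> q e G \<Longrightarrow> q \<in> D \<Longrightarrow> hcoords v q \<Longrightarrow> hcoords (\<chi> i. meval (G i) v) (\<phi> q)"
  unfolding rep_at_def represents_def by blast

text \<open>Two representations of the same map are proportional where both hold, so their
  two-by-two minors vanish there; factors vanishing outside the two open sets extend this to the
  whole of \<open>D\<close>.\<close>

lemma rep_at_change:
  fixes a :: "'a::field ^ 'k::finite"
  assumes G: "rep_at D \<phi> q e G" and G': "rep_at D \<phi> q e' G'" and q: "q \<in> D"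
    and o: "order_ge D q (pull a G') k"
  shows "order_ge D q (pull a G) k"
proof -
  obtain U where U: "zopen U" "q \<in> U" "represents e G \<phi> (D \<inter> U)" using G unfolding rep_at_def by blast
  obtain U' where U': "zopen U'" "q \<in> U'" "represents e' G' \<phi> (D \<inter> U')" using G' unfolding rep_at_def by blast
  obtain s where s: "nonvan q s" "\<forall>x. x \<notin> U \<longrightarrow> vanishes_at s x"
    by (rule zopen_nonvan[OF U(1,2)])
  obtain s' where s': "nonvan q s'" "\<forall>x. x \<notin> U' \<longrightarrow> vanishes_at s' x"
    by (rule zopen_nonvan[OF U'(1,2)])
  obtain v where v: "hcoords v q" using hcoords_exists by blast
  have "(\<chi> i. meval (G' i) v) \<noteq> 0" using rep_at_hcoords[OF G' q v] hcoords_nz by blast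
  then obtain j where j: "meval (G' j) v \<noteq> 0" by (auto simp: vec_eq_iff)
  then have nj: "nonvan q (G' j)" using nonvan_iff[OF rep_at_homogeneous[OF G'] v] by blast
  define \<beta> where "\<beta> = s * s' * (G' j * pull a G - G j * pull a G')"
  have "\<beta> \<in> vanishing_ideal D"
    unfolding vanishing_ideal_def vanishes_at_def
  proof (intro CollectI ballI allI impI)
    fix x w
    assume x: "x \<in> D" and w: "hcoords w x"
    show "meval \<beta> w = 0"
    proof (cases "x \<in> U \<and> x \<in> U'")
      case True
      then have "hcoords (\<chi> i. meval (G i) w) (\<phi> x)" "hcoords (\<chi> i. meval (G' i) w) (\<phi> x)"
        using U(3) U'(3) x w unfolding represents_def by blast+
      then obtain c where c: "(\<chi> i. meval (G' i) w) = c *s (\<chi> i. meval (G i) w)"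
        using hcoords_unique by blast
      then have "meval (G' j) w = c * meval (G j) w" by (simp add: vec_eq_iff)
      then show ?thesis
        unfolding \<beta>_def mev.mult mev.diff meval_pull c dot_scale by (simp add: mult_ac)
    next
      case False
      then have "meval s w = 0 \<or> meval s' w = 0" using s(2) s'(2) w unfolding vanishes_at_def by blast
      then show ?thesis unfolding \<beta>_def mev.mult by auto
    qed
  qed
  moreover have "nonvan q (s * s' * G' j)" using s s' nj nonvan_mult by blast
  moreover have "(s * s' * G' j) * pull a G = (s * s' * G j) * pull a G' + \<beta>"
    unfolding \<beta>_def by (simp add: algebra_simps)
  ultimately show ?thesis using order_ge_cancel[OF o] by blast
qed

lemma enat_le_Sup:
  assumes "\<And>j k. P k \<Longrightarrow> j \<le> k \<Longrightarrow> P j" "P 0"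
  shows "enat k \<le> Sup {enat k |k. P k} \<longleftrightarrow> P k"
proof
  assume "P k"
  then show "enat k \<le> Sup {enat k |k. P k}" by (intro Sup_upper) blast
next
  assume le: "enat k \<le> Sup {enat k |k. P k}"
  show "P k"
  proof (rule ccontr)
    assume n: "\<not> P k"
    then obtain k' where k': "k = Suc k'" using assms(2) by (cases k) auto
    have "Sup {enat k |k. P k} \<le> enat k'"
    proof (rule Sup_least)
      fix x
      assume "x \<in> {enat k |k. P k}"
      then obtain i where "x = enat i" "P i" by blast
      then show "x \<le> enat k'" using assms(1)[of i k] n k' by (metis enat_ord_simps(1) not_less_eq_eq)
    qed
    then have "enat k \<le> enat k'" using le by (rule order_trans[rotated])
    then show False using k' by simp
  qed
qed

text \<open>Eliminates the supremum and the choices of equation and representation; from here on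
  multiplicities are handled through \<open>order_ge\<close>.\<close>

lemma branch_mult_iff:
  assumes G: "rep_at D \<phi> q e G" and q: "q \<in> D" and a: "a \<noteq> 0"
  shows "enat k \<le> branch_mult D \<phi> q (pline a) \<longleftrightarrow> order_ge D q (pull a G) k"
proof -
  have "(\<exists>a' U e G. a' \<noteq> 0 \<and> pline a = pline a' \<and> zopen U \<and> q \<in> U \<and> represents e G \<phi> (D \<inter> U) \<and>
     order_ge D q (\<Sum>i\<in>UNIV. mconst (a' $ i) * G i) k) \<longleftrightarrow> order_ge D q (pull a G) k" (is "?L k \<longleftrightarrow> _") for k
  proof
    assume "?L k"
    then obtain a' e' G' where *: "a' \<noteq> 0" "pline a = pline a'" "rep_at D \<phi> q e' G'" "order_ge D q (pull a' G') k"
      unfolding rep_at_def pull_def by blast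
    obtain c where "a = c *s a'" using pline_eq[OF *(2)[symmetric] *(1)] by blast
    then have "order_ge D q (pull a G') k" using *(4) order_ge_mult_left by (simp add: pull_scale)
    then show "order_ge D q (pull a G) k" using rep_at_change[OF G *(3) q] by blast
  next
    assume "order_ge D q (pull a G) k"
    then show "?L k" using a G unfolding rep_at_def pull_def by blast
  qed
  then have "branch_mult D \<phi> q (pline a) = Sup {enat k |k. order_ge D q (pull a G) k}"
    unfolding branch_mult_def by simp
  then show ?thesis
    using enat_le_Sup[of "order_ge D q (pull a G)", OF order_ge_antimono order_ge_0] by simp
qed

text \<open>Multiplicities may be infinite, so a strict inequality is expressed by a finite order
  that one side reaches and the other does not.\<close>

lemma enat_less_iff: "x < y \<longleftrightarrow> (\<exists>k. enat k \<le> y \<and> \<not> enat k \<le> x)"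
proof
  assume "x < y"
  then obtain m where "x = enat m" by (cases x) auto
  then show "\<exists>k. enat k \<le> y \<and> \<not> enat k \<le> x" using \<open>x < y\<close>
    by (intro exI[of _ "Suc m"]) (auto simp: Suc_ile_eq)
qed (metis not_le order_trans)

lemma regular_rep_at:
  assumes "regular_on D \<phi>" "q \<in> D"
  obtains e G where "rep_at D \<phi> q e G"
  using assms unfolding regular_on_def rep_at_def by blast

lemma branch_tangent_iff:
  assumes G: "rep_at D \<phi> q e G" and q: "q \<in> D" and p: "hcoords p (\<phi> q)"
  shows "branch_tangent D \<phi> q l \<longleftrightarrow> (\<exists>a. a \<noteq> 0 \<and> l = pline a \<and> dot a p = 0 \<and>
     (\<exists>b k. b \<noteq> 0 \<and> dot b p = 0 \<and> order_ge D q (pull a G) k \<and> \<not> order_ge D q (pull b G) k))"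
  unfolding branch_tangent_def is_line_def enat_less_iff
  using branch_mult_iff[OF G q] pline_iff[OF p] by blast

lemma order_ge_1:
  assumes G: "rep_at D \<phi> q e G" and q: "q \<in> D" and p: "hcoords p (\<phi> q)" and a: "dot a p = 0"
  shows "order_ge D q (pull a G) 1"
proof -
  have "meval (pull a G) v = 0" if "hcoords v q" for v
  proof -
    have "hcoords (\<chi> i. meval (G i) v) (\<phi> q)" using rep_at_hcoords[OF G q] that by blast
    then obtain c where "(\<chi> i. meval (G i) v) = c *s p" using hcoords_unique[OF p] by blast
    then show ?thesis unfolding meval_pull by (simp add: dot_scale a)
  qed
  then have "pull a G \<in> vanishing_ideal {q}"
    unfolding vanishing_ideal_def vanishes_at_def by blast
  then have "pull a G \<in> ideal_power (vanishing_ideal {q}) 1" by (rule ideal_power_1)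
  then show ?thesis unfolding order_ge_iff using nonvan_1 vanishing_ideal_0
    by (intro exI[of _ 1] exI[of _ "pull a G"] exI[of _ 0]) auto
qed

lemma nonsingular_branchD:
  assumes G: "rep_at D \<phi> q e G" and q: "q \<in> D" and p: "hcoords p (\<phi> q)" and n: "nonsingular_branch D \<phi> q"
  obtains b where "b \<noteq> 0" "dot b p = 0" "\<not> order_ge D q (pull b G) 2"
proof -
  obtain b where b: "b \<noteq> 0" "\<phi> q \<in> pline b" "branch_mult D \<phi> q (pline b) = 1"
    using n unfolding nonsingular_branch_def is_line_def by blast
  have "\<not> enat 2 \<le> branch_mult D \<phi> q (pline b)" unfolding b(3) by (simp add: one_enat_def)
  then show ?thesis using that[OF b(1)] b branch_mult_iff[OF G q b(1)] pline_iff[OF p] by blast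
qed

text \<open>Every line through the origin has order at least 1 on the branch, so an order that some
  other line does not reach is at least 2.\<close>

lemma branch_tangent_order_2:
  assumes G: "rep_at D \<phi> q e G" and q: "q \<in> D" and p: "hcoords p (\<phi> q)" and t: "branch_tangent D \<phi> q l"
  obtains a where "a \<noteq> 0" "l = pline a" "dot a p = 0" "order_ge D q (pull a G) 2"
proof -
  obtain a b k where a: "a \<noteq> 0" "l = pline a" "dot a p = 0" and b: "b \<noteq> 0" "dot b p = 0"
    "order_ge D q (pull a G) k" "\<not> order_ge D q (pull b G) k"
    using t unfolding branch_tangent_iff[OF G q p] by blast
  have "2 \<le> k"
  proof (rule ccontr)
    assume "\<not> 2 \<le> k"
    then have "k \<le> 1" by simp
    then show False using b(4) order_ge_antimono[OF order_ge_1[OF G q p b(2)]] by blast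
  qed
  then show ?thesis using that a order_ge_antimono[OF b(3)] by blast
qed

text \<open>Two distinct lines generate the pencil; consequently at most one line through the origin
  can exceed the minimal multiplicity.\<close>

lemma order_ge_pencil:
  assumes "cross a b \<noteq> 0" "p \<noteq> 0" "dot a p = 0" "dot b p = 0" "dot c p = 0"
    and "order_ge D q (pull a G) k" "order_ge D q (pull b G) k"
  shows "order_ge D q (pull c G) k"
proof -
  obtain \<alpha> \<beta> where "c = \<alpha> *s a + \<beta> *s b" using dot_perp_span[OF assms(1-5)] by blast
  then show ?thesis using assms(6,7) by (auto simp: pull_add pull_scale intro: order_ge_add order_ge_mult_left)
qed

lemma nonsingular_branch_tangent:
  assumes G: "rep_at D \<phi> q e G" and q: "q \<in> D" and p: "hcoords p (\<phi> q)"
    and n: "nonsingular_branch D \<phi> q" and t: "branch_tangent D \<phi> q l"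
    and a: "a \<noteq> 0" "dot a p = 0" "order_ge D q (pull a G) 2"
  shows "l = pline a"
proof (rule ccontr)
  assume ne: "l \<noteq> pline a"
  obtain a' where a': "a' \<noteq> 0" "l = pline a'" "dot a' p = 0" "order_ge D q (pull a' G) 2"
    using branch_tangent_order_2[OF G q p t] .
  have "cross a' a \<noteq> 0" using ne a' a(1) pline_eq_iff by blast
  moreover obtain b where "dot b p = 0" "\<not> order_ge D q (pull b G) 2"
    using nonsingular_branchD[OF G q p n] by metis
  ultimately show False using order_ge_pencil[OF _ hcoords_nz[OF p]] a a' by blast
qed

lemma nonsingular_branch_tangent_unique:
  assumes \<phi>: "regular_on D \<phi>" and q: "q \<in> D" and n: "nonsingular_branch D \<phi> q"
    and "branch_tangent D \<phi> q l" "branch_tangent D \<phi> q l'"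
  shows "l = l'"
proof -
  obtain e G where G: "rep_at D \<phi> q e G" using regular_rep_at[OF \<phi> q] .
  obtain p where p: "hcoords p (\<phi> q)" using hcoords_exists by blast
  show ?thesis
    using branch_tangent_order_2[OF G q p assms(5)] nonsingular_branch_tangent[OF G q p n assms(4)] by metis
qed

section \<open>The tangent at a smooth point\<close>

definition grad :: "('a::comm_ring_1, 'n::finite) mpoly \<Rightarrow> 'a ^ 'n \<Rightarrow> 'a ^ 'n" where
  "grad f v = (\<chi> i. meval (mderiv i f) v)"

lemma dot_grad: "homogeneous e f \<Longrightarrow> dot (grad f v) v = of_nat e * meval f v"
  using ev_id.euler_evalh[of e f "\<lambda>i. v $ i"]
  by (simp add: dot_def grad_def meval_evalh mult.commute)

lemma grad_scale: "homogeneous e f \<Longrightarrow> grad f (c *s v) = c ^ (e - 1) *s grad f v"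
  by (simp add: grad_def vec_eq_iff meval_scale[OF homogeneous_mderiv])

text \<open>Write the coordinates of the map as \<open>p * s + l\<close>, where each
  \<open>l i\<close> is the pullback of a line through the origin and so has order at least
  \<open>k\<close>. When \<open>F\<close> of them, which is 0 on the model, is expanded, the
  constant term vanishes, the linear term is the pullback of the gradient line up to a unit, and the
  rest is quadratic in the \<open>l i\<close>.\<close>

lemma tangent_order_double:
  fixes F :: "('a::field, 3) mpoly"
  assumes G: "rep_at D \<phi> q e G" and q: "q \<in> D" and p: "hcoords p (\<phi> q)"
    and F: "homogeneous n F" "\<And>x. x \<in> \<phi> ` D \<Longrightarrow> vanishes_at F x"
    and all: "\<And>b. dot b p = 0 \<Longrightarrow> order_ge D q (pull b G) k"
  shows "order_ge D q (pull (grad F p) G) (2 * k)"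
proof -
  obtain j0 where j0: "p $ j0 \<noteq> 0" using hcoords_nz[OF p] by (auto simp: vec_eq_iff)
  define s where "s = mconst (inverse (p $ j0)) * G j0"
  define l where "l i = G i - mconst (p $ i) * s" for i
  obtain v where v: "hcoords v q" using hcoords_exists by blast
  have hs: "homogeneous e s" unfolding s_def by (intro homogeneous_const_mult rep_at_homogeneous[OF G])
  obtain c where c: "c \<noteq> 0" "(\<chi> i. meval (G i) v) = c *s p" using hcoords_unique[OF p rep_at_hcoords[OF G q v]] by blast
  then have "meval (G j0) v = c * p $ j0" by (simp add: vec_eq_iff)
  then have "meval s v \<noteq> 0" using c j0 by (simp add: s_def mev.mult)
  then have ns: "nonvan q s" using nonvan_iff[OF hs v] by blast
  have lo: "order_ge D q (l i) k" for i
  proof -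
    let ?b = "axis i 1 - (p $ i * inverse (p $ j0)) *s axis j0 (1::'a)"
    have "pull ?b G = l i"
      by (simp add: pull_diff pull_scale pull_axis l_def s_def mconst_simps mult.assoc)
    moreover have "dot (axis m (1::'a)) p = p $ m" for m
      unfolding dot_def axis_def by (simp add: if_distrib[of "\<lambda>x. x * _"] cong: if_cong)
    then have "dot ?b p = 0" using j0 unfolding dot_diff dot_scale by simp
    ultimately show ?thesis using all by metis
  qed
  define \<Z> where "\<Z> = ideal.span {l r * l s |r s. True}"
  have Z: "order_ge D q z (2 * k)" if "z \<in> \<Z>" for z
    using that unfolding \<Z>_def
  proof (induction rule: ideal.span_induct_alt)
    case base
    show ?case by (rule order_ge_zero)
  next
    case (step c x y)
    then obtain r s where "x = l r * l s" by blast
    then have "order_ge D q x (2 * k)" using order_ge_mult[OF lo lo] by (simp add: mult_2)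
    then show ?case using step by (intro order_ge_add order_ge_mult_left) auto
  qed
  have Gl: "G i = mconst (p $ i) * s + l i" for i by (simp add: l_def)
  interpret m: rhom "mconst :: 'a \<Rightarrow> ('a, 'b) mpoly" by (rule rhom_mconst)
  have evp: "homogeneous d f \<Longrightarrow> evalh mconst f (\<lambda>i. mconst (p $ i) * s) = s ^ d * mconst (meval f p)" for d f
    using m.evalh_scale[of d f s "\<lambda>i. mconst (p $ i)"] m.evalh_comp[OF rhom_mconst]
      ev_id.evalh_comp[OF m.rhom_axioms, of f "\<lambda>i. p $ i"]
    by (simp only: meval_evalh mult.commute)
  have Fp: "meval F p = 0" using F q p vanishes_at_iff by (metis imageI)
  have "evalh mconst F (\<lambda>i. mconst (p $ i) * s + l i) - evalh mconst F (\<lambda>i. mconst (p $ i) * s)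
      - (\<Sum>i\<in>UNIV. evalh mconst (mderiv i F) (\<lambda>i. mconst (p $ i) * s) * l i) \<in> \<Z>"
    unfolding \<Z>_def by (rule m.taylor)
  then have "evalh mconst F G - (\<Sum>i\<in>UNIV. (s ^ (n - 1) * mconst (meval (mderiv i F) p)) * l i) \<in> \<Z>"
    unfolding Gl[symmetric] evp[OF F(1)] evp[OF homogeneous_mderiv[OF F(1)]] Fp mconst_simps by simp
  moreover have "(\<Sum>i\<in>UNIV. (s ^ (n - 1) * mconst (meval (mderiv i F) p)) * l i) = s ^ (n - 1) * pull (grad F p) G"
  proof -
    have "(\<Sum>i\<in>UNIV. mconst (meval (mderiv i F) p) * (mconst (p $ i) * s)) = mconst (dot (grad F p) p) * s"
      unfolding dot_def m.sum sum_distrib_right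
      by (intro sum.cong refl) (simp add: grad_def mconst_simps mult.assoc)
    also have "\<dots> = 0" using dot_grad[OF F(1), of p] Fp by (simp add: mconst_simps)
    finally have "(\<Sum>i\<in>UNIV. mconst (meval (mderiv i F) p) * l i) = pull (grad F p) G"
      by (simp add: l_def right_diff_distrib sum_subtractf pull_def grad_def)
    then show ?thesis by (simp add: mult.assoc sum_distrib_left[symmetric])
  qed
  ultimately have z: "evalh mconst F G - s ^ (n - 1) * pull (grad F p) G \<in> \<Z>" by simp
  obtain U where U: "zopen U" "q \<in> U" "represents e G \<phi> (D \<inter> U)" using G unfolding rep_at_def by blast
  obtain t where t: "nonvan q t" "\<forall>x. x \<notin> U \<longrightarrow> vanishes_at t x"
    by (rule zopen_nonvan[OF U(1,2)])
  define \<beta> where "\<beta> = t * evalh mconst F G"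
  have "\<beta> \<in> vanishing_ideal D"
    unfolding vanishing_ideal_def vanishes_at_def
  proof (intro CollectI ballI allI impI)
    fix x w
    assume x: "x \<in> D" and w: "hcoords w x"
    show "meval \<beta> w = 0"
    proof (cases "x \<in> U")
      case True
      then have "hcoords (\<chi> i. meval (G i) w) (\<phi> x)"
        using U(3) x w unfolding represents_def by blast
      then have "meval F (\<chi> i. meval (G i) w) = 0" using F(2) x unfolding vanishes_at_def by blast
      moreover have "meval (evalh mconst F G) w = meval F (\<chi> i. meval (G i) w)"
        unfolding meval_evalh using evalh_subst[OF rhom_ident, of F G "\<lambda>i. w $ i"] by (simp only: vec_nth_lambda)
      ultimately show ?thesis unfolding \<beta>_def mev.mult by simp
    next
      case False
      then show ?thesis using t(2) w unfolding \<beta>_def mev.mult vanishes_at_def by simp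
    qed
  qed
  moreover have "nonvan q (t * s ^ (n - 1))" using t ns nonvan_mult nonvan_power by blast
  moreover have "(t * s ^ (n - 1)) * pull (grad F p) G = (- t) * (evalh mconst F G - s ^ (n - 1) * pull (grad F p) G) + \<beta>"
    unfolding \<beta>_def by (simp add: algebra_simps)
  ultimately show ?thesis using order_ge_cancel[OF Z[OF z]] by blast
qed

text \<open>Let \<open>k'\<close> be the least order among the lines through the origin. It is at
  least 1, so doubling gives the gradient line an order of at least \<open>2 * k' > k'\<close>, and
  only one line of a pencil can exceed the minimum. The minimum exists as soon as some line has
  finite order.\<close>

lemma smooth_tangent:
  fixes F :: "('a::field, 3) mpoly"
  assumes \<phi>: "regular_on D \<phi>" and q: "q \<in> D" and p: "hcoords p (\<phi> q)"
    and F: "homogeneous n F" "\<And>x. x \<in> \<phi> ` D \<Longrightarrow> vanishes_at F x" and g: "grad F p \<noteq> 0"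
  shows "branch_tangent D \<phi> q l \<Longrightarrow> l = pline (grad F p)"
    and "rep_at D \<phi> q e G \<Longrightarrow> dot b p = 0 \<Longrightarrow> \<not> order_ge D q (pull b G) k \<Longrightarrow> branch_tangent D \<phi> q (pline (grad F p))"
proof -
  have Tp: "dot (grad F p) p = 0"
    using dot_grad[OF F(1), of p] F q p vanishes_at_iff by (metis imageI mult_zero_right)
  have key: "\<exists>k' b'. (\<forall>b. dot b p = 0 \<longrightarrow> order_ge D q (pull b G) k') \<and> dot b' p = 0 \<and>
       \<not> order_ge D q (pull b' G) (Suc k') \<and> Suc k' \<le> k \<and> order_ge D q (pull (grad F p) G) (Suc k')"
    if G: "rep_at D \<phi> q e G" and b: "dot b p = 0" "\<not> order_ge D q (pull b G) k" for e G b k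
  proof -
    let ?P = "\<lambda>k. \<exists>b. dot b p = 0 \<and> \<not> order_ge D q (pull b G) k"
    \<comment> \<open>\<open>k1\<close> is the first order that some line fails to reach, so the
      minimal order is its predecessor \<open>k'\<close>.\<close>
    define k1 where "k1 = (LEAST k. ?P k)"
    have k1: "?P k1" unfolding k1_def by (rule LeastI_ex) (use b in blast)
    have le: "k1 \<le> k" unfolding k1_def by (rule Least_le) (use b in blast)
    have "k1 > 1"
    proof (rule ccontr)
      assume "\<not> k1 > 1"
      then have "k1 \<le> 1" by simp
      then show False using k1 order_ge_antimono[OF order_ge_1[OF G q p]] by blast
    qed
    then obtain k' where k': "k1 = Suc k'" "k' \<ge> 1" by (cases k1) auto
    have "\<not> ?P k'" using not_less_Least[of k' ?P] k' unfolding k1_def by simp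
    then have all: "\<forall>b. dot b p = 0 \<longrightarrow> order_ge D q (pull b G) k'" by blast
    have "order_ge D q (pull (grad F p) G) (2 * k')"
      by (rule tangent_order_double[OF G q p F]) (use all in blast)+
    then have "order_ge D q (pull (grad F p) G) (Suc k')" using order_ge_antimono k'(2) by (metis Suc_leI add_le_cancel_left le_eq_less_or_eq less_add_same_cancel1 mult_2 plus_1_eq_Suc add.commute)
    then show ?thesis using all k1 le k' by metis
  qed
  show "l = pline (grad F p)" if t: "branch_tangent D \<phi> q l"
  proof -
    obtain e G where G: "rep_at D \<phi> q e G" using regular_rep_at[OF \<phi> q] .
    obtain a b k where a: "a \<noteq> 0" "l = pline a" "dot a p = 0" "order_ge D q (pull a G) k" and b: "dot b p = 0" "\<not> order_ge D q (pull b G) k"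
      using t unfolding branch_tangent_iff[OF G q p] by blast
    obtain k' b' where k': "dot b' p = 0" "\<not> order_ge D q (pull b' G) (Suc k')" "Suc k' \<le> k" "order_ge D q (pull (grad F p) G) (Suc k')"
      using key[OF G b] by blast
    show ?thesis
    proof (rule ccontr)
      assume "l \<noteq> pline (grad F p)"
      then have "cross a (grad F p) \<noteq> 0" using pline_eq_iff[OF a(1) g] a(2) by blast
      then have "order_ge D q (pull b' G) (Suc k')"
        using order_ge_pencil[OF _ hcoords_nz[OF p] a(3) Tp k'(1) order_ge_antimono[OF a(4) k'(3)] k'(4)] by blast
      then show False using k' by blast
    qed
  qed
  show "branch_tangent D \<phi> q (pline (grad F p))"
    if G: "rep_at D \<phi> q e G" and b: "dot b p = 0" "\<not> order_ge D q (pull b G) k"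
  proof -
    obtain k' b' where k': "dot b' p = 0" "\<not> order_ge D q (pull b' G) (Suc k')" "order_ge D q (pull (grad F p) G) (Suc k')"
      using key[OF G b] by blast
    have "b' \<noteq> 0"
    proof
      assume "b' = 0"
      then have "pull b' G = 0" by (simp add: pull_def mconst_simps)
      then show False using k' order_ge_zero by metis
    qed
    then show ?thesis unfolding branch_tangent_iff[OF G q p] using g Tp k' by blast
  qed
qed

section \<open>Univariate polynomials under ring homomorphisms\<close>

lemma (in rhom) poly_hom: "h (poly p x) = poly (map_poly h p) (h x)"
  by (induction p) (simp_all add: zero map_poly_pCons add mult)

lemma map_poly_comp: "g 0 = 0 \<Longrightarrow> h 0 = 0 \<Longrightarrow> map_poly g (map_poly h p) = map_poly (\<lambda>x. g (h x)) p"
  by (rule poly_eqI) (simp add: coeff_map_poly)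

lemma pderiv_map_poly:
  fixes h :: "'a::idom \<Rightarrow> 'b::idom"
  assumes "rhom h"
  shows "pderiv (map_poly h p) = map_poly h (pderiv p)"
proof -
  interpret h: rhom h by fact
  show ?thesis by (rule poly_eqI) (simp only: coeff_pderiv h.coeff_map h.mult h.of_nat)
qed

lemma (in rhom) degree_map_monic:
  assumes "lead_coeff p = 1" "(1::'b) \<noteq> 0"
  shows "degree (map_poly h p) = degree p" "lead_coeff (map_poly h p) = 1"
proof -
  have c: "coeff (map_poly h p) (degree p) = 1" using assms by (simp add: coeff_map one)
  then have "degree p \<le> degree (map_poly h p)" using assms(2) by (intro le_degree) simp
  moreover have "degree (map_poly h p) \<le> degree p" by (rule degree_le) (simp add: coeff_map coeff_eq_0 zero)
  ultimately show "degree (map_poly h p) = degree p" by simp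
  then show "lead_coeff (map_poly h p) = 1" using c by simp
qed

lemma monic_division:
  fixes f g :: "'a::idom poly"
  assumes "lead_coeff f = 1"
  obtains q r where "g = f * q + r" "r = 0 \<or> degree r < degree f"
proof -
  have f0: "f \<noteq> 0" using assms by auto
  obtain q r where qr: "pseudo_divmod g f = (q, r)" by fastforce
  show ?thesis using pseudo_divmod[OF f0 qr] assms that by simp
qed

lemma poly_pderiv_linear_mult: "poly (pderiv ([:- a, 1:] * p)) a = poly p a" for a :: "'a::idom"
  by (simp only: pderiv_mult poly_add poly_mult) (simp add: pderiv_pCons)

lemma affine_vec_nth:
  "($) (e2 + z0 *s Q) = (\<lambda>i. e2 $ i + z0 * Q $ i)"
  "($) (e1 + t0 *s e2 + z0 *s Q) = (\<lambda>i. e1 $ i + t0 * e2 $ i + z0 * Q $ i)"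
  by (simp_all add: fun_eq_iff)

section \<open>The field of algebraic functions of one variable\<close>

text \<open>Kept abstract because the same closure is used with two parameters: \<open>t\<close>,
  and later \<open>- inverse t\<close>, when the line at infinity is moved to the origin.\<close>

locale funfield =
  fixes cst :: "'a::{alg_closed_field, field_char_0} \<Rightarrow> 'b::{alg_closed_field, field_char_0}" and t :: 'b
  assumes cst: "rhom cst"
    and transcendental: "poly (map_poly cst p) t = 0 \<Longrightarrow> p = 0"
    and algebraic: "\<exists>P. P \<noteq> 0 \<and> poly (map_poly (\<lambda>p. poly (map_poly cst p) t) P) w = 0"
begin

sublocale cst: rhom cst by (rule cst)

definition emb :: "'a poly \<Rightarrow> 'b" where
  "emb p = poly (map_poly cst p) t"

sublocale emb: rhom emb
  unfolding emb_def[abs_def] by (rule cst.poly_map_poly_rhom)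

lemma emb_eq_0 [simp]: "emb p = 0 \<longleftrightarrow> p = 0"
  using transcendental emb.zero by (auto simp: emb_def)

lemma emb_const: "emb [:c:] = cst c"
  by (simp add: emb_def cst.map_poly_pCons)

lemma emb_t: "emb [:0, 1:] = t"
  by (simp add: emb_def cst.map_poly_pCons cst.zero cst.one)

definition ev :: "'a poly poly \<Rightarrow> 'b \<Rightarrow> 'b" where
  "ev g z = poly (map_poly emb g) z"

lemma rhom_ev: "rhom (\<lambda>g. ev g z)"
  unfolding ev_def[abs_def] by (rule emb.poly_map_poly_rhom)

sublocale ev: rhom "\<lambda>g. ev g z" for z by (rule rhom_ev)

lemma ev_const: "ev [:p:] z = emb p"
  by (simp add: ev_def emb.map_poly_pCons)

lemma ev_pCons: "ev (pCons p g) z = emb p + z * ev g z"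
  by (simp add: ev_def emb.map_poly_pCons)

lemma algebraic_ev: "\<exists>P. P \<noteq> 0 \<and> ev P w = 0"
  using algebraic[of w] unfolding ev_def emb_def[abs_def] by simp

lemma algebraic_nonzero:
  assumes "w \<noteq> 0"
  shows "\<exists>P. coeff P 0 \<noteq> 0 \<and> ev P w = 0"
proof -
  obtain P where P: "P \<noteq> 0" "ev P w = 0" using algebraic_ev by blast
  have "P \<noteq> 0 \<Longrightarrow> ev P w = 0 \<Longrightarrow> ?thesis" for P
  proof (induction P)
    case (pCons a P)
    show ?case
    proof (cases "a = 0")
      case True
      then show ?thesis using pCons assms by (auto simp: ev_pCons emb.zero)
    next
      case False
      then show ?thesis using pCons.prems by (intro exI[of _ "pCons a P"]) simp
    qed
  qed simp
  then show ?thesis using P by blast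
qed

end

section \<open>Irreducible affine equations\<close>

text \<open>\<open>irr\<close> is irreducibility over the rational functions of \<open>t\<close>
  with denominators cleared: even after multiplication by a nonzero polynomial in \<open>t\<close>,
  \<open>f\<close> has no factors of smaller degree in \<open>z\<close>.\<close>

locale affine_curve = funfield cst t
  for cst :: "'a::{alg_closed_field, field_char_0} \<Rightarrow> 'b::{alg_closed_field, field_char_0}" and t :: 'b +
  fixes f :: "'a poly poly" and n :: nat
  assumes deg_f: "degree f = n" and monic_f: "lead_coeff f = 1" and n_pos: "n > 0"
    and irr: "c \<noteq> 0 \<Longrightarrow> smult c f = g * q \<Longrightarrow> degree g < n \<Longrightarrow> degree q < n \<Longrightarrow> False"
begin

text \<open>Pseudo-division shows that a nonzero polynomial of least degree vanishing at
  \<open>z\<close> divides a multiple of \<open>f\<close>; by irreducibility its degree is then at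
  least \<open>n\<close>. So the remainder of \<open>g\<close> modulo the monic \<open>f\<close>,
  which has smaller degree and vanishes at \<open>z\<close>, is 0.\<close>

lemma root_ideal:
  assumes z: "ev f z = 0"
  shows "ev g z = 0 \<longleftrightarrow> f dvd g"
proof
  assume "f dvd g"
  then show "ev g z = 0" using z by (auto simp: dvd_def ev.mult)
next
  assume g: "ev g z = 0"
  have f0: "f \<noteq> 0" using monic_f by auto
  let ?P = "\<lambda>g. g \<noteq> 0 \<and> ev g z = 0"
  define g0 where "g0 = (ARG_MIN degree g. ?P g)"
  have g0: "?P g0" unfolding g0_def using arg_min_natI[of ?P f degree] f0 z by blast
  have le: "degree g0 \<le> degree g" if "?P g" for g unfolding g0_def using that by (rule arg_min_nat_le)
  have d1: "degree g0 > 0"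
  proof (rule ccontr)
    assume "\<not> ?thesis"
    then obtain p where "g0 = [:p:]" using degree_eq_zeroE by blast
    then show False using g0 by (simp add: ev_const)
  qed
  obtain q r where qr: "pseudo_divmod f g0 = (q, r)" by fastforce
  define c where "c = coeff g0 (degree g0) ^ (Suc (degree f) - degree g0)"
  have c: "smult c f = g0 * q + r" "r = 0 \<or> degree r < degree g0" "c \<noteq> 0"
    unfolding c_def using pseudo_divmod[OF _ qr] g0 by auto
  have "r = [:c:] * f - g0 * q" using c(1) by simp
  then have "ev r z = 0" using g0 z by (simp only: ev.diff ev.mult) simp
  then have "r = 0" using le[of r] c(2) by fastforce
  then have s: "smult c f = g0 * q" using c by simp
  have q0: "q \<noteq> 0" using s c(3) f0 by auto
  have "degree g0 + degree q = n" using degree_mult_eq[of g0 q] g0 q0 s c(3) deg_f by (metis degree_smult_eq)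
  then have "degree q < n" using d1 by linarith
  then have n: "\<not> degree g0 < n" using irr[OF c(3) s] by blast
  obtain q' r' where r': "g = f * q' + r'" "r' = 0 \<or> degree r' < degree f" using monic_division[OF monic_f] .
  then have "ev r' z = 0" using g z by (simp add: ev.add ev.mult)
  then have "r' = 0" using le[of r'] r'(2) n deg_f by fastforce
  then show "f dvd g" using r' by simp
qed

definition Z :: "'b set" where
  "Z = {z. ev f z = 0}"

lemma pderiv_nonzero: "z \<in> Z \<Longrightarrow> ev (pderiv f) z \<noteq> 0"
proof
  assume "z \<in> Z" "ev (pderiv f) z = 0"
  then have "f dvd pderiv f" using root_ideal unfolding Z_def by blast
  moreover have "pderiv f \<noteq> 0" using pderiv_eq_0_iff[of f] deg_f n_pos by simp
  ultimately have "degree f \<le> degree (pderiv f)" by (rule dvd_imp_degree_le)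
  then show False using degree_pderiv[of f] deg_f n_pos by simp
qed

lemma map_f: "degree (map_poly emb f) = n" "lead_coeff (map_poly emb f) = 1"
  using emb.degree_map_monic[OF monic_f] deg_f by auto

lemma finite_Z: "finite Z" and map_f_prod: "map_poly emb f = (\<Prod>z\<in>Z. [:- z, 1:])" and card_Z: "card Z = n"
proof -
  let ?p = "map_poly emb f"
  have p0: "?p \<noteq> 0" using map_f by auto
  obtain A where A: "size A = n" "?p = (\<Prod>x\<in>#A. [:- x, 1:])"
    using alg_closed_imp_factorization[OF p0] map_f by auto
  have Z: "Z = {z. poly ?p z = 0}" by (simp add: Z_def ev_def)
  show fin: "finite Z" unfolding Z using p0 by (rule poly_roots_finite)
  have poly_A: "poly (\<Prod>x\<in>#B. [:- x, 1:]) y = 0 \<longleftrightarrow> y \<in># B" for B :: "'b multiset" and y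
    by (induction B) auto
  have setA: "set_mset A = Z" unfolding Z A(2) using poly_A by auto
  have "count A x = 1" if x: "x \<in># A" for x
  proof -
    obtain B where B: "A = add_mset x B" using x by (metis multi_member_split)
    have "?p = [:- x, 1:] * (\<Prod>x\<in>#B. [:- x, 1:])" unfolding A(2) B by simp
    then have "poly (pderiv ?p) x = poly (\<Prod>x\<in>#B. [:- x, 1:]) x"
      by (simp only: poly_pderiv_linear_mult)
    moreover have "poly (pderiv ?p) x \<noteq> 0"
      using pderiv_nonzero[of x] setA x unfolding ev_def pderiv_map_poly[OF emb.rhom_axioms] by blast
    ultimately have "x \<notin># B" using poly_A by metis
    then show ?thesis using B by (simp add: count_eq_zero_iff)
  qed
  then have AZ: "A = mset_set Z"
    using fin setA by (intro multiset_eqI) (metis count_mset_set(1) count_mset_set(3) count_eq_zero_iff)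
  show "?p = (\<Prod>z\<in>Z. [:- z, 1:])" unfolding A(2) AZ by (simp add: prod_unfold_prod_mset)
  show "card Z = n" using A(1) AZ by simp
qed

lemma Z_nonempty: "Z \<noteq> {}"
  using card_Z n_pos by auto

lemma ev_pderiv_f:
  assumes "z \<in> Z"
  shows "ev (pderiv f) z = (\<Prod>y\<in>Z - {z}. z - y)"
proof -
  have "map_poly emb f = [:- z, 1:] * (\<Prod>y\<in>Z - {z}. [:- y, 1:])"
    unfolding map_f_prod using assms finite_Z by (simp add: prod.remove)
  then have "poly (pderiv (map_poly emb f)) z = poly (\<Prod>y\<in>Z - {z}. [:- y, 1:]) z"
    by (simp only: poly_pderiv_linear_mult)
  then show ?thesis unfolding ev_def pderiv_map_poly[OF emb.rhom_axioms] by (simp add: poly_prod)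
qed

lemma norm_emb: "\<exists>p. (\<Prod>z\<in>Z. ev g z) = emb p"
proof -
  have "(\<Prod>z\<in>Z. poly (map_poly emb g) z) \<in> range emb"
  proof (rule norm_in_subring[OF finite_Z])
    show "1 \<in> range emb" using rangeI[of emb 1] by (simp only: emb.one)
    show "x + y \<in> range emb" if xy: "x \<in> range emb" "y \<in> range emb" for x y
    proof -
      obtain p q where "x = emb p" "y = emb q" using xy by blast
      then have "x + y = emb (p + q)" by (simp only: emb.add)
      then show ?thesis by blast
    qed
    show "x * y \<in> range emb" if xy: "x \<in> range emb" "y \<in> range emb" for x y
    proof -
      obtain p q where "x = emb p" "y = emb q" using xy by blast
      then have "x * y = emb (p * q)" by (simp only: emb.mult)
      then show ?thesis by blast
    qed
    show "- x \<in> range emb" if x: "x \<in> range emb" for x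
    proof -
      obtain p where "x = emb p" using x by blast
      then have "- x = emb (- p)" by (simp only: emb.uminus)
      then show ?thesis by blast
    qed
    show "x / of_nat (Suc k) \<in> range emb" if xr: "x \<in> range emb" for x k
    proof -
      obtain p where p: "x = emb p" using xr by blast
      have "of_nat (Suc k) * emb (smult (inverse (of_nat (Suc k))) p) = emb (of_nat (Suc k) * smult (inverse (of_nat (Suc k))) p)"
        by (simp only: emb.mult emb.of_nat)
      also have "of_nat (Suc k) * smult (inverse (of_nat (Suc k))) p = p"
        by (simp add: of_nat_poly del: of_nat_Suc)
      finally have "x / of_nat (Suc k) = emb (smult (inverse (of_nat (Suc k))) p)"
        using p by (simp add: field_simps del: of_nat_Suc)
      then show ?thesis by blast
    qed
    show "coeff (\<Prod>z\<in>Z. [:- z, 1:]) k \<in> range emb" for k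
      unfolding map_f_prod[symmetric] by (simp add: emb.coeff_map)
    show "coeff (map_poly emb g) k \<in> range emb" for k by (simp add: emb.coeff_map)
  qed
  then show ?thesis unfolding ev_def by blast
qed

definition spec :: "'a \<Rightarrow> 'a poly poly \<Rightarrow> 'a poly" where
  "spec t0 g = map_poly (\<lambda>p. poly p t0) g"

lemma rhom_spec: "rhom (spec t0)"
  unfolding spec_def[abs_def] by (rule rhom.map_poly_rhom[OF rhom_poly])

lemma spec_f: "degree (spec t0 f) = n" "lead_coeff (spec t0 f) = 1"
  using rhom.degree_map_monic[OF rhom_poly monic_f] deg_f by (auto simp: spec_def)

lemma finite_common_zeros_affine:
  assumes "\<not> f dvd g"
  shows "finite {(t0, z0). poly (spec t0 f) z0 = 0 \<and> poly (spec t0 g) z0 = 0}"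
proof -
  obtain z where z: "ev f z = 0" using Z_nonempty unfolding Z_def by blast
  define w where "w = ev g z"
  have "w \<noteq> 0" using root_ideal[OF z] assms unfolding w_def by blast
  then obtain P where P: "coeff P 0 \<noteq> 0" "ev P w = 0" using algebraic_nonzero by blast
  define A where "A = poly (map_poly (\<lambda>p. [:p:]) P) g"
  have "ev A z = poly (map_poly (\<lambda>p. ev [:p:] z) P) w"
    unfolding A_def w_def 
    using ev.poly_hom[where p = "map_poly (\<lambda>p. [:p:]) P" and x = g and z = z] by (simp add: map_poly_comp ev.zero)
  then have "ev A z = 0" using P unfolding ev_const by (simp add: ev_def)
  then have fA: "f dvd A" using root_ideal[OF z] by blast
  have c0: "poly (coeff P 0) t0 = 0" if "poly (spec t0 f) z0 = 0" "poly (spec t0 g) z0 = 0" for t0 z0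
  proof -
    have r: "rhom (\<lambda>g. poly (spec t0 g) z0)" by (rule rhom_comp[OF rhom_poly rhom_spec])
    interpret r: rhom "\<lambda>g. poly (spec t0 g) z0" by (rule r)
    have "poly (spec t0 A) z0 = 0" using fA that(1) by (auto simp: dvd_def r.mult)
    moreover have "poly (spec t0 A) z0 = poly (map_poly (\<lambda>p. poly p t0) P) (poly (spec t0 g) z0)"
      unfolding A_def using r.poly_hom
      by (simp add: map_poly_comp r.zero) (simp add: spec_def rhom.map_poly_pCons[OF rhom_poly])
    ultimately show ?thesis using that(2)
      by (simp add: poly_0_coeff_0 rhom.coeff_map[OF rhom_poly])
  qed
  have "{(t0, z0). poly (spec t0 f) z0 = 0 \<and> poly (spec t0 g) z0 = 0}
    \<subseteq> Sigma {t0. poly (coeff P 0) t0 = 0} (\<lambda>t0. {z0. poly (spec t0 f) z0 = 0})"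
    using c0 by auto
  moreover have "finite (Sigma {t0. poly (coeff P 0) t0 = 0} (\<lambda>t0. {z0. poly (spec t0 f) z0 = 0}))"
  proof (intro finite_SigmaI poly_roots_finite)
    show "spec t0 f \<noteq> 0" for t0 using spec_f(2)[of t0] by auto
  qed (rule P)
  ultimately show ?thesis by (rule finite_subset)
qed

end

section \<open>Affine coordinates\<close>

lemma coeff_mult_bounded:
  assumes "degree p \<le> i" "degree q \<le> j"
  shows "coeff (p * q) (i + j) = coeff p i * coeff q j" "degree (p * q) \<le> i + j"
proof -
  have "coeff p k * coeff q (i + j - k) = (if k = i then coeff p i * coeff q j else 0)" if "k \<le> i + j" for k
    using assms coeff_eq_0[of p k] coeff_eq_0[of q "i + j - k"] by (cases k i rule: linorder_cases) auto
  then have "coeff (p * q) (i + j) = (\<Sum>k\<le>i + j. if k = i then coeff p i * coeff q j else 0)"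
    unfolding coeff_mult by (intro sum.cong) auto
  then show "coeff (p * q) (i + j) = coeff p i * coeff q j" by simp
  show "degree (p * q) \<le> i + j" using degree_mult_le[of p q] assms by simp
qed

lemma linear_power_bounded:
  "degree ([:a, b:] ^ k) \<le> k \<and> coeff ([:a, b:] ^ k) k = b ^ k" for a b :: "'a::comm_ring_1"
proof (induction k)
  case (Suc k)
  then show ?case using coeff_mult_bounded[of "[:a, b:]" 1 "[:a, b:] ^ k" k] by simp
qed simp

lemma linear_prod_bounded:
  fixes a b :: "'n \<Rightarrow> 'a::comm_ring_1"
  assumes "finite S"
  shows "degree (\<Prod>i\<in>S. [:a i, b i:] ^ m i) \<le> (\<Sum>i\<in>S. m i) \<and>
     coeff (\<Prod>i\<in>S. [:a i, b i:] ^ m i) (\<Sum>i\<in>S. m i) = (\<Prod>i\<in>S. b i ^ m i)"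
  using assms
proof (induction S rule: finite_induct)
  case (insert j S)
  then show ?case
    using coeff_mult_bounded[of "[:a j, b j:] ^ m j" "m j" "\<Prod>i\<in>S. [:a i, b i:] ^ m i" "\<Sum>i\<in>S. m i"]
      linear_power_bounded[of "a j" "b j" "m j"] by simp
qed simp

text \<open>The coefficient at the bound \<open>N\<close> is the value at the direction of the line,
  that is, at its point at infinity.\<close>

lemma homogeneous_line:
  assumes "rhom h" "homogeneous N G"
  shows "degree (evalh (\<lambda>c. [:h c:]) G (\<lambda>i. [:a i, b i:])) \<le> N"
    "coeff (evalh (\<lambda>c. [:h c:]) G (\<lambda>i. [:a i, b i:])) N = evalh h G b"
proof -
  interpret h: rhom h by fact
  have r: "rhom (\<lambda>c. [:h c:])" by (rule rhom_comp[OF rhom_pconst assms(1)])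
  interpret hc: rhom "\<lambda>c. [:h c:]" by (rule r)
  have "degree (evalh (\<lambda>c. [:h c:]) G (\<lambda>i. [:a i, b i:])) \<le> N \<and>
    coeff (evalh (\<lambda>c. [:h c:]) G (\<lambda>i. [:a i, b i:])) N = evalh h G b"
    using assms(2)
  proof (induction rule: homogeneous_induct)
    case zero
    show ?case by (simp add: evalh_def)
  next
    case (single m c)
    show ?case
      using linear_prod_bounded[of UNIV a b "Poly_Mapping.lookup m"] single
      by (auto simp: hc.evalh_single h.evalh_single intro: order_trans[OF degree_smult_le])
  next
    case (add f g)
    then show ?case by (auto simp: hc.evalh_add h.evalh_add intro: degree_add_le)
  qed
  then show "degree (evalh (\<lambda>c. [:h c:]) G (\<lambda>i. [:a i, b i:])) \<le> N"
    "coeff (evalh (\<lambda>c. [:h c:]) G (\<lambda>i. [:a i, b i:])) N = evalh h G b" by auto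
qed

lemma rhom_pconst2: "rhom (\<lambda>c::'a::comm_ring_1. [:[:c:]:])"
  by (rule rhom_comp[OF rhom_pconst rhom_pconst])

text \<open>Restriction of a form to the affine plane \<open>e1 + t e2 + z Q\<close>, as a polynomial in \<open>z\<close> over the
  polynomials in \<open>t\<close>.\<close>

definition aff :: "'a::comm_ring_1 ^ 'n \<Rightarrow> 'a ^ 'n \<Rightarrow> 'a ^ 'n \<Rightarrow> ('a, 'n::finite) mpoly \<Rightarrow> 'a poly poly" where
  "aff e1 e2 Q G = evalh (\<lambda>c. [:[:c:]:]) G (\<lambda>i. [:[:e1 $ i, e2 $ i:], [:Q $ i:]:])"

lemma rhom_aff: "rhom (aff e1 e2 Q)"
  unfolding aff_def[abs_def] by (rule rhom.rhom_evalh[OF rhom_pconst2])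

interpretation aff: rhom "aff e1 e2 Q" for e1 e2 Q by (rule rhom_aff)

definition linform :: "'a::comm_ring_1 ^ 'n \<Rightarrow> ('a, 'n::finite) mpoly" where
  "linform a = pull a mvar"

lemma homogeneous_linform: "homogeneous 1 (linform a)"
  unfolding linform_def by (intro homogeneous_pull homogeneous_mvar)

lemma meval_linform: "meval (linform a) v = dot a v"
  by (simp add: linform_def meval_pull dot_def)

lemma aff_mconst: "aff e1 e2 Q (mconst c) = [:[:c:]:]"
  by (simp add: aff_def rhom.evalh_mconst[OF rhom_pconst2])

lemma aff_linform: "aff e1 e2 Q (linform a) = [:[:dot a e1, dot a e2:], [:dot a Q:]:]"
proof -
  have s: "(\<Sum>i\<in>S. [:f i, g i:]) = [:\<Sum>i\<in>S. f i, \<Sum>i\<in>S. g i:]" for f g :: "'b \<Rightarrow> 'c::comm_ring_1" and S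
    by (induction S rule: infinite_finite_induct) auto
  have s0: "(\<Sum>i\<in>S. [:f i:]) = [:\<Sum>i\<in>S. f i:]" for f :: "'b \<Rightarrow> 'c::comm_ring_1" and S
    by (induction S rule: infinite_finite_induct) auto
  show ?thesis
    unfolding aff_def linform_def evalh_pull[OF rhom_pconst2] rhom.evalh_mvar[OF rhom_pconst2]
    by (simp add: s s0 dot_def)
qed

lemma (in funfield) ev_aff: "ev (aff e1 e2 Q G) z = evalh cst G (\<lambda>i. cst (e1 $ i) + t * cst (e2 $ i) + z * cst (Q $ i))"
proof -
  have "ev (aff e1 e2 Q G) z = evalh (\<lambda>c. ev [:[:c:]:] z) G (\<lambda>i. ev [:[:e1 $ i, e2 $ i:], [:Q $ i:]:] z)"
    unfolding aff_def by (rule rhom.evalh_comp[OF rhom_pconst2 rhom_ev])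
  moreover have "ev [:[:c:]:] z = cst c" for c by (simp add: ev_const emb_const)
  moreover have "ev [:[:e1 $ i, e2 $ i:], [:Q $ i:]:] z = cst (e1 $ i) + t * cst (e2 $ i) + z * cst (Q $ i)" for i
    by (simp add: ev_pCons ev_const emb_const ev.zero) (simp add: emb_def cst.map_poly_pCons cst.zero)
  ultimately show ?thesis by simp
qed

lemma poly_map_aff:
  "poly (map_poly (\<lambda>p. poly p t0) (aff e1 e2 Q G)) z0 = meval G (e1 + t0 *s e2 + z0 *s Q)"
proof -
  have r: "rhom (\<lambda>g. poly (map_poly (\<lambda>p. poly p t0) g) z0)"
    by (rule rhom.poly_map_poly_rhom[OF rhom_poly])
  have "poly (map_poly (\<lambda>p. poly p t0) (aff e1 e2 Q G)) z0
     = evalh (\<lambda>c. poly (map_poly (\<lambda>p. poly p t0) [:[:c:]:]) z0) G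
        (\<lambda>i. poly (map_poly (\<lambda>p. poly p t0) [:[:e1 $ i, e2 $ i:], [:Q $ i:]:]) z0)"
    unfolding aff_def by (rule rhom.evalh_comp[OF rhom_pconst2 r])
  also have "\<dots> = meval G (e1 + t0 *s e2 + z0 *s Q)"
    unfolding meval_evalh affine_vec_nth by (simp add: rhom.map_poly_pCons[OF rhom_poly])
  finally show ?thesis .
qed

text \<open>Up to the determinant of the frame, the three cross products form the dual basis of
  \<open>e1\<close>, \<open>e2\<close>, \<open>Q\<close>.\<close>

lemma frame_expand:
  fixes e1 e2 Q v :: "'a::comm_ring_1 ^ 3"
  shows "dot (cross e2 Q) e1 *s v = dot (cross e2 Q) v *s e1 + dot (cross Q e1) v *s e2 + dot (cross e1 e2) v *s Q"
  by (simp add: vec3_eq_iff dot_3 cross_simps algebra_simps)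

section \<open>Plane curves\<close>

text \<open>Primeness is asked of forms only, since it comes from the irreducibility of a closed
  set, and closed sets are cut out by forms.\<close>

locale curve =
  fixes F :: "('a::{alg_closed_field, field_char_0}, 3) mpoly" and n :: nat
  assumes hom_F: "homogeneous n F" and n0: "n > 0" and nz: "F \<noteq> 0"
    and prime_F: "homogeneous d G \<Longrightarrow> homogeneous d' H \<Longrightarrow> F dvd G * H \<Longrightarrow> F dvd G \<or> F dvd H"

text \<open>\<open>F_Q\<close> makes the affine equation monic in \<open>z\<close>; determinant 1
  makes the cross products of the frame exactly its dual basis.\<close>

locale framed_curve = curve F n + funfield cst t
  for F :: "('a::{alg_closed_field, field_char_0}, 3) mpoly" and n
    and cst :: "'a \<Rightarrow> 'b::{alg_closed_field, field_char_0}" and t +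
  fixes e1 e2 Q :: "'a ^ 3"
  assumes F_Q: "meval F Q = 1" and frame: "dot (cross e2 Q) e1 = 1"
begin

abbreviation "AF \<equiv> aff e1 e2 Q"

text \<open>The equation of the line through \<open>e2\<close> and \<open>Q\<close>, the line at
  infinity of the chart. It restricts to 1, so its powers serve to homogenise.\<close>

abbreviation "L0 \<equiv> linform (cross e2 Q)"

lemma frame_dots: "dot (cross e2 Q) e1 = 1" "dot (cross e2 Q) e2 = 0" "dot (cross e2 Q) Q = 0"
  "dot (cross Q e1) e1 = 0" "dot (cross Q e1) e2 = 1" "dot (cross Q e1) Q = 0"
  "dot (cross e1 e2) e1 = 0" "dot (cross e1 e2) e2 = 0" "dot (cross e1 e2) Q = 1"
proof -
  show 1: "dot (cross Q e1) e2 = 1"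
    using frame dot_cross_cyclic[of e1 e2 Q] unfolding dot_commute[of "cross _ _"] by simp
  show "dot (cross e1 e2) Q = 1"
    using 1 dot_cross_cyclic[of e2 Q e1] unfolding dot_commute[of "cross _ _"] by simp
qed (use frame in \<open>simp_all add: dot_commute[of "cross _ _"] dot_cross\<close>)

lemma expand: "v = dot (cross e2 Q) v *s e1 + dot (cross Q e1) v *s e2 + dot (cross e1 e2) v *s Q"
  using frame_expand[of e2 Q e1 v] frame by simp

lemma aff_L0: "AF L0 = 1"
  by (simp add: aff_linform frame_dots one_pCons)

lemma aff_surj: "\<exists>N G. homogeneous N G \<and> AF G = g"
proof -
  have comb: "\<exists>N G. homogeneous N G \<and> AF G = g + h" if gh: "\<exists>N G. homogeneous N G \<and> AF G = g" "\<exists>N G. homogeneous N G \<and> AF G = h" for g h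
  proof -
    from gh obtain N G M H where *: "homogeneous N G" "AF G = g" "homogeneous M H" "AF H = h" by blast
    have "homogeneous (M * 1 + N) (L0 ^ M * G)" "homogeneous (N * 1 + M) (L0 ^ N * H)"
      using * by (intro homogeneous_mult homogeneous_power homogeneous_linform; simp)+
    then have "homogeneous (N + M) (L0 ^ M * G + L0 ^ N * H)"
      by (intro homogeneous_add) (simp_all add: add.commute)
    moreover have "AF (L0 ^ M * G + L0 ^ N * H) = g + h"
      using * by (simp add: aff.add aff.mult aff.power aff_L0)
    ultimately show ?thesis by blast
  qed
  have mul: "\<exists>N G. homogeneous N G \<and> AF G = AF (linform a) * g" if gh: "\<exists>N G. homogeneous N G \<and> AF G = g" for a g
    using gh homogeneous_mult[OF homogeneous_linform] by (metis aff.mult)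
  have tt: "AF (linform (cross Q e1)) = [:[:0, 1:]:]" and zz: "AF (linform (cross e1 e2)) = [:0, 1:]"
    by (simp_all add: aff_linform frame_dots one_pCons)
  have base: "\<exists>N G. homogeneous N G \<and> AF G = [:p:]" for p
  proof (induction p)
    case 0
    show ?case using homogeneous_0 aff.zero by (metis pCons_0_0)
  next
    case (pCons c p)
    have "[:pCons c p:] = [:[:c:]:] + AF (linform (cross Q e1)) * [:p:]" by (simp add: tt)
    moreover have "\<exists>N G. homogeneous N G \<and> AF G = [:[:c:]:]" using homogeneous_mconst aff_mconst by blast
    ultimately show ?case using comb[OF _ mul[OF pCons(2)]] by metis
  qed
  show ?thesis
  proof (induction g)
    case 0
    show ?case using homogeneous_0 aff.zero by blast
  next
    case (pCons p g)
    have "pCons p g = [:p:] + AF (linform (cross e1 e2)) * g" by (simp add: zz)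
    then show ?case using comb[OF base mul[OF pCons(2)]] by metis
  qed
qed

lemma aff_inj:
  assumes "homogeneous N G" "homogeneous M H" "AF G = AF H"
  shows "L0 ^ Suc M * G = L0 ^ Suc N * H"
proof -
  \<comment> \<open>The additional factor \<open>L0\<close> hidden in each \<open>Suc\<close> makes
    \<open>P\<close> vanish on the line at infinity, where the chart gives no information.\<close>
  define P where "P = L0 ^ Suc M * G - L0 ^ Suc N * H"
  have hP: "homogeneous (N + M + 1) P"
    unfolding P_def
    using homogeneous_mult[OF homogeneous_power[OF homogeneous_linform, of "Suc M"] assms(1)]
      homogeneous_mult[OF homogeneous_power[OF homogeneous_linform, of "Suc N"] assms(2)]
    by (intro homogeneous_diff) (simp_all add: add.commute add.left_commute)
  have AP: "AF P = 0"
    unfolding P_def using assms(3) by (simp add: aff.diff aff.mult aff.power aff_L0)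
  have "meval P v = 0" for v
  proof (cases "dot (cross e2 Q) v = 0")
    case True
    then show ?thesis by (simp add: P_def mev.diff mev.mult mev.power meval_linform)
  next
    case False
    define c where "c = dot (cross e2 Q) v"
    have "v = c *s (e1 + (dot (cross Q e1) v / c) *s e2 + (dot (cross e1 e2) v / c) *s Q)"
      using False expand[of v] by (simp add: c_def vec.scale_right_distrib)
    then have "meval P v = c ^ (N + M + 1) * poly (map_poly (\<lambda>p. poly p (dot (cross Q e1) v / c)) (AF P)) (dot (cross e1 e2) v / c)"
      unfolding poly_map_aff using meval_scale[OF hP] by metis
    then show ?thesis by (simp add: AP)
  qed
  then have "P = 0" by (rule mpoly3_eq_0)
  then show ?thesis by (simp add: P_def)
qed

abbreviation "f \<equiv> AF F"

lemma degree_f: "degree f = n" "lead_coeff f = 1"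
proof -
  have *: "degree f \<le> n" "coeff f n = 1"
    using homogeneous_line[OF rhom_pconst hom_F, of "\<lambda>i. [:e1 $ i, e2 $ i:]" "\<lambda>i. [:Q $ i:]"]
      ev_id.evalh_comp[OF rhom_pconst, of F "\<lambda>i. Q $ i"] F_Q
    by (simp_all add: aff_def meval_evalh one_pCons)
  then have "n \<le> degree f" by (intro le_degree) simp
  then show "degree f = n" "lead_coeff f = 1" using * by auto
qed

text \<open>\<open>L0\<close> restricts to 1 and \<open>f\<close> has positive degree, so
  \<open>F\<close> does not divide \<open>L0\<close>, and primeness removes its powers one at a
  time.\<close>

lemma dvd_power_L0: "homogeneous d G \<Longrightarrow> F dvd L0 ^ k * G \<Longrightarrow> F dvd G"
proof (induction k)
  case (Suc k)
  have "F dvd L0 * (L0 ^ k * G)" using Suc(3) by (simp add: mult.assoc)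
  moreover have "homogeneous (k * 1 + d) (L0 ^ k * G)"
    by (intro homogeneous_mult homogeneous_power homogeneous_linform Suc(2))
  ultimately have "F dvd L0 \<or> F dvd L0 ^ k * G" using prime_F[OF homogeneous_linform] by blast
  moreover have "\<not> F dvd L0"
  proof
    assume "F dvd L0"
    then have "f dvd 1" unfolding dvd_def using aff_L0 by (metis aff.mult)
    then have "degree f \<le> degree (1::'a poly poly)" by (rule dvd_imp_degree_le) simp
    then show False using degree_f n0 by simp
  qed
  ultimately show ?case using Suc(1)[OF Suc(2)] by blast
qed simp

lemma dvd_aff_iff:
  assumes "homogeneous d G"
  shows "f dvd AF G \<longleftrightarrow> F dvd G"
proof
  assume "f dvd AF G"
  then obtain h where h: "AF G = f * h" by (auto simp: dvd_def)
  obtain N H where H: "homogeneous N H" "AF H = h" using aff_surj by blast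
  have "AF G = AF (F * H)" using h H by (simp add: aff.mult)
  then have "L0 ^ Suc (n + N) * G = L0 ^ Suc d * (F * H)"
    using aff_inj[OF assms homogeneous_mult[OF hom_F H(1)]] by blast
  also have "\<dots> = F * (L0 ^ Suc d * H)" by (simp only: mult_ac)
  finally have "F dvd L0 ^ Suc (n + N) * G" by (metis dvd_triv_left)
  then show "F dvd G" using dvd_power_L0[OF assms] by blast
next
  assume "F dvd G"
  then show "f dvd AF G" by (auto simp: dvd_def aff.mult)
qed

text \<open>The factors of a multiple of \<open>f\<close> homogenise to forms whose product is
  divisible by \<open>F\<close>. So \<open>f\<close> divides one of the factors, which their degrees
  forbid.\<close>

sublocale affine_curve cst t f n
proof
  show "degree f = n" "lead_coeff f = 1" "n > 0" using degree_f n0 by auto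
  fix c g q
  assume c: "c \<noteq> 0" and e: "smult c f = g * q" and d: "degree g < n" "degree q < n"
  obtain N G where G: "homogeneous N G" "AF G = g" using aff_surj by blast
  obtain M H where H: "homogeneous M H" "AF H = q" using aff_surj by blast
  obtain K C where C: "homogeneous K C" "AF C = [:c:]" using aff_surj by blast
  have "AF (G * H) = f * [:c:]" using e G H by (simp add: aff.mult)
  then have "f dvd AF (G * H)" by (metis dvd_triv_left)
  then have "F dvd G * H" using dvd_aff_iff[OF homogeneous_mult[OF G(1) H(1)]] by blast
  then have "F dvd G \<or> F dvd H" using prime_F G(1) H(1) by blast
  then have "f dvd g \<or> f dvd q" using dvd_aff_iff G H by blast
  moreover have "g \<noteq> 0" "q \<noteq> 0" using c e degree_f by auto
  ultimately show False using d degree_f dvd_imp_degree_le by (metis not_le)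
qed

text \<open>The point with these coordinates in the closure is a generic point of the curve.\<close>

lemma generic_vanish:
  assumes "z \<in> Z" "homogeneous d G"
  shows "evalh cst G (\<lambda>i. cst (e1 $ i) + t * cst (e2 $ i) + z * cst (Q $ i)) = 0 \<longleftrightarrow> F dvd G"
  using root_ideal[of z "AF G"] dvd_aff_iff[OF assms(2)] assms(1) unfolding Z_def ev_aff by blast

lemma spec_aff: "poly (spec t0 (AF G)) z0 = meval G (e1 + t0 *s e2 + z0 *s Q)"
  unfolding spec_def by (rule poly_map_aff)

lemma affine_point_nonzero: "e1 + t0 *s e2 + z0 *s Q \<noteq> 0"
proof
  assume "e1 + t0 *s e2 + z0 *s Q = 0"
  then have "dot (cross e2 Q) (e1 + t0 *s e2 + z0 *s Q) = 0" by (simp add: dot_zero)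
  then show False by (simp add: dot_add dot_scale frame_dots)
qed

lemma affine_coords:
  assumes "hcoords v x" "dot (cross e2 Q) v \<noteq> 0"
  obtains t0 z0 where "hcoords (e1 + t0 *s e2 + z0 *s Q) x"
proof -
  let ?c = "dot (cross e2 Q) v"
  have "inverse ?c *s v = inverse ?c *s (?c *s e1 + dot (cross Q e1) v *s e2 + dot (cross e1 e2) v *s Q)"
    using expand[of v] by simp
  also have "\<dots> = e1 + (inverse ?c * dot (cross Q e1) v) *s e2 + (inverse ?c * dot (cross e1 e2) v) *s Q"
    using assms(2) by (simp add: vec.scale_right_distrib)
  finally show ?thesis using that hcoords_scale[OF assms(1), of "inverse ?c"] assms(2) by simp
qed

lemma infinite_line_coords:
  assumes "hcoords v x" "dot (cross e2 Q) v = 0" "vanishes_at F x"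
  obtains z0 where "hcoords (e2 + z0 *s Q) x"
proof -
  let ?a = "dot (cross Q e1) v" and ?b = "dot (cross e1 e2) v"
  have v: "v = ?a *s e2 + ?b *s Q" using expand[of v] assms(2) by simp
  have "?a \<noteq> 0"
  proof
    assume a: "?a = 0"
    then have vQ: "v = ?b *s Q" using v by simp
    have "meval F v = ?b ^ n" using meval_scale[OF hom_F, of ?b Q] F_Q vQ by simp
    then have "?b = 0" using assms(1,3) vanishes_at_iff[OF hom_F] by auto
    then show False using vQ hcoords_nz[OF assms(1)] by simp
  qed
  then have "inverse ?a *s v = e2 + (inverse ?a * ?b) *s Q"
    using arg_cong[OF v, of "\<lambda>w. inverse ?a *s w"] by (simp add: vec.scale_right_distrib)
  then show ?thesis using that hcoords_scale[OF assms(1), of "inverse ?a"] \<open>?a \<noteq> 0\<close> by simp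
qed

text \<open>The affine common zeros are finite in number, and the line at infinity contains only
  finitely many points of the curve because it passes through \<open>Q\<close>, which is not on the
  curve.\<close>

lemma finite_common_zeros_framed:
  assumes "homogeneous d G" "\<not> F dvd G"
  shows "finite {x. vanishes_at F x \<and> vanishes_at G x}"
proof -
  define S where "S = {(t0, z0). poly (spec t0 f) z0 = 0 \<and> poly (spec t0 (AF G)) z0 = 0}"
  have S: "finite S" unfolding S_def using finite_common_zeros_affine dvd_aff_iff assms by blast
  define p where "p = evalh (\<lambda>c. [:c:]) F (\<lambda>i. [:e2 $ i, Q $ i:])"
  have "coeff p n = 1"
    using homogeneous_line(2)[OF rhom_ident hom_F] F_Q unfolding p_def meval_evalh by simp
  then have p0: "p \<noteq> 0" by auto
  have pv: "poly p z0 = meval F (e2 + z0 *s Q)" for z0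
    unfolding p_def meval_evalh affine_vec_nth rhom.evalh_comp[OF rhom_pconst rhom_poly] by simp
  have "{x. vanishes_at F x \<and> vanishes_at G x} \<subseteq>
     (\<lambda>(t0, z0). abs_proj (e1 + t0 *s e2 + z0 *s Q)) ` S \<union> (\<lambda>z0. abs_proj (e2 + z0 *s Q)) ` {z0. poly p z0 = 0}"
  proof
    fix x
    assume x: "x \<in> {x. vanishes_at F x \<and> vanishes_at G x}"
    obtain v where v: "hcoords v x" using hcoords_exists by blast
    show "x \<in> (\<lambda>(t0, z0). abs_proj (e1 + t0 *s e2 + z0 *s Q)) ` S \<union> (\<lambda>z0. abs_proj (e2 + z0 *s Q)) ` {z0. poly p z0 = 0}"
    proof (cases "dot (cross e2 Q) v = 0")
      case True
      obtain z0 where z0: "hcoords (e2 + z0 *s Q) x" using infinite_line_coords[OF v True] x by blast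
      then have "poly p z0 = 0" unfolding pv using x vanishes_at_iff[OF hom_F z0] by blast
      then show ?thesis using z0 unfolding hcoords_def by blast
    next
      case False
      obtain t0 z0 where z0: "hcoords (e1 + t0 *s e2 + z0 *s Q) x" using affine_coords[OF v False] by blast
      then have "(t0, z0) \<in> S" unfolding S_def spec_aff
        using x vanishes_at_iff[OF hom_F z0] vanishes_at_iff[OF assms(1) z0] by blast
      moreover have "x = abs_proj (e1 + t0 *s e2 + z0 *s Q)" using z0 unfolding hcoords_def by simp
      ultimately show ?thesis by (intro UnI1 image_eqI[of _ _ "(t0, z0)"]) simp_all
    qed
  qed
  moreover have "finite {z0. poly p z0 = 0}" using p0 by (rule poly_roots_finite)
  ultimately show ?thesis using S by (meson finite_UnI finite_imageI finite_subset)
qed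

end

section \<open>The algebraic closure of the rational function field\<close>

instance fract :: ("{idom, ring_char_0}") field_char_0
proof
  show "inj (of_nat :: nat \<Rightarrow> 'a fract)"
  proof (rule injI)
    fix m k :: nat
    assume "of_nat m = (of_nat k :: 'a fract)"
    then have "to_fract (of_nat m :: 'a) = to_fract (of_nat k)"
      by (simp add: to_fract_def of_nat_fract)
    then show "m = k" by simp
  qed
qed

definition ratcst :: "'a::field \<Rightarrow> 'a poly fract alg_closure" where
  "ratcst c = to_ac (to_fract [:c:])"

definition ratvar :: "'a::field poly fract alg_closure" where
  "ratvar = to_ac (to_fract [:0, 1:])"

lemma rhom_ratcst: "rhom (ratcst :: 'a::field \<Rightarrow> _)"
proof
  have "[:x + y:] = [:x:] + [:y:]" "[:x * y:] = [:x:] * [:y:]" for x y :: 'a by simp_all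
  then show "ratcst (x + y) = ratcst x + ratcst y" "ratcst (x * y) = ratcst x * ratcst y" for x y :: 'a
    unfolding ratcst_def by (simp_all only: to_fract_add to_ac_add to_fract_mult to_ac_mult)
  show "ratcst (1 :: 'a) = 1" by (simp add: ratcst_def one_pCons[symmetric])
qed

lemma ratcst_poly: "poly (map_poly ratcst p) ratvar = to_ac (to_fract p)"
proof (induction p)
  case (pCons c p)
  have "poly (map_poly ratcst (pCons c p)) ratvar = ratcst c + ratvar * to_ac (to_fract p)"
    by (simp add: rhom.map_poly_pCons[OF rhom_ratcst] pCons.IH)
  also have "\<dots> = to_ac (to_fract ([:c:] + [:0, 1:] * p))"
    by (simp only: ratcst_def ratvar_def to_fract_add to_fract_mult to_ac_add to_ac_mult)
  finally show ?case by simp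
qed simp

lemma fract_poly_clear_denominators:
  "\<exists>c P. c \<noteq> 0 \<and> smult (to_fract c) p = map_poly to_fract P"
  for p :: "'a::idom fract poly"
proof (induction p)
  case 0
  show ?case by (intro exI[of _ 1] exI[of _ 0]) simp
next
  case (pCons a p)
  then obtain c P where P: "c \<noteq> 0" "smult (to_fract c) p = map_poly to_fract P" by blast
  obtain x y where xy: "a = Fract x y" "y \<noteq> 0" by (rule Fract_cases)
  have a: "to_fract y * a = to_fract x" using xy by (simp add: Fract_conv_to_fract)
  have "smult (to_fract (y * c)) (pCons a p) = pCons (to_fract c * (to_fract y * a)) (smult (to_fract y) (smult (to_fract c) p))"
    by (simp add: mult_ac)
  also have "\<dots> = pCons (to_fract (c * x)) (smult (to_fract y) (map_poly to_fract P))"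
    unfolding P(2) a by simp
  also have "\<dots> = map_poly to_fract (pCons (c * x) (smult y P))"
    by (intro poly_eqI) (simp add: coeff_map_poly coeff_pCons split: nat.split)
  finally show ?case using P xy by (intro exI[of _ "y * c"] exI[of _ "pCons (c * x) (smult y P)"]) simp
qed

lemma funfield_ratcst: "funfield (ratcst :: 'a::{alg_closed_field, field_char_0} \<Rightarrow> _) ratvar"
proof (rule funfield.intro)
  show "rhom (ratcst :: 'a \<Rightarrow> _)" by (rule rhom_ratcst)
  show "p = 0" if "poly (map_poly ratcst p) ratvar = 0" for p :: "'a poly"
    using that by (simp add: ratcst_poly)
  show "\<exists>P. P \<noteq> 0 \<and> poly (map_poly (\<lambda>p. poly (map_poly ratcst p) ratvar) P) w = 0"
    for w :: "'a poly fract alg_closure"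
  proof -
    obtain p where p: "p \<noteq> 0" "poly (map_poly to_ac p) w = 0" using alg_closure_algebraic[of w] by blast
    obtain c P where P: "c \<noteq> 0" "smult (to_fract c) p = map_poly to_fract P"
      using fract_poly_clear_denominators[of p] by blast
    have "P \<noteq> 0" using P p by auto
    have "map_poly (\<lambda>x. to_ac (to_fract x)) P = map_poly to_ac (map_poly to_fract P)"
      by (rule poly_eqI) (simp add: coeff_map_poly)
    also have "\<dots> = smult (to_ac (to_fract c)) (map_poly to_ac p)"
      unfolding P(2)[symmetric] by (rule poly_eqI) (simp add: coeff_map_poly)
    finally have "poly (map_poly (\<lambda>x. to_ac (to_fract x)) P) w = 0" using p by simp
    then show ?thesis using \<open>P \<noteq> 0\<close> unfolding ratcst_poly by blast
  qed
qed

lemma linform_nonzero: "a \<noteq> 0 \<Longrightarrow> linform a \<noteq> 0"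
proof
  assume "a \<noteq> 0" "linform a = 0"
  then obtain k where "a $ k \<noteq> 0" by (auto simp: vec_eq_iff)
  moreover have "dot a (axis k 1) = a $ k"
    unfolding dot_def axis_def by (simp add: if_distrib[of "\<lambda>x. _ * x"] cong: if_cong)
  ultimately show False using \<open>linform a = 0\<close> meval_linform[of a "axis k 1"] mev.zero by metis
qed

lemma mpoly3_common_nonzero:
  fixes f g :: "('a::field_char_0, 3) mpoly"
  assumes "f \<noteq> 0" "g \<noteq> 0"
  obtains v where "meval f v \<noteq> 0" "meval g v \<noteq> 0"
proof -
  have "f * g \<noteq> 0" using assms by simp
  then obtain v where "meval (f * g) v \<noteq> 0" using mpoly3_eq_0 by blast
  then show ?thesis using that[of v] by (auto simp: mev.mult)
qed

context curve
begin

lemma normalise_point: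
  assumes "meval F v \<noteq> 0"
  obtains c where "c \<noteq> 0" "meval F (c *s v) = 1"
proof -
  obtain c where c: "c ^ n = inverse (meval F v)" using nth_root_exists[OF n0] by metis
  then have "c \<noteq> 0" using assms n0 by (metis inverse_nonzero_iff_nonzero power_0_left not_gr_zero)
  moreover have "meval F (c *s v) = 1" using c assms by (simp add: meval_scale[OF hom_F])
  ultimately show ?thesis using that by blast
qed

lemma frame_complete:
  assumes "cross e2 Q \<noteq> (0::'a ^ 3)"
  obtains e1 where "dot (cross e2 Q) e1 = 1"
proof -
  obtain a where "dot a (cross e2 Q) \<noteq> 0" using dot_separates[OF assms] by blast
  then have "dot (cross e2 Q) (inverse (dot a (cross e2 Q)) *s a) = 1"
    unfolding dot_scale dot_commute[of "cross e2 Q"] by simp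
  then show ?thesis using that by blast
qed

text \<open>Any nonzero vector can be prescribed as the direction \<open>e2\<close>; this freedom is
  what the treatment of polars relies on.\<close>

lemma framed_exists:
  fixes a :: "'a ^ 3"
  assumes "a \<noteq> 0"
  obtains e1 Q where "framed_curve F n (ratcst :: 'a \<Rightarrow> _) ratvar e1 a Q"
proof -
  have "\<exists>k. cross a (axis k 1) \<noteq> 0"
  proof (rule ccontr)
    assume "\<not> ?thesis"
    then have c: "cross a (axis k 1) = 0" for k by blast
    have "dot a (cross b (axis k 1)) = 0" for b k
      using dot_cross_cyclic[of a b "axis k 1"] dot_cross_cyclic[of b "axis k 1" a] c[of k] cross_skew[of a "axis k 1"]
      by (simp add: dot_zero)
    then have "cross a b $ k = 0" for b k using cross_axis_dot[of a b k] by metis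
    then have "cross a b = 0" for b by (simp add: vec_eq_iff)
    then have "\<exists>c. b = c *s a" for b using cross_eq_0 assms by blast
    then obtain x y where x: "axis 1 1 = x *s a" and y: "axis 2 1 = y *s a" by metis
    have "x * a $ 1 = 1" "x * a $ 2 = 0" "y * a $ 2 = 1"
      using arg_cong[OF x, of "\<lambda>v. v $ 1"] arg_cong[OF x, of "\<lambda>v. v $ 2"] arg_cong[OF y, of "\<lambda>v. v $ 2"]
      by (simp_all add: axis_def)
    then show False by auto
  qed
  then obtain k where k: "cross a (axis k 1) \<noteq> 0" by blast
  obtain v where v: "meval F v \<noteq> 0" "meval (linform (cross a (axis k 1))) v \<noteq> 0"
    using mpoly3_common_nonzero[OF nz linform_nonzero[OF k]] .
  have "dot v (cross a (axis k 1)) \<noteq> 0" using v by (simp add: meval_linform dot_commute)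
  then have "cross v a \<noteq> 0" by (auto simp: cross_axis_dot)
  then have cv: "cross a v \<noteq> 0" using cross_skew[of a v] by simp
  obtain c where c: "c \<noteq> 0" "meval F (c *s v) = 1" using normalise_point[OF v(1)] .
  have "cross a (c *s v) \<noteq> 0" using cv c by (simp add: cross_scale)
  then obtain e1 where e1: "dot (cross a (c *s v)) e1 = 1" by (rule frame_complete)
  interpret funfield "ratcst :: 'a \<Rightarrow> _" ratvar by (rule funfield_ratcst)
  have "framed_curve F n (ratcst :: 'a \<Rightarrow> _) ratvar e1 a (c *s v)"
    by unfold_locales (use c e1 in auto)
  then show ?thesis using that by blast
qed

lemma some_frame:
  obtains e1 e2 Q where "framed_curve F n (ratcst :: 'a \<Rightarrow> _) ratvar e1 e2 Q"
proof -
  have "(1::'a ^ 3) \<noteq> 0" by (simp add: vec_eq_iff)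
  then show ?thesis using framed_exists that by metis
qed

lemma finite_common_zeros:
  assumes "homogeneous d G" "\<not> F dvd G"
  shows "finite {x. vanishes_at F x \<and> vanishes_at G x}"
proof -
  obtain e1 e2 Q where fr: "framed_curve F n (ratcst :: 'a \<Rightarrow> _) ratvar e1 e2 Q" using some_frame .
  interpret framed_curve F n "ratcst :: 'a \<Rightarrow> _" ratvar e1 e2 Q by (rule fr)
  show ?thesis by (rule finite_common_zeros_framed[OF assms])
qed

text \<open>The restriction of \<open>G\<close> to the chart has degree at most \<open>d\<close> in
  \<open>z\<close>, too small for a nonzero multiple of \<open>f\<close>; then
  \<open>aff_inj\<close> gives \<open>G = 0\<close>.\<close>

lemma dvd_small:
  assumes "homogeneous d G" "d < n" "F dvd G"
  shows "G = 0"
proof -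
  obtain e1 e2 Q where fr: "framed_curve F n (ratcst :: 'a \<Rightarrow> _) ratvar e1 e2 Q" using some_frame .
  interpret framed_curve F n "ratcst :: 'a \<Rightarrow> _" ratvar e1 e2 Q by (rule fr)
  have "degree (AF G) \<le> d" unfolding aff_def by (rule homogeneous_line(1)[OF rhom_pconst assms(1)])
  moreover have "f dvd AF G" using dvd_aff_iff[OF assms(1)] assms(3) by blast
  ultimately have "AF G = 0" using assms(2) degree_f(1) dvd_imp_degree_le by (metis le_trans not_le)
  then have "AF G = AF 0" by (simp add: aff.zero)
  then have "L0 ^ Suc 0 * G = L0 ^ Suc d * 0" using aff_inj[OF assms(1) homogeneous_0] by blast
  moreover have "L0 \<noteq> 0" using aff_L0 aff.zero[of e1 e2 Q] by (metis zero_neq_one)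
  ultimately show "G = 0" by simp
qed

end

section \<open>Derivations on the coordinate ring\<close>

text \<open>In characteristic 0 the top coefficients of the two products differ by the factors
  \<open>degree a\<close> and \<open>degree b\<close>, so the degrees agree. Subtracting the
  multiple of \<open>b\<close> with the same leading coefficient leaves a polynomial with the same
  Wronskian property and the wrong degree, hence 0.\<close>

lemma poly_wronskian:
  fixes a b :: "'a::field_char_0 poly"
  assumes "a * pderiv b = pderiv a * b" "b \<noteq> 0"
  shows "\<exists>c. a = smult c b"
proof -
  have deg: "degree a = degree b" if a: "a \<noteq> 0" "a * pderiv b = pderiv a * b" for a
  proof (rule ccontr)
    assume ne: "degree a \<noteq> degree b"
    then obtain m where m: "degree a + degree b = Suc m" by (cases "degree a + degree b") auto
    have *: "coeff (p * pderiv q) m = of_nat (degree q) * (lead_coeff p * lead_coeff q)"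
      if "degree p + degree q = Suc m" for p q :: "'a poly"
    proof (cases "degree q")
      case 0
      then show ?thesis using pderiv_eq_0_iff[of q] by simp
    next
      case (Suc k)
      then have mk: "m = degree p + k" using that by simp
      have "degree (pderiv q) \<le> k" using Suc by (simp add: degree_pderiv)
      then show ?thesis unfolding mk using coeff_mult_bounded(1)[of p "degree p" "pderiv q" k] Suc
        by (simp add: coeff_pderiv mult_ac)
    qed
    have 1: "coeff (a * pderiv b) m = of_nat (degree b) * (lead_coeff a * lead_coeff b)" by (rule *[OF m])
    have 2: "coeff (b * pderiv a) m = of_nat (degree a) * (lead_coeff b * lead_coeff a)" by (rule *) (use m in simp)
    have "of_nat (degree b) * (lead_coeff a * lead_coeff b) = of_nat (degree a) * (lead_coeff b * lead_coeff a)"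
      unfolding 1[symmetric] 2[symmetric] a(2) by (simp only: mult.commute)
    then show False using ne a assms(2) by (simp add: mult.commute)
  qed
  show ?thesis
  proof (cases "a = 0")
    case True
    then show ?thesis by (intro exI[of _ 0]) simp
  next
    case False
    define c where "c = lead_coeff a / lead_coeff b"
    define r where "r = a - smult c b"
    have "r * pderiv b = pderiv r * b"
      unfolding r_def using assms(1) by (simp add: algebra_simps pderiv_diff pderiv_smult)
    moreover have "coeff r (degree b) = 0"
      unfolding r_def c_def using deg[OF False assms(1)] assms(2) by simp
    ultimately have "r = 0" using deg[of r] by (metis leading_coeff_0_iff)
    then show ?thesis unfolding r_def by auto
  qed
qed

abbreviation dt :: "'a::field_char_0 poly poly \<Rightarrow> 'a poly poly" where
  "dt \<equiv> map_poly pderiv"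

lemma dt_add: "dt (g + h) = dt g + dt h"
  by (rule poly_eqI) (simp add: coeff_map_poly pderiv_add)

lemma pderiv_sum': "pderiv (sum p S) = (\<Sum>x\<in>S. pderiv (p x))"
  by (induction S rule: infinite_finite_induct) (simp_all add: pderiv_add)

lemma dt_mult: "dt (g * h) = dt g * h + g * dt h"
proof (rule poly_eqI)
  fix k
  have "pderiv (coeff (g * h) k) = (\<Sum>i\<le>k. pderiv (coeff g i) * coeff h (k - i) + coeff g i * pderiv (coeff h (k - i)))"
    unfolding coeff_mult pderiv_sum' by (intro sum.cong refl) (simp add: pderiv_mult algebra_simps)
  then show "coeff (dt (g * h)) k = coeff (dt g * h + g * dt h) k"
    by (simp add: coeff_map_poly coeff_mult sum.distrib)
qed

lemma dt_pCons: "dt (pCons p g) = pCons (pderiv p) (dt g)"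
  by (rule poly_eqI) (simp add: coeff_map_poly coeff_pCons split: nat.split)

lemma pderiv_poly_poly: "pderiv (poly g p) = poly (dt g) p + poly (pderiv g) p * pderiv p"
  for g :: "'a::field_char_0 poly poly"
  by (induction g) (simp_all add: dt_pCons pderiv_add pderiv_mult pderiv_pCons algebra_simps)

context affine_curve
begin

text \<open>The derivation tangent to the curve: it kills \<open>f\<close>, and on functions of the
  curve it is \<open>pderiv f\<close> times differentiation by \<open>t\<close>.\<close>

definition D :: "'a poly poly \<Rightarrow> 'a poly poly" where
  "D g = pderiv f * dt g - dt f * pderiv g"

lemma D_add: "D (g + h) = D g + D h"
  by (simp add: D_def dt_add pderiv_add algebra_simps)

lemma D_mult: "D (g * h) = D g * h + g * D h"
  by (simp add: D_def dt_mult pderiv_mult algebra_simps)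

lemma D_sum: "D (sum g S) = (\<Sum>x\<in>S. D (g x))"
  by (induction S rule: infinite_finite_induct) (simp_all add: D_add, simp_all add: D_def)

lemma D_f: "D f = 0"
  by (simp add: D_def mult.commute)

lemma D_dvd: "f dvd g \<Longrightarrow> f dvd D g"
  by (auto simp: dvd_def D_mult D_f)

lemma D_const: "D [:p:] = pderiv f * [:pderiv p:]"
  by (simp add: D_def dt_pCons pderiv_pCons)

lemma ev_smult: "ev (smult p g) z = emb p * ev g z"
  using ev.mult[of "[:p:]" g z] by (simp add: ev_const)

lemma D_smult: "D (smult p g) = smult (pderiv p) (pderiv f * g) + smult p (D g)"
  using D_mult[of "[:p:]" g] by (simp add: D_const)

lemma D_power: "D (g ^ k) = of_nat k * g ^ (k - 1) * D g"
proof (induction k)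
  case 0
  have "D (1 * 1) = D 1 * 1 + 1 * D 1" by (rule D_mult)
  then show ?case by simp
next
  case (Suc k)
  then show ?case by (cases k) (simp_all add: D_mult algebra_simps)
qed

text \<open>The hypothesis says that the quotient \<open>w\<close> of \<open>u\<close> and
  \<open>v\<close> has derivative 0. Differentiating its equation of least degree over the
  polynomials in \<open>t\<close> then differentiates the coefficients only. By minimality the new
  equation is proportional to the old one, so by \<open>poly_wronskian\<close> the coefficients are
  constants up to a common factor. Hence \<open>w\<close> is algebraic over the constants, which are
  algebraically closed.\<close>

lemma constants_of_D:
  assumes z: "z \<in> Z" and v0: "ev v z \<noteq> 0" and uv: "f dvd D u * v - u * D v"
  shows "\<exists>c. ev u z = cst c * ev v z"
proof -
  have fz: "ev f z = 0" using z by (simp add: Z_def)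
  have vanish: "ev g z = 0 \<longleftrightarrow> f dvd g" for g by (rule root_ideal[OF fz])
  define V V' where "V = ev v z" and "V' = ev (D v) z"
  define w where "w = ev u z / V"
  have U: "ev u z = w * V" using v0 by (simp add: w_def V_def)
  have "ev (D u) z * V = ev u z * V'"
    using uv unfolding vanish[symmetric] V_def V'_def by (simp add: ev.diff ev.mult)
  then have "ev (D u) z * V = (w * V') * V" unfolding U by (simp only: mult_ac)
  then have U': "ev (D u) z = w * V'" using v0 unfolding V_def by simp
  let ?P = "\<lambda>P. P \<noteq> 0 \<and> ev P w = 0"
  define P where "P = (ARG_MIN degree P. ?P P)"
  have P: "?P P" unfolding P_def using algebraic_ev[of w] arg_min_natI[of ?P _ degree] by blast
  have le: "degree P \<le> degree R" if "?P R" for R unfolding P_def using that by (rule arg_min_nat_le)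
  define r where "r = degree P"
  have r0: "r > 0"
  proof (rule ccontr)
    assume "\<not> ?thesis"
    then obtain p where "P = [:p:]" unfolding r_def using degree_eq_zeroE by blast
    then show False using P by (simp add: ev_const)
  qed
  have evR: "ev R x = (\<Sum>j\<le>r. emb (coeff R j) * x ^ j)" if "degree R \<le> r" for R x
  proof -
    have "ev R x = (\<Sum>j\<le>degree (map_poly emb R). emb (coeff R j) * x ^ j)"
      unfolding ev_def poly_altdef by (simp add: emb.coeff_map)
    also have "\<dots> = (\<Sum>j\<le>r. emb (coeff R j) * x ^ j)"
    proof (rule sum.mono_neutral_left)
      have "degree (map_poly emb R) \<le> degree R" by (rule degree_le) (simp add: emb.coeff_map coeff_eq_0 emb.zero)
      then show "{..degree (map_poly emb R)} \<subseteq> {..r}" using that by auto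
      show "\<forall>j\<in>{..r} - {..degree (map_poly emb R)}. emb (coeff R j) * x ^ j = 0"
        using emb.coeff_map[of R] by (auto simp: coeff_eq_0 simp del: emb_eq_0) (metis coeff_eq_0 linorder_not_le)
    qed simp
    finally show ?thesis .
  qed
  \<comment> \<open>The equation of \<open>w\<close> multiplied by the \<open>r\<close>-th power of
    \<open>v\<close>; this is a polynomial, so that \<open>D\<close> applies to it.\<close>
  define h where "h = (\<Sum>j\<le>r. [:coeff P j:] * (u ^ j * v ^ (r - j)))"
  have term_ev: "ev (u ^ j * v ^ (r - j)) z = V ^ r * w ^ j" if "j \<le> r" for j
  proof -
    have "ev (u ^ j * v ^ (r - j)) z = w ^ j * (V ^ j * V ^ (r - j))"
      by (simp add: ev.mult ev.power U V_def[symmetric] power_mult_distrib)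
    then show ?thesis using that by (simp add: power_add[symmetric] mult.commute)
  qed
  have term_D: "ev (D (u ^ j * v ^ (r - j))) z = of_nat r * V ^ (r - 1) * V' * w ^ j" if j: "j \<le> r" for j
  proof -
    have 1: "of_nat j * (w * V) ^ (j - 1) * (w * V') * V ^ (r - j) = of_nat j * (V ^ (r - 1) * V' * w ^ j)"
    proof (cases j)
      case (Suc i)
      have "V ^ (r - 1) = V ^ i * V ^ (r - j)" using j Suc by (simp add: power_add[symmetric])
      then show ?thesis using Suc by (simp add: power_mult_distrib mult_ac)
    qed simp
    have 2: "(w * V) ^ j * (of_nat (r - j) * V ^ (r - j - 1) * V') = of_nat (r - j) * (V ^ (r - 1) * V' * w ^ j)"
    proof (cases "r - j")
      case (Suc i)
      have "r - 1 = j + i" using j Suc by simp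
      then have "V ^ (r - 1) = V ^ j * V ^ i" by (simp only: power_add)
      then show ?thesis using Suc by (simp add: power_mult_distrib mult_ac)
    qed simp
    have "ev (D (u ^ j * v ^ (r - j))) z
        = of_nat j * (w * V) ^ (j - 1) * (w * V') * V ^ (r - j) + (w * V) ^ j * (of_nat (r - j) * V ^ (r - j - 1) * V')"
      by (simp add: D_mult D_power ev.add ev.mult ev.power ev.of_nat U U' V_def[symmetric] V'_def[symmetric])
    also have "\<dots> = (of_nat j + of_nat (r - j)) * (V ^ (r - 1) * V' * w ^ j)"
      unfolding 1 2 by (simp only: distrib_right)
    also have "of_nat j + of_nat (r - j) = (of_nat r :: 'b)" using j by (simp add: of_nat_diff)
    finally show ?thesis by (simp only: mult_ac)
  qed
  have "ev h z = V ^ r * ev P w"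
    unfolding h_def ev.sum evR[of P w, unfolded r_def, folded r_def, OF order_refl] sum_distrib_left
    by (intro sum.cong refl) (simp add: ev_smult term_ev mult_ac)
  then have "f dvd h" using P vanish by simp
  then have "ev (D h) z = 0" using D_dvd vanish by blast
  moreover have "ev (D h) z = ev (pderiv f) z * V ^ r * ev (dt P) w + of_nat r * V ^ (r - 1) * V' * ev P w"
  proof -
    have dP: "degree (dt P) \<le> r" unfolding r_def by (rule degree_le) (simp add: coeff_map_poly coeff_eq_0)
    have cP: "coeff (dt P) j = pderiv (coeff P j)" for j by (simp add: coeff_map_poly)
    have "ev (D h) z = (\<Sum>j\<le>r. ev (pderiv f) z * V ^ r * (emb (coeff (dt P) j) * w ^ j)
        + of_nat r * V ^ (r - 1) * V' * (emb (coeff P j) * w ^ j))"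
      unfolding h_def D_sum ev.sum
      by (intro sum.cong refl)
        (simp add: D_smult ev.add ev_smult ev.mult[of "pderiv f"] term_ev term_D cP mult_ac)
    then show ?thesis
      using evR[OF dP, of w] evR[of P w] unfolding r_def[symmetric] by (simp add: sum.distrib sum_distrib_left)
  qed
  ultimately have "ev (pderiv f) z * V ^ r * ev (dt P) w = 0" using P by simp
  then have dP: "ev (dt P) w = 0" using pderiv_nonzero[OF z] v0 by (simp add: V_def)
  define lc where "lc = lead_coeff P"
  have lc0: "lc \<noteq> 0" using P by (simp add: lc_def)
  \<comment> \<open>The combination of \<open>P\<close> and its coefficientwise derivative in which
    the coefficients of degree \<open>r\<close> cancel.\<close>
  define R where "R = smult lc (dt P) - smult (pderiv lc) P"
  have "ev R w = 0" unfolding R_def using dP P by (simp add: ev.diff ev_smult)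
  moreover have "coeff R k = 0" if "k \<ge> r" for k
    using that unfolding R_def r_def lc_def by (cases "k = degree P") (simp_all add: coeff_map_poly coeff_eq_0 mult.commute)
  then have "R = 0 \<or> degree R < r" using r0 by (metis leading_coeff_0_iff linorder_not_le)
  ultimately have "R = 0" using le[of R] unfolding r_def by fastforce
  then have "coeff P j * pderiv lc = pderiv (coeff P j) * lc" for j
  proof -
    have "coeff R j = 0" using \<open>R = 0\<close> by simp
    then show ?thesis unfolding R_def by (simp add: coeff_map_poly mult.commute)
  qed
  then have "\<exists>c. coeff P j = smult c lc" for j using poly_wronskian[OF _ lc0] by blast
  then obtain \<gamma> where \<gamma>: "\<And>j. coeff P j = smult (\<gamma> j) lc" by metis
  have \<gamma>r: "\<gamma> r \<noteq> 0" using \<gamma>[of r] lc0 unfolding r_def lc_def by auto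
  define p where "p = (\<Sum>j\<le>r. monom (\<gamma> j) j)"
  have cp: "coeff p j = (if j \<le> r then \<gamma> j else 0)" for j unfolding p_def coeff_sum by simp
  have p0: "p \<noteq> 0" using cp[of r] \<gamma>r by auto
  have "ev P w = emb lc * poly (map_poly cst p) w"
  proof -
    have e: "emb (coeff P j) = emb lc * cst (\<gamma> j)" for j
      unfolding \<gamma>[of j] using emb.mult[of "[:\<gamma> j:]" lc] by (simp add: emb_const mult.commute)
    have "poly (map_poly cst p) w = (\<Sum>j\<le>r. cst (\<gamma> j) * w ^ j)"
      unfolding p_def rhom.sum[OF cst.map_poly_rhom] poly_sum
      by (intro sum.cong refl) (simp add: map_poly_monom cst.zero poly_monom)
    then show ?thesis using evR[of P w] unfolding r_def[symmetric] by (simp add: e sum_distrib_left mult.assoc)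
  qed
  then have pw: "poly (map_poly cst p) w = 0" using P lc0 by simp
  obtain A where A: "p = smult (lead_coeff p) (\<Prod>x\<in>#A. [:- x, 1:])"
    using alg_closed_imp_factorization[OF p0] by blast
  have m: "poly (map_poly cst (\<Prod>x\<in>#B. [:- x, 1:])) w = (\<Prod>x\<in>#B. w - cst x)" for B
  proof (induction B)
    case (add x B)
    have 1: "poly (map_poly cst [:- x, 1:]) w = w - cst x"
      by (simp add: cst.map_poly_pCons cst.uminus cst.one)
    show ?case
      unfolding image_mset_add_mset prod_mset.add_mset rhom.mult[OF cst.poly_map_poly_rhom] 1 add ..
  qed (simp add: rhom.one[OF cst.map_poly_rhom])
  have "poly (map_poly cst p) w = cst (lead_coeff p) * (\<Prod>x\<in>#A. w - cst x)"
    by (subst A) (simp add: m[symmetric] rhom.mult[OF cst.map_poly_rhom, of "[:_:]", simplified] cst.map_poly_pCons)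
  moreover have "cst (lead_coeff p) \<noteq> 0"
    using p0 emb_eq_0[of "[:lead_coeff p:]"] by (simp add: emb_const)
  ultimately have "(\<Prod>x\<in>#A. w - cst x) = 0" using pw by simp
  then obtain x where "w = cst x" by (auto simp: prod_mset_zero_iff)
  then show ?thesis using U unfolding V_def by blast
qed

text \<open>The equation makes \<open>f\<close> constant along the line
  \<open>z = z0 - c * t\<close>. Starting at a zero, this line is contained in the curve, so it
  gives a linear factor of \<open>f\<close>.\<close>

lemma translation_invariant:
  assumes "dt f = [:[:c:]:] * pderiv f"
  shows "n \<le> 1"
proof (rule ccontr)
  assume n: "\<not> n \<le> 1"
  have "degree (spec 0 f) > 0" using spec_f n_pos by simp
  then obtain z0 where z0: "poly (spec 0 f) z0 = 0" using alg_closed_imp_poly_has_root by blast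
  define p where "p = [:z0, - c:]"
  have "pderiv (poly f p) = 0"
    unfolding pderiv_poly_poly assms p_def by (simp add: pderiv_pCons)
  then have "degree (poly f p) = 0" using pderiv_eq_0_iff by blast
  then obtain y where y: "poly f p = [:y:]" using degree_eq_zeroE by blast
  have "poly (poly f p) 0 = poly (spec 0 f) (poly p 0)"
    unfolding spec_def by (rule rhom.poly_hom[OF rhom_poly])
  then have "poly f p = 0" using y z0 by (simp add: p_def)
  then have "[:- p, 1:] dvd f" using poly_eq_0_iff_dvd by blast
  then obtain q where q: "f = [:- p, 1:] * q" by (auto simp: dvd_def)
  have q0: "q \<noteq> 0" using q monic_f by auto
  have "degree f = 1 + degree q" unfolding q using q0 by (subst degree_mult_eq) auto
  then show False using irr[of 1 "[:- p, 1:]" q] q n deg_f by simp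
qed

end

section \<open>Gradients and Hessians\<close>

definition hess :: "('a::comm_ring_1, 'n::finite) mpoly \<Rightarrow> 'a ^ 'n \<Rightarrow> 'a ^ 'n ^ 'n" where
  "hess f v = (\<chi> i j. meval (mderiv j (mderiv i f)) v)"

definition dirderiv :: "'a::comm_ring_1 ^ 'n \<Rightarrow> ('a, 'n::finite) mpoly \<Rightarrow> ('a, 'n) mpoly" where
  "dirderiv a f = pull a (\<lambda>i. mderiv i f)"

lemma homogeneous_dirderiv: "homogeneous e f \<Longrightarrow> homogeneous (e - 1) (dirderiv a f)"
  unfolding dirderiv_def by (intro homogeneous_pull homogeneous_mderiv)

lemma meval_dirderiv: "meval (dirderiv a f) v = dot a (grad f v)"
  by (simp add: dirderiv_def meval_pull grad_def)

lemma evalh_dirderiv: "rhom h \<Longrightarrow> evalh h (dirderiv a f) v = (\<Sum>i\<in>UNIV. h (a $ i) * evalh h (mderiv i f) v)"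
  unfolding dirderiv_def by (rule evalh_pull)

lemma mderiv_dirderiv: "mderiv j (dirderiv a f) = dirderiv a (mderiv j f)"
  unfolding dirderiv_def pull_def by (simp add: mderiv_sum mderiv_mult mderiv_commute[of j])

lemma evalh_dirderiv2:
  assumes "rhom h"
  shows "evalh h (dirderiv a (dirderiv b f)) v
     = (\<Sum>i\<in>UNIV. \<Sum>j\<in>UNIV. h (a $ i) * h (b $ j) * evalh h (mderiv j (mderiv i f)) v)"
  unfolding evalh_dirderiv[OF assms] mderiv_dirderiv sum_distrib_left by (simp only: mult.assoc)

definition hessdet :: "('a::comm_ring_1, 3) mpoly \<Rightarrow> ('a, 3) mpoly" where
  "hessdet f = det (\<chi> i j. mderiv j (mderiv i f))"

lemma evalh_hessdet:
  assumes "rhom h"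
  shows "evalh h (hessdet f) v = det (\<chi> i j. evalh h (mderiv j (mderiv i f)) v)"
proof -
  interpret h: rhom h by fact
  interpret e: rhom "\<lambda>f. evalh h f v" by (rule h.rhom_evalh)
  show ?thesis unfolding hessdet_def det_3 by (simp add: e.add e.diff e.mult)
qed

lemma meval_hessdet: "meval (hessdet f) v = det (hess f v)"
  unfolding meval_evalh evalh_hessdet[OF rhom_ident] hess_def ..

lemma homogeneous_hessdet:
  assumes "homogeneous e f"
  shows "homogeneous ((e - 1 - 1) + (e - 1 - 1) + (e - 1 - 1)) (hessdet f)"
proof -
  have "homogeneous (e - 1 - 1) (mderiv j (mderiv i f))" for i j by (intro homogeneous_mderiv assms)
  then show ?thesis
    unfolding hessdet_def det_3 vec_lambda_beta
    by (intro homogeneous_add homogeneous_diff homogeneous_mult)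
qed

lemma hess_mult_vec: "homogeneous e f \<Longrightarrow> hess f v *v v = of_nat (e - 1) *s grad f v"
  using ev_id.euler_evalh[OF homogeneous_mderiv, of e f "\<lambda>i. v $ i"]
  by (simp add: vec_eq_iff hess_def grad_def matrix_vector_mult_def meval_evalh mult.commute)

section \<open>Kernels of matrices, isotropic vectors and linear systems\<close>

lemma det_0_kernel:
  fixes A :: "'a::field ^ 'n ^ 'n"
  assumes "det A = 0"
  obtains k where "k \<noteq> 0" "A *v k = 0"
proof -
  have "\<not> invertible A" using assms by (simp add: invertible_det_nz)
  then have "\<not> (\<exists>B. B ** A = mat 1)" by (simp add: invertible_left_inverse)
  then show ?thesis using that unfolding matrix_left_invertible_ker by blast
qed

lemma det_nonzero_kernel:
  fixes A :: "'a::field ^ 'n ^ 'n"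
  assumes "det A \<noteq> 0" "A *v k = 0"
  shows "k = 0"
proof -
  have "invertible A" using assms by (simp add: invertible_det_nz)
  then have "\<exists>B. B ** A = mat 1" by (simp add: invertible_left_inverse)
  then show ?thesis using assms(2) unfolding matrix_left_invertible_ker by blast
qed

lemma dot_symmetric_matrix:
  fixes A :: "'a::comm_ring_1 ^ 'n ^ 'n"
  assumes "\<And>i j. A $ i $ j = A $ j $ i"
  shows "dot (A *v x) y = dot x (A *v y)"
proof -
  have "dot (A *v x) y = (\<Sum>i\<in>UNIV. \<Sum>j\<in>UNIV. A $ i $ j * x $ j * y $ i)"
    by (simp add: dot_def matrix_vector_mult_def sum_distrib_right)
  also have "\<dots> = (\<Sum>j\<in>UNIV. \<Sum>i\<in>UNIV. A $ i $ j * x $ j * y $ i)" by (rule sum.swap)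
  also have "\<dots> = dot x (A *v y)"
    unfolding dot_def matrix_vector_mult_def vec_lambda_beta sum_distrib_left
    by (intro sum.cong refl) (simp add: assms mult_ac)
  finally show ?thesis .
qed

lemma matvec_linear: "A *v (x + y) = A *v x + A *v y" "A *v (c *s x) = c *s (A *v x)"
    "A *v (x - y) = A *v x - A *v y"
  for A :: "'a::comm_ring_1 ^ 'n ^ 'm"
  by (simp_all add: vec_eq_iff matrix_vector_mult_def distrib_left right_diff_distrib sum.distrib sum_subtractf sum_distrib_left mult_ac)

text \<open>The polar of \<open>x\<close> is spanned by \<open>x\<close> and the radical of the form.\<close>

lemma degenerate_form_isotropic:
  fixes A :: "'a::field ^ 3 ^ 3"
  assumes sym: "\<And>i j. A $ i $ j = A $ j $ i" and det: "det A = 0"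
    and x: "dot (A *v x) x = 0" "A *v x \<noteq> 0" and w: "dot (A *v x) w = 0"
  shows "dot (A *v w) w = 0"
proof -
  obtain k where k: "k \<noteq> 0" "A *v k = 0" using det_0_kernel[OF det] .
  have gk: "dot (A *v x) k = 0" using dot_symmetric_matrix[OF sym, of x k] k by (simp add: dot_zero)
  have "cross x k \<noteq> 0"
  proof
    assume "cross x k = 0"
    then have "cross k x = 0" using cross_skew[of k x] by simp
    then obtain c where "x = c *s k" using cross_eq_0 k(1) by blast
    then show False using x(2) k(2) by (simp add: matvec_linear)
  qed
  then obtain \<alpha> \<beta> where "w = \<alpha> *s x + \<beta> *s k"
    using dot_perp_span[of x k "A *v x" w] x gk w by (auto simp: dot_commute[of _ "A *v x"])
  then have "A *v w = \<alpha> *s (A *v x)" using k by (simp add: matvec_linear)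
  then show ?thesis using w by (simp add: dot_scale)
qed

lemma linear_system_nontrivial:
  fixes M :: "'x \<Rightarrow> 'y \<Rightarrow> 'a::field"
  assumes "finite B" "finite A" "card B < card A"
  shows "\<exists>c. (\<exists>a\<in>A. c a \<noteq> 0) \<and> (\<forall>b\<in>B. (\<Sum>a\<in>A. c a * M a b) = 0)"
  using assms
proof (induction B arbitrary: A M rule: finite_induct)
  case empty
  then obtain a where "a \<in> A" by fastforce
  then show ?case by (intro exI[of _ "\<lambda>_. 1"]) auto
next
  case (insert b B)
  show ?case
  proof (cases "\<forall>a\<in>A. M a b = 0")
    case True
    have "card B < card A" using insert by simp
    then obtain c where "\<exists>a\<in>A. c a \<noteq> 0" "\<forall>b\<in>B. (\<Sum>a\<in>A. c a * M a b) = 0"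
      using insert.IH insert.prems(1) by blast
    then show ?thesis using True by (intro exI[of _ c]) auto
  next
    case False
    then obtain a0 where a0: "a0 \<in> A" "M a0 b \<noteq> 0" by blast
    define A' where "A' = A - {a0}"
    have A': "finite A'" "card B < card A'" using insert a0 unfolding A'_def by auto
    define M' where "M' a y = M a y - M a b / M a0 b * M a0 y" for a y
    obtain c where c: "\<exists>a\<in>A'. c a \<noteq> 0" "\<forall>y\<in>B. (\<Sum>a\<in>A'. c a * M' a y) = 0"
      using insert.IH[OF A'] by blast
    define e where "e = - (\<Sum>a\<in>A'. c a * (M a b / M a0 b))"
    define c' where "c' = c(a0 := e)"
    have s: "(\<Sum>a\<in>A. c' a * M a y) = e * M a0 y + (\<Sum>a\<in>A'. c a * M a y)" for y
    proof -
      have "(\<Sum>a\<in>A. c' a * M a y) = c' a0 * M a0 y + (\<Sum>a\<in>A'. c' a * M a y)"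
        unfolding A'_def using a0(1) insert.prems(1) by (simp add: sum.remove)
      also have "(\<Sum>a\<in>A'. c' a * M a y) = (\<Sum>a\<in>A'. c a * M a y)"
        by (intro sum.cong) (auto simp: c'_def A'_def)
      finally show ?thesis by (simp add: c'_def)
    qed
    have "(\<Sum>a\<in>A. c' a * M a y) = 0" if "y \<in> insert b B" for y
    proof (cases "y = b")
      case True
      have "e * M a0 b = - (\<Sum>a\<in>A'. c a * M a b)"
        unfolding e_def using a0 by (simp add: sum_distrib_right)
      then show ?thesis unfolding s True by simp
    next
      case False
      have "e * M a0 y = - (\<Sum>a\<in>A'. c a * (M a b / M a0 b * M a0 y))"
        unfolding e_def by (simp add: sum_distrib_right mult.assoc)
      then have "e * M a0 y + (\<Sum>a\<in>A'. c a * M a y) = (\<Sum>a\<in>A'. c a * M' a y)"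
        unfolding M'_def by (simp add: right_diff_distrib sum_subtractf)
      then show ?thesis unfolding s using c(2) that False by simp
    qed
    moreover have "\<exists>a\<in>A. c' a \<noteq> 0" using c(1) unfolding c'_def A'_def by auto
    ultimately show ?thesis by blast
  qed
qed

section \<open>Total degree in affine coordinates\<close>

definition tdeg_le :: "nat \<Rightarrow> 'a::comm_ring_1 poly poly \<Rightarrow> bool" where
  "tdeg_le B g \<longleftrightarrow> (\<forall>i j. B < i + j \<longrightarrow> coeff (coeff g j) i = 0)"

lemma tdeg_le_add: "tdeg_le B g \<Longrightarrow> tdeg_le B h \<Longrightarrow> tdeg_le B (g + h)"
  by (simp add: tdeg_le_def)

lemma tdeg_le_diff: "tdeg_le B g \<Longrightarrow> tdeg_le B h \<Longrightarrow> tdeg_le B (g - h)"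
  by (simp add: tdeg_le_def)

lemma tdeg_le_mult:
  assumes "tdeg_le B g" "tdeg_le C h"
  shows "tdeg_le (B + C) (g * h)"
  unfolding tdeg_le_def
proof (intro allI impI)
  fix i j
  assume ij: "B + C < i + j"
  have "coeff (coeff g a) b * coeff (coeff h (j - a)) (i - b) = 0" if "a \<le> j" "b \<le> i" for a b
  proof -
    have "B < b + a \<or> C < (i - b) + (j - a)" using ij that by linarith
    then show ?thesis using assms unfolding tdeg_le_def by auto
  qed
  then show "coeff (coeff (g * h) j) i = 0"
    by (simp add: coeff_mult coeff_sum)
qed

lemma tdeg_le_power: "tdeg_le B g \<Longrightarrow> tdeg_le (k * B) (g ^ k)"
proof (induction k)
  case 0
  show ?case by (auto simp: tdeg_le_def coeff_1)
next
  case (Suc k)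
  then show ?case using tdeg_le_mult[of B g "k * B" "g ^ k"] by simp
qed

lemma tdeg_le_prod: "finite S \<Longrightarrow> (\<And>x. x \<in> S \<Longrightarrow> tdeg_le (B x) (g x)) \<Longrightarrow> tdeg_le (sum B S) (prod g S)"
proof (induction S rule: finite_induct)
  case empty
  show ?case by (auto simp: tdeg_le_def coeff_1)
qed (auto intro: tdeg_le_mult)

lemma tdeg_le_aff:
  assumes "homogeneous N G"
  shows "tdeg_le N (aff e1 e2 Q G)"
  using assms
proof (induction rule: homogeneous_induct)
  case zero
  show ?case by (simp add: aff.zero tdeg_le_def)
next
  case (single m c)
  have l: "tdeg_le 1 [:[:a, b:], [:d:]:]" for a b d
    by (auto simp: tdeg_le_def coeff_pCons split: nat.split)
  have c: "tdeg_le 0 [:[:c:]:]"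
    by (auto simp: tdeg_le_def coeff_pCons split: nat.split)
  have "tdeg_le (\<Sum>i\<in>UNIV. Poly_Mapping.lookup m i * 1)
     (\<Prod>i\<in>UNIV. [:[:e1 $ i, e2 $ i:], [:Q $ i:]:] ^ Poly_Mapping.lookup m i)"
    by (intro tdeg_le_prod tdeg_le_power l) simp
  then show ?case
    using tdeg_le_mult[OF c] single unfolding aff_def rhom.evalh_single[OF rhom_pconst2] by fastforce
next
  case (add G H)
  then show ?case by (simp add: aff.add tdeg_le_add)
qed

text \<open>Since \<open>f\<close> is monic in \<open>z\<close> with total degree equal to its
  degree in \<open>z\<close>, each step of the division by \<open>f\<close> preserves the bound on
  the total degree.\<close>

lemma tdeg_le_reduce:
  fixes f :: "'a::idom poly poly"
  assumes f: "degree f = n" "lead_coeff f = 1" "tdeg_le n f" and g: "tdeg_le B g" and n: "n > 0"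
  shows "\<exists>q w. g = f * q + w \<and> degree w < n \<and> tdeg_le B w"
  using g
proof (induction "degree g" arbitrary: g rule: less_induct)
  case less
  show ?case
  proof (cases "degree g < n")
    case True
    then show ?thesis using less by (intro exI[of _ 0] exI[of _ g]) simp
  next
    case False
    define d where "d = degree g"
    have dn: "n \<le> d" "d > 0" using False n unfolding d_def by auto
    define m where "m = monom (lead_coeff g) (d - n)"
    have g0: "g \<noteq> 0" using dn d_def by auto
    have dB: "d \<le> B"
    proof (rule ccontr)
      assume "\<not> d \<le> B"
      then have "coeff (coeff g d) i = 0" for i using less(2) unfolding tdeg_le_def by simp
      then have "coeff g d = 0" by (intro poly_eqI) simp
      then show False using g0 unfolding d_def by simp
    qed
    have "tdeg_le (B - n) m"
      using less(2) dn dB unfolding tdeg_le_def m_def d_def[symmetric] by auto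
    then have t: "tdeg_le B (g - f * m)"
      using tdeg_le_diff[OF less(2)] tdeg_le_mult[OF f(3), of "B - n" m] dn dB by simp
    have "degree (g - f * m) < d"
    proof (rule degree_lessI)
      show "\<forall>k\<ge>d. coeff (g - f * m) k = 0"
      proof (intro allI impI)
        fix k
        assume k: "d \<le> k"
        have dm: "degree m = d - n" unfolding m_def using g0 by (simp add: degree_monom_eq)
        have dfm: "degree (f * m) \<le> d" using degree_mult_le[of f m] f(1) dm dn by simp
        show "coeff (g - f * m) k = 0"
        proof (cases "k = d")
          case True
          have "coeff (f * m) (n + (d - n)) = coeff f n * coeff m (d - n)"
            by (rule coeff_mult_bounded(1)) (use f dm in auto)
          then show ?thesis using True dn f by (simp add: m_def d_def)
        next
          case False
          then show ?thesis using k dfm unfolding d_def by (simp add: coeff_eq_0)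
        qed
      qed
    qed (use dn in simp)
    then obtain q w where "g - f * m = f * q + w" "degree w < n" "tdeg_le B w"
      using less(1)[of "g - f * m"] t unfolding d_def by blast
    moreover have "g = f * (q + m) + w" using calculation(1) by (simp add: algebra_simps)
    ultimately show ?thesis by blast
  qed
qed

section \<open>The Hessian and the dual curve\<close>

context framed_curve
begin

abbreviation "xi z \<equiv> (\<lambda>i. cst (e1 $ i) + t * cst (e2 $ i) + z * cst (Q $ i))"

lemma dt_aff: "dt (AF G) = AF (dirderiv e2 G)" and pderiv_aff: "pderiv (AF G) = AF (dirderiv Q G)"
proof -
  have c: "[:[:c:]:] = AF (mconst c)" for c by (simp add: aff_mconst)
  have "dt (AF G) = (\<Sum>i\<in>UNIV. AF (mderiv i G) * dt [:[:e1 $ i, e2 $ i:], [:Q $ i:]:])"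
    unfolding aff_def
    by (rule rhom.chain_rule[OF rhom_pconst2]) (simp_all only: dt_add dt_mult, simp_all add: dt_pCons pderiv_pCons)
  also have "\<dots> = AF (dirderiv e2 G)"
    unfolding dirderiv_def pull_def aff.sum aff.mult
    by (intro sum.cong refl) (simp add: dt_pCons pderiv_pCons aff_mconst mult.commute)
  finally show "dt (AF G) = AF (dirderiv e2 G)" .
  have "pderiv (AF G) = (\<Sum>i\<in>UNIV. AF (mderiv i G) * pderiv [:[:e1 $ i, e2 $ i:], [:Q $ i:]:])"
    unfolding aff_def
    by (rule rhom.chain_rule[OF rhom_pconst2]) (simp_all add: pderiv_add pderiv_mult pderiv_pCons algebra_simps)
  also have "\<dots> = AF (dirderiv Q G)"
    unfolding dirderiv_def pull_def aff.sum aff.mult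
    by (intro sum.cong refl) (simp add: pderiv_pCons aff_mconst mult.commute)
  finally show "pderiv (AF G) = AF (dirderiv Q G)" .
qed

text \<open>If the Hessian form is degenerate at the generic point \<open>x\<close>, then
  \<open>x\<close> is isotropic and, by \<open>degenerate_form_isotropic\<close>, so is every vector
  in its polar, in particular the tangent direction. This says that the slope of the tangent has
  derivative 0, so it is a constant \<open>c\<close>, and the curve is invariant under a
  translation.\<close>

lemma hessdet_nonzero:
  assumes n2: "n \<ge> 2"
  shows "\<not> F dvd hessdet F"
proof
  assume dv: "F dvd hessdet F"
  obtain z where z: "z \<in> Z" using Z_nonempty by blast
  define A where "A = (\<chi> i j. evalh cst (mderiv j (mderiv i F)) (xi z))"
  define g where "g = (\<chi> i. evalh cst (mderiv i F) (xi z))"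
  define x where "x = (\<chi> i. xi z i)"
  have sym: "A $ i $ j = A $ j $ i" for i j by (simp add: A_def mderiv_commute)
  have det: "det A = 0"
    using generic_vanish[OF z homogeneous_hessdet[OF hom_F]] dv
    unfolding evalh_hessdet[OF cst] A_def by simp
  have Ax: "A *v x = of_nat (n - 1) *s g"
    using cst.euler_evalh[OF homogeneous_mderiv[OF hom_F], of "xi z"]
    by (simp add: vec_eq_iff A_def g_def x_def matrix_vector_mult_def mult.commute)
  have gx: "dot g x = 0"
    using cst.euler_evalh[OF hom_F, of "xi z"] generic_vanish[OF z hom_F]
    by (simp add: dot_def g_def x_def mult.commute)
  define u v where "u = dt f" and "v = pderiv f"
  have uv: "u = AF (dirderiv e2 F)" "v = AF (dirderiv Q F)" by (simp_all add: u_def v_def dt_aff pderiv_aff)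
  define E2 EQ where "E2 = (\<chi> i. cst (e2 $ i))" and "EQ = (\<chi> i. cst (Q $ i))"
  have evd: "ev (AF (dirderiv a F)) z = dot (\<chi> i. cst (a $ i)) g" for a
    unfolding ev_aff evalh_dirderiv[OF cst] by (simp add: dot_def g_def)
  have evdd: "ev (AF (dirderiv a (dirderiv b F))) z = dot (\<chi> i. cst (a $ i)) (A *v (\<chi> i. cst (b $ i)))" for a b
    unfolding ev_aff evalh_dirderiv2[OF cst] dot_def matrix_vector_mult_def A_def sum_distrib_left
    by (intro sum.cong refl) (simp add: mult_ac sum_distrib_left)
  \<comment> \<open>The tangent direction of the affine curve at the generic point. The value of the
    Hessian form on it is the numerator of the derivative of the slope \<open>u / v\<close>.\<close>
  define w where "w = dot EQ g *s E2 - dot E2 g *s EQ"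
  have gw: "dot g w = 0" unfolding w_def dot_diff dot_scale by (simp add: dot_commute mult.commute)
  have ww: "dot (A *v w) w = 0"
  proof (cases "g = 0")
    case True
    then show ?thesis by (simp add: w_def dot_zero)
  next
    case False
    have "of_nat (n - 1) \<noteq> (0::'b)" using n2 by simp
    then have "A *v x \<noteq> 0" unfolding Ax using False by (simp add: vec_eq_iff)
    then show ?thesis using degenerate_form_isotropic[OF sym det, of x w] gx gw unfolding Ax by (simp add: dot_scale)
  qed
  have D2: "D u * v - u * D v = v * v * AF (dirderiv e2 (dirderiv e2 F)) - u * v * AF (dirderiv Q (dirderiv e2 F))
      - u * v * AF (dirderiv e2 (dirderiv Q F)) + u * u * AF (dirderiv Q (dirderiv Q F))"
    unfolding D_def uv dt_aff pderiv_aff by (simp add: algebra_simps)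
  have "ev (D u * v - u * D v) z = dot EQ g * dot EQ g * dot E2 (A *v E2) - dot E2 g * dot EQ g * dot EQ (A *v E2)
      - dot E2 g * dot EQ g * dot E2 (A *v EQ) + dot E2 g * dot E2 g * dot EQ (A *v EQ)"
    unfolding D2 unfolding ev.add ev.diff ev.mult uv evd evdd E2_def EQ_def ..
  also have "\<dots> = dot w (A *v w)"
    unfolding w_def matvec_linear dot_diff dot_scale by (simp add: algebra_simps)
  finally have "ev (D u * v - u * D v) z = 0" using ww by (simp add: dot_commute)
  then have "f dvd D u * v - u * D v" using root_ideal z unfolding Z_def by blast
  moreover have "ev v z \<noteq> 0" unfolding v_def by (rule pderiv_nonzero[OF z])
  ultimately obtain c where c: "ev u z = cst c * ev v z" using constants_of_D[OF z] by blast
  have "ev (u - [:[:c:]:] * v) z = 0" by (simp add: ev.diff ev_smult emb_const c)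
  then have "f dvd u - [:[:c:]:] * v" using root_ideal z unfolding Z_def by blast
  \<comment> \<open>The top coefficient of \<open>f\<close> in \<open>z\<close> is 1, so both
    derivatives have degree below \<open>n\<close>, and a multiple of \<open>f\<close> of that
    degree is 0.\<close>
  moreover have "u - [:[:c:]:] * v = 0 \<or> degree (u - [:[:c:]:] * v) < n"
  proof -
    have "coeff (u - [:[:c:]:] * v) k = 0" if "k \<ge> n" for k
    proof -
      have "coeff f k = 0 \<or> coeff f k = 1" using that degree_f by (cases "k = n") (auto simp: coeff_eq_0)
      then have "coeff u k = 0" by (auto simp: u_def coeff_map_poly)
      moreover have "coeff v k = 0" unfolding v_def using that degree_f(1) by (simp add: coeff_pderiv coeff_eq_0)
      ultimately show ?thesis by simp
    qed
    then show ?thesis by (metis leading_coeff_0_iff linorder_not_le)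
  qed
  ultimately have "u - [:[:c:]:] * v = 0" using degree_f(1) dvd_imp_degree_le by (metis not_le)
  then have "dt f = [:[:c:]:] * pderiv f" by (simp add: u_def v_def)
  then show False using translation_invariant n2 by fastforce
qed

text \<open>Counting dimensions: the forms of degree \<open>N\<close> in the partial derivatives of \<open>F\<close> outnumber,
  for large \<open>N\<close>, the dimension of the space of their restrictions to the curve.\<close>

lemma dual_form_exists:
  "\<exists>N G. homogeneous N G \<and> G \<noteq> 0 \<and> F dvd evalh mconst G (\<lambda>i. mderiv i F)"
proof -
  \<comment> \<open>There are \<open>(K + 1) ^ 2\<close> monomials against
    \<open>n * (B + 1)\<close> conditions. With \<open>K = 2 * n ^ 2\<close> the leading parts are
    \<open>4 * n ^ 4\<close> and \<open>4 * n ^ 3 * (n - 1)\<close>.\<close>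
  define K where "K = 2 * n * n"
  define N where "N = 2 * K"
  define B where "B = N * (n - 1)"
  \<comment> \<open>Since \<open>N = 2 * K\<close>, the truncated difference
    \<open>N - i - j\<close> is a true one on \<open>S\<close>, and all these monomials have degree
    \<open>N\<close>.\<close>
  define mon :: "nat \<times> nat \<Rightarrow> 3 \<Rightarrow>\<^sub>0 nat" where
    "mon = (\<lambda>(i, j). Poly_Mapping.single 1 i + Poly_Mapping.single 2 j + Poly_Mapping.single 3 (N - i - j))"
  define S where "S = {..K} \<times> {..K}"
  have lmon: "Poly_Mapping.lookup (mon (i, j)) 1 = i" "Poly_Mapping.lookup (mon (i, j)) 2 = j"
    "Poly_Mapping.lookup (mon (i, j)) 3 = N - i - j" for i j
    by (simp_all add: mon_def lookup_add lookup_single)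
  have mdeg_mon: "mdeg (mon p) = N" if "p \<in> S" for p
    using that lmon[of "fst p" "snd p"] by (auto simp: S_def N_def sum_3)
  define \<mu> where "\<mu> p = evalh mconst (Poly_Mapping.single (mon p) 1) (\<lambda>i. mderiv i F)" for p
  have h\<mu>: "homogeneous B (\<mu> p)" if "p \<in> S" for p
    unfolding \<mu>_def B_def using mdeg_mon[OF that]
    by (intro homogeneous_subst homogeneous_single homogeneous_mderiv hom_F)
  have "\<exists>q w. AF (\<mu> p) = f * q + w \<and> degree w < n \<and> tdeg_le B w" if "p \<in> S" for p
    by (rule tdeg_le_reduce[OF degree_f tdeg_le_aff[OF hom_F] tdeg_le_aff[OF h\<mu>[OF that]] n0])
  then obtain q w where qw: "\<And>p. p \<in> S \<Longrightarrow> AF (\<mu> p) = f * q p + w p \<and> degree (w p) < n \<and> tdeg_le B (w p)"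
    by metis
  have nn: "n * (B + 1) < (K + 1) * (K + 1)"
  proof -
    obtain k where k: "n = Suc k" using n0 by (cases n) auto
    show ?thesis unfolding B_def N_def K_def k by (simp add: algebra_simps)
  qed
  then have "card ({..<n} \<times> {..B}) < card S" unfolding S_def by simp
  then obtain c where c: "\<exists>p\<in>S. c p \<noteq> 0" "\<forall>b\<in>{..<n} \<times> {..B}. (\<Sum>p\<in>S. c p * coeff (coeff (w p) (fst b)) (snd b)) = 0"
    using linear_system_nontrivial[of "{..<n} \<times> {..B}" S "\<lambda>p b. coeff (coeff (w p) (fst b)) (snd b)"]
    unfolding S_def by auto
  define G where "G = (\<Sum>p\<in>S. Poly_Mapping.single (mon p) (c p))"
  have hG: "homogeneous N G" unfolding G_def by (intro homogeneous_sum homogeneous_single mdeg_mon)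
  have inj: "mon p = mon p' \<longleftrightarrow> p = p'" for p p'
    using lmon by (metis prod.collapse)
  have "G \<noteq> 0"
  proof
    assume G0: "G = 0"
    obtain p where p: "p \<in> S" "c p \<noteq> 0" using c(1) by blast
    have "Poly_Mapping.lookup G (mon p) = (\<Sum>p'\<in>S. if p' = p then c p' else 0)"
      unfolding G_def lookup_sum by (intro sum.cong refl) (auto simp: lookup_single when_def inj)
    also have "\<dots> = c p" using p(1) by (simp add: S_def)
    finally show False using G0 p(2) by simp
  qed
  have comp: "evalh mconst G (\<lambda>i. mderiv i F) = (\<Sum>p\<in>S. mconst (c p) * \<mu> p)"
    unfolding G_def rhom.sum[OF rhom.rhom_evalh[OF rhom_mconst]] \<mu>_def rhom.evalh_single[OF rhom_mconst]
    by (simp add: mconst_simps)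
  have "(\<Sum>p\<in>S. smult [:c p:] (w p)) = 0"
  proof (intro poly_eqI)
    fix a b
    show "coeff (coeff (\<Sum>p\<in>S. smult [:c p:] (w p)) a) b = coeff (coeff 0 a) b"
    proof (cases "a < n \<and> b \<le> B")
      case True
      then show ?thesis using c(2) by (simp add: coeff_sum)
    next
      case False
      have "coeff (coeff (w p) a) b = 0" if "p \<in> S" for p
        using qw[OF that] False unfolding tdeg_le_def by (cases "a < n") (simp_all add: coeff_eq_0)
      then show ?thesis by (simp add: coeff_sum)
    qed
  qed
  then have e: "AF (evalh mconst G (\<lambda>i. mderiv i F)) = f * (\<Sum>p\<in>S. smult [:c p:] (q p))"
    unfolding comp using qw
    by (simp add: aff.sum aff.mult aff_mconst smult_add_right sum.distrib sum_distrib_left)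
  have "f dvd AF (evalh mconst G (\<lambda>i. mderiv i F))" unfolding e by (rule dvd_triv_left)
  then have "F dvd evalh mconst G (\<lambda>i. mderiv i F)"
    by (rule iffD1[OF dvd_aff_iff[OF homogeneous_subst[OF hG homogeneous_mderiv[OF hom_F]]]])
  then show ?thesis using hG \<open>G \<noteq> 0\<close> by (intro exI[of _ N] exI[of _ G] conjI)
qed

end

section \<open>Finiteness of the exceptional points\<close>

context curve
begin

text \<open>The polar has degree \<open>n - 1\<close>, so it is divisible by \<open>F\<close> only
  if it is 0. With \<open>a\<close> as the direction \<open>e2\<close> this means that
  \<open>f\<close> does not depend on \<open>t\<close>, which is a translation invariance with
  \<open>c = 0\<close>.\<close>

lemma polar_nonzero:
  assumes "n \<ge> 2" "a \<noteq> 0"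
  shows "\<not> F dvd dirderiv a F"
proof
  assume "F dvd dirderiv a F"
  then have 0: "dirderiv a F = 0" using dvd_small[OF homogeneous_dirderiv[OF hom_F]] n0 by simp
  obtain e1 Q where fr: "framed_curve F n (ratcst :: 'a \<Rightarrow> _) ratvar e1 a Q" using framed_exists[OF assms(2)] .
  interpret framed_curve F n "ratcst :: 'a \<Rightarrow> _" ratvar e1 a Q by (rule fr)
  have "dt f = [:[:0:]:] * pderiv f" unfolding dt_aff 0 aff.zero by simp
  then show False using translation_invariant assms(1) by fastforce
qed

lemma finite_hessian_zeros:
  assumes "n \<ge> 2"
  shows "finite {x. vanishes_at F x \<and> vanishes_at (hessdet F) x}"
proof -
  obtain e1 e2 Q where fr: "framed_curve F n (ratcst :: 'a \<Rightarrow> _) ratvar e1 e2 Q" using some_frame .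
  interpret framed_curve F n "ratcst :: 'a \<Rightarrow> _" ratvar e1 e2 Q by (rule fr)
  show ?thesis by (rule finite_common_zeros[OF homogeneous_hessdet[OF hom_F] hessdet_nonzero[OF assms]])
qed

text \<open>If \<open>G\<close> is a form of minimal degree vanishing on the dual curve, then a point \<open>p\<close> of the curve is
  recovered from its tangent line \<open>grad F p\<close> as \<open>grad G (grad F p)\<close>.\<close>

lemma finite_multitangent:
  assumes n2: "n \<ge> 2"
  shows "\<exists>B. finite B \<and> (\<forall>v v'. v \<noteq> 0 \<and> v' \<noteq> 0 \<and> meval F v = 0 \<and> meval F v' = 0 \<and> abs_proj v \<notin> B \<and> abs_proj v' \<notin> B
     \<and> det (hess F v) \<noteq> 0 \<and> det (hess F v') \<noteq> 0 \<and> cross (grad F v) (grad F v') = 0 \<longrightarrow> cross v v' = 0)"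
proof -
  let ?P = "\<lambda>N. \<exists>G. homogeneous N G \<and> G \<noteq> 0 \<and> F dvd evalh mconst G (\<lambda>i. mderiv i F)"
  obtain e1 e2 Q where fr: "framed_curve F n (ratcst :: 'a \<Rightarrow> _) ratvar e1 e2 Q" using some_frame .
  interpret framed_curve F n "ratcst :: 'a \<Rightarrow> _" ratvar e1 e2 Q by (rule fr)
  define N where "N = (LEAST N. ?P N)"
  have "?P N" unfolding N_def by (rule LeastI_ex) (rule dual_form_exists)
  then obtain G where G: "homogeneous N G" "G \<noteq> 0" "F dvd evalh mconst G (\<lambda>i. mderiv i F)" by blast
  have Nmin: "\<not> ?P k" if "k < N" for k using that not_less_Least unfolding N_def by blast
  interpret mc: rhom "mconst :: 'a \<Rightarrow> ('a, 3) mpoly" by (rule rhom_mconst)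
  have N0: "N > 0"
  proof (rule ccontr)
    assume "\<not> N > 0"
    then obtain c where c: "G = mconst c" using homogeneous_0_const G(1) by blast
    then have "F dvd mconst c" using G(3) by (simp add: mc.evalh_mconst)
    then have "mconst c = (0 :: ('a, 3) mpoly)" using dvd_small[OF homogeneous_mconst n0] by blast
    then show False using c G(2) by simp
  qed
  \<comment> \<open>By minimality of \<open>N\<close>, a partial derivative of \<open>G\<close>
    vanishes on the dual curve only if it is 0, and by Euler's relation not all of them are
    0.\<close>
  have "\<exists>i0. \<not> F dvd evalh mconst (mderiv i0 G) (\<lambda>i. mderiv i F)"
  proof (rule ccontr)
    assume "\<not> ?thesis"
    then have "mderiv i G = 0" for i
      using Nmin[of "N - 1"] homogeneous_mderiv[OF G(1), of i] N0 by fastforce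
    then have "of_nat N * G = 0" using euler[OF G(1)] by simp
    then show False using N0 G(2) by simp
  qed
  then obtain i0 where i0: "\<not> F dvd evalh mconst (mderiv i0 G) (\<lambda>i. mderiv i F)" by blast
  define g where "g = evalh mconst (mderiv i0 G) (\<lambda>i. mderiv i F)"
  have hg: "homogeneous ((N - 1) * (n - 1)) g"
    unfolding g_def by (intro homogeneous_subst homogeneous_mderiv G hom_F)
  define B where "B = {x. vanishes_at F x \<and> vanishes_at g x}"
  have finB: "finite B" unfolding B_def by (rule finite_common_zeros[OF hg]) (use i0 in \<open>simp add: g_def\<close>)
  obtain H where H: "evalh mconst G (\<lambda>i. mderiv i F) = F * H" using G(3) by (auto simp: dvd_def)
  have meval_comp: "meval (evalh mconst R (\<lambda>i. mderiv i F)) v = meval R (grad F v)" for R v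
    unfolding meval_evalh using evalh_subst[OF rhom_ident, of R "\<lambda>i. mderiv i F" "\<lambda>i. v $ i"]
    by (simp add: grad_def meval_evalh vec_nth_lambda)
  \<comment> \<open>Obtained by differentiating the relation \<open>H\<close>. At a point
    \<open>v\<close> of the curve it says that the Hessian sends \<open>grad G (grad F v)\<close> to
    a multiple of \<open>grad F v\<close>; by Euler's relation it does the same with
    \<open>v\<close>. Where it is invertible, the two vectors are therefore proportional.\<close>
  have chain: "(\<Sum>i\<in>UNIV. evalh mconst (mderiv i G) (\<lambda>i. mderiv i F) * mderiv j (mderiv i F)) = mderiv j F * H + F * mderiv j H" for j
    using mc.chain_rule[of "mderiv j" G "\<lambda>i. mderiv i F"] H by (simp add: mderiv_add mderiv_mult)
  have key: "grad G (grad F v) \<noteq> 0 \<and> cross v (grad G (grad F v)) = 0"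
    if v: "v \<noteq> 0" "meval F v = 0" "abs_proj v \<notin> B" "det (hess F v) \<noteq> 0" for v
  proof -
    define y where "y = grad G (grad F v)"
    have hv: "hcoords v (abs_proj v)" using hcoords_abs v(1) by blast
    have "meval g v \<noteq> 0"
      using v(2,3) vanishes_at_iff[OF hom_F hv] vanishes_at_iff[OF hg hv] unfolding B_def by blast
    then have y0: "y $ i0 \<noteq> 0" unfolding g_def meval_comp y_def by (simp add: grad_def)
    have "(\<Sum>i\<in>UNIV. y $ i * meval (mderiv j (mderiv i F)) v) = meval (mderiv j F) v * meval H v" for j
      using arg_cong[OF chain[of j], of "\<lambda>f. meval f v"] v(2)
      by (simp add: mev.sum mev.mult mev.add meval_comp y_def grad_def)
    then have hy: "hess F v *v y = meval H v *s grad F v"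
      by (simp add: vec_eq_iff hess_def matrix_vector_mult_def grad_def mult.commute mderiv_commute)
    have "hess F v *v (of_nat (n - 1) *s y - meval H v *s v) = 0"
      unfolding matvec_linear hy hess_mult_vec[OF hom_F] by (simp add: mult.commute)
    then have "of_nat (n - 1) *s y - meval H v *s v = 0" by (rule det_nonzero_kernel[OF v(4)])
    then have "of_nat (n - 1) *s y = meval H v *s v" by simp
    then have "cross v (of_nat (n - 1) *s y) = cross v (meval H v *s v)" by (rule arg_cong)
    then have "of_nat (n - 1) *s cross v y = 0" by (simp add: cross_scale)
    moreover have "of_nat (n - 1) \<noteq> (0::'a)" using n2 by simp
    ultimately show ?thesis using y0 unfolding y_def[symmetric] by (auto simp: vec_eq_iff)
  qed
  show ?thesis
  proof (intro exI[of _ B] conjI finB allI impI)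
    fix v v' :: "'a ^ 3"
    assume *: "v \<noteq> 0 \<and> v' \<noteq> 0 \<and> meval F v = 0 \<and> meval F v' = 0 \<and> abs_proj v \<notin> B \<and> abs_proj v' \<notin> B
     \<and> det (hess F v) \<noteq> 0 \<and> det (hess F v') \<noteq> 0 \<and> cross (grad F v) (grad F v') = 0"
    have k: "grad G (grad F v) \<noteq> 0" "cross v (grad G (grad F v)) = 0" using key * by blast+
    have k': "grad G (grad F v') \<noteq> 0" "cross v' (grad G (grad F v')) = 0" using key * by blast+
    have "grad F v \<noteq> 0"
    proof
      assume "grad F v = 0"
      then have "hess F v *v v = 0" using hess_mult_vec[OF hom_F, of v] by simp
      then show False using det_nonzero_kernel * by blast
    qed
    then obtain c where c: "grad F v' = c *s grad F v" using cross_eq_0 * by blast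
    have "grad G (grad F v') = c ^ (N - 1) *s grad G (grad F v)" unfolding c by (rule grad_scale[OF G(1)])
    then have "c ^ (N - 1) *s cross v' (grad G (grad F v)) = 0" "c ^ (N - 1) \<noteq> 0"
      using k' by (auto simp: cross_scale)
    then have "cross v' (grad G (grad F v)) = 0" by (auto simp: vec_eq_iff)
    then obtain b where b: "grad G (grad F v) = b *s v'" using cross_eq_0 * by blast
    obtain b' where b': "grad G (grad F v) = b' *s v" using cross_eq_0 * k(2) by blast
    have "b' \<noteq> 0" using b' k(1) by auto
    have "b *s cross v v' = 0" using k(2) unfolding b by (simp add: cross_scale)
    moreover have "b \<noteq> 0" using b k(1) by auto
    ultimately show "cross v v' = 0" by (auto simp: vec_eq_iff)
  qed
qed

end

section \<open>Homogeneous components of elements of the vanishing ideal\<close>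

definition hcomp :: "nat \<Rightarrow> ('a::comm_ring_1, 'n::finite) mpoly \<Rightarrow> ('a, 'n) mpoly" where
  "hcomp e f = (\<Sum>m\<in>{m \<in> Poly_Mapping.keys f. mdeg m = e}. Poly_Mapping.single m (Poly_Mapping.lookup f m))"

lemma homogeneous_hcomp: "homogeneous e (hcomp e f)"
  unfolding hcomp_def by (intro homogeneous_sum homogeneous_single) auto

lemma hcomp_sum: "\<exists>E. f = (\<Sum>e\<le>E. hcomp e f)"
proof -
  let ?K = "Poly_Mapping.keys f"
  obtain E where E: "\<And>m. m \<in> ?K \<Longrightarrow> mdeg m \<le> E"
    using finite_nat_set_iff_bounded_le[of "mdeg ` ?K"] by auto
  have "(\<Sum>e\<le>E. hcomp e f) = (\<Sum>m\<in>?K. Poly_Mapping.single m (Poly_Mapping.lookup f m))"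
    unfolding hcomp_def by (rule sum.group) (use E in auto)
  then show ?thesis using mpoly_sum_monomials[of f] by metis
qed

text \<open>The value at a scalar multiple \<open>s\<close> of the coordinates is a polynomial in
  \<open>s\<close> with the values of the components as coefficients, and it vanishes for all
  nonzero \<open>s\<close>.\<close>

lemma hcomp_vanishing_ideal:
  fixes f :: "('a::field_char_0, 'n::finite) mpoly"
  assumes f: "f \<in> vanishing_ideal M"
  shows "hcomp e f \<in> vanishing_ideal M"
proof -
  obtain E where E: "f = (\<Sum>e\<le>E. hcomp e f)" using hcomp_sum by blast
  have "meval (hcomp e f) w = 0" if x: "x \<in> M" and w: "hcoords w x" for x w
  proof -
    define p where "p = (\<Sum>e\<le>E. monom (meval (hcomp e f) w) e)"
    have "poly p s = 0" if "s \<in> - {0}" for s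
    proof -
      have "meval f (s *s w) = 0"
        using f x hcoords_scale[OF w, of s] that unfolding vanishing_ideal_def vanishes_at_def by simp
      then have "meval (\<Sum>e\<le>E. hcomp e f) (s *s w) = 0" using E by simp
      then show ?thesis
        by (simp add: mev.sum meval_scale[OF homogeneous_hcomp] p_def poly_sum poly_monom mult.commute)
    qed
    moreover have "infinite (- {0::'a})" using infinite_UNIV_char_0[where 'a = 'a] by (simp add: Compl_eq_Diff_UNIV)
    ultimately have p0: "p = 0" using poly_eq_0_on_infinite by blast
    show ?thesis
    proof (cases "e \<le> E")
      case True
      then have "meval (hcomp e f) w = coeff p e" unfolding p_def by (simp add: coeff_sum)
      then show ?thesis using p0 by simp
    next
      case False
      have e0: "{m \<in> Poly_Mapping.keys f. mdeg m = e} = {}"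
      proof -
        have "Poly_Mapping.lookup f m = 0" if m: "mdeg m = e" for m
        proof -
          have "Poly_Mapping.lookup (hcomp e' f) m = 0" if "e' \<le> E" for e'
            using homogeneous_hcomp[of e' f] that m False unfolding homogeneous_def by (auto simp: in_keys_iff)
          then have "Poly_Mapping.lookup (\<Sum>e\<le>E. hcomp e f) m = 0" by (simp add: lookup_sum)
          then show ?thesis using E by simp
        qed
        then show ?thesis by (auto simp: in_keys_iff)
      qed
      have "hcomp e f = 0" by (simp only: hcomp_def e0 sum.empty)
      then show ?thesis by (simp add: mev.zero)
    qed
  qed
  then show ?thesis unfolding vanishing_ideal_def vanishes_at_def by blast
qed

text \<open>The components are brought to a common degree by powers of the \<open>j\<close>-th
  variable. As this variable is 1 at \<open>v\<close> and every component vanishes there, the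
  product rule leaves the gradient at \<open>v\<close> unchanged.\<close>

lemma homogenise_gradient:
  fixes f :: "('a::field_char_0, 'n::finite) mpoly"
  assumes f: "f \<in> vanishing_ideal M" and q: "q \<in> M" and v: "hcoords v q" "v $ j = 1"
  shows "\<exists>N g. homogeneous N g \<and> g \<in> vanishing_ideal M \<and> grad g v = grad f v"
proof -
  obtain E where E: "f = (\<Sum>e\<le>E. hcomp e f)" using hcomp_sum by blast
  define g where "g = (\<Sum>e\<le>E. mvar j ^ (E - e) * hcomp e f)"
  have "homogeneous E (mvar j ^ (E - e) * hcomp e f)" if "e \<le> E" for e
    using homogeneous_mult[OF homogeneous_power[OF homogeneous_mvar, of "E - e" j] homogeneous_hcomp[of e f]] that by simp
  then have "homogeneous E g" unfolding g_def by (intro homogeneous_sum) simp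
  moreover have "g \<in> vanishing_ideal M"
  proof -
    have "(\<Sum>e\<in>S. mvar j ^ (E - e) * hcomp e f) \<in> vanishing_ideal M" for S
      by (induction S rule: infinite_finite_induct)
        (auto intro: vanishing_ideal_0 vanishing_ideal_add vanishing_ideal_mult hcomp_vanishing_ideal[OF f])
    then show ?thesis unfolding g_def .
  qed
  moreover have "grad g v = grad f v"
  proof -
    have h0: "meval (hcomp e f) v = 0" for e
      using hcomp_vanishing_ideal[OF f, of e] q v unfolding vanishing_ideal_def vanishes_at_def by blast
    have "meval (mderiv i g) v = (\<Sum>e\<le>E. meval (mderiv i (hcomp e f)) v)" for i
      unfolding g_def mderiv_sum mderiv_mult mev.sum mev.add mev.mult mev.power h0 meval_mvar v(2) by simp
    also have "(\<Sum>e\<le>E. meval (mderiv i (hcomp e f)) v) = meval (mderiv i (\<Sum>e\<le>E. hcomp e f)) v" for i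
      by (simp add: mderiv_sum mev.sum)
    finally have "meval (mderiv i g) v = meval (mderiv i f) v" for i unfolding E[symmetric] .
    then show ?thesis by (simp add: grad_def)
  qed
  ultimately show ?thesis by blast
qed

section \<open>Local parameters\<close>

text \<open>For \<open>v $ j = 1\<close> this is the affine coordinate function
  \<open>x i - v $ i\<close>, homogenised by the \<open>j\<close>-th variable.\<close>

definition lparam :: "'a::comm_ring_1 ^ 'n \<Rightarrow> 'n \<Rightarrow> 'n \<Rightarrow> ('a, 'n::finite) mpoly" where
  "lparam v j i = mvar i - mconst (v $ i) * mvar j"

text \<open>The quadratic remainders at the point \<open>v\<close>. The explicit span allows their
  values at lifted points to be estimated generator by generator.\<close>

definition lsquares :: "'a::comm_ring_1 ^ 'n \<Rightarrow> 'n \<Rightarrow> ('a, 'n::finite) mpoly set" where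
  "lsquares v j = ideal.span {lparam v j r * lparam v j s |r s. True}"

lemma lsquares_ideal: "x \<in> lsquares v j \<Longrightarrow> y \<in> lsquares v j \<Longrightarrow> x + y \<in> lsquares v j"
  "x \<in> lsquares v j \<Longrightarrow> c * x \<in> lsquares v j" "x \<in> lsquares v j \<Longrightarrow> y \<in> lsquares v j \<Longrightarrow> x - y \<in> lsquares v j"
  unfolding lsquares_def by (auto intro: ideal.span_add ideal.span_scale ideal.span_diff)

text \<open>The factor \<open>mvar j\<close> raises the exponent \<open>N - 1\<close> of the linear
  term to \<open>N\<close>, so that the case \<open>N = 0\<close> needs no separate
  statement.\<close>

lemma taylor_form:
  fixes f :: "('a::comm_ring_1, 'n::finite) mpoly"
  assumes f: "homogeneous N f" "meval f v = 0"
  shows "mvar j * f - mvar j ^ N * (\<Sum>i\<in>UNIV. mconst (grad f v $ i) * lparam v j i) \<in> lsquares v j"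
proof -
  interpret m: rhom "mconst :: 'a \<Rightarrow> ('a, 'n) mpoly" by (rule rhom_mconst)
  have evp: "homogeneous d g \<Longrightarrow> evalh mconst g (\<lambda>i. mconst (v $ i) * mvar j) = mvar j ^ d * mconst (meval g v)" for d g
    using m.evalh_scale[of d g "mvar j" "\<lambda>i. mconst (v $ i)"]
      ev_id.evalh_comp[OF m.rhom_axioms, of g "\<lambda>i. v $ i"]
    by (simp only: meval_evalh mult.commute)
  have "evalh mconst f (\<lambda>i. mconst (v $ i) * mvar j + lparam v j i) - evalh mconst f (\<lambda>i. mconst (v $ i) * mvar j)
      - (\<Sum>i\<in>UNIV. evalh mconst (mderiv i f) (\<lambda>i. mconst (v $ i) * mvar j) * lparam v j i) \<in> lsquares v j"
    unfolding lsquares_def by (rule m.taylor)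
  moreover have "(\<lambda>i. mconst (v $ i) * mvar j + lparam v j i) = mvar" by (simp add: lparam_def fun_eq_iff)
  ultimately have "f - (\<Sum>i\<in>UNIV. (mvar j ^ (N - 1) * mconst (grad f v $ i)) * lparam v j i) \<in> lsquares v j"
    unfolding evp[OF f(1)] evp[OF homogeneous_mderiv[OF f(1)]] f(2) mconst_simps
    by (simp add: evalh_mconst_mvar grad_def)
  then have "mvar j * (f - (\<Sum>i\<in>UNIV. (mvar j ^ (N - 1) * mconst (grad f v $ i)) * lparam v j i)) \<in> lsquares v j"
    by (rule lsquares_ideal)
  moreover have "mvar j * (\<Sum>i\<in>UNIV. (mvar j ^ (N - 1) * mconst (grad f v $ i)) * lparam v j i)
     = mvar j ^ N * (\<Sum>i\<in>UNIV. mconst (grad f v $ i) * lparam v j i)"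
  proof (cases N)
    case 0
    then obtain c where "f = mconst c" using homogeneous_0_const f(1) by blast
    then show ?thesis by (simp add: grad_def mev.zero mconst_simps)
  next
    case (Suc k)
    then show ?thesis by (simp add: sum_distrib_left mult.assoc)
  qed
  ultimately show ?thesis by (simp only: right_diff_distrib)
qed

lemma separating_functional:
  fixes S :: "('a::field ^ 'n) set"
  assumes S: "vec.subspace S" and l: "l \<notin> S"
  shows "\<exists>w. (\<forall>s\<in>S. dot s w = 0) \<and> dot l w \<noteq> 0"
proof -
  obtain B where B: "B \<subseteq> S" "vec.independent B" "S \<subseteq> vec.span B"
    using vec.basis_exists[of S] by metis
  have spB: "vec.span B = S" using B S by (metis vec.span_minimal subset_antisym)
  have ind: "vec.independent (insert l B)"
    using B(2) l spB by (simp add: vec.independent_insert)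
  obtain i0 :: 'n where True by simp
  obtain g where g: "Vector_Spaces.linear (*s) (*s) g" "\<forall>x\<in>insert l B. g x = (if x = l then axis i0 (1::'a) else (0::'a ^ 'n))"
    using vec.linear_independent_extend[OF ind, of "\<lambda>x. if x = l then axis i0 (1::'a) else 0"] by blast
  define w where "w = (\<chi> i. g (axis i 1) $ i0)"
  have d: "dot x w = g x $ i0" for x
  proof -
    have "g x = g (\<Sum>i\<in>UNIV. x $ i *s axis i 1)" by (simp add: basis_expansion)
    also have "\<dots> = (\<Sum>i\<in>UNIV. g (x $ i *s axis i 1))" by (rule vec.linear_sum[OF g(1)])
    also have "\<dots> = (\<Sum>i\<in>UNIV. x $ i *s g (axis i 1))" by (simp only: vec.linear_scale[OF g(1)])
    finally show ?thesis by (simp add: dot_def w_def sum_component)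
  qed
  have "g s = 0" if "s \<in> S" for s
  proof -
    have "vec.span B \<subseteq> {x. g x = 0}"
    proof (rule vec.span_minimal)
      have "l \<notin> B" using l B(1) by blast
      then show "B \<subseteq> {x. g x = 0}" using g(2) by auto
      show "vec.subspace {x. g x = 0}"
        using vec.linear_subspace_kernel[OF g(1)] .
    qed
    then show ?thesis using that spB by blast
  qed
  then have "\<forall>s\<in>S. dot s w = 0" using d by simp
  moreover have "dot l w \<noteq> 0" unfolding d using g(2) by (simp add: axis_def)
  ultimately show ?thesis by blast
qed

text \<open>At a nonsingular point, a form vanishing to order exactly one generates, together with the
  ideal of the curve, the maximal ideal modulo its square.\<close>

lemma nonsingular_local_parameter:
  fixes M :: "('a::field_char_0, 'n::finite) proj set"
  assumes ns: "nonsingular_at M q" and q: "q \<in> M" and v: "hcoords v q" "v $ j = 1"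
    and A: "homogeneous e A" "meval A v = 0" "\<not> order_ge M q A 2"
  shows "\<exists>c N N' g \<zeta>. g \<in> vanishing_ideal M \<and> \<zeta> \<in> lsquares v j \<and>
     mvar j ^ N * lparam v j i = mconst c * mvar j ^ N' * A + g + \<zeta>"
proof -
  define S where "S = {grad f v |f. f \<in> vanishing_ideal M}"
  define T where "T = {w. \<forall>f\<in>vanishing_ideal M. dot (grad f v) w = 0}"
  have dT: "vec.dim T = 2"
    using ns v(1) unfolding nonsingular_at_def T_def dot_def grad_def by simp
  have gadd: "grad f v + grad g v = grad (f + g) v" and gscale: "c *s grad f v = grad (mconst c * f) v"
    and g0: "grad 0 v = 0" for f g c
    by (simp_all add: grad_def vec_eq_iff mderiv_add mev.add mderiv_mult mev.mult mev.zero)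
  have "vec.subspace S"
    unfolding vec.subspace_def S_def
  proof (intro conjI ballI allI)
    show "0 \<in> {grad f v |f. f \<in> vanishing_ideal M}" using g0 vanishing_ideal_0 by (metis (mono_tags, lifting) mem_Collect_eq)
    fix x
    assume "x \<in> {grad f v |f. f \<in> vanishing_ideal M}"
    then obtain f where f: "x = grad f v" "f \<in> vanishing_ideal M" by blast
    show "c *s x \<in> {grad f v |f. f \<in> vanishing_ideal M}" for c
      unfolding f(1) gscale using vanishing_ideal_mult[OF f(2)] by blast
    fix y
    assume "y \<in> {grad f v |f. f \<in> vanishing_ideal M}"
    then obtain g where g: "y = grad g v" "g \<in> vanishing_ideal M" by blast
    show "x + y \<in> {grad f v |f. f \<in> vanishing_ideal M}"
      unfolding f(1) g(1) gadd using vanishing_ideal_add[OF f(2) g(2)] by blast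
  qed
  note S = this
  have form: "\<exists>N g. homogeneous N g \<and> g \<in> vanishing_ideal M \<and> meval g v = 0 \<and> grad g v = s" if "s \<in> S" for s
  proof -
    obtain f where "s = grad f v" "f \<in> vanishing_ideal M" using \<open>s \<in> S\<close> unfolding S_def by blast
    then obtain N g where "homogeneous N g" "g \<in> vanishing_ideal M" "grad g v = s"
      using homogenise_gradient[OF _ q v] by metis
    moreover have "meval g v = 0" using calculation(2) q v unfolding vanishing_ideal_def vanishes_at_def by blast
    ultimately show ?thesis by blast
  qed
  define \<alpha> where "\<alpha> = grad A v"
  have \<alpha>v: "dot \<alpha> v = 0" unfolding \<alpha>_def dot_grad[OF A(1)] A(2) by simp
  have Sv: "dot s v = 0" if s: "s \<in> S" for s
  proof -
    obtain N g where "homogeneous N g" "meval g v = 0" "grad g v = s" using form[OF s] by blast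
    then show ?thesis using dot_grad[of N g v] by simp
  qed
  have v0: "v \<noteq> 0" using hcoords_nz v(1) by blast
  have L0: "lparam v j i \<in> vanishing_ideal {q}" for i
  proof -
    have "homogeneous 1 (lparam v j i)"
      unfolding lparam_def by (intro homogeneous_diff homogeneous_const_mult homogeneous_mvar)
    moreover have "meval (lparam v j i) v = 0" by (simp add: lparam_def mev.diff mev.mult v(2))
    ultimately have "vanishes_at (lparam v j i) q" using vanishes_at_iff v(1) by blast
    then show ?thesis by (simp add: vanishing_ideal_def)
  qed
  have sq: "\<zeta> \<in> ideal_power (vanishing_ideal {q}) 2" if "\<zeta> \<in> lsquares v j" for \<zeta>
  proof -
    have "{lparam v j r * lparam v j s |r s. True} \<subseteq> ideal_power (vanishing_ideal {q}) 2"
      using ideal_power_mult[OF ideal_power_1[OF L0] ideal_power_1[OF L0]] by (auto simp: numeral_2_eq_2)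
    then show ?thesis using that ideal.span_minimal[OF _ ideal_power_subspace] unfolding lsquares_def by blast
  qed
  have nj: "nonvan q (mvar j ^ k)" for k
    using nonvan_iff[OF homogeneous_mvar v(1), of j] v(2) by (intro nonvan_power) simp
  define \<Sigma> where "\<Sigma> u = (\<Sum>i\<in>UNIV. mconst (u $ i) * lparam v j i)" for u
  have \<Sigma>_add: "\<Sigma> (x + y) = \<Sigma> x + \<Sigma> y" and \<Sigma>_scale: "\<Sigma> (c *s x) = mconst c * \<Sigma> x" for x y c
    by (simp_all add: \<Sigma>_def mconst_simps distrib_right sum.distrib sum_distrib_left mult.assoc)
  have tA: "mvar j * A - mvar j ^ e * \<Sigma> \<alpha> \<in> lsquares v j"
    unfolding \<Sigma>_def \<alpha>_def by (rule taylor_form[OF A(1,2)])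
  \<comment> \<open>If the gradient of \<open>A\<close> were that of an element of the ideal,
    \<open>A\<close> would agree with it to first order, up to powers of \<open>mvar j\<close>, and
    so have order at least 2.\<close>
  have \<alpha>S: "\<alpha> \<notin> S"
  proof
    assume "\<alpha> \<in> S"
    then obtain N g where g: "homogeneous N g" "g \<in> vanishing_ideal M" "meval g v = 0" "grad g v = \<alpha>" using form by blast
    have tg: "mvar j * g - mvar j ^ N * \<Sigma> \<alpha> \<in> lsquares v j"
      unfolding \<Sigma>_def g(4)[symmetric] by (rule taylor_form[OF g(1,3)])
    define \<zeta> where "\<zeta> = mvar j ^ N * (mvar j * A - mvar j ^ e * \<Sigma> \<alpha>) - mvar j ^ e * (mvar j * g - mvar j ^ N * \<Sigma> \<alpha>)"
    have "\<zeta> \<in> lsquares v j" unfolding \<zeta>_def by (intro lsquares_ideal(2,3) tA tg)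
    moreover have "mvar j ^ (N + 1) * A = \<zeta> + (mvar j ^ (e + 1)) * g"
      unfolding \<zeta>_def by (simp add: algebra_simps)
    ultimately have "order_ge M q A 2"
      unfolding order_ge_iff
      by (intro exI[of _ "mvar j ^ (N + 1)"] exI[of _ \<zeta>] exI[of _ "mvar j ^ (e + 1) * g"] conjI nj sq
          vanishing_ideal_mult[OF g(2)])
    then show False using A(3) by blast
  qed
  define l where "l = axis i 1 - v $ i *s axis j (1::'a)"
  have dax: "dot (axis k (1::'a)) x = x $ k" for k x
    unfolding dot_def axis_def by (simp add: if_distrib[of "\<lambda>x. x * _"] cong: if_cong)
  have lv: "dot l v = 0" unfolding l_def dot_diff dot_scale dax v(2) by simp
  define S' where "S' = {c *s \<alpha> + s |c s. s \<in> S}"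
  have "vec.subspace S'"
    unfolding vec.subspace_def S'_def
  proof (intro conjI ballI allI)
    show "0 \<in> {c *s \<alpha> + s |c s. s \<in> S}"
      using vec.subspace_0[OF S] by (intro CollectI exI[of _ 0]) simp
    fix x
    assume "x \<in> {c *s \<alpha> + s |c s. s \<in> S}"
    then obtain c s where x: "x = c *s \<alpha> + s" "s \<in> S" by blast
    show "d *s x \<in> {c *s \<alpha> + s |c s. s \<in> S}" for d
      unfolding x(1) using vec.subspace_scale[OF S x(2), of d]
      by (intro CollectI exI[of _ "d * c"] exI[of _ "d *s s"]) (simp add: vec.scale_right_distrib)
    fix y
    assume "y \<in> {c *s \<alpha> + s |c s. s \<in> S}"
    then obtain d s' where y: "y = d *s \<alpha> + s'" "s' \<in> S" by blast
    show "x + y \<in> {c *s \<alpha> + s |c s. s \<in> S}"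
      unfolding x(1) y(1) using vec.subspace_add[OF S x(2) y(2)]
      by (intro CollectI exI[of _ "c + d"] exI[of _ "s + s'"]) (simp add: vec.scale_left_distrib)
  qed
  note S' = this
  \<comment> \<open>Otherwise \<open>v\<close>, \<open>w\<close> and \<open>w2\<close> would be
    three independent vectors in the tangent space \<open>T\<close> of the cone, whose dimension is
    2.\<close>
  have "l \<in> S'"
  proof (rule ccontr)
    assume "l \<notin> S'"
    then obtain w where w: "\<forall>s\<in>S'. dot s w = 0" "dot l w \<noteq> 0" using separating_functional[OF S'] by blast
    obtain w2 where w2: "\<forall>s\<in>S. dot s w2 = 0" "dot \<alpha> w2 \<noteq> 0" using separating_functional[OF S \<alpha>S] by blast
    have "\<alpha> \<in> S'" unfolding S'_def using vec.subspace_0[OF S] by (intro CollectI exI[of _ 1] exI[of _ 0]) simp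
    then have \<alpha>w: "dot \<alpha> w = 0" using w by blast
    have "S \<subseteq> S'"
    proof
      fix x
      assume "x \<in> S"
      moreover have "x = 0 *s \<alpha> + x" by simp
      ultimately show "x \<in> S'" unfolding S'_def by blast
    qed
    then have T: "w \<in> T" "w2 \<in> T" "v \<in> T"
      using w w2 Sv unfolding T_def S_def by blast+
    have sub: "vec.subspace {x. dot u x = 0}" for u :: "'a ^ 'n"
      unfolding vec.subspace_def by (simp add: dot_add dot_scale dot_zero)
    have "w \<notin> vec.span {v}"
      using vec.span_minimal[OF _ sub[of l], of "{v}"] lv w(2) by auto
    moreover have "w2 \<notin> vec.span {w, v}"
      using vec.span_minimal[OF _ sub[of \<alpha>], of "{w, v}"] \<alpha>v \<alpha>w w2(2) by auto
    moreover have "vec.independent {v}" using v0 by simp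
    ultimately have ind: "vec.independent {w2, w, v}" by (simp add: vec.independent_insert)
    have "w2 \<noteq> w" "w2 \<noteq> v" "w \<noteq> v" using \<alpha>w \<alpha>v w2(2) lv w(2) by auto
    then have "card {w2, w, v} = 3" by simp
    moreover have "card {w2, w, v} \<le> vec.dim T" using T ind by (intro vec.independent_card_le_dim) auto
    ultimately show False using dT by simp
  qed
  then obtain c s where ls: "l = c *s \<alpha> + s" "s \<in> S" unfolding S'_def by blast
  obtain N g where g: "homogeneous N g" "g \<in> vanishing_ideal M" "meval g v = 0" "grad g v = s" using form[OF ls(2)] by blast
  have tg: "mvar j * g - mvar j ^ N * \<Sigma> s \<in> lsquares v j"
    unfolding \<Sigma>_def g(4)[symmetric] by (rule taylor_form[OF g(1,3)])
  have "\<Sigma> l = lparam v j i"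
  proof -
    have ax: "\<Sigma> (axis k 1) = lparam v j k" for k
    proof -
      have "\<Sigma> (axis k 1) = (\<Sum>i\<in>UNIV. if i = k then lparam v j k else 0)"
        unfolding \<Sigma>_def by (intro sum.cong refl) (auto simp: axis_def mconst_simps)
      then show ?thesis by simp
    qed
    have "\<Sigma> l = \<Sigma> (axis i 1 + (- (v $ i)) *s axis j 1)" by (simp add: l_def vec.scale_minus_left)
    also have "\<dots> = lparam v j i + mconst (- (v $ i)) * lparam v j j" unfolding \<Sigma>_add \<Sigma>_scale ax ..
    also have "lparam v j j = 0" by (simp add: lparam_def v(2) mconst_simps)
    finally show ?thesis by simp
  qed
  then have L: "lparam v j i = mconst c * \<Sigma> \<alpha> + \<Sigma> s" unfolding ls(1) \<Sigma>_add \<Sigma>_scale by simp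
  define \<zeta> where "\<zeta> = (- mconst c * mvar j ^ N) * (mvar j * A - mvar j ^ e * \<Sigma> \<alpha>) + (- (mvar j ^ e)) * (mvar j * g - mvar j ^ N * \<Sigma> s)"
  have "\<zeta> \<in> lsquares v j" unfolding \<zeta>_def by (intro lsquares_ideal(1,2) tA tg)
  moreover have "mvar j ^ (e + N) * lparam v j i = mconst c * mvar j ^ (N + 1) * A + mvar j ^ (e + 1) * g + \<zeta>"
    unfolding \<zeta>_def L by (simp add: algebra_simps power_add)
  ultimately show ?thesis
    by (intro exI[of _ c] exI[of _ "e + N"] exI[of _ "N + 1"] exI[of _ "mvar j ^ (e + 1) * g"] exI[of _ \<zeta>]
        conjI vanishing_ideal_mult[OF g(2)])
qed

section \<open>Places of the function field\<close>

locale funplace = funfield cst t + place \<Gamma> cst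
  for cst :: "'a::{alg_closed_field, field_char_0} \<Rightarrow> 'b::{alg_closed_field, field_char_0}" and t and \<Gamma> +
  fixes t0 :: 'a
  assumes t_t0: "(t, t0) \<in> \<Gamma>"
begin

lemma emb_pCons: "emb (pCons c p) = cst c + t * emb p"
  by (simp add: emb_def cst.map_poly_pCons)

lemma emb_rel: "(emb p, poly p t0) \<in> \<Gamma>"
proof (induction p)
  case 0
  show ?case by (simp add: zero emb.zero)
next
  case (pCons c p)
  then show ?case unfolding emb_pCons poly_pCons by (intro add const mult t_t0)
qed

lemma ev_rel: "(z, z0) \<in> \<Gamma> \<Longrightarrow> (ev g z, poly (map_poly (\<lambda>p. poly p t0) g) z0) \<in> \<Gamma>"
proof (induction g)
  case 0
  then show ?case by (simp add: zero ev.zero)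
next
  case (pCons p g)
  then show ?case
    unfolding ev_pCons rhom.map_poly_pCons[OF rhom_poly] poly_pCons by (intro add mult emb_rel)
qed

definition unif :: 'b where
  "unif = t - cst t0"

lemma unif_rel: "(unif, 0) \<in> \<Gamma>"
  using diff[OF t_t0 const[of t0]] by (simp add: unif_def)

lemma emb_unif: "emb [:- t0, 1:] = unif"
  by (simp add: emb_pCons unif_def cst.uminus cst.one emb.zero)

lemma unif_nonzero: "unif \<noteq> 0"
  using emb_eq_0[of "[:- t0, 1:]"] unfolding emb_unif by simp

lemma vdvd_unif_emb:
  assumes "poly c t0 = 0"
  shows "vdvd unif (emb c)"
proof -
  obtain c' where "c = [:- t0, 1:] * c'" using assms poly_eq_0_iff_dvd by (auto simp: dvd_def)
  then have "emb c = unif * emb c'" by (simp only: emb.mult emb_unif)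
  then show ?thesis unfolding vdvd_def using emb_rel by blast
qed

lemma vdvd_unif_ev:
  assumes "\<And>i. poly (coeff R i) t0 = 0" "b \<in> Domain \<Gamma>"
  shows "vdvd unif (ev R b)"
  using assms(1)
proof (induction R)
  case 0
  show ?case unfolding ev.zero by (rule vdvd_0)
next
  case (pCons c R)
  have "poly c t0 = 0" using pCons.prems[of 0] by simp
  moreover have "poly (coeff R i) t0 = 0" for i using pCons.prems[of "Suc i"] by simp
  ultimately show ?case unfolding ev_pCons using pCons.IH assms(2) by (intro vdvd_add vdvd_unif_emb vdvd_mult) auto
qed

text \<open>Take an equation of \<open>b\<close> whose coefficients do not all vanish at
  \<open>t0\<close>, and let \<open>r\<close> be the first index where one does not. The terms below
  \<open>r\<close> are divisible by \<open>unif\<close>, and the rest is \<open>b ^ r\<close> times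
  a unit.\<close>

lemma power_in_unif:
  assumes b: "(b, 0) \<in> \<Gamma>"
  shows "\<exists>r. vdvd unif (b ^ r)"
proof -
  let ?P = "\<lambda>P. P \<noteq> 0 \<and> ev P b = 0"
  \<comment> \<open>Minimising the degree of the leading coefficient guarantees that
    \<open>t - t0\<close> cannot be cancelled from all coefficients.\<close>
  define P where "P = (ARG_MIN (\<lambda>P. degree (lead_coeff P)) P. ?P P)"
  have P: "?P P" unfolding P_def using algebraic_ev[of b] arg_min_natI[of ?P _ "\<lambda>P. degree (lead_coeff P)"] by blast
  have le: "degree (lead_coeff P) \<le> degree (lead_coeff R)" if "?P R" for R unfolding P_def using that by (rule arg_min_nat_le)
  have ex: "\<exists>i. poly (coeff P i) t0 \<noteq> 0"
  proof (rule ccontr)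
    assume "\<not> ?thesis"
    then have d: "[:- t0, 1:] dvd coeff P i" for i using poly_eq_0_iff_dvd by blast
    define R where "R = map_poly (\<lambda>p. p div [:- t0, 1:]) P"
    have PR: "P = smult [:- t0, 1:] R"
      by (rule poly_eqI) (use d in \<open>simp add: R_def coeff_map_poly del: smult_pCons mult_pCons_left\<close>)
    have R0: "R \<noteq> 0" using PR P by auto
    have "emb [:- t0, 1:] * ev R b = 0"
      using P ev.mult[of "[:[:- t0, 1:]:]" R b] PR by (simp add: ev_const)
    then have "ev R b = 0" using unif_nonzero unfolding emb_unif by simp
    then have "degree (lead_coeff P) \<le> degree (lead_coeff R)" using le R0 by blast
    moreover have "degree P = degree R" unfolding PR by (rule degree_smult_eq[THEN trans]) simp
    then have "lead_coeff P = [:- t0, 1:] * lead_coeff R" by (subst PR) (simp only: coeff_smult)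
    then have "degree (lead_coeff P) = 1 + degree (lead_coeff R)"
      using R0 by (simp add: degree_mult_eq del: mult_pCons_left)
    ultimately show False by simp
  qed
  define r where "r = (LEAST i. poly (coeff P i) t0 \<noteq> 0)"
  have r: "poly (coeff P r) t0 \<noteq> 0" unfolding r_def by (rule LeastI_ex[OF ex])
  have lt: "poly (coeff P i) t0 = 0" if "i < r" for i using that not_less_Least unfolding r_def by blast
  have split: "P = poly_cutoff r P + monom 1 r * poly_shift r P"
    by (rule poly_eqI) (simp add: coeff_poly_cutoff coeff_poly_shift coeff_monom_mult)
  have "ev (monom 1 r) b = b ^ r"
    using ev.power[of "[:0, 1:]" r b] by (simp add: monom_altdef ev_pCons ev_const emb.zero emb.one ev.zero)
  then have e: "0 = ev (poly_cutoff r P) b + ev (poly_shift r P) b * b ^ r"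
    using P split by (metis ev.add ev.mult mult.commute)
  have "poly (coeff (poly_cutoff r P) i) t0 = 0" for i using lt by (simp add: coeff_poly_cutoff)
  then have "vdvd unif (ev (poly_cutoff r P) b)" using vdvd_unif_ev b by blast
  then have "vdvd unif (- ev (poly_cutoff r P) b)" by (rule vdvd_uminus)
  moreover have "- ev (poly_cutoff r P) b = ev (poly_shift r P) b * b ^ r" using e by (metis add_eq_0_iff)
  ultimately have "vdvd unif (ev (poly_shift r P) b * b ^ r)" by simp
  moreover have "(ev (poly_shift r P) b, poly (coeff P r) t0) \<in> \<Gamma>"
    using ev_rel[OF b, of "poly_shift r P"]
    by (simp add: poly_0_coeff_0 rhom.coeff_map[OF rhom_poly] coeff_poly_shift)
  ultimately show ?thesis using vdvd_unit_cancel r by blast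
qed

text \<open>A nonzero \<open>w\<close> divides the constant term of an equation that it satisfies,
  hence a power \<open>unif ^ v\<close>. On the other hand some power of \<open>b\<close> is
  divisible by \<open>unif\<close>, so \<open>w\<close> would be divisible by
  \<open>unif ^ Suc v\<close>.\<close>

lemma rank_one:
  assumes b: "(b, 0) \<in> \<Gamma>" and w: "\<And>k. vdvd (b ^ k) w"
  shows "w = 0"
proof (rule ccontr)
  assume "w \<noteq> 0"
  then obtain P where P: "coeff P 0 \<noteq> 0" "ev P w = 0" using algebraic_nonzero by blast
  have wD: "w \<in> Domain \<Gamma>" using w[of 0] unfolding vdvd_def by auto
  obtain c0 P' where P': "P = pCons c0 P'" by (cases P) auto
  have c0: "c0 \<noteq> 0" using P P' by simp
  obtain a where "(w, a) \<in> \<Gamma>" using wD by blast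
  then have "ev P' w \<in> Domain \<Gamma>" using ev_rel by blast
  then have "- ev P' w \<in> Domain \<Gamma>" by (rule Domain_uminus)
  moreover have "emb c0 = w * (- ev P' w)" using P(2) unfolding P' ev_pCons by (simp add: eq_neg_iff_add_eq_0)
  ultimately have wc: "vdvd w (emb c0)" unfolding vdvd_def by blast
  define v where "v = order t0 c0"
  obtain c' where c': "c0 = [:- t0, 1:] ^ v * c'" "\<not> [:- t0, 1:] dvd c'"
    using order_decomp[OF c0] unfolding v_def by blast
  have c't: "poly c' t0 \<noteq> 0" using c'(2) poly_eq_0_iff_dvd by blast
  have "emb c0 = emb c' * unif ^ v" unfolding c'(1) emb.mult emb.power emb_unif by (rule mult.commute)
  then have wv: "vdvd w (unif ^ v)" using wc vdvd_unit_cancel[OF emb_rel c't] by simp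
  obtain r where r: "vdvd unif (b ^ r)" using power_in_unif[OF b] by blast
  have "vdvd (unif ^ Suc v) ((b ^ r) ^ Suc v)" by (rule vdvd_power[OF r])
  moreover have "vdvd ((b ^ r) ^ Suc v) w" unfolding power_mult[symmetric] by (rule w)
  ultimately have "vdvd (unif * unif ^ v) (unif ^ v)" using vdvd_trans wv by (metis power_Suc)
  then have "unif ^ v = 0" using vdvd_self_mult[OF unif_rel] by blast
  then show False using unif_nonzero by simp
qed

section \<open>Values of forms at points of a valuation ring\<close>

lemma cst_Domain: "cst c \<in> Domain \<Gamma>"
  using const by blast

lemma eval_Domain: "(\<And>i. \<eta> i \<in> Domain \<Gamma>) \<Longrightarrow> evalh cst f \<eta> \<in> Domain \<Gamma>"
  by (rule cst.evalh_difference(1)[of "Domain \<Gamma>" UNIV \<eta> \<eta>]) (use Domain_add Domain_mult cst_Domain in auto)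

lemma eval_difference:
  assumes "\<And>i. \<eta> i \<in> Domain \<Gamma>" "\<And>i. \<eta>' i \<in> Domain \<Gamma>" "\<And>i. vdvd \<epsilon> (\<eta> i - \<eta>' i)"
  shows "vdvd \<epsilon> (evalh cst f \<eta> - evalh cst f \<eta>')"
proof -
  have "evalh cst f \<eta> - evalh cst f \<eta>' \<in> {x. vdvd \<epsilon> x}"
    by (rule cst.evalh_difference(2)[of "Domain \<Gamma>"])
      (use assms Domain_add Domain_mult cst_Domain vdvd_0 vdvd_add vdvd_mult in auto)
  then show ?thesis by blast
qed

lemma eval_lparam: "\<eta> j = 1 \<Longrightarrow> evalh cst (lparam v j i) \<eta> = \<eta> i - cst (v $ i)"
  by (simp add: lparam_def cst.evalh_mvar cst.evalh_mconst rhom.diff[OF cst.rhom_evalh] cst.evalh_mult)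

lemma eval_lsquares:
  assumes \<eta>: "\<And>i. \<eta> i \<in> Domain \<Gamma>" "\<eta> j = 1" "\<And>i. vdvd b (\<eta> i - cst (v $ i))" and \<zeta>: "\<zeta> \<in> lsquares v j"
  shows "vdvd (b ^ 2) (evalh cst \<zeta> \<eta>)"
  using \<zeta> unfolding lsquares_def
proof (induction rule: ideal.span_induct_alt)
  case base
  show ?case by (simp add: vdvd_0 rhom.zero[OF cst.rhom_evalh])
next
  case (step c x y)
  then obtain r s where "x = lparam v j r * lparam v j s" by blast
  then have "evalh cst x \<eta> = (\<eta> r - cst (v $ r)) * (\<eta> s - cst (v $ s))"
    by (simp add: cst.evalh_mult eval_lparam[where \<eta> = \<eta>, OF \<eta>(2)])
  then have "vdvd (b ^ 2) (evalh cst x \<eta>)" unfolding power2_eq_square using vdvd_mult2[OF \<eta>(3) \<eta>(3)] by simp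
  then show ?case
    unfolding cst.evalh_add cst.evalh_mult by (intro vdvd_add vdvd_mult step eval_Domain \<eta>)
qed

text \<open>The generators are products of two quantities divisible by \<open>b\<close>, so moving
  the point by \<open>\<epsilon>\<close> changes them by a multiple of
  \<open>b * \<epsilon>\<close>. The gain of the factor \<open>b\<close> is what makes lifts
  unique.\<close>

lemma eval_lsquares_difference:
  assumes \<eta>: "\<And>i. \<eta> i \<in> Domain \<Gamma>" "\<eta> j = 1" "\<And>i. vdvd b (\<eta> i - cst (v $ i))"
    and \<eta>': "\<And>i. \<eta>' i \<in> Domain \<Gamma>" "\<eta>' j = 1" "\<And>i. vdvd b (\<eta>' i - cst (v $ i))"
    and \<epsilon>: "\<And>i. vdvd \<epsilon> (\<eta> i - \<eta>' i)" and b: "b \<in> Domain \<Gamma>" and \<zeta>: "\<zeta> \<in> lsquares v j"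
  shows "vdvd (b * \<epsilon>) (evalh cst \<zeta> \<eta> - evalh cst \<zeta> \<eta>')"
  using \<zeta> unfolding lsquares_def
proof (induction rule: ideal.span_induct_alt)
  case base
  show ?case by (simp add: vdvd_0 rhom.zero[OF cst.rhom_evalh])
next
  case (step c x y)
  then obtain r s where x: "x = lparam v j r * lparam v j s" by blast
  define A A' B B' where "A = \<eta> r - cst (v $ r)" and "A' = \<eta>' r - cst (v $ r)"
    and "B = \<eta> s - cst (v $ s)" and "B' = \<eta>' s - cst (v $ s)"
  have ex: "evalh cst x \<eta> = A * B" "evalh cst x \<eta>' = A' * B'"
    by (simp_all add: x cst.evalh_mult eval_lparam[where \<eta> = \<eta>, OF \<eta>(2)] eval_lparam[where \<eta> = \<eta>', OF \<eta>'(2)] A_def A'_def B_def B'_def)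
  have v: "vdvd b A" "vdvd b B" "vdvd b A'" "vdvd b B'" using \<eta> \<eta>' by (simp_all add: A_def A'_def B_def B'_def)
  have d: "vdvd \<epsilon> (A - A')" "vdvd \<epsilon> (B - B')" using \<epsilon> by (simp_all add: A_def A'_def B_def B'_def)
  have "vdvd (b * \<epsilon>) (A * (B - B') + B' * (A - A'))" by (intro vdvd_add vdvd_mult2 v d)
  then have 1: "vdvd (b * \<epsilon>) (evalh cst x \<eta> - evalh cst x \<eta>')" unfolding ex by (simp add: algebra_simps)
  have bA: "vdvd b (A * B)" using vdvd_mult[OF v(2), of A] \<eta>(1) Domain_diff const unfolding A_def by blast
  have 2: "vdvd (\<epsilon> * b) ((evalh cst c \<eta> - evalh cst c \<eta>') * evalh cst x \<eta>)"
    unfolding ex by (intro vdvd_mult2 eval_difference \<eta> \<eta>' \<epsilon> bA)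
  have 2: "vdvd (b * \<epsilon>) ((evalh cst c \<eta> - evalh cst c \<eta>') * evalh cst x \<eta>)"
    using 2 by (simp only: mult.commute[of b \<epsilon>])
  have 3: "evalh cst (c * x + y) \<eta> - evalh cst (c * x + y) \<eta>'
     = ((evalh cst c \<eta> - evalh cst c \<eta>') * evalh cst x \<eta> + evalh cst c \<eta>' * (evalh cst x \<eta> - evalh cst x \<eta>'))
       + (evalh cst y \<eta> - evalh cst y \<eta>')"
    by (simp add: cst.evalh_add cst.evalh_mult algebra_simps)
  show ?case
    unfolding 3 by (rule vdvd_add[OF vdvd_add[OF 2 vdvd_mult[OF 1 eval_Domain]] step(2)]) (rule \<eta>')
qed

lemma eval_ideal_power:
  assumes \<eta>: "\<And>i. (\<eta> i, v $ i) \<in> \<Gamma>" "\<And>i. vdvd b (\<eta> i - cst (v $ i))" and v: "hcoords v q"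
  shows "g \<in> ideal_power (vanishing_ideal {q}) k \<Longrightarrow> vdvd (b ^ k) (evalh cst g \<eta>)"
proof (induction k arbitrary: g)
  case 0
  then show ?case using eval_Domain[of \<eta> g] \<eta>(1) unfolding vdvd_def by auto
next
  case (Suc k)
  have \<eta>D: "\<eta> i \<in> Domain \<Gamma>" for i using \<eta>(1) by blast
  have base: "vdvd b (evalh cst a \<eta>)" if "a \<in> vanishing_ideal {q}" for a
  proof -
    have "meval a v = 0" using that v unfolding vanishing_ideal_def vanishes_at_def by blast
    then have "evalh cst a (\<lambda>i. cst (v $ i)) = 0"
      using ev_id.evalh_comp[OF cst, of a "\<lambda>i. v $ i"] cst.zero unfolding meval_evalh by simp
    moreover have "vdvd b (evalh cst a \<eta> - evalh cst a (\<lambda>i. cst (v $ i)))"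
      by (rule eval_difference) (use \<eta>D \<eta>(2) cst_Domain in auto)
    ultimately show ?thesis by simp
  qed
  have "g \<in> ideal.span {a * b |a b. a \<in> vanishing_ideal {q} \<and> b \<in> ideal_power (vanishing_ideal {q}) k}"
    using Suc(2) by simp
  then show ?case
  proof (induction rule: ideal.span_induct_alt)
    case base
    show ?case by (simp add: vdvd_0 rhom.zero[OF cst.rhom_evalh])
  next
    case (step c x y)
    then obtain a d where "x = a * d" "a \<in> vanishing_ideal {q}" "d \<in> ideal_power (vanishing_ideal {q}) k" by blast
    then have "vdvd (b ^ Suc k) (evalh cst x \<eta>)"
      unfolding power_Suc using vdvd_mult2[OF base Suc.IH] by (simp add: cst.evalh_mult)
    then show ?case unfolding cst.evalh_add cst.evalh_mult by (intro vdvd_add vdvd_mult step eval_Domain \<eta>D)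
  qed
qed

text \<open>Where the geometry of the model reaches the place: a form vanishing to order
  \<open>k\<close> at \<open>q\<close> takes a value divisible by \<open>b ^ k\<close> at a point
  whose distance from \<open>v\<close> is divisible by \<open>b\<close>.\<close>

lemma eval_order_ge:
  assumes \<eta>: "\<And>i. (\<eta> i, v $ i) \<in> \<Gamma>" "\<And>i. vdvd b (\<eta> i - cst (v $ i))" and v: "hcoords v q"
    and M: "\<And>g. g \<in> vanishing_ideal M \<Longrightarrow> evalh cst g \<eta> = 0" and o: "order_ge M q A k"
  shows "vdvd (b ^ k) (evalh cst A \<eta>)"
proof -
  obtain s \<alpha> \<beta> where s: "nonvan q s" "\<alpha> \<in> ideal_power (vanishing_ideal {q}) k" "\<beta> \<in> vanishing_ideal M" "s * A = \<alpha> + \<beta>"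
    using o unfolding order_ge_iff by blast
  have "evalh cst s \<eta> * evalh cst A \<eta> = evalh cst \<alpha> \<eta>"
    using arg_cong[OF s(4), of "\<lambda>f. evalh cst f \<eta>"] M[OF s(3)] by (simp add: cst.evalh_add cst.evalh_mult)
  then have "vdvd (b ^ k) (evalh cst s \<eta> * evalh cst A \<eta>)" using eval_ideal_power[OF \<eta> v s(2)] by simp
  moreover have "(evalh cst s \<eta>, meval s v) \<in> \<Gamma>" unfolding meval_evalh by (rule evalh_rel[OF cst \<eta>(1)])
  moreover have "meval s v \<noteq> 0" using s(1) nonvan_iff[OF _ v] unfolding nonvan_def by (metis nonvan_def nonvan_iff s(1) v)
  ultimately show ?thesis using vdvd_unit_cancel by blast
qed

lemma least_parameter:
  assumes "\<And>i. (\<eta> i, v $ i) \<in> \<Gamma>"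
  obtains i0 where "\<And>i. vdvd (\<eta> i0 - cst (v $ i0)) (\<eta> i - cst (v $ i))" "(\<eta> i0 - cst (v $ i0), 0) \<in> \<Gamma>"
proof -
  obtain x where "x \<in> range (\<lambda>i. \<eta> i - cst (v $ i))" "\<forall>y\<in>range (\<lambda>i. \<eta> i - cst (v $ i)). vdvd x y"
    using vdvd_least[of "range (\<lambda>i. \<eta> i - cst (v $ i))"] by auto
  then obtain i0 where "\<And>i. vdvd (\<eta> i0 - cst (v $ i0)) (\<eta> i - cst (v $ i))" by auto
  moreover have "(\<eta> i0 - cst (v $ i0), 0) \<in> \<Gamma>" using diff[OF assms[of i0] const[of "v $ i0"]] by simp
  ultimately show ?thesis using that by blast
qed

end

section \<open>Plane curves with a nonsingular model\<close>

locale modelled_curve = curve F n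
  for F :: "('a::{alg_closed_field, field_char_0}, 3) mpoly" and n +
  fixes C :: "('a, 3) proj set" and M :: "('a, 'n::finite) proj set" and \<phi> :: "('a, 'n) proj \<Rightarrow> ('a, 3) proj"
  assumes C_iff: "x \<in> C \<longleftrightarrow> vanishes_at F x"
    and IC: "vanishing_ideal C = {G. F dvd G}"
    and M_closed: "zclosed M"
    and M_nonsingular: "q \<in> M \<Longrightarrow> nonsingular_at M q"
    and birational: "birational_morphism M \<phi> C"
begin

lemma regular: "regular_on M \<phi>" and image: "\<phi> ` M \<subseteq> C"
  using birational unfolding birational_morphism_def by blast+

lemma vanishes_on_image: "x \<in> \<phi> ` M \<Longrightarrow> vanishes_at F x"
  using image C_iff by blast

text \<open>The inverse of the birational morphism made explicit by forms \<open>G\<close>, valid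
  wherever the single form \<open>s\<close> does not vanish; \<open>c0\<close> witnesses that
  neither \<open>s\<close> nor all of \<open>G\<close> vanish identically on the curve.\<close>

lemma inverse_forms:
  obtains s d e G c0 where "homogeneous d s" "c0 \<in> C" "\<not> vanishes_at s c0"
    "\<forall>i. homogeneous e (G i)" "\<forall>v. hcoords v c0 \<longrightarrow> (\<chi> i. meval (G i) v) \<noteq> 0"
    "\<forall>x v. x \<in> C \<longrightarrow> hcoords v x \<longrightarrow> meval s v \<noteq> 0 \<longrightarrow> (\<exists>y\<in>M. \<phi> y = x \<and> hcoords (\<chi> i. meval (G i) v) y)"
proof -
  obtain U V \<psi> where *: "zopen U" "zopen V" "M \<inter> U \<noteq> {}" "\<phi> ` (M \<inter> U) = C \<inter> V"
    "regular_on (C \<inter> V) \<psi>" "\<forall>x\<in>M \<inter> U. \<psi> (\<phi> x) = x"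
    using birational unfolding birational_morphism_def by blast
  obtain x0 where "x0 \<in> M \<inter> U" using *(3) by blast
  then have c0: "\<phi> x0 \<in> C \<inter> V" using *(4) by blast
  then obtain W e G where W: "zopen W" "\<phi> x0 \<in> W" "represents e G \<psi> (C \<inter> V \<inter> W)"
    using *(5) unfolding regular_on_def by blast
  obtain s1 d1 where s1: "homogeneous d1 s1" "\<not> vanishes_at s1 (\<phi> x0)" "\<And>x. x \<notin> V \<Longrightarrow> vanishes_at s1 x"
    using zopen_form[OF *(2), of "\<phi> x0"] c0 by blast
  obtain s2 d2 where s2: "homogeneous d2 s2" "\<not> vanishes_at s2 (\<phi> x0)" "\<And>x. x \<notin> W \<Longrightarrow> vanishes_at s2 x"
    using zopen_form[OF W(1,2)] by blast
  obtain v0 where v0: "hcoords v0 (\<phi> x0)" using hcoords_exists by blast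
  have h: "homogeneous (d1 + d2) (s1 * s2)" by (intro homogeneous_mult s1 s2)
  show ?thesis
  proof (rule that[OF h])
    show "\<phi> x0 \<in> C" using c0 by blast
    show "\<not> vanishes_at (s1 * s2) (\<phi> x0)"
      using s1(2) s2(2) vanishes_at_iff[OF s1(1) v0] vanishes_at_iff[OF s2(1) v0] vanishes_at_iff[OF h v0]
      by (simp add: mev.mult)
    show "\<forall>i. homogeneous e (G i)" using W(3) unfolding represents_def by blast
    show "\<forall>v. hcoords v (\<phi> x0) \<longrightarrow> (\<chi> i. meval (G i) v) \<noteq> 0"
      using W(2,3) c0 hcoords_nz unfolding represents_def by blast
    show "\<forall>x v. x \<in> C \<longrightarrow> hcoords v x \<longrightarrow> meval (s1 * s2) v \<noteq> 0 \<longrightarrow> (\<exists>y\<in>M. \<phi> y = x \<and> hcoords (\<chi> i. meval (G i) v) y)"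
    proof (intro allI impI)
      fix x v
      assume x: "x \<in> C" and v: "hcoords v x" and nz: "meval (s1 * s2) v \<noteq> 0"
      have xV: "x \<in> V" using s1(3) v nz unfolding vanishes_at_def by (auto simp: mev.mult)
      have xW: "x \<in> W" using s2(3) v nz unfolding vanishes_at_def by (auto simp: mev.mult)
      have "x \<in> \<phi> ` (M \<inter> U)" unfolding *(4) using x xV by (rule IntI)
      then obtain y where y: "y \<in> M \<inter> U" "\<phi> y = x" by (rule imageE) simp
      have "hcoords (\<chi> i. meval (G i) v) (\<psi> x)" using W(3) IntI[OF IntI[OF x xV] xW] v unfolding represents_def by simp
      moreover have "\<psi> x = y" using *(6) y by blast
      ultimately show "\<exists>y\<in>M. \<phi> y = x \<and> hcoords (\<chi> i. meval (G i) v) y" using y by blast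
    qed
  qed
qed

end

locale local_curve = modelled_curve F n C M \<phi> + framed_curve F n cst t e1 e2 Q + funplace cst t \<Gamma> t0
  for F :: "('a::{alg_closed_field, field_char_0}, 3) mpoly" and n and C and M :: "('a, 'n::finite) proj set" and \<phi>
    and cst :: "'a \<Rightarrow> 'b::{alg_closed_field, field_char_0}" and t e1 e2 Q \<Gamma> t0
begin

abbreviation "pt z0 \<equiv> e1 + t0 *s e2 + z0 *s Q"

lemma xi_rel: "(z, z0) \<in> \<Gamma> \<Longrightarrow> (xi z i, pt z0 $ i) \<in> \<Gamma>"
  by (auto intro!: add mult const t_t0)

lemma sum_linear_xi: "(\<Sum>i\<in>UNIV. cst (a $ i) * xi z i) = cst (dot a e1) + t * cst (dot a e2) + z * cst (dot a Q)"
  unfolding dot_def cst.sum cst.mult by (simp add: algebra_simps sum.distrib sum_distrib_left)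

text \<open>\<open>lift z q v \<eta>\<close>: the generic point \<open>xi z\<close> of the plane curve lifts to the point \<open>\<eta>\<close> of the model, which
  specialises to the point \<open>q\<close> with coordinates \<open>v\<close>.\<close>

definition lift :: "'b \<Rightarrow> ('a, 'n) proj \<Rightarrow> 'a ^ 'n \<Rightarrow> ('n \<Rightarrow> 'b) \<Rightarrow> bool" where
  "lift z q v \<eta> \<longleftrightarrow> (\<forall>i. (\<eta> i, v $ i) \<in> \<Gamma>) \<and> (\<forall>g\<in>vanishing_ideal M. evalh cst g \<eta> = 0) \<and>
     (\<forall>e H. rep_at M \<phi> q e H \<longrightarrow> (\<exists>k. k \<noteq> 0 \<and>
        (evalh cst (pull (cross e2 Q) H) \<eta>, k) \<in> \<Gamma> \<and> (\<forall>i. evalh cst (H i) \<eta> = evalh cst (pull (cross e2 Q) H) \<eta> * xi z i)))"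

text \<open>Properness of the model: its points over the field of algebraic functions specialise along
  every place.\<close>

lemma lift_exists:
  assumes z: "z \<in> Z" and z0: "(z, z0) \<in> \<Gamma>"
  shows "\<exists>q\<in>M. hcoords (pt z0) (\<phi> q) \<and> (\<forall>v j. hcoords v q \<and> v $ j = 1 \<longrightarrow> (\<exists>\<eta>. \<eta> j = 1 \<and> lift z q v \<eta>))"
proof -
  obtain s d e G c0 where s: "homogeneous d s" and c0: "c0 \<in> C" "\<not> vanishes_at s c0"
    and G: "\<forall>i. homogeneous e (G i)" "\<forall>v. hcoords v c0 \<longrightarrow> (\<chi> i. meval (G i) v) \<noteq> 0"
    and invf: "\<forall>x v. x \<in> C \<longrightarrow> hcoords v x \<longrightarrow> meval s v \<noteq> 0 \<longrightarrow> (\<exists>y\<in>M. \<phi> y = x \<and> hcoords (\<chi> i. meval (G i) v) y)"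
    by (rule inverse_forms)
  have Cvan: "x \<in> C \<Longrightarrow> F dvd g \<Longrightarrow> vanishes_at g x" for x g using IC unfolding vanishing_ideal_def by blast
  have s\<xi>: "evalh cst s (xi z) \<noteq> 0" using generic_vanish[OF z s] Cvan c0 by blast
  \<comment> \<open>An identity that holds on the curve wherever the inverse is defined becomes a
    multiple of \<open>F\<close> after multiplication by \<open>s\<close>, and \<open>s\<close> does
    not vanish at the generic point.\<close>
  have key: "evalh cst g (xi z) = 0"
    if g: "\<And>x v y. x \<in> C \<Longrightarrow> hcoords v x \<Longrightarrow> y \<in> M \<Longrightarrow> \<phi> y = x \<Longrightarrow> hcoords (\<chi> i. meval (G i) v) y \<Longrightarrow> meval g v = 0" for g
  proof -
    have "meval (s * g) v = 0" if x: "x \<in> C" and v: "hcoords v x" for x v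
    proof (cases "meval s v = 0")
      case False
      then show ?thesis using invf x v g by (metis mev.mult mult_zero_right)
    qed (simp add: mev.mult)
    then have "F dvd s * g" using IC unfolding vanishing_ideal_def vanishes_at_def by blast
    then obtain h where "s * g = F * h" by (auto simp: dvd_def)
    then have "evalh cst s (xi z) * evalh cst g (xi z) = evalh cst F (xi z) * evalh cst h (xi z)"
      by (simp add: cst.evalh_mult[symmetric])
    moreover have "evalh cst F (xi z) = 0" using generic_vanish[OF z hom_F] by simp
    ultimately show ?thesis using s\<xi> by simp
  qed
  define \<eta>0 where "\<eta>0 i = evalh cst (G i) (xi z)" for i
  obtain w0 where w0: "hcoords w0 c0" using hcoords_exists by blast
  obtain i1 where i1: "meval (G i1) w0 \<noteq> 0" using G(2) w0 by (auto simp: vec_eq_iff)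
  have "\<not> F dvd G i1" using Cvan[OF c0(1)] w0 i1 unfolding vanishes_at_def by blast
  then have nz: "\<eta>0 i1 \<noteq> 0" unfolding \<eta>0_def using generic_vanish[OF z] G(1) by blast
  \<comment> \<open>Elements of the vanishing ideal need not be forms, so scaling by
    \<open>c\<close> is not automatic. As a polynomial in \<open>c\<close>, the value vanishes at
    all nonzero constants by \<open>key\<close>, hence identically.\<close>
  have ideal: "evalh cst g (\<lambda>i. c * \<eta>0 i) = 0" if g: "g \<in> vanishing_ideal M" for g c
  proof -
    define p where "p = evalh (\<lambda>a. [:cst a:]) g (\<lambda>i. [:0, \<eta>0 i:])"
    have pc: "poly p c = evalh cst g (\<lambda>i. c * \<eta>0 i)" for c
      unfolding p_def rhom.evalh_comp[OF rhom_comp[OF rhom_pconst cst] rhom_poly] by simp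
    have "poly p (cst a) = 0" if a: "a \<noteq> 0" for a
    proof -
      define g' where "g' = evalh mconst g (\<lambda>i. mconst a * G i)"
      have "evalh cst g' (xi z) = evalh cst g (\<lambda>i. evalh cst (mconst a * G i) (xi z))"
        unfolding g'_def by (rule evalh_subst[OF cst])
      also have "\<dots> = poly p (cst a)" unfolding pc by (simp add: cst.evalh_mult cst.evalh_mconst \<eta>0_def)
      finally have "poly p (cst a) = evalh cst g' (xi z)" by simp
      also have "\<dots> = 0"
      proof (rule key)
        fix x v y
        assume y: "y \<in> M" "hcoords (\<chi> i. meval (G i) v) y"
        have "meval g' v = meval g (a *s (\<chi> i. meval (G i) v))"
          unfolding g'_def meval_evalh evalh_subst[OF rhom_ident]
          by (rule arg_cong[of _ _ "evalh (\<lambda>x. x) g"]) (simp add: fun_eq_iff ev_id.evalh_mult ev_id.evalh_mconst)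
        then show "meval g' v = 0"
          using g y(1) hcoords_scale[OF y(2) a] unfolding vanishing_ideal_def vanishes_at_def by simp
      qed
      finally show ?thesis .
    qed
    moreover have "infinite (cst ` (- {0}))"
    proof -
      have "inj cst"
        using cst.diff emb_eq_0[of "[:_:]"] unfolding emb_const by (intro injI) (metis eq_iff_diff_eq_0 pCons_eq_0_iff)
      then show ?thesis
        using infinite_UNIV_char_0[where 'a = 'a] finite_imageD[of cst "- {0}"]
        by (auto simp: Compl_eq_Diff_UNIV intro: inj_on_subset)
    qed
    ultimately have "p = 0" using poly_eq_0_on_infinite[of "cst ` (- {0})" p] by auto
    then show ?thesis using pc by simp
  qed
  have rep: "k \<noteq> 0 \<and> hcoords (pt z0) (\<phi> q) \<and> (evalh cst (pull (cross e2 Q) H) (\<lambda>i. c * \<eta>0 i), k) \<in> \<Gamma> \<and>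
      (\<forall>i. evalh cst (H i) (\<lambda>i. c * \<eta>0 i) = evalh cst (pull (cross e2 Q) H) (\<lambda>i. c * \<eta>0 i) * xi z i)"
    if q: "q \<in> M" and v: "hcoords v q" and cv: "\<And>i. (c * \<eta>0 i, v $ i) \<in> \<Gamma>" and H: "rep_at M \<phi> q e' H"
      and k: "k = dot (cross e2 Q) (\<chi> i. meval (H i) v)" for q v c e' H k
  proof -
    obtain U where U: "zopen U" "q \<in> U" "represents e' H \<phi> (M \<inter> U)" using H unfolding rep_at_def by blast
    obtain s3 d3 where s3: "homogeneous d3 s3" "\<not> vanishes_at s3 q" "\<And>x. x \<notin> U \<Longrightarrow> vanishes_at s3 x"
      using zopen_form[OF U(1,2)] by blast
    define \<eta> where "\<eta> i = c * \<eta>0 i" for i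
    have \<eta>v: "(\<eta> i, v $ i) \<in> \<Gamma>" for i using cv by (simp add: \<eta>_def)
    have val: "(evalh cst g \<eta>, meval g v) \<in> \<Gamma>" for g unfolding meval_evalh by (rule evalh_rel[OF cst \<eta>v])
    have sub: "evalh cst (evalh mconst g G) (xi z) = evalh cst g \<eta>0" for g
      unfolding evalh_subst[OF cst] \<eta>0_def ..
    have s3\<eta>: "evalh cst s3 \<eta>0 \<noteq> 0"
    proof
      assume "evalh cst s3 \<eta>0 = 0"
      then have "evalh cst s3 \<eta> = 0" unfolding \<eta>_def cst.evalh_scale[OF s3(1)] by simp
      then have "meval s3 v = 0" using val[of s3] uniq by simp
      then show False using s3(2) vanishes_at_iff[OF s3(1) v] by blast
    qed
    have Hh: "homogeneous e' (H i)" for i by (rule rep_at_homogeneous[OF H])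
    \<comment> \<open>The map followed by its inverse is the identity, so the image of the lifted
      point is proportional to the generic point; proportionality is an identity to which
      \<open>key\<close> applies.\<close>
    have minors: "evalh cst (H i) \<eta>0 * xi z j = evalh cst (H j) \<eta>0 * xi z i" for i j
    proof -
      define g where "g = evalh mconst s3 G * (evalh mconst (H i) G * mvar j - evalh mconst (H j) G * mvar i)"
      have "evalh cst g (xi z) = 0"
      proof (rule key)
        fix x v y
        assume x: "hcoords v x" and y: "y \<in> M" "\<phi> y = x" "hcoords (\<chi> i. meval (G i) v) y"
        have m: "meval (evalh mconst h G) v = meval h (\<chi> i. meval (G i) v)" for h
          unfolding meval_evalh evalh_subst[OF rhom_ident] vec_nth_lambda ..
        show "meval g v = 0"
        proof (cases "y \<in> U")
          case True
          then have "hcoords (\<chi> i. meval (H i) (\<chi> i. meval (G i) v)) x"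
            using U(3) y unfolding represents_def by blast
          then obtain b where b: "(\<chi> i. meval (H i) (\<chi> i. meval (G i) v)) = b *s v" using hcoords_unique[OF x] by blast
          have "meval (H i) (\<chi> i. meval (G i) v) = b * v $ i" for i
            using arg_cong[OF b, of "\<lambda>w. w $ i"] by simp
          then show ?thesis unfolding g_def mev.mult mev.diff m meval_mvar by (simp add: mult_ac)
        next
          case False
          then show ?thesis using s3(3) y(3) unfolding g_def mev.mult m vanishes_at_def by simp
        qed
      qed
      then show ?thesis
        using s3\<eta> rhom.diff[OF cst.rhom_evalh, of "evalh mconst (H i) G * mvar j" "evalh mconst (H j) G * mvar i" "xi z"]
        unfolding g_def cst.evalh_mult sub cst.evalh_mvar by simp
    qed
    have minors': "evalh cst (H i) \<eta> * xi z j = evalh cst (H j) \<eta> * xi z i" for i j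
      unfolding \<eta>_def cst.evalh_scale[OF Hh] mult.assoc minors[of i j] ..
    define \<kappa> where "\<kappa> = evalh cst (pull (cross e2 Q) H) \<eta>"
    have one: "(\<Sum>j\<in>UNIV. cst (cross e2 Q $ j) * xi z j) = 1"
      unfolding sum_linear_xi frame_dots by (simp add: cst.one cst.zero)
    have pr: "evalh cst (H i) \<eta> = \<kappa> * xi z i" for i
    proof -
      have "evalh cst (H i) \<eta> = (\<Sum>j\<in>UNIV. cst (cross e2 Q $ j) * (evalh cst (H i) \<eta> * xi z j))"
        using one by (simp add: sum_distrib_left[symmetric] mult.left_commute)
      also have "\<dots> = (\<Sum>j\<in>UNIV. cst (cross e2 Q $ j) * evalh cst (H j) \<eta>) * xi z i"
        unfolding minors' sum_distrib_right by (intro sum.cong refl) (simp only: mult.assoc)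
      finally show ?thesis unfolding \<kappa>_def evalh_pull[OF cst] .
    qed
    have \<kappa>k: "(\<kappa>, k) \<in> \<Gamma>" using val[of "pull (cross e2 Q) H"] unfolding \<kappa>_def k meval_pull .
    have hc: "hcoords (\<chi> i. meval (H i) v) (\<phi> q)" by (rule rep_at_hcoords[OF H q v])
    have "meval (H i) v = k * pt z0 $ i" for i
      using det[OF val[of "H i"]] mult[OF \<kappa>k xi_rel[OF z0, of i]] unfolding pr by blast
    then have kp: "(\<chi> i. meval (H i) v) = k *s pt z0" by (simp add: vec_eq_iff)
    have k0: "k \<noteq> 0" using hcoords_nz[OF hc] kp by auto
    have "hcoords (inverse k *s (k *s pt z0)) (\<phi> q)" using hcoords_scale[OF hc, of "inverse k"] k0 unfolding kp by simp
    then have "hcoords (pt z0) (\<phi> q)" using k0 by simp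
    then show ?thesis using k0 \<kappa>k pr unfolding \<kappa>_def \<eta>_def by blast
  qed
  \<comment> \<open>Dividing by a coordinate of least value brings all coordinates into the
    valuation ring and turns one of them into 1, so that they specialise to a point.\<close>
  obtain x where x: "x \<in> range \<eta>0" "\<forall>y\<in>range \<eta>0. vdvd x y" using vdvd_least[of "range \<eta>0"] by auto
  then obtain j0 where j0: "\<And>i. vdvd (\<eta>0 j0) (\<eta>0 i)" by blast
  have nj0: "\<eta>0 j0 \<noteq> 0" using j0[of i1] nz unfolding vdvd_def by auto
  have "\<exists>a. (inverse (\<eta>0 j0) * \<eta>0 i, a) \<in> \<Gamma>" for i
    using j0[of i] nj0 unfolding vdvd_def by (auto simp: mult.assoc[symmetric])
  then obtain a where a: "\<And>i. (inverse (\<eta>0 j0) * \<eta>0 i, a i) \<in> \<Gamma>" by metis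
  define v1 where "v1 = (\<chi> i. a i)"
  have v1: "(inverse (\<eta>0 j0) * \<eta>0 i, v1 $ i) \<in> \<Gamma>" for i using a by (simp add: v1_def)
  have "v1 $ j0 = 1" using det[OF v1[of j0]] one nj0 by simp
  then have "v1 \<noteq> 0" by auto
  define q where "q = abs_proj v1"
  have hv1: "hcoords v1 q" unfolding q_def by (rule hcoords_abs) fact
  have "q \<in> M"
  proof -
    obtain S where S: "\<forall>f\<in>S. \<exists>e. homogeneous e f" "M = {x. \<forall>f\<in>S. vanishes_at f x}"
      using M_closed unfolding zclosed_def by blast
    have "vanishes_at f q" if f: "f \<in> S" for f
    proof -
      have "f \<in> vanishing_ideal M" using f unfolding vanishing_ideal_def S(2) by simp
      then have "evalh cst f (\<lambda>i. inverse (\<eta>0 j0) * \<eta>0 i) = 0" by (rule ideal)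
      moreover have "(evalh cst f (\<lambda>i. inverse (\<eta>0 j0) * \<eta>0 i), evalh (\<lambda>x. x) f (\<lambda>i. v1 $ i)) \<in> \<Gamma>"
        by (rule evalh_rel[OF cst v1])
      ultimately have "(0, meval f v1) \<in> \<Gamma>" unfolding meval_evalh by simp
      then have "meval f v1 = 0" by (rule uniq)
      moreover obtain e' where "homogeneous e' f" using bspec[OF S(1) f] by (rule exE)
      ultimately show ?thesis using vanishes_at_iff[OF _ hv1] by simp
    qed
    then show ?thesis unfolding S(2) by simp
  qed
  moreover have "hcoords (pt z0) (\<phi> q)"
  proof -
    obtain e' H where H: "rep_at M \<phi> q e' H" using regular_rep_at[OF regular \<open>q \<in> M\<close>] .
    show ?thesis using rep[OF \<open>q \<in> M\<close> hv1 v1 H refl] by blast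
  qed
  moreover have "\<exists>\<eta>. \<eta> j = 1 \<and> lift z q v \<eta>" if v: "hcoords v q" "v $ j = 1" for v j
  proof -
    obtain c where c: "c \<noteq> 0" "v = c *s v1" using hcoords_unique[OF hv1 v(1)] by blast
    have e: "v1 $ j * c = 1" using c(2) v(2) by (simp add: mult.commute)
    have vj: "v1 $ j \<noteq> 0" "c = inverse (v1 $ j)" using e inverse_unique[OF e] by auto
    \<comment> \<open>The scaling that makes the \<open>j\<close>-th coordinate of the lift equal to
      1, in step with the normalisation of \<open>v\<close>.\<close>
    define c' where "c' = inverse (inverse (\<eta>0 j0) * \<eta>0 j) * inverse (\<eta>0 j0)"
    have nj: "inverse (\<eta>0 j0) * \<eta>0 j \<noteq> 0" using unit_eq_0[OF v1 vj(1)] .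
    have cv: "(c' * \<eta>0 i, v $ i) \<in> \<Gamma>" for i
      using mult[OF inv[OF v1 vj(1)] v1[of i]] unfolding c'_def c(2) vj(2) by (simp add: mult.assoc)
    have "c' * \<eta>0 j = 1" unfolding c'_def mult.assoc using nj by (rule left_inverse)
    moreover have "lift z q v (\<lambda>i. c' * \<eta>0 i)"
      unfolding lift_def
    proof (intro conjI allI ballI impI)
      fix e' H
      assume H: "rep_at M \<phi> q e' H"
      show "\<exists>k. k \<noteq> 0 \<and> (evalh cst (pull (cross e2 Q) H) (\<lambda>i. c' * \<eta>0 i), k) \<in> \<Gamma> \<and>
          (\<forall>i. evalh cst (H i) (\<lambda>i. c' * \<eta>0 i) = evalh cst (pull (cross e2 Q) H) (\<lambda>i. c' * \<eta>0 i) * xi z i)"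
        using rep[OF \<open>q \<in> M\<close> v(1) cv H refl]
        by (intro exI[of _ "dot (cross e2 Q) (\<chi> i. meval (H i) v)"]) simp
    qed (rule cv ideal, assumption?)+
    ultimately show ?thesis by (intro exI[of _ "\<lambda>i. c' * \<eta>0 i"] conjI)
  qed
  ultimately show ?thesis by blast
qed

end

section \<open>The discriminant at a place\<close>

lemma (in phom) rel_poly_prod: "(\<And>x. x \<in> S \<Longrightarrow> rel_poly (p x) (q x)) \<Longrightarrow> rel_poly (prod p S) (prod q S)"
proof (induction S rule: infinite_finite_induct)
  case (infinite S)
  then show ?case using rel_poly_pCons[OF one rel_poly_0] by (simp add: one_pCons)
next
  case empty
  then show ?case using rel_poly_pCons[OF one rel_poly_0] by (simp add: one_pCons)
next
  case (insert x S)
  then show ?case by (simp add: rel_poly_mult)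
qed

lemma (in phom) rel_poly_unique: "rel_poly p q \<Longrightarrow> rel_poly p q' \<Longrightarrow> q = q'"
  using det unfolding rel_poly_def by (intro poly_eqI) blast

locale affine_place = affine_curve cst t f n + funplace cst t \<Gamma> t0
  for cst :: "'a::{alg_closed_field, field_char_0} \<Rightarrow> 'b::{alg_closed_field, field_char_0}" and t f n \<Gamma> t0
begin

text \<open>Roots of a monic polynomial are integral: if \<open>z\<close> were outside the valuation
  ring, \<open>inverse z\<close> would specialise to 0, and the reversed equation would specialise
  to \<open>1 = 0\<close>.\<close>

lemma Z_Domain:
  assumes z: "z \<in> Z"
  shows "z \<in> Domain \<Gamma>"
proof (rule ccontr)
  assume nz: "z \<notin> Domain \<Gamma>"
  then have z0: "z \<noteq> 0" using zero by blast
  obtain a where a: "(inverse z, a) \<in> \<Gamma>" using val[of z] nz by blast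
  have "a = 0" using inv[OF a] nz by auto
  then have y: "(inverse z, 0) \<in> \<Gamma>" using a by simp
  have "(\<Sum>i\<le>n. emb (coeff f i) * inverse z ^ (n - i)) = inverse z ^ n * ev f z"
  proof -
    have s: "ev f z = (\<Sum>i\<le>n. emb (coeff f i) * z ^ i)"
      unfolding ev_def poly_altdef using map_f(1) by (simp add: emb.coeff_map)
    have e: "emb (coeff f i) * inverse z ^ (n - i) = inverse z ^ n * (emb (coeff f i) * z ^ i)" if "i \<le> n" for i
    proof -
      have "inverse z ^ n = inverse z ^ (n - i) * inverse z ^ i" using that by (simp add: power_add[symmetric])
      moreover have "inverse z ^ i * z ^ i = 1" using z0 by (simp add: power_mult_distrib[symmetric])
      ultimately show ?thesis by (simp add: mult_ac)
    qed
    show ?thesis unfolding s sum_distrib_left by (intro sum.cong refl e) simp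
  qed
  then have s0: "(\<Sum>i\<le>n. emb (coeff f i) * inverse z ^ (n - i)) = 0" using z unfolding Z_def by simp
  have "(\<Sum>i\<le>n. poly (coeff f i) t0 * 0 ^ (n - i)) = (\<Sum>i\<le>n. if i = n then poly (coeff f n) t0 else 0)"
    by (intro sum.cong refl) auto
  then have s1: "(\<Sum>i\<le>n. poly (coeff f i) t0 * 0 ^ (n - i)) = 1" using monic_f deg_f by simp
  have "(\<Sum>i\<le>n. emb (coeff f i) * inverse z ^ (n - i), \<Sum>i\<le>n. poly (coeff f i) t0 * 0 ^ (n - i)) \<in> \<Gamma>"
    by (intro sum mult emb_rel power y)
  then show False unfolding s0 s1 using uniq by fastforce
qed

definition res :: "'b \<Rightarrow> 'a" where
  "res z = (SOME a. (z, a) \<in> \<Gamma>)"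

lemma res: "z \<in> Z \<Longrightarrow> (z, res z) \<in> \<Gamma>"
  unfolding res_def using Z_Domain[of z] by (metis Domain.cases someI_ex)

text \<open>Both sides specialise the same polynomial coefficient by coefficient. So the residues
  run through the roots of the specialised equation with multiplicities.\<close>

lemma spec_prod: "spec t0 f = (\<Prod>z\<in>Z. [:- res z, 1:])"
proof (rule rel_poly_unique)
  show "rel_poly (map_poly emb f) (spec t0 f)"
    unfolding rel_poly_def spec_def by (simp add: emb.coeff_map rhom.coeff_map[OF rhom_poly] emb_rel)
  show "rel_poly (map_poly emb f) (\<Prod>z\<in>Z. [:- res z, 1:])"
    unfolding map_f_prod
    by (intro rel_poly_prod rel_poly_pCons one uminus res rel_poly_0)
qed

lemma spec_root: "poly (spec t0 f) z0 = 0 \<longleftrightarrow> (\<exists>z\<in>Z. res z = z0)"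
  unfolding spec_prod poly_prod using finite_Z by auto

lemma spec_pderiv: "pderiv (spec t0 f) = spec t0 (pderiv f)"
  unfolding spec_def by (rule pderiv_map_poly[OF rhom_poly])

lemma spec_double_root:
  assumes z: "z \<in> Z"
  shows "poly (spec t0 (pderiv f)) (res z) = 0 \<longleftrightarrow> (\<exists>y\<in>Z - {z}. res y = res z)"
proof -
  have "spec t0 f = [:- res z, 1:] * (\<Prod>y\<in>Z - {z}. [:- res y, 1:])"
    unfolding spec_prod using z finite_Z by (simp add: prod.remove)
  then have "poly (spec t0 (pderiv f)) (res z) = poly (\<Prod>y\<in>Z - {z}. [:- res y, 1:]) (res z)"
    unfolding spec_pderiv[symmetric] by (simp only: poly_pderiv_linear_mult)
  moreover have "poly (\<Prod>y\<in>Z - {z}. [:- res y, 1:]) (res z) = 0 \<longleftrightarrow> (\<exists>y\<in>Z - {z}. res z - res y = 0)"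
    unfolding poly_prod using finite_Z by (subst prod_zero_iff) auto
  ultimately show ?thesis by (metis right_minus_eq)
qed

lemma spec_triple_root:
  assumes z: "z \<in> Z" "y \<in> Z" "x \<in> Z" "z \<noteq> y" "z \<noteq> x" "y \<noteq> x" "res y = res z" "res x = res z"
  shows "poly (spec t0 (pderiv (pderiv f))) (res z) = 0"
proof -
  define h where "h = (\<Prod>w\<in>Z - {z, y, x}. [:- res w, 1:])"
  have "(\<Prod>w\<in>Z. [:- res w, 1:]) = [:- res z, 1:] * ([:- res y, 1:] * ([:- res x, 1:] * h))"
  proof -
    have "Z = insert z (insert y (insert x (Z - {z, y, x})))" using z by auto
    moreover have "finite (Z - {z, y, x})" using finite_Z by simp
    ultimately show ?thesis unfolding h_def using z(4-6)
      by (metis (no_types, lifting) DiffD2 finite_insert insertE insertI1 insertI2 prod.insert)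
  qed
  then have s: "spec t0 f = [:- res z, 1:] ^ 3 * h"
    unfolding spec_prod using z(7,8) by (simp only: power3_eq_cube mult.assoc)
  have "spec t0 (pderiv (pderiv f)) = pderiv (pderiv (spec t0 f))"
    unfolding spec_def pderiv_map_poly[OF rhom_poly] ..
  also have "\<dots> = pderiv (pderiv ([:- res z, 1:] * ([:- res z, 1:] * ([:- res z, 1:] * h))))"
    unfolding s power3_eq_cube mult.assoc ..
  also have "poly \<dots> (res z) = 0"
    by (simp only: pderiv_mult pderiv_add poly_add poly_mult) (simp add: pderiv_pCons)
  finally show ?thesis .
qed

definition discr :: 'b where
  "discr = (\<Prod>z\<in>Z. ev (pderiv f) z)"

lemma unit_prod: "finite S \<Longrightarrow> (\<And>x. x \<in> S \<Longrightarrow> \<exists>a. (g x, a) \<in> \<Gamma> \<and> a \<noteq> 0) \<Longrightarrow> \<exists>a. (prod g S, a) \<in> \<Gamma> \<and> a \<noteq> 0"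
proof (induction S rule: finite_induct)
  case empty
  then show ?case using one by auto
next
  case (insert x S)
  then obtain a b where "(g x, a) \<in> \<Gamma>" "a \<noteq> 0" "(prod g S, b) \<in> \<Gamma>" "b \<noteq> 0" by (metis insert_iff)
  then show ?case using insert.hyps mult by (intro exI[of _ "a * b"]) simp
qed

lemma diff_unit: "z \<in> Z \<Longrightarrow> y \<in> Z \<Longrightarrow> res z \<noteq> res y \<Longrightarrow> \<exists>a. (z - y, a) \<in> \<Gamma> \<and> a \<noteq> 0"
  using diff[OF res res, of z y] by auto

lemma discr_unit:
  assumes "\<And>z y. z \<in> Z \<Longrightarrow> y \<in> Z \<Longrightarrow> z \<noteq> y \<Longrightarrow> res z \<noteq> res y"
  shows "\<exists>a. (discr, a) \<in> \<Gamma> \<and> a \<noteq> 0"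
  unfolding discr_def
proof (intro unit_prod finite_Z)
  fix z
  assume z: "z \<in> Z"
  show "\<exists>a. (ev (pderiv f) z, a) \<in> \<Gamma> \<and> a \<noteq> 0"
    unfolding ev_pderiv_f[OF z] using finite_Z assms z by (intro unit_prod diff_unit) auto
qed

text \<open>Among the differences of roots only those of \<open>z1\<close> and \<open>z2\<close>, in
  both orders, can fail to be units.\<close>

lemma discr_pair:
  assumes z: "z1 \<in> Z" "z2 \<in> Z" "z1 \<noteq> z2"
    and d: "\<And>z y. z \<in> Z \<Longrightarrow> y \<in> Z \<Longrightarrow> z \<noteq> y \<Longrightarrow> res z = res y \<Longrightarrow> {z, y} = {z1, z2}"
  shows "\<exists>u a. (u, a) \<in> \<Gamma> \<and> a \<noteq> 0 \<and> discr = (z1 - z2) ^ 2 * u"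
proof -
  have U: "\<exists>u a. (u, a) \<in> \<Gamma> \<and> a \<noteq> 0 \<and> ev (pderiv f) z = (z - y) * u" if zy: "{z, y} = {z1, z2}" "z \<noteq> y" for z y
  proof -
    have m: "z \<in> Z" "y \<in> Z" using zy z by (auto simp: doubleton_eq_iff)
    have "\<exists>a. (\<Prod>w\<in>Z - {z} - {y}. z - w, a) \<in> \<Gamma> \<and> a \<noteq> 0"
    proof (intro unit_prod diff_unit)
      fix w
      assume w: "w \<in> Z - {z} - {y}"
      show "res z \<noteq> res w"
      proof
        assume "res z = res w"
        then have "{z, w} = {z, y}" using d[of z w] w m zy by auto
        then show False using w by (auto simp: doubleton_eq_iff)
      qed
    qed (use m finite_Z in auto)
    moreover have "ev (pderiv f) z = (z - y) * (\<Prod>w\<in>Z - {z} - {y}. z - w)"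
      unfolding ev_pderiv_f[OF m(1)] using m zy finite_Z by (subst prod.remove[of _ y]) auto
    ultimately show ?thesis by blast
  qed
  obtain u1 a1 where 1: "(u1, a1) \<in> \<Gamma>" "a1 \<noteq> 0" "ev (pderiv f) z1 = (z1 - z2) * u1" using U[of z1 z2] z by blast
  obtain u2 a2 where 2: "(u2, a2) \<in> \<Gamma>" "a2 \<noteq> 0" "ev (pderiv f) z2 = (z2 - z1) * u2" using U[of z2 z1] z by blast
  have "\<exists>a. (\<Prod>z\<in>Z - {z1} - {z2}. ev (pderiv f) z, a) \<in> \<Gamma> \<and> a \<noteq> 0"
  proof (rule unit_prod)
    fix x
    assume x: "x \<in> Z - {z1} - {z2}"
    then have xZ: "x \<in> Z" by blast
    show "\<exists>a. (ev (pderiv f) x, a) \<in> \<Gamma> \<and> a \<noteq> 0"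
      unfolding ev_pderiv_f[OF xZ]
    proof (intro unit_prod diff_unit)
      fix y
      assume y: "y \<in> Z - {x}"
      show "res x \<noteq> res y"
      proof
        assume "res x = res y"
        then have "{x, y} = {z1, z2}" using d[of x y] x y by auto
        then show False using x by (auto simp: doubleton_eq_iff)
      qed
    qed (use xZ finite_Z in auto)
  qed (use finite_Z in auto)
  then obtain u3 a3 where 3: "(u3, a3) \<in> \<Gamma>" "a3 \<noteq> 0" "(\<Prod>z\<in>Z - {z1} - {z2}. ev (pderiv f) z) = u3" by blast
  have "discr = ev (pderiv f) z1 * (ev (pderiv f) z2 * u3)"
    unfolding discr_def 3(3)[symmetric] using z finite_Z
    by (subst prod.remove[of _ z1]) (auto simp: prod.remove[of _ z2])
  also have "\<dots> = (z1 - z2) ^ 2 * (- (u1 * u2 * u3))"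
    unfolding 1 2 by (simp add: power2_eq_square algebra_simps)
  finally show ?thesis
    using uminus[OF mult[OF mult[OF 1(1) 2(1)] 3(1)]] 1(2) 2(2) 3(2)
    by (intro exI[of _ "- (u1 * u2 * u3)"] exI[of _ "- (a1 * a2 * a3)"]) simp
qed

text \<open>Evaluate at the constant \<open>x\<close> with value \<open>z0\<close>. There
  \<open>f\<close> is a polynomial in \<open>t\<close> with a simple zero at \<open>t0\<close>, so
  \<open>(x - z1) * (x - z2)\<close> is \<open>unif\<close> times a unit; the derivative of
  \<open>f\<close> is divisible by \<open>unif\<close>, hence so is \<open>2 * x - z1 - z2\<close>.
  The square of the difference of the roots is the square of this sum minus four times the
  product.\<close>

lemma simple_vertical_tangent:
  assumes z: "z1 \<in> Z" "z2 \<in> Z" "z1 \<noteq> z2" "res z1 = z0" "res z2 = z0"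
    and only: "\<And>z. z \<in> Z \<Longrightarrow> res z = z0 \<Longrightarrow> z = z1 \<or> z = z2"
    and ft: "poly (spec t0 (dt f)) z0 \<noteq> 0"
  shows "\<exists>u a. (u, a) \<in> \<Gamma> \<and> a \<noteq> 0 \<and> (z1 - z2) ^ 2 = unif * u"
proof -
  define x where "x = cst z0"
  define h where "h = (\<Prod>z\<in>Z - {z1} - {z2}. [:- z, 1:])"
  have fh: "map_poly emb f = [:- z1, 1:] * ([:- z2, 1:] * h)"
    unfolding map_f_prod h_def using z finite_Z by (subst prod.remove[of _ z1]) (auto simp: prod.remove[of _ z2])
  have xr: "(x, z0) \<in> \<Gamma>" unfolding x_def by (rule const)
  have "\<exists>a. (\<Prod>z\<in>Z - {z1} - {z2}. x - z, a) \<in> \<Gamma> \<and> a \<noteq> 0"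
  proof (rule unit_prod)
    fix z
    assume zz: "z \<in> Z - {z1} - {z2}"
    then have "(x - z, z0 - res z) \<in> \<Gamma>" using diff[OF xr res[of z]] by blast
    moreover have "z0 - res z \<noteq> 0" using only[of z] zz by auto
    ultimately show "\<exists>a. (x - z, a) \<in> \<Gamma> \<and> a \<noteq> 0" by blast
  qed (use finite_Z in simp)
  then obtain a where a: "(poly h x, a) \<in> \<Gamma>" "a \<noteq> 0" unfolding h_def by (auto simp: poly_prod)
  have ci: "emb [:c:] = cst c" for c by (rule emb_const)
  have evx: "ev g x = emb (poly g [:z0:])" for g
    using emb.poly_hom[of g "[:z0:]"] by (simp add: ev_def x_def ci)
  have spx: "poly (poly g [:z0:]) t0 = poly (spec t0 g) z0" for g
    unfolding spec_def using rhom.poly_hom[OF rhom_poly, of g "[:z0:]" t0] by simp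
  define p where "p = poly f [:z0:]"
  have "poly p t0 = 0" unfolding p_def spx spec_root using z by blast
  then obtain c where c: "p = [:- t0, 1:] * c" using poly_eq_0_iff_dvd by (auto simp: dvd_def)
  have "poly c t0 = poly (pderiv p) t0" unfolding c by (simp only: poly_pderiv_linear_mult)
  also have "\<dots> = poly (poly (dt f) [:z0:]) t0" unfolding p_def pderiv_poly_poly by (simp add: pderiv_pCons)
  finally have ct: "poly c t0 \<noteq> 0" using ft unfolding spx by simp
  have "(x - z1) * (x - z2) * poly h x = unif * emb c"
    using evx[of f] unfolding p_def[symmetric] c emb.mult emb_unif unfolding ev_def fh by (simp add: algebra_simps)
  then have prod: "(x - z1) * (x - z2) = unif * (emb c * inverse (poly h x))"
    using unit_eq_0[OF a] by (simp add: field_simps)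
  define u where "u = emb c * inverse (poly h x)"
  have u: "(u, poly c t0 * inverse a) \<in> \<Gamma>" unfolding u_def by (intro mult emb_rel inv a)
  have "poly (spec t0 (pderiv f)) (res z1) = 0" using spec_double_root[OF z(1)] z by auto
  then have "poly (poly (pderiv f) [:z0:]) t0 = 0" using z(4) unfolding spx by simp
  then have dv: "vdvd unif (ev (pderiv f) x)" unfolding evx by (rule vdvd_unif_emb)
  have "ev (pderiv f) x = (2 * x - z1 - z2) * poly h x + (x - z1) * (x - z2) * poly (pderiv h) x"
    unfolding ev_def pderiv_map_poly[OF emb.rhom_axioms, symmetric] fh
    by (simp only: pderiv_mult poly_add poly_mult) (simp add: pderiv_pCons algebra_simps)
  then have e: "poly h x * (2 * x - z1 - z2) = ev (pderiv f) x - (x - z1) * (x - z2) * poly (pderiv h) x"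
    by (simp add: algebra_simps)
  have hD: "poly (pderiv h) x \<in> Domain \<Gamma>"
  proof -
    have "rel_poly h (\<Prod>z\<in>Z - {z1} - {z2}. [:- res z, 1:])"
      unfolding h_def by (intro rel_poly_prod rel_poly_pCons one uminus res rel_poly_0) blast
    then obtain g where g: "rel_poly h g" by blast
    have "rel_poly (pderiv h) (pderiv g)"
      using g const[of "of_nat _"] unfolding rel_poly_def by (auto simp: coeff_pderiv cst.of_nat[symmetric] simp del: of_nat_Suc intro!: mult)
    then show ?thesis using poly_rel[OF _ xr] by blast
  qed
  have "vdvd unif ((x - z1) * (x - z2) * poly (pderiv h) x)"
    unfolding prod u_def[symmetric] using vdvd_mult[OF vdvd_mult[OF vdvd_refl[of unif]]] hD u
    by (metis Domain.simps mult.commute)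
  then have "vdvd unif (poly h x * (2 * x - z1 - z2))" unfolding e using dv by (intro vdvd_diff)
  then have "vdvd unif (2 * x - z1 - z2)" using vdvd_unit_cancel[OF a] by blast
  then obtain y b where y: "(y, b) \<in> \<Gamma>" "2 * x - z1 - z2 = unif * y" unfolding vdvd_def by blast
  have "(z1 - z2) ^ 2 = (2 * x - z1 - z2) ^ 2 - 4 * ((x - z1) * (x - z2))"
    by (simp add: power2_eq_square algebra_simps)
  also have "\<dots> = unif * (unif * y ^ 2 - cst 4 * u)"
    unfolding y prod u_def[symmetric] using cst.of_nat[of 4] by (simp add: power2_eq_square algebra_simps)
  finally have "(z1 - z2) ^ 2 = unif * (unif * y ^ 2 - cst 4 * u)" .
  moreover have "(unif * y ^ 2 - cst 4 * u, 0 * b ^ 2 - 4 * (poly c t0 * inverse a)) \<in> \<Gamma>"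
    by (intro diff mult unif_rel power y const u)
  moreover have "0 * b ^ 2 - 4 * (poly c t0 * inverse a) \<noteq> 0" using ct a(2) by simp
  ultimately show ?thesis by blast
qed

text \<open>Although the place is not discrete, the exponent of \<open>unif\<close> in front of a
  unit is well defined, because \<open>unif\<close> specialises to 0.\<close>

lemma order_eqI:
  assumes "emb p = unif ^ k * u" "(u, a) \<in> \<Gamma>" "a \<noteq> 0"
  shows "order t0 p = k"
proof -
  have p0: "p \<noteq> 0" using assms(1) unif_nonzero unit_eq_0[OF assms(2,3)] by (auto simp: emb.zero)
  define v where "v = order t0 p"
  obtain c where c: "p = [:- t0, 1:] ^ v * c" "\<not> [:- t0, 1:] dvd c"
    using order_decomp[OF p0] unfolding v_def by blast
  have ct: "poly c t0 \<noteq> 0" using c(2) poly_eq_0_iff_dvd by blast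
  have e: "unif ^ v * emb c = unif ^ k * u" using assms(1) unfolding c(1) emb.mult emb.power emb_unif .
  have key: False if "i < j" "unif ^ i * w = unif ^ j * w'" "(w, b) \<in> \<Gamma>" "b \<noteq> 0" "(w', b') \<in> \<Gamma>" for i j w w' b b'
  proof -
    have "\<exists>m. j = Suc (i + m)" using that(1) by (simp add: less_iff_Suc_add)
    then obtain m where m: "j = Suc (i + m)" by blast
    have "unif ^ i * w = unif ^ i * (unif * (unif ^ m * w'))" using that(2) unfolding m by (simp add: power_add mult_ac)
    then have "w = unif * (unif ^ m * w')" using unif_nonzero by simp
    then have "(w, 0 * (0 ^ m * b')) \<in> \<Gamma>" using mult[OF unif_rel mult[OF power[OF unif_rel, of m] that(5)]] by simp
    then show False using det[OF that(3)] that(4) by simp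
  qed
  show ?thesis
    using key[OF _ e emb_rel ct assms(2)] key[OF _ e[symmetric] assms(2,3) emb_rel] unfolding v_def[symmetric]
    by (metis linorder_neqE_nat)
qed

end

section \<open>Nodes and smooth points on a vertical line\<close>

context framed_curve
begin

text \<open>The line joining \<open>Q\<close> to the points with first affine coordinate \<open>t0\<close>.\<close>

definition vline :: "'a \<Rightarrow> 'a ^ 3" where
  "vline t0 = cross Q e1 - t0 *s cross e2 Q"

lemma vline_dots: "dot (vline t0) e1 = - t0" "dot (vline t0) e2 = 1" "dot (vline t0) Q = 0"
  "dot (vline t0) (e1 + t0 *s e2 + z0 *s Q) = 0"
  by (simp_all add: vline_def dot_diff dot_add dot_scale frame_dots)

lemma vline_nonzero: "vline t0 \<noteq> 0"
  using vline_dots(2)[of t0] by (metis dot_zero(1) zero_neq_one)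

end

context local_curve
begin

sublocale affine_place cst t f n \<Gamma> t0 ..

lemma lin_value:
  assumes "dot a (pt z0) = 0"
  shows "cst (dot a e1) + t * cst (dot a e2) + z * cst (dot a Q) = cst (dot a e2) * unif + cst (dot a Q) * (z - cst z0)"
proof -
  have "dot a e1 = - (t0 * dot a e2 + z0 * dot a Q)"
    using assms unfolding dot_add dot_scale by (metis add.assoc eq_neg_iff_add_eq_0)
  then have e: "cst (dot a e1) = - (cst t0 * cst (dot a e2) + cst z0 * cst (dot a Q))"
    by (simp only: cst.uminus cst.add cst.mult)
  show ?thesis unfolding e unif_def by (simp add: algebra_simps)
qed

lemma lift_pull:
  assumes "lift z q v \<eta>" "rep_at M \<phi> q e H"
  shows "\<exists>k. k \<noteq> 0 \<and> (evalh cst (pull (cross e2 Q) H) \<eta>, k) \<in> \<Gamma> \<and>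
    (\<forall>a. evalh cst (pull a H) \<eta> = evalh cst (pull (cross e2 Q) H) \<eta> * (cst (dot a e1) + t * cst (dot a e2) + z * cst (dot a Q)))"
proof -
  let ?\<kappa> = "evalh cst (pull (cross e2 Q) H) \<eta>"
  obtain k where k: "k \<noteq> 0" "(?\<kappa>, k) \<in> \<Gamma>" "\<And>i. evalh cst (H i) \<eta> = ?\<kappa> * xi z i"
    using assms unfolding lift_def by blast
  have "evalh cst (pull a H) \<eta> = ?\<kappa> * (\<Sum>i\<in>UNIV. cst (a $ i) * xi z i)" for a
    unfolding evalh_pull[OF cst, of a] k(3) sum_distrib_left by (intro sum.cong refl) (simp only: mult_ac)
  then show ?thesis using k unfolding sum_linear_xi by blast
qed

lemma lift_order:
  assumes l: "lift z q v \<eta>" and v: "hcoords v q" and H: "rep_at M \<phi> q e H"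
    and b: "\<And>i. vdvd b (\<eta> i - cst (v $ i))" and o: "order_ge M q (pull a H) k" and a: "dot a (pt z0) = 0"
  shows "vdvd (b ^ k) (cst (dot a e2) * unif + cst (dot a Q) * (z - cst z0))"
proof -
  obtain c where c: "c \<noteq> 0" "(evalh cst (pull (cross e2 Q) H) \<eta>, c) \<in> \<Gamma>"
    "evalh cst (pull a H) \<eta> = evalh cst (pull (cross e2 Q) H) \<eta> * (cst (dot a e1) + t * cst (dot a e2) + z * cst (dot a Q))"
    using lift_pull[OF l H] by blast
  have "vdvd (b ^ k) (evalh cst (pull a H) \<eta>)"
    by (rule eval_order_ge[where \<eta> = \<eta> and b = b, OF _ b v _ o]) (use l in \<open>auto simp: lift_def\<close>)
  then show ?thesis unfolding c(3) lin_value[OF a] using vdvd_unit_cancel[OF c(2,1)] by blast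
qed

text \<open>\<open>nonsingular_local_parameter\<close> evaluated at a lift: the part in the ideal
  vanishes, and the pullback of the vertical line becomes \<open>unif\<close> times a unit. The
  witnesses do not depend on the lift, so the identities of two lifts can be subtracted.\<close>

lemma local_parameter_eval:
  assumes q: "q \<in> M" and v: "hcoords v q" "v $ j = 1" and p: "hcoords (pt z0) (\<phi> q)"
    and H: "rep_at M \<phi> q e H" and o: "\<not> order_ge M q (pull (vline t0) H) 2"
  shows "\<exists>c \<zeta>. \<zeta> \<in> lsquares v j \<and> (\<forall>z \<eta>. lift z q v \<eta> \<longrightarrow> \<eta> j = 1 \<longrightarrow>
     \<eta> i - cst (v $ i) = cst c * (evalh cst (pull (cross e2 Q) H) \<eta> * unif) + evalh cst \<zeta> \<eta>)"
proof -
  have hA: "homogeneous e (pull (vline t0) H)" by (intro homogeneous_pull rep_at_homogeneous[OF H])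
  have "hcoords (\<chi> i. meval (H i) v) (\<phi> q)" by (rule rep_at_hcoords[OF H q v(1)])
  then obtain c where "(\<chi> i. meval (H i) v) = c *s pt z0" using hcoords_unique[OF p] by blast
  then have Av: "meval (pull (vline t0) H) v = 0" unfolding meval_pull by (simp add: dot_scale vline_dots)
  obtain c N N' g \<zeta> where *: "g \<in> vanishing_ideal M" "\<zeta> \<in> lsquares v j"
    "mvar j ^ N * lparam v j i = mconst c * mvar j ^ N' * pull (vline t0) H + g + \<zeta>"
    using nonsingular_local_parameter[OF M_nonsingular[OF q] q v hA Av o] by blast
  have "\<eta> i - cst (v $ i) = cst c * (evalh cst (pull (cross e2 Q) H) \<eta> * unif) + evalh cst \<zeta> \<eta>"
    if l: "lift z q v \<eta>" and j: "\<eta> j = 1" for z \<eta>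
  proof -
    have g0: "evalh cst g \<eta> = 0" using l *(1) unfolding lift_def by blast
    have A: "evalh cst (pull (vline t0) H) \<eta> = evalh cst (pull (cross e2 Q) H) \<eta> * unif"
    proof -
      have "evalh cst (pull (vline t0) H) \<eta> = evalh cst (pull (cross e2 Q) H) \<eta> * (cst (dot (vline t0) e1) + t * cst (dot (vline t0) e2) + z * cst (dot (vline t0) Q))"
        using lift_pull[OF l H] by blast
      then show ?thesis unfolding vline_dots by (simp add: cst.one cst.zero cst.uminus unif_def)
    qed
    have "evalh cst (mvar j ^ N * lparam v j i) \<eta> = evalh cst (mconst c * mvar j ^ N' * pull (vline t0) H + g + \<zeta>) \<eta>"
      using *(3) by simp
    then show ?thesis
      by (simp add: cst.evalh_mult cst.evalh_add rhom.power[OF cst.rhom_evalh] cst.evalh_mvar j cst.evalh_mconst g0 A eval_lparam)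
  qed
  then show ?thesis using *(2) by blast
qed

text \<open>Nakayama's argument for the displacement \<open>b\<close> of least value: it is a
  multiple of \<open>unif\<close> plus a multiple of its own square.\<close>

lemma lift_param:
  assumes q: "q \<in> M" and v: "hcoords v q" "v $ j = 1" and p: "hcoords (pt z0) (\<phi> q)"
    and H: "rep_at M \<phi> q e H" and o: "\<not> order_ge M q (pull (vline t0) H) 2"
    and l: "lift z q v \<eta>" "\<eta> j = 1"
  shows "vdvd unif (\<eta> i - cst (v $ i))"
proof -
  have \<eta>v: "(\<eta> i, v $ i) \<in> \<Gamma>" for i using l unfolding lift_def by blast
  obtain i0 where i0: "\<And>i. vdvd (\<eta> i0 - cst (v $ i0)) (\<eta> i - cst (v $ i))" "(\<eta> i0 - cst (v $ i0), 0) \<in> \<Gamma>"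
    using least_parameter[of \<eta> v, OF \<eta>v] by blast
  define b where "b = \<eta> i0 - cst (v $ i0)"
  obtain c \<zeta> where c: "\<zeta> \<in> lsquares v j" "b = cst c * (evalh cst (pull (cross e2 Q) H) \<eta> * unif) + evalh cst \<zeta> \<eta>"
    using local_parameter_eval[OF q v p H o, of i0] l unfolding b_def by blast
  obtain k where "(evalh cst (pull (cross e2 Q) H) \<eta>, k) \<in> \<Gamma>" using lift_pull[OF l(1) H] by blast
  then have "vdvd unif (cst c * (evalh cst (pull (cross e2 Q) H) \<eta> * unif))"
    by (intro vdvd_mult vdvd_refl cst_Domain) blast
  moreover have "vdvd (b ^ 2) (evalh cst \<zeta> \<eta>)"
    by (rule eval_lsquares[where \<eta> = \<eta>, OF _ l(2) _ c(1)]) (use \<eta>v i0(1) in \<open>auto simp: b_def\<close>)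
  ultimately have "vdvd unif b" using vdvd_nakayama[of b] i0(2) c(2) unfolding b_def by blast
  then show ?thesis using vdvd_trans i0(1) unfolding b_def by blast
qed

text \<open>A line through \<open>Q\<close> that is not the tangent of the branch cuts out a local parameter of the model at \<open>q\<close>.
  So the difference of two lifts is divisible by \<open>unif\<close> times itself.\<close>

lemma lift_unique:
  assumes q: "q \<in> M" and v: "hcoords v q" "v $ j = 1" and p: "hcoords (pt z0) (\<phi> q)"
    and H: "rep_at M \<phi> q e H" and o: "\<not> order_ge M q (pull (vline t0) H) 2"
    and l: "lift z q v \<eta>" "\<eta> j = 1" and l': "lift z' q v \<eta>'" "\<eta>' j = 1"
  shows "z = z'"
proof -
  have \<eta>v: "(\<eta> i, v $ i) \<in> \<Gamma>" "(\<eta>' i, v $ i) \<in> \<Gamma>" for i using l l' unfolding lift_def by blast+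
  then have \<eta>D: "\<eta> i \<in> Domain \<Gamma>" "\<eta>' i \<in> Domain \<Gamma>" for i by blast+
  note par = lift_param[OF q v p H o l] lift_param[OF q v p H o l']
  obtain x where "x \<in> range (\<lambda>i. \<eta> i - \<eta>' i)" "\<forall>y\<in>range (\<lambda>i. \<eta> i - \<eta>' i). vdvd x y"
    using vdvd_least[of "range (\<lambda>i. \<eta> i - \<eta>' i)"] by auto
  then obtain i0 where i0: "\<And>i. vdvd (\<eta> i0 - \<eta>' i0) (\<eta> i - \<eta>' i)" by auto
  define \<epsilon> where "\<epsilon> = \<eta> i0 - \<eta>' i0"
  define \<kappa> where "\<kappa> \<eta> = evalh cst (pull (cross e2 Q) H) \<eta>" for \<eta>
  obtain c \<zeta> where c: "\<zeta> \<in> lsquares v j" and e: "\<eta> i0 - cst (v $ i0) = cst c * (\<kappa> \<eta> * unif) + evalh cst \<zeta> \<eta>"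
    "\<eta>' i0 - cst (v $ i0) = cst c * (\<kappa> \<eta>' * unif) + evalh cst \<zeta> \<eta>'"
    using local_parameter_eval[OF q v p H o, of i0] l l' unfolding \<kappa>_def by blast
  have "\<epsilon> = cst c * (unif * (\<kappa> \<eta> - \<kappa> \<eta>')) + (evalh cst \<zeta> \<eta> - evalh cst \<zeta> \<eta>')"
    using arg_cong2[OF e, of "(-)"] unfolding \<epsilon>_def by (simp add: algebra_simps)
  moreover have "vdvd (unif * \<epsilon>) (cst c * (unif * (\<kappa> \<eta> - \<kappa> \<eta>')))"
    unfolding \<kappa>_def
    by (intro vdvd_mult[OF _ cst_Domain] vdvd_mult2[OF vdvd_refl] eval_difference) (use \<eta>D i0 in \<open>auto simp: \<epsilon>_def\<close>)
  moreover have "vdvd (unif * \<epsilon>) (evalh cst \<zeta> \<eta> - evalh cst \<zeta> \<eta>')"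
    by (rule eval_lsquares_difference[where \<eta> = \<eta> and \<eta>' = \<eta>' and \<epsilon> = \<epsilon> and b = unif, OF _ l(2) par(1) _ l'(2) par(2) _ _ c]) (use \<eta>D i0 unif_rel in \<open>auto simp: \<epsilon>_def\<close>)
  ultimately have "vdvd (unif * \<epsilon>) \<epsilon>" using vdvd_add by metis
  then have "\<epsilon> = 0" using vdvd_self_mult[OF unif_rel] by blast
  then have "\<eta> i = \<eta>' i" for i using i0[of i] unfolding \<epsilon>_def vdvd_def by auto
  then have eq: "\<eta> = \<eta>'" by blast
  obtain k where k: "k \<noteq> 0" "(\<kappa> \<eta>, k) \<in> \<Gamma>"
    "\<And>a. evalh cst (pull a H) \<eta> = \<kappa> \<eta> * (cst (dot a e1) + t * cst (dot a e2) + z * cst (dot a Q))"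
    using lift_pull[OF l(1) H] unfolding \<kappa>_def by blast
  have k': "evalh cst (pull a H) \<eta> = \<kappa> \<eta> * (cst (dot a e1) + t * cst (dot a e2) + z' * cst (dot a Q))" for a
    using lift_pull[OF l'(1) H] unfolding \<kappa>_def eq by blast
  \<comment> \<open>The line \<open>cross e1 e2\<close> takes the value \<open>z\<close> at the
    generic point, so equal lifts belong to equal roots.\<close>
  have "\<kappa> \<eta> * z = \<kappa> \<eta> * z'"
    using trans[OF k(3)[of "cross e1 e2", symmetric] k'[of "cross e1 e2"]] unfolding frame_dots by (simp add: cst.zero cst.one)
  then show ?thesis using unit_eq_0[OF k(2,1)] by simp
qed

text \<open>Every root over the node lifts to one of its two branches. As \<open>Q\<close> is on
  neither tangent, the vertical line is transversal to both, so each branch carries at most one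
  root. Modulo \<open>unif ^ 2\<close> the root follows the tangent of its branch.\<close>

lemma node_roots:
  assumes fib: "{q \<in> M. \<phi> q = p} = {q1, q2}" and p: "hcoords (pt z0) p"
    and ns: "nonsingular_branch M \<phi> q1" "nonsingular_branch M \<phi> q2"
    and tg: "branch_tangent M \<phi> q1 l1" "branch_tangent M \<phi> q2 l2" and ne: "l1 \<noteq> l2"
    and Ql: "abs_proj Q \<notin> l1" "abs_proj Q \<notin> l2"
    and z: "z \<in> Z" "res z = z0" and z': "z' \<in> Z" "res z' = z0" and zz': "z \<noteq> z'"
  shows "(\<exists>u a. (u, a) \<in> \<Gamma> \<and> a \<noteq> 0 \<and> z - z' = unif * u) \<and> (\<forall>y\<in>Z. res y = z0 \<longrightarrow> y = z \<or> y = z')"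
proof -
  have Q0: "hcoords Q (abs_proj Q)"
  proof (rule hcoords_abs)
    show "Q \<noteq> 0" using frame_dots(9) by (auto simp: dot_zero)
  qed
  have q12: "q1 \<in> M" "q2 \<in> M" "\<phi> q1 = p" "\<phi> q2 = p" using fib by blast+
  have data: "\<exists>v j e H a. hcoords v q \<and> v $ j = 1 \<and> rep_at M \<phi> q e H \<and> \<not> order_ge M q (pull (vline t0) H) 2 \<and>
      a \<noteq> 0 \<and> l = pline a \<and> dot a (pt z0) = 0 \<and> dot a Q \<noteq> 0 \<and> order_ge M q (pull a H) 2"
    if q: "q \<in> M" "\<phi> q = p" "nonsingular_branch M \<phi> q" "branch_tangent M \<phi> q l" "abs_proj Q \<notin> l" for q l
  proof -
    obtain w where w: "hcoords w q" using hcoords_exists by blast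
    then obtain j where j: "w $ j \<noteq> 0" using hcoords_nz[OF w] by (auto simp: vec_eq_iff)
    note vv = hcoords_normalise[OF w j]
    obtain e H where H: "rep_at M \<phi> q e H" using regular_rep_at[OF regular q(1)] .
    have pq: "hcoords (pt z0) (\<phi> q)" using p q(2) by simp
    obtain a where a: "a \<noteq> 0" "l = pline a" "dot a (pt z0) = 0" "order_ge M q (pull a H) 2"
      using branch_tangent_order_2[OF H q(1) pq q(4)] .
    have aQ: "dot a Q \<noteq> 0" using q(5) a(2) pline_iff[OF Q0] by blast
    have "\<not> order_ge M q (pull (vline t0) H) 2"
    proof
      assume "order_ge M q (pull (vline t0) H) 2"
      then have "l = pline (vline t0)"
        using nonsingular_branch_tangent[OF H q(1) pq q(3,4) vline_nonzero vline_dots(4)] by blast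
      then show False using q(5) pline_iff[OF Q0] vline_dots(3) by blast
    qed
    then show ?thesis using vv H a aQ by blast
  qed
  have branch: "\<exists>q\<in>{q1, q2}. hcoords (pt z0) (\<phi> q) \<and> (\<forall>v j. hcoords v q \<and> v $ j = 1 \<longrightarrow> (\<exists>\<eta>. \<eta> j = 1 \<and> lift y q v \<eta>))"
    if y: "y \<in> Z" "res y = z0" for y
  proof -
    have "(y, z0) \<in> \<Gamma>" using res y by blast
    then obtain q where q: "q \<in> M" "hcoords (pt z0) (\<phi> q)" "\<forall>v j. hcoords v q \<and> v $ j = 1 \<longrightarrow> (\<exists>\<eta>. \<eta> j = 1 \<and> lift y q v \<eta>)"
      using lift_exists[OF y(1)] by blast
    have "\<phi> q = p" using hcoords_same p q(2) by blast
    then have "q \<in> {q1, q2}" using fib q(1) by blast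
    then show ?thesis using q by blast
  qed
  obtain v1 j1 e1' H1 a1 where d1: "hcoords v1 q1" "v1 $ j1 = 1" "rep_at M \<phi> q1 e1' H1" "\<not> order_ge M q1 (pull (vline t0) H1) 2"
      "a1 \<noteq> 0" "l1 = pline a1" "dot a1 (pt z0) = 0" "dot a1 Q \<noteq> 0" "order_ge M q1 (pull a1 H1) 2"
    using data[OF q12(1,3) ns(1) tg(1) Ql(1)] by blast
  obtain v2 j2 e2' H2 a2 where d2: "hcoords v2 q2" "v2 $ j2 = 1" "rep_at M \<phi> q2 e2' H2" "\<not> order_ge M q2 (pull (vline t0) H2) 2"
      "a2 \<noteq> 0" "l2 = pline a2" "dot a2 (pt z0) = 0" "dot a2 Q \<noteq> 0" "order_ge M q2 (pull a2 H2) 2"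
    using data[OF q12(2,4) ns(2) tg(2) Ql(2)] by blast
  define T1 where "T1 y \<longleftrightarrow> (\<exists>\<eta>. \<eta> j1 = 1 \<and> lift y q1 v1 \<eta>)" for y
  define T2 where "T2 y \<longleftrightarrow> (\<exists>\<eta>. \<eta> j2 = 1 \<and> lift y q2 v2 \<eta>)" for y
  have T: "T1 y \<or> T2 y" if y: "y \<in> Z" "res y = z0" for y
    using branch[OF y] d1(1,2) d2(1,2) unfolding T1_def T2_def by blast
  have pq: "hcoords (pt z0) (\<phi> q1)" "hcoords (pt z0) (\<phi> q2)" using p q12 by simp_all
  have T1u: "y = y'" if "T1 y" "T1 y'" for y y'
    using that lift_unique[OF q12(1) d1(1,2) pq(1) d1(3,4)] unfolding T1_def by blast
  have T2u: "y = y'" if "T2 y" "T2 y'" for y y'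
    using that lift_unique[OF q12(2) d2(1,2) pq(2) d2(3,4)] unfolding T2_def by blast
  have S1: "vdvd (unif ^ 2) (cst (dot a1 e2) * unif + cst (dot a1 Q) * (y - cst z0))" if y: "T1 y" for y
  proof -
    obtain \<eta> where \<eta>: "\<eta> j1 = 1" "lift y q1 v1 \<eta>" using y unfolding T1_def by blast
    have par: "vdvd unif (\<eta> i - cst (v1 $ i))" for i
      by (rule lift_param[OF q12(1) d1(1,2) pq(1) d1(3,4) \<eta>(2,1)])
    show ?thesis by (rule lift_order[OF \<eta>(2) d1(1,3) par d1(9,7)])
  qed
  have S2: "vdvd (unif ^ 2) (cst (dot a2 e2) * unif + cst (dot a2 Q) * (y - cst z0))" if y: "T2 y" for y
  proof -
    obtain \<eta> where \<eta>: "\<eta> j2 = 1" "lift y q2 v2 \<eta>" using y unfolding T2_def by blast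
    have par: "vdvd unif (\<eta> i - cst (v2 $ i))" for i
      by (rule lift_param[OF q12(2) d2(1,2) pq(2) d2(3,4) \<eta>(2,1)])
    show ?thesis by (rule lift_order[OF \<eta>(2) d2(1,3) par d2(9,7)])
  qed
  \<comment> \<open>Equal slopes would give a combination of \<open>a1\<close> and \<open>a2\<close>
    that vanishes on the whole frame, and the two tangents would coincide.\<close>
  have det12: "dot a2 e2 * dot a1 Q - dot a1 e2 * dot a2 Q \<noteq> 0"
  proof
    assume 0: "dot a2 e2 * dot a1 Q - dot a1 e2 * dot a2 Q = 0"
    define b where "b = dot a2 Q *s a1 - dot a1 Q *s a2"
    have bQ: "dot b Q = 0" and be2: "dot b e2 = 0" and bp: "dot b (pt z0) = 0"
      using 0 d1(7) d2(7) by (simp_all add: b_def dot_diff dot_scale mult.commute)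
    then have be1: "dot b e1 = 0" unfolding dot_add dot_scale by simp
    have "dot b v = 0" for v
      using expand[of v] bQ be2 be1 by (metis add.right_neutral dot_add(2) dot_scale(2) mult_zero_right)
    then have "b = 0" using dot_separates[of b] dot_commute by metis
    then have e: "dot a2 Q *s a1 = dot a1 Q *s a2" unfolding b_def by simp
    have "pline a1 = pline (dot a2 Q *s a1)" by (rule pline_scale[OF d2(8), symmetric])
    also have "\<dots> = pline a2" unfolding e by (rule pline_scale[OF d1(8)])
    finally show False using ne d1(6) d2(6) by blast
  qed
  \<comment> \<open>To first order \<open>y - cst z0\<close> is
    \<open>- (dot a e2 / dot a Q)\<close> times \<open>unif\<close>, with \<open>a\<close> the
    tangent of the branch; \<open>det12\<close> is the difference of the two slopes up to the factor
    \<open>dot a1 Q * dot a2 Q\<close>.\<close>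
  have slope: "\<exists>u a. (u, a) \<in> \<Gamma> \<and> a \<noteq> 0 \<and> y - y' = unif * u" if y: "T1 y" "T2 y'" for y y'
  proof -
    obtain x b where x: "(x, b) \<in> \<Gamma>" "cst (dot a1 e2) * unif + cst (dot a1 Q) * (y - cst z0) = unif ^ 2 * x"
      using S1[OF y(1)] unfolding vdvd_def by blast
    obtain x' b' where x': "(x', b') \<in> \<Gamma>" "cst (dot a2 e2) * unif + cst (dot a2 Q) * (y' - cst z0) = unif ^ 2 * x'"
      using S2[OF y(2)] unfolding vdvd_def by blast
    define P1 P2 R1 R2 where "P1 = cst (dot a1 e2)" and "P2 = cst (dot a2 e2)" and "R1 = cst (dot a1 Q)" and "R2 = cst (dot a2 Q)"
    have "R1 * R2 * (y - y') = R2 * (P1 * unif + R1 * (y - cst z0)) - R1 * (P2 * unif + R2 * (y' - cst z0))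
        + (P2 * R1 - P1 * R2) * unif"
      by (simp add: algebra_simps)
    also have "\<dots> = unif * ((P2 * R1 - P1 * R2) + unif * (R2 * x - R1 * x'))"
      using x(2) x'(2) unfolding P1_def[symmetric] P2_def[symmetric] R1_def[symmetric] R2_def[symmetric]
      by (simp add: power2_eq_square algebra_simps)
    finally have e: "R1 * R2 * (y - y') = unif * ((P2 * R1 - P1 * R2) + unif * (R2 * x - R1 * x'))" .
    have Ru: "(R1 * R2, dot a1 Q * dot a2 Q) \<in> \<Gamma>" "dot a1 Q * dot a2 Q \<noteq> 0"
      unfolding R1_def R2_def using d1(8) d2(8) by (auto intro: mult const)
    have R0: "R1 * R2 \<noteq> 0" by (rule unit_eq_0[OF Ru])
    have "((P2 * R1 - P1 * R2) + unif * (R2 * x - R1 * x'),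
        (dot a2 e2 * dot a1 Q - dot a1 e2 * dot a2 Q) + 0 * (dot a2 Q * b - dot a1 Q * b')) \<in> \<Gamma>"
      unfolding P1_def P2_def R1_def R2_def by (intro add diff mult const unif_rel x x')
    then have "(inverse (R1 * R2) * ((P2 * R1 - P1 * R2) + unif * (R2 * x - R1 * x')),
        inverse (dot a1 Q * dot a2 Q) * ((dot a2 e2 * dot a1 Q - dot a1 e2 * dot a2 Q) + 0 * (dot a2 Q * b - dot a1 Q * b'))) \<in> \<Gamma>"
      by (intro mult inv Ru)
    moreover have "y - y' = unif * (inverse (R1 * R2) * ((P2 * R1 - P1 * R2) + unif * (R2 * x - R1 * x')))"
    proof -
      have "y - y' = inverse (R1 * R2) * (R1 * R2 * (y - y'))" using left_inverse[OF R0] by (metis mult.assoc mult_1_left)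
      then show ?thesis unfolding e by (simp only: mult.left_commute)
    qed
    moreover have "inverse (dot a1 Q * dot a2 Q) * ((dot a2 e2 * dot a1 Q - dot a1 e2 * dot a2 Q) + 0 * (dot a2 Q * b - dot a1 Q * b')) \<noteq> 0"
      using det12 Ru(2) by simp
    ultimately show ?thesis by blast
  qed
  have cases: "T1 z \<and> T2 z' \<or> T2 z \<and> T1 z'" using T[OF z] T[OF z'] T1u T2u zz' by blast
  have "\<exists>u a. (u, a) \<in> \<Gamma> \<and> a \<noteq> 0 \<and> z - z' = unif * u"
    using cases
  proof
    assume "T1 z \<and> T2 z'"
    then show ?thesis using slope by blast
  next
    assume "T2 z \<and> T1 z'"
    then obtain u a where u: "(u, a) \<in> \<Gamma>" "a \<noteq> 0" "z' - z = unif * u" using slope by blast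
    have "z - z' = unif * (- u)" using u(3) by (simp add: algebra_simps)
    then show ?thesis using uminus[OF u(1)] u(2) by (metis neg_equal_0_iff_equal)
  qed
  moreover have "\<forall>y\<in>Z. res y = z0 \<longrightarrow> y = z \<or> y = z'"
    using cases T T1u T2u by blast
  ultimately show ?thesis by blast
qed

text \<open>By \<open>smooth_tangent\<close> it suffices that some line through the point has finite
  order on the branch. If the line \<open>u\<close> had infinite order, the difference
  \<open>z - cst z0\<close> would be divisible by all powers of a non-unit, hence 0, and a constant
  root contradicts \<open>n \<ge> 2\<close>.\<close>

lemma smooth_tangent_exists:
  assumes n2: "n \<ge> 2" and z: "z \<in> Z" "res z = z0" and g: "grad F (pt z0) \<noteq> 0"
  shows "\<exists>q\<in>M. branch_tangent M \<phi> q (pline (grad F (pt z0)))"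
proof -
  have zr: "(z, z0) \<in> \<Gamma>" using res z by blast
  obtain q where q: "q \<in> M" "hcoords (pt z0) (\<phi> q)" and L: "\<forall>v j. hcoords v q \<and> v $ j = 1 \<longrightarrow> (\<exists>\<eta>. \<eta> j = 1 \<and> lift z q v \<eta>)"
    using lift_exists[OF z(1) zr] by blast
  obtain w where w: "hcoords w q" using hcoords_exists by blast
  then obtain j where j: "w $ j \<noteq> 0" using hcoords_nz[OF w] by (auto simp: vec_eq_iff)
  define v where "v = inverse (w $ j) *s w"
  have v: "hcoords v q" "v $ j = 1" unfolding v_def by (rule hcoords_normalise[OF w j])+
  obtain \<eta> where \<eta>: "\<eta> j = 1" "lift z q v \<eta>" using L v by blast
  have \<eta>v: "(\<eta> i, v $ i) \<in> \<Gamma>" for i using \<eta> unfolding lift_def by blast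
  obtain i0 where i0: "\<And>i. vdvd (\<eta> i0 - cst (v $ i0)) (\<eta> i - cst (v $ i))" "(\<eta> i0 - cst (v $ i0), 0) \<in> \<Gamma>"
    using least_parameter[of \<eta> v, OF \<eta>v] by blast
  obtain e H where H: "rep_at M \<phi> q e H" using regular_rep_at[OF regular q(1)] .
  \<comment> \<open>The line through the point on which \<open>z\<close> is constant: it contains
    the direction \<open>e2\<close>, and its value at the generic point is
    \<open>z - cst z0\<close>.\<close>
  define u where "u = cross e1 e2 - z0 *s cross e2 Q"
  have u: "dot u (pt z0) = 0" "dot u e2 = 0" "dot u Q = 1"
    by (simp_all add: u_def dot_diff dot_add dot_scale frame_dots)
  have "\<exists>k. \<not> order_ge M q (pull u H) k"
  proof (rule ccontr)
    assume "\<not> ?thesis"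
    then have "vdvd ((\<eta> i0 - cst (v $ i0)) ^ k) (z - cst z0)" for k
      using lift_order[OF \<eta>(2) v(1) H i0(1) _ u(1), of k] unfolding u(2,3) by (simp add: cst.zero cst.one)
    then have "z - cst z0 = 0" by (rule rank_one[OF i0(2)])
    then have "ev [:- [:z0:], 1:] z = 0"
      by (simp add: ev_pCons ev_const emb.one ev.zero emb.uminus emb_const[symmetric] flip: minus_pCons)
    then have "f dvd [:- [:z0:], 1:]" using root_ideal z(1) unfolding Z_def by blast
    then have "degree f \<le> degree [:- [:z0:], 1:]" by (rule dvd_imp_degree_le) simp
    then show False using degree_f(1) n2 by simp
  qed
  then obtain k where k: "\<not> order_ge M q (pull u H) k" by blast
  have "branch_tangent M \<phi> q (pline (grad F (pt z0)))"
    by (rule smooth_tangent(2)[OF regular q hom_F vanishes_on_image g H u(1) k])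
  then show ?thesis using q(1) by blast
qed

end

section \<open>Counting the zeros of the discriminant\<close>

lemma perp_pair:
  fixes v w :: "'a::field ^ 3"
  assumes "cross v w \<noteq> 0" "dot a v = 0" "dot a w = 0"
  shows "\<exists>\<alpha>. a = \<alpha> *s cross v w"
proof -
  have "cross (cross v w) a = - (dot a w *s v - dot a v *s w)"
    using cross_cross[of a v w] cross_skew[of "cross v w" a] by simp
  then have "cross (cross v w) a = 0" using assms(2,3) by simp
  then show ?thesis using cross_eq_0 assms(1) by blast
qed

lemma perp_pair_parallel:
  fixes v w :: "'a::field ^ 3"
  assumes "cross v w \<noteq> 0" "dot a v = 0" "dot a w = 0" "dot b v = 0" "dot b w = 0"
  shows "cross a b = 0"
proof -
  obtain \<alpha> \<beta> where "a = \<alpha> *s cross v w" "b = \<beta> *s cross v w"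
    using perp_pair[OF assms(1-3)] perp_pair[OF assms(1,4,5)] by blast
  then show ?thesis by (simp add: cross_scale)
qed

text \<open>Otherwise \<open>x\<close> and \<open>w\<close> would span a totally isotropic plane.
  The matrix maps it into the one-dimensional space of vectors orthogonal to it, so it would have a
  kernel.\<close>

lemma nondegenerate_form_isotropic:
  fixes A :: "'a::field ^ 3 ^ 3"
  assumes sym: "\<And>i j. A $ i $ j = A $ j $ i" and det: "det A \<noteq> 0"
    and x: "dot (A *v x) x = 0" "dot (A *v x) w = 0" and w: "dot (A *v w) w = 0"
  shows "cross x w = 0"
proof (rule ccontr)
  assume ne: "cross x w \<noteq> 0"
  have wx: "dot (A *v w) x = 0" using dot_symmetric_matrix[of A w x, OF sym] x(2) dot_commute by metis
  obtain \<alpha> \<beta> where ab: "A *v x = \<alpha> *s cross x w" "A *v w = \<beta> *s cross x w"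
    using perp_pair[OF ne x] perp_pair[OF ne wx w] by blast
  have "A *v (\<beta> *s x - \<alpha> *s w) = 0" unfolding matvec_linear ab by (simp add: mult.commute)
  then have e: "\<beta> *s x = \<alpha> *s w" using det_nonzero_kernel[OF det] by fastforce
  have "\<beta> *s cross x w = cross (\<beta> *s x) w" by (simp add: cross_scale)
  then have "\<beta> *s cross x w = 0" unfolding e cross_scale by simp
  then have "\<beta> = 0" using ne by simp
  then have "A *v w = 0" using ab(2) by simp
  then have "w = 0" by (rule det_nonzero_kernel[OF det])
  then show False using ne by (simp add: vec3_eq_iff cross_simps)
qed

lemma sum_order_roots:
  fixes p :: "'a::alg_closed_field poly"
  assumes p: "p \<noteq> 0"
  shows "(\<Sum>x | poly p x = 0. order x p) = degree p"
proof -
  obtain A where A: "size A = degree p" "p = smult (lead_coeff p) (\<Prod>x\<in>#A. [:-x, 1:])"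
    using alg_closed_imp_factorization[OF p] by blast
  have lp: "lead_coeff p \<noteq> 0" using p by simp
  have nz: "0 \<notin># image_mset (\<lambda>x. [:- x, 1:]) A" by auto
  have "proots p = proots (\<Prod>x\<in>#A. [:-x, 1:])" by (subst A(2)) (rule proots_smult[OF lp])
  also have "\<dots> = (\<Sum>x\<in>#A. {#x#})" using proots_prod_mset[OF nz] by (simp add: multiset.map_comp o_def)
  also have "\<dots> = A" by simp
  finally have pr: "proots p = A" .
  have "set_mset A = {x. poly p x = 0}" unfolding pr[symmetric] by (rule set_count_proots[OF p])
  moreover have "count A x = order x p" for x unfolding pr[symmetric] using p by simp
  ultimately show ?thesis unfolding A(1)[symmetric] size_multiset_overloaded_eq by simp
qed

section \<open>Reversed polynomials, and the parameter \<open>- inverse t\<close>\<close>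

lemma poly_altdef_le: "degree p \<le> N \<Longrightarrow> poly p x = (\<Sum>i\<le>N. coeff p i * x ^ i)"
  for p :: "'a::comm_ring_1 poly"
  unfolding poly_altdef by (intro sum.mono_neutral_left) (auto simp: coeff_eq_0 not_le)

text \<open>This is \<open>t ^ N\<close> times the value of \<open>p\<close> at
  \<open>- 1 / t\<close>. The bound \<open>N\<close> is a parameter so that all coefficients of an
  equation can be reversed with the same power of \<open>t\<close>.\<close>

definition poly_rev :: "nat \<Rightarrow> 'a::comm_ring_1 poly \<Rightarrow> 'a poly" where
  "poly_rev N p = (\<Sum>i\<le>N. monom ((- 1) ^ i * coeff p i) (N - i))"

lemma coeff_poly_rev: "i \<le> N \<Longrightarrow> coeff (poly_rev N p) (N - i) = (- 1) ^ i * coeff p i"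
proof -
  assume i: "i \<le> N"
  have "coeff (poly_rev N p) (N - i) = (\<Sum>j\<le>N. if j = i then (- 1) ^ j * coeff p j else 0)"
    unfolding poly_rev_def coeff_sum coeff_monom using i by (intro sum.cong refl) auto
  then show ?thesis using i by simp
qed

lemma poly_rev_0 [simp]: "poly_rev N 0 = 0"
  by (simp add: poly_rev_def)

lemma poly_rev_nonzero:
  fixes p :: "'a::idom poly"
  assumes "p \<noteq> 0" "degree p \<le> N"
  shows "poly_rev N p \<noteq> 0"
  using coeff_poly_rev[OF assms(2), of p] assms(1) by auto

lemma poly_poly_rev:
  fixes h :: "'a::comm_ring_1 \<Rightarrow> 'b::field"
  assumes h: "rhom h" and t: "t \<noteq> 0" and p: "degree p \<le> N"
  shows "poly (map_poly h (poly_rev N p)) t = t ^ N * poly (map_poly h p) (- inverse t)"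
proof -
  interpret rhom h by (rule h)
  have "poly (map_poly h p) (- inverse t) = (\<Sum>i\<le>N. h (coeff p i) * (- inverse t) ^ i)"
  proof -
    have "degree (map_poly h p) \<le> N" using p by (intro degree_le) (simp add: coeff_map coeff_eq_0 zero)
    then have "poly (map_poly h p) (- inverse t) = (\<Sum>i\<le>N. coeff (map_poly h p) i * (- inverse t) ^ i)"
      by (rule poly_altdef_le)
    then show ?thesis by (simp add: coeff_map)
  qed
  moreover have "poly (map_poly h (poly_rev N p)) t = (\<Sum>i\<le>N. h ((- 1) ^ i * coeff p i) * t ^ (N - i))"
    unfolding poly_rev_def rhom.sum[OF map_poly_rhom] poly_sum
    by (intro sum.cong refl) (simp add: map_poly_monom zero poly_monom)
  moreover have "h ((- 1) ^ i * coeff p i) * t ^ (N - i) = t ^ N * (h (coeff p i) * (- inverse t) ^ i)" if i: "i \<le> N" for i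
  proof -
    have "t ^ N = t ^ (N - i) * t ^ i" using i by (simp add: power_add[symmetric])
    moreover have "t ^ i * (- inverse t) ^ i = (- 1) ^ i" using t by (simp add: power_mult_distrib[symmetric])
    ultimately have e: "t ^ N * (h (coeff p i) * (- inverse t) ^ i) = t ^ (N - i) * h (coeff p i) * (- 1) ^ i"
      by (metis (no_types, opaque_lifting) mult.assoc mult.left_commute)
    show ?thesis unfolding e by (simp only: mult power uminus one mult_ac)
  qed
  ultimately show ?thesis by (simp add: sum_distrib_left)
qed

context funfield
begin

lemma t_nonzero: "t \<noteq> 0"
  using emb_eq_0[of "[:0, 1:]"] unfolding emb_t by simp

lemma funfield_inverse: "funfield cst (- inverse t)"
proof
  fix p
  assume "poly (map_poly cst p) (- inverse t) = 0"
  then have "emb (poly_rev (degree p) p) = 0"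
    unfolding emb_def poly_poly_rev[OF cst t_nonzero order.refl] by simp
  then show "p = 0" using poly_rev_nonzero[of p "degree p"] by auto
next
  fix w
  obtain P where P: "P \<noteq> 0" "ev P w = 0" using algebraic_ev by blast
  define s where "s = - inverse t"
  have s0: "s \<noteq> 0" and ts: "- inverse s = t" unfolding s_def using t_nonzero by simp_all
  define N where "N = (\<Sum>i\<le>degree P. degree (coeff P i))"
  have N: "degree (coeff P i) \<le> N" for i
  proof (cases "i \<le> degree P")
    case True
    then show ?thesis unfolding N_def by (intro member_le_sum) auto
  qed (simp add: coeff_eq_0)
  define P' where "P' = map_poly (poly_rev N) P"
  have cP': "coeff P' i = poly_rev N (coeff P i)" for i unfolding P'_def by (simp add: coeff_map_poly)
  have "coeff P' (degree P) \<noteq> 0" unfolding cP' using P(1) N by (intro poly_rev_nonzero) auto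
  then have "P' \<noteq> 0" by auto
  moreover have "map_poly (\<lambda>p. poly (map_poly cst p) s) P' = smult (s ^ N) (map_poly emb P)"
  proof (rule poly_eqI)
    fix i
    show "coeff (map_poly (\<lambda>p. poly (map_poly cst p) s) P') i = coeff (smult (s ^ N) (map_poly emb P)) i"
      using poly_poly_rev[OF cst s0 N, of i]
      by (simp add: coeff_map_poly cP' ts emb_def emb.coeff_map rhom.coeff_map[OF cst.poly_map_poly_rhom])
  qed
  then have "poly (map_poly (\<lambda>p. poly (map_poly cst p) s) P') w = 0" using P(2) unfolding ev_def by simp
  ultimately show "\<exists>P. P \<noteq> 0 \<and> poly (map_poly (\<lambda>p. poly (map_poly cst p) (- inverse t)) P) w = 0"
    unfolding s_def by blast
qed

text \<open>Evaluation at \<open>t0\<close> is a homomorphism on the polynomials in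
  \<open>t\<close>, single-valued because \<open>t\<close> is transcendental; it extends to a place
  of the whole closure.\<close>

lemma funplace_exists: "\<exists>\<Gamma>. funplace cst t \<Gamma> t0"
proof -
  define G0 where "G0 = {(emb p, poly p t0) |p. True}"
  have G0: "(emb p, poly p t0) \<in> G0" for p unfolding G0_def by blast
  have "phom G0 cst"
  proof
    show "(1, 1) \<in> G0" using G0[of 1] by (simp add: emb.one)
    show "(cst c, c) \<in> G0" for c using G0[of "[:c:]"] by (simp add: emb_const)
    show "(x + y, a + b) \<in> G0" if xy: "(x, a) \<in> G0" "(y, b) \<in> G0" for x a y b
    proof -
      obtain p q where "x = emb p" "a = poly p t0" "y = emb q" "b = poly q t0" using xy unfolding G0_def by blast
      then show ?thesis using G0[of "p + q"] by (simp add: emb.add)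
    qed
    show "(x * y, a * b) \<in> G0" if xy: "(x, a) \<in> G0" "(y, b) \<in> G0" for x a y b
    proof -
      obtain p q where "x = emb p" "a = poly p t0" "y = emb q" "b = poly q t0" using xy unfolding G0_def by blast
      then show ?thesis using G0[of "p * q"] by (simp add: emb.mult)
    qed
    show "(- x, - a) \<in> G0" if xy: "(x, a) \<in> G0" for x a
    proof -
      obtain p where "x = emb p" "a = poly p t0" using xy unfolding G0_def by blast
      then show ?thesis using G0[of "- p"] by (simp add: emb.uminus)
    qed
    show "a = 0" if a: "(0, a) \<in> G0" for a
    proof -
      obtain p where p: "0 = emb p" "a = poly p t0" using a unfolding G0_def by blast
      then have "p = 0" using emb_eq_0[of p] by simp
      then show ?thesis using p by simp
    qed
  qed
  then obtain \<Gamma> where \<Gamma>: "G0 \<subseteq> \<Gamma>" "place \<Gamma> cst" using place_exists by blast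
  have "(t, t0) \<in> \<Gamma>" using G0[of "[:0, 1:]"] \<Gamma>(1) by (auto simp: emb_t)
  then have "funplace cst t \<Gamma> t0"
    using \<Gamma>(2) by (intro funplace.intro funplace_axioms.intro funfield_axioms)
  then show ?thesis by blast
qed

end

section \<open>Special points: where a line through the centre of projection is tangent, or the
  curve singular\<close>

context curve
begin

text \<open>The points of the curve on the first polar of \<open>Q\<close>.\<close>

definition special :: "'a ^ 3 \<Rightarrow> 'a ^ 3 \<Rightarrow> bool" where
  "special Q v \<longleftrightarrow> v \<noteq> 0 \<and> meval F v = 0 \<and> dot Q (grad F v) = 0"

text \<open>On a line the gradient is constant, and by Euler's relation its product with
  \<open>Q\<close> is the value of \<open>F\<close> at \<open>Q\<close>, which is 1.\<close>

lemma special_degree: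
  assumes "special Q v" "meval F Q = 1"
  shows "n \<ge> 2"
proof (rule ccontr)
  assume "\<not> n \<ge> 2"
  then have n1: "n = 1" using n0 by simp
  then have "homogeneous 0 (dirderiv Q F)" using homogeneous_dirderiv[OF hom_F, of Q] by simp
  then obtain c where "dirderiv Q F = mconst c" using homogeneous_0_const by blast
  then have "dot Q (grad F v) = dot Q (grad F Q)" unfolding meval_dirderiv[symmetric] by simp
  also have "\<dots> = 1" using dot_grad[OF hom_F, of Q] assms(2) n1 dot_commute[of Q] by simp
  finally show False using assms(1) unfolding special_def by simp
qed

end

context modelled_curve
begin

text \<open>At a smooth point all branch tangents are the gradient line, whereas the two branches of
  a node have different tangents.\<close>

lemma node_grad:
  assumes N: "node M \<phi> p" and v: "hcoords v p"
  shows "grad F v = 0"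
proof (rule ccontr)
  assume g: "grad F v \<noteq> 0"
  obtain q1 q2 l1 l2 where q: "{q \<in> M. \<phi> q = p} = {q1, q2}"
    "branch_tangent M \<phi> q1 l1" "branch_tangent M \<phi> q2 l2" "l1 \<noteq> l2"
    using N unfolding node_def by blast
  have m: "q1 \<in> M" "\<phi> q1 = p" "q2 \<in> M" "\<phi> q2 = p" using q(1) by blast+
  have "l1 = pline (grad F v)" "l2 = pline (grad F v)"
    using smooth_tangent(1)[OF regular m(1) _ hom_F vanishes_on_image g q(2)]
      smooth_tangent(1)[OF regular m(3) _ hom_F vanishes_on_image g q(3)] v m(2,4) by auto
  then show False using q(4) by simp
qed

lemma node_on_curve:
  assumes "node M \<phi> p"
  shows "p \<in> C"
proof -
  obtain q1 q2 where "{q \<in> M. \<phi> q = p} = {q1, q2}" using assms unfolding node_def by (elim exE conjE)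
  then have "q1 \<in> M" "\<phi> q1 = p" by blast+
  then show ?thesis using image by blast
qed

end

text \<open>What is required of the centre \<open>Q\<close>: no tangent from it touches at a flex, a
  line through it contains at most one special point, and it lies on no branch tangent at a node.
  \<open>infinity\<close> says that the line at infinity of the chart meets the curve in
  \<open>n\<close> distinct points.\<close>

locale generic_curve = modelled_curve F n C M \<phi> + framed_curve F n cst t e1 e2 Q
  for F :: "('a::{alg_closed_field, field_char_0}, 3) mpoly" and n and C and M :: "('a, 'n::finite) proj set" and \<phi>
    and cst :: "'a \<Rightarrow> 'b::{alg_closed_field, field_char_0}" and t e1 e2 Q +
  assumes singular_node: "hcoords v p \<Longrightarrow> meval F v = 0 \<Longrightarrow> grad F v = 0 \<Longrightarrow> node M \<phi> p"
    and no_flex: "special Q v \<Longrightarrow> grad F v \<noteq> 0 \<Longrightarrow> det (hess F v) \<noteq> 0"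
    and special_collinear: "special Q v \<Longrightarrow> special Q v' \<Longrightarrow> dot (cross Q v) v' = 0 \<Longrightarrow> cross v v' = 0"
    and node_tangent: "node M \<phi> p \<Longrightarrow> q \<in> M \<Longrightarrow> \<phi> q = p \<Longrightarrow> branch_tangent M \<phi> q l \<Longrightarrow> abs_proj Q \<notin> l"
    and infinity: "\<not> special Q (e2 + z0 *s Q)"
begin

abbreviation "pnt t0 z0 \<equiv> e1 + t0 *s e2 + z0 *s Q"

lemma special_pnt: "special Q (pnt t0 z0) \<longleftrightarrow> poly (spec t0 f) z0 = 0 \<and> poly (spec t0 (pderiv f)) z0 = 0"
  unfolding special_def pderiv_aff spec_aff meval_dirderiv using affine_point_nonzero by simp

lemma special_unique:
  assumes "special Q (pnt t0 z0)" "special Q (pnt t0 z1)"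
  shows "z0 = z1"
proof -
  have "dot (cross Q (pnt t0 z0)) (pnt t0 z1) = 0"
    by (simp add: dot_3 cross_simps algebra_simps)
  then have "cross (pnt t0 z0) (pnt t0 z1) = 0" by (rule special_collinear[OF assms])
  then obtain c where c: "pnt t0 z1 = c *s pnt t0 z0" using cross_eq_0[OF _ affine_point_nonzero] by blast
  have L: "dot (cross e2 Q) (pnt t0 z) = 1" "dot (cross e1 e2) (pnt t0 z) = z" for z
    by (simp_all add: dot_add dot_scale frame_dots)
  have "c = 1" using arg_cong[OF c, of "dot (cross e2 Q)"] unfolding dot_scale L by simp
  then show ?thesis using arg_cong[OF c, of "dot (cross e1 e2)"] unfolding dot_scale L by simp
qed

definition delta :: "'a poly" where
  "delta = (SOME p. (\<Prod>z\<in>Z. ev (pderiv f) z) = emb p)"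

lemma emb_delta: "emb delta = (\<Prod>z\<in>Z. ev (pderiv f) z)"
  unfolding delta_def using someI_ex[OF norm_emb[of "pderiv f"]] by simp

lemma delta_nonzero: "delta \<noteq> 0"
proof
  assume "delta = 0"
  then have "(\<Prod>z\<in>Z. ev (pderiv f) z) = 0" using emb_delta by (simp add: emb.zero)
  then show False using pderiv_nonzero finite_Z by (simp add: prod_zero_iff)
qed

lemma hess_form:
  "hess F v $ i $ j = hess F v $ j $ i" "dot (hess F v *v x) y = meval (dirderiv x (dirderiv y F)) v"
proof -
  show "hess F v $ i $ j = hess F v $ j $ i" by (simp add: hess_def mderiv_commute)
  have "meval (dirderiv x (dirderiv y F)) v = (\<Sum>i\<in>UNIV. \<Sum>j\<in>UNIV. x $ i * y $ j * meval (mderiv j (mderiv i F)) v)"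
    unfolding meval_evalh by (rule evalh_dirderiv2[OF rhom_ident])
  also have "\<dots> = (\<Sum>j\<in>UNIV. \<Sum>i\<in>UNIV. x $ i * y $ j * meval (mderiv j (mderiv i F)) v)"
    by (rule sum.swap)
  also have "\<dots> = (\<Sum>j\<in>UNIV. (\<Sum>i\<in>UNIV. meval (mderiv i (mderiv j F)) v * x $ i) * y $ j)"
    unfolding sum_distrib_right by (intro sum.cong refl) (simp only: mderiv_commute mult_ac)
  finally show "dot (hess F v *v x) y = meval (dirderiv x (dirderiv y F)) v"
    by (simp add: dot_def matrix_vector_mult_def hess_def)
qed

text \<open>Otherwise \<open>v\<close> and \<open>Q\<close> would be isotropic and orthogonal for
  the Hessian form, which is nondegenerate away from flexes. They would be proportional, but
  \<open>Q\<close> is not on the curve.\<close>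

lemma simple_polar:
  assumes s: "special Q v" and g: "grad F v \<noteq> 0"
  shows "meval (dirderiv Q (dirderiv Q F)) v \<noteq> 0"
proof
  assume 0: "meval (dirderiv Q (dirderiv Q F)) v = 0"
  have v: "meval F v = 0" "dot Q (grad F v) = 0" "v \<noteq> 0" using s unfolding special_def by blast+
  have Hv: "hess F v *v v = of_nat (n - 1) *s grad F v" by (rule hess_mult_vec[OF hom_F])
  have "cross v Q = 0"
  proof (rule nondegenerate_form_isotropic[of "hess F v"])
    show "det (hess F v) \<noteq> 0" by (rule no_flex[OF s g])
    show "dot (hess F v *v v) v = 0" unfolding Hv using dot_grad[OF hom_F, of v] v by (simp add: dot_scale)
    show "dot (hess F v *v v) Q = 0" unfolding Hv using v(2) dot_commute[of Q] by (simp add: dot_scale)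
    show "dot (hess F v *v Q) Q = 0" unfolding hess_form(2) by (rule 0)
    show "hess F v $ i $ j = hess F v $ j $ i" for i j by (rule hess_form(1))
  qed
  then obtain c where "Q = c *s v" using cross_eq_0 v(3) by blast
  then have "meval F Q = 0" using meval_scale[OF hom_F] v(1) by simp
  then show False using F_Q by simp
qed

lemma local_curve_exists:
  fixes t0 :: 'a
  obtains \<Gamma> where "local_curve F n C M \<phi> cst t e1 e2 Q \<Gamma> t0"
proof -
  obtain \<Gamma> where "funplace cst t \<Gamma> t0" using funplace_exists by blast
  then have "local_curve F n C M \<phi> cst t e1 e2 Q \<Gamma> t0"
    by (intro local_curve.intro modelled_curve_axioms framed_curve_axioms)
  then show ?thesis by (rule that)
qed

lemma order_delta_0:
  assumes ns: "\<And>z0. \<not> special Q (pnt t0 z0)"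
  shows "order t0 delta = 0"
proof -
  obtain \<Gamma> where "local_curve F n C M \<phi> cst t e1 e2 Q \<Gamma> t0" by (rule local_curve_exists)
  then interpret local_curve F n C M \<phi> cst t e1 e2 Q \<Gamma> t0 .
  have "\<exists>a. (discr, a) \<in> \<Gamma> \<and> a \<noteq> 0"
  proof (rule discr_unit, rule notI)
    fix z y
    assume zy: "z \<in> Z" "y \<in> Z" "z \<noteq> y" "res z = res y"
    have "poly (spec t0 (pderiv f)) (res z) = 0" using spec_double_root[OF zy(1)] zy(2-4) by auto
    moreover have "poly (spec t0 f) (res z) = 0" using spec_root zy(1) by blast
    ultimately show False using ns special_pnt by blast
  qed
  then obtain a where a: "(discr, a) \<in> \<Gamma>" "a \<noteq> 0" by blast
  show ?thesis by (rule order_eqI[OF _ a]) (simp add: emb_delta discr_def)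
qed

lemma order_delta_special:
  assumes s: "special Q (pnt t0 z0)"
  shows "order t0 delta = (if grad F (pnt t0 z0) = 0 then 2 else 1)"
proof -
  obtain \<Gamma> where "local_curve F n C M \<phi> cst t e1 e2 Q \<Gamma> t0" by (rule local_curve_exists)
  then interpret local_curve F n C M \<phi> cst t e1 e2 Q \<Gamma> t0 .
  have "poly (spec t0 f) z0 = 0" "poly (spec t0 (pderiv f)) z0 = 0" using s special_pnt by blast+
  then obtain z1 where z1: "z1 \<in> Z" "res z1 = z0" using spec_root by blast
  then obtain z2 where z2: "z2 \<in> Z" "z2 \<noteq> z1" "res z2 = z0"
    using spec_double_root[OF z1(1)] \<open>poly (spec t0 (pderiv f)) z0 = 0\<close> by auto
  have sp: "res z = z0" if zy: "z \<in> Z" "y \<in> Z" "z \<noteq> y" "res z = res y" for z y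
  proof -
    have "poly (spec t0 (pderiv f)) (res z) = 0" using spec_double_root[OF zy(1)] zy(2-4) by auto
    moreover have "poly (spec t0 f) (res z) = 0" using spec_root zy(1) by blast
    ultimately have "special Q (pnt t0 (res z))" using special_pnt by blast
    then show ?thesis using special_unique[OF s] by metis
  qed
  have main: "order t0 delta = k" if only: "\<And>y. y \<in> Z \<Longrightarrow> res y = z0 \<Longrightarrow> y = z1 \<or> y = z2"
    and u: "(u, a) \<in> \<Gamma>" "a \<noteq> 0" "(z1 - z2) ^ 2 = unif ^ k * u" for k u a
  proof -
    have pr: "{z, y} = {z1, z2}" if zy: "z \<in> Z" "y \<in> Z" "z \<noteq> y" "res z = res y" for z y
    proof -
      have "res z = z0" "res y = z0" using sp[OF zy] zy(4) by simp_all
      then have "z = z1 \<or> z = z2" "y = z1 \<or> y = z2" using only zy(1,2) by blast+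
      then show ?thesis using zy(3) by blast
    qed
    obtain u' a' where u': "(u', a') \<in> \<Gamma>" "a' \<noteq> 0" "discr = (z1 - z2) ^ 2 * u'"
      using discr_pair[OF z1(1) z2(1) z2(2)[symmetric] pr] by blast
    have "emb delta = unif ^ k * (u * u')" using emb_delta u'(3) u(3) unfolding discr_def by (simp add: mult.assoc)
    then show ?thesis using order_eqI[OF _ mult[OF u(1) u'(1)], of delta k] u(2) u'(2) by simp
  qed
  show ?thesis
  proof (cases "grad F (pnt t0 z0) = 0")
    case True
    define p where "p = abs_proj (pnt t0 z0)"
    have p: "hcoords (pnt t0 z0) p" unfolding p_def by (rule hcoords_abs[OF affine_point_nonzero])
    have N: "node M \<phi> p" using singular_node[OF p _ True] s unfolding special_def by blast
    obtain q1 q2 l1 l2 where q: "{q \<in> M. \<phi> q = p} = {q1, q2}" "nonsingular_branch M \<phi> q1" "nonsingular_branch M \<phi> q2"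
      "branch_tangent M \<phi> q1 l1" "branch_tangent M \<phi> q2 l2" "l1 \<noteq> l2"
      using N unfolding node_def by blast
    have m: "q1 \<in> M" "\<phi> q1 = p" "q2 \<in> M" "\<phi> q2 = p" using q(1) by blast+
    have nr: "(\<exists>u a. (u, a) \<in> \<Gamma> \<and> a \<noteq> 0 \<and> z1 - z2 = unif * u) \<and> (\<forall>y\<in>Z. res y = z0 \<longrightarrow> y = z1 \<or> y = z2)"
      by (rule node_roots[OF q(1) p q(2-6) node_tangent[OF N m(1,2) q(4)] node_tangent[OF N m(3,4) q(5)] z1 z2(1,3) z2(2)[symmetric]])
    then obtain u a where u: "(u, a) \<in> \<Gamma>" "a \<noteq> 0" "z1 - z2 = unif * u" by blast
    have "order t0 delta = 2"
    proof (rule main)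
      show "(z1 - z2) ^ 2 = unif ^ 2 * u ^ 2" unfolding u(3) by (rule power_mult_distrib)
      show "(u ^ 2, a ^ 2) \<in> \<Gamma>" by (rule power[OF u(1)])
      show "a ^ 2 \<noteq> 0" using u(2) by simp
    qed (use nr in blast)
    then show ?thesis using True by simp
  next
    case g: False
    have only: "y = z1 \<or> y = z2" if y: "y \<in> Z" "res y = z0" for y
    proof (rule ccontr)
      assume "\<not> (y = z1 \<or> y = z2)"
      then have "poly (spec t0 (pderiv (pderiv f))) (res z1) = 0"
        by (intro spec_triple_root[OF z1(1) z2(1) y(1)]) (use z1 z2 y in auto)
      then have "meval (dirderiv Q (dirderiv Q F)) (pnt t0 z0) = 0"
        unfolding pderiv_aff spec_aff z1(2) .
      then show False using simple_polar[OF s g] by blast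
    qed
    \<comment> \<open>Otherwise the gradient would annihilate \<open>e2\<close>, \<open>Q\<close>
      and, by Euler's relation, the point itself, and these span.\<close>
    have "poly (spec t0 (dt f)) z0 \<noteq> 0"
    proof
      assume "poly (spec t0 (dt f)) z0 = 0"
      then have 2: "dot (grad F (pnt t0 z0)) e2 = 0"
        unfolding dt_aff spec_aff meval_dirderiv by (simp add: dot_commute)
      have 3: "dot (grad F (pnt t0 z0)) Q = 0" using s unfolding special_def by (simp add: dot_commute)
      have "dot (grad F (pnt t0 z0)) (pnt t0 z0) = 0" using dot_grad[OF hom_F] s unfolding special_def by simp
      then have 1: "dot (grad F (pnt t0 z0)) e1 = 0"
        using 2 3 dot_add(2)[of "grad F (pnt t0 z0)"] dot_scale(2)[of "grad F (pnt t0 z0)"] by simp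
      obtain a where "dot a (grad F (pnt t0 z0)) \<noteq> 0" using dot_separates[OF g] by blast
      moreover have "dot (grad F (pnt t0 z0)) a = 0"
        by (subst expand[of a]) (simp only: dot_add dot_scale 1 2 3, simp)
      ultimately show False by (simp add: dot_commute)
    qed
    then obtain u a where "(u, a) \<in> \<Gamma>" "a \<noteq> 0" "(z1 - z2) ^ 2 = unif * u"
      using simple_vertical_tangent[OF z1(1) z2(1) z2(2)[symmetric] z1(2) z2(3) only] by blast
    then have "order t0 delta = 1" using main[OF only, of _ _ 1] by simp
    then show ?thesis using g by simp
  qed
qed

text \<open>Exchanging the two affine coordinate axes replaces \<open>t\<close> by \<open>- 1 / t\<close> and the roots \<open>z\<close> by \<open>z / t\<close>, so that
  the line at infinity becomes the line over \<open>0\<close>.\<close>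

lemma degree_delta: "degree delta = n * (n - 1)"
proof -
  interpret I: funfield cst "- inverse t" by (rule funfield_inverse)
  \<comment> \<open>In this frame the generic point is the old one divided by \<open>t\<close>; the
    sign of \<open>- e1\<close> keeps the determinant equal to 1.\<close>
  interpret I: framed_curve F n cst "- inverse t" e2 "- e1" Q
  proof
    show "meval F Q = 1" by (rule F_Q)
    show "dot (cross (- e1) Q) e2 = 1"
      using frame by (simp add: dot_3 cross_simps algebra_simps)
  qed
  obtain \<Gamma> where "funplace cst (- inverse t) \<Gamma> 0" using I.funplace_exists by blast
  then interpret P: funplace cst "- inverse t" \<Gamma> 0 .
  interpret P: affine_place cst "- inverse t" I.f n \<Gamma> 0 ..
  have it: "(inverse t, 0) \<in> \<Gamma>" using P.uminus[OF P.t_t0] by simp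
  have t0: "t \<noteq> 0" by (rule t_nonzero)
  have evI: "ev f z = t ^ n * I.ev I.f (inverse t * z)" for z
  proof -
    have "ev f z = evalh cst F (\<lambda>i. t * (cst (e2 $ i) + - inverse t * cst ((- e1) $ i) + inverse t * z * cst (Q $ i)))"
      unfolding ev_aff using t0 by (intro arg_cong[of _ _ "evalh cst F"]) (auto simp: fun_eq_iff cst.uminus field_simps)
    then show ?thesis unfolding I.ev_aff cst.evalh_scale[OF hom_F] .
  qed
  have ZI: "I.Z = (\<lambda>z. inverse t * z) ` Z"
  proof (intro Set.set_eqI iffI)
    fix w
    assume "w \<in> I.Z"
    then have "I.ev I.f (inverse t * (t * w)) = 0" using t0 unfolding I.Z_def by (simp add: mult.assoc[symmetric])
    then have "t * w \<in> Z" unfolding Z_def evI by simp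
    moreover have "w = inverse t * (t * w)" using t0 by (simp add: mult.assoc[symmetric])
    ultimately show "w \<in> (\<lambda>z. inverse t * z) ` Z" by blast
  next
    fix w
    assume "w \<in> (\<lambda>z. inverse t * z) ` Z"
    then obtain z where "ev f z = 0" "w = inverse t * z" unfolding Z_def by blast
    then show "w \<in> I.Z" using t0 unfolding I.Z_def evI by simp
  qed
  have inj: "inj_on (\<lambda>z. inverse t * z) A" for A using t0 by (intro inj_onI) simp
  have dI: "I.ev (pderiv I.f) (inverse t * z) = inverse t ^ (n - 1) * ev (pderiv f) z" if z: "z \<in> Z" for z
  proof -
    have m: "inverse t * z \<in> I.Z" unfolding ZI using z by (rule imageI)
    have e: "I.Z - {inverse t * z} = (\<lambda>z. inverse t * z) ` (Z - {z})"
      unfolding ZI using t0 by auto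
    have "I.ev (pderiv I.f) (inverse t * z) = (\<Prod>y\<in>Z - {z}. inverse t * z - inverse t * y)"
      unfolding I.ev_pderiv_f[OF m] e prod.reindex[OF inj] by simp
    also have "\<dots> = (\<Prod>y\<in>Z - {z}. inverse t) * (\<Prod>y\<in>Z - {z}. z - y)"
      unfolding right_diff_distrib[symmetric] by (rule prod.distrib)
    finally show ?thesis unfolding ev_pderiv_f[OF z] using z finite_Z card_Z by (simp add: card_Diff_singleton)
  qed
  have "P.discr = (\<Prod>z\<in>Z. inverse t ^ (n - 1) * ev (pderiv f) z)"
    unfolding P.discr_def ZI prod.reindex[OF inj] using dI by simp
  also have "\<dots> = inverse t ^ (n * (n - 1)) * emb delta"
    unfolding emb_delta prod.distrib using card_Z by (simp add: power_mult[symmetric] mult.commute)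
  finally have dd: "P.discr = inverse t ^ (n * (n - 1)) * emb delta" .
  have "\<exists>a. (P.discr, a) \<in> \<Gamma> \<and> a \<noteq> 0"
  proof (rule P.discr_unit, rule notI)
    fix z y
    assume zy: "z \<in> I.Z" "y \<in> I.Z" "z \<noteq> y" "P.res z = P.res y"
    have d: "poly (I.spec 0 (pderiv I.f)) (P.res z) = 0" using P.spec_double_root[OF zy(1)] zy(2-4) by auto
    have r: "poly (I.spec 0 I.f) (P.res z) = 0" using P.spec_root zy(1) by blast
    have "e2 + 0 *s (- e1) + P.res z *s Q = e2 + P.res z *s Q" by simp
    then have "special Q (e2 + P.res z *s Q)"
      using d r I.affine_point_nonzero[of 0 "P.res z"] unfolding I.pderiv_aff I.spec_aff meval_dirderiv special_def by simp
    then show False using infinity by blast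
  qed
  then obtain a where a: "(inverse t ^ (n * (n - 1)) * emb delta, a) \<in> \<Gamma>" "a \<noteq> 0" unfolding dd by blast
  define D where "D = degree delta"
  \<comment> \<open>Since \<open>inverse t\<close> specialises to 0, \<open>delta\<close> divided by
    \<open>t ^ D\<close> specialises to its leading coefficient. Division by \<open>t\<close> to the
    power \<open>n * (n - 1)\<close> gives a unit as well, and two different exponents cannot both
    do so.\<close>
  have L: "(inverse t ^ D * emb delta, lead_coeff delta) \<in> \<Gamma>"
  proof -
    have s: "emb delta = (\<Sum>i\<le>D. cst (coeff delta i) * t ^ i)"
    proof -
      have "degree (map_poly cst delta) \<le> D" unfolding D_def by (intro degree_le) (simp add: cst.coeff_map coeff_eq_0 cst.zero)
      then show ?thesis unfolding emb_def by (simp add: poly_altdef_le cst.coeff_map)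
    qed
    have c: "inverse t ^ D * (cst (coeff delta i) * t ^ i) = cst (coeff delta i) * inverse t ^ (D - i)" if "i \<le> D" for i
    proof -
      have "inverse t ^ D = inverse t ^ (D - i) * inverse t ^ i" using that by (simp add: power_add[symmetric])
      moreover have "inverse t ^ i * t ^ i = 1" using t0 by (simp add: power_mult_distrib[symmetric])
      ultimately show ?thesis by (simp add: mult_ac)
    qed
    have e: "inverse t ^ D * emb delta = (\<Sum>i\<le>D. cst (coeff delta i) * inverse t ^ (D - i))"
      unfolding s sum_distrib_left by (intro sum.cong refl c) simp
    have "(\<Sum>i\<le>D. coeff delta i * 0 ^ (D - i)) = (\<Sum>i\<le>D. if i = D then coeff delta D else 0)"
      by (intro sum.cong refl) auto
    then have "(\<Sum>i\<le>D. coeff delta i * 0 ^ (D - i)) = lead_coeff delta" unfolding D_def by simp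
    moreover have "(\<Sum>i\<le>D. cst (coeff delta i) * inverse t ^ (D - i), \<Sum>i\<le>D. coeff delta i * 0 ^ (D - i)) \<in> \<Gamma>"
      by (intro P.sum P.mult P.const P.power it)
    ultimately show ?thesis unfolding e by simp
  qed
  have l0: "lead_coeff delta \<noteq> 0" using delta_nonzero by simp
  have step: False if "i < j" "(inverse t ^ i * x, b) \<in> \<Gamma>" "b \<noteq> 0" "(inverse t ^ j * x, b') \<in> \<Gamma>" "b' \<noteq> 0" for i j x b b'
  proof -
    have e: "inverse t ^ j * x = inverse t ^ (j - i) * (inverse t ^ i * x)"
      using that(1) by (simp add: mult.assoc[symmetric] power_add[symmetric])
    have "(inverse t ^ (j - i) * (inverse t ^ i * x), 0 ^ (j - i) * b) \<in> \<Gamma>"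
      by (intro P.mult P.power it that(2))
    then have "(inverse t ^ j * x, 0) \<in> \<Gamma>" unfolding e[symmetric] using that(1) by (simp add: power_0_left)
    then show False using P.det that(4,5) by blast
  qed
  show ?thesis
    using step[OF _ L l0 a] step[OF _ a L l0] unfolding D_def by (metis linorder_neqE_nat)
qed

lemma special_at_finite:
  assumes v: "hcoords v p" and s: "special Q v"
  obtains t0 z0 where "hcoords (pnt t0 z0) p" "special Q (pnt t0 z0)"
proof -
  have sc: "special Q (c *s v)" if "c \<noteq> 0" for c
    using s that meval_scale[OF hom_F, of c v] grad_scale[OF hom_F, of c v] unfolding special_def by (simp add: dot_scale)
  have "dot (cross e2 Q) v \<noteq> 0"
  proof
    assume 0: "dot (cross e2 Q) v = 0"
    have "vanishes_at F p" using s vanishes_at_iff[OF hom_F v] unfolding special_def by blast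
    then obtain z0 where z0: "hcoords (e2 + z0 *s Q) p" using infinite_line_coords[OF v 0] by blast
    obtain c where "c \<noteq> 0" "e2 + z0 *s Q = c *s v" using hcoords_unique[OF v z0] by blast
    then show False using sc infinity[of z0] by metis
  qed
  then obtain t0 z0 where p: "hcoords (pnt t0 z0) p" using affine_coords[OF v] by blast
  obtain c where "c \<noteq> 0" "pnt t0 z0 = c *s v" using hcoords_unique[OF v p] by blast
  then show ?thesis using that[OF p] sc by metis
qed

definition Sing where "Sing = {(t0, z0). special Q (pnt t0 z0) \<and> grad F (pnt t0 z0) = 0}"
definition Tang where "Tang = {(t0, z0). special Q (pnt t0 z0) \<and> grad F (pnt t0 z0) \<noteq> 0}"

text \<open>Nodes are exactly the singular points of the curve, by \<open>singular_node\<close> and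
  \<open>node_grad\<close>, and a singular point is special for every centre.\<close>

lemma card_Sing: "card (fst ` Sing) = card {p \<in> C. node M \<phi> p}"
proof -
  have "inj_on fst Sing" unfolding Sing_def using special_unique by (auto simp: inj_on_def)
  then have fst: "card (fst ` Sing) = card Sing" by (rule card_image)
  have inj: "inj_on (\<lambda>(t0, z0). abs_proj (pnt t0 z0)) Sing"
  proof (rule inj_onI, clarify)
    fix t0 z0 t1 z1
    assume e: "abs_proj (pnt t0 z0) = abs_proj (pnt t1 z1)"
    obtain c where c: "pnt t1 z1 = c *s pnt t0 z0"
      using hcoords_unique hcoords_abs[OF affine_point_nonzero] e by metis
    have L: "dot (cross e2 Q) (pnt t z) = 1" "dot (cross e1 e2) (pnt t z) = z" "dot (cross Q e1) (pnt t z) = t" for t z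
      by (simp_all add: dot_add dot_scale frame_dots)
    have "c = 1" using arg_cong[OF c, of "dot (cross e2 Q)"] unfolding dot_scale L by simp
    then show "t0 = t1 \<and> z0 = z1"
      using arg_cong[OF c, of "dot (cross e1 e2)"] arg_cong[OF c, of "dot (cross Q e1)"] unfolding dot_scale L by simp
  qed
  have im: "(\<lambda>(t0, z0). abs_proj (pnt t0 z0)) ` Sing = {p \<in> C. node M \<phi> p}"
  proof (intro Set.set_eqI iffI)
    fix p
    assume "p \<in> (\<lambda>(t0, z0). abs_proj (pnt t0 z0)) ` Sing"
    then obtain t0 z0 where 1: "p = abs_proj (pnt t0 z0)" "special Q (pnt t0 z0)" "grad F (pnt t0 z0) = 0"
      unfolding Sing_def by auto
    have "hcoords (pnt t0 z0) p" unfolding 1(1) by (rule hcoords_abs[OF affine_point_nonzero])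
    then have "node M \<phi> p" using singular_node 1(2,3) unfolding special_def by blast
    then show "p \<in> {p \<in> C. node M \<phi> p}" using node_on_curve by blast
  next
    fix p
    assume "p \<in> {p \<in> C. node M \<phi> p}"
    then have p: "p \<in> C" "node M \<phi> p" by blast+
    obtain v where v: "hcoords v p" using hcoords_exists by blast
    have "meval F v = 0" using p(1) C_iff vanishes_at_iff[OF hom_F v] by blast
    then have "special Q v" using hcoords_nz[OF v] node_grad[OF p(2) v] unfolding special_def by (simp add: dot_zero)
    then obtain t0 z0 where t0: "hcoords (pnt t0 z0) p" "special Q (pnt t0 z0)" using special_at_finite[OF v] by blast
    have "(t0, z0) \<in> Sing" unfolding Sing_def using t0(2) node_grad[OF p(2) t0(1)] by blast
    moreover have "p = abs_proj (pnt t0 z0)" using t0(1) unfolding hcoords_def by simp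
    ultimately show "p \<in> (\<lambda>(t0, z0). abs_proj (pnt t0 z0)) ` Sing" by force
  qed
  show ?thesis unfolding fst im[symmetric] card_image[OF inj] ..
qed

lemma Q_hcoords: "hcoords Q (abs_proj Q)"
proof (rule hcoords_abs)
  show "Q \<noteq> 0" using frame_dots(9) by (metis dot_zero(2) zero_neq_one)
qed

lemma tangent_vertical:
  assumes "(t0, z0) \<in> Tang"
  shows "pline (grad F (pnt t0 z0)) = pline (vline t0)"
proof -
  have s: "special Q (pnt t0 z0)" "grad F (pnt t0 z0) \<noteq> 0" using assms unfolding Tang_def by blast+
  have v: "meval F (pnt t0 z0) = 0" "dot (grad F (pnt t0 z0)) Q = 0"
    using s(1) dot_commute[of Q] unfolding special_def by auto
  have "cross (pnt t0 z0) Q \<noteq> 0"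
  proof
    assume "cross (pnt t0 z0) Q = 0"
    then obtain c where c: "Q = c *s pnt t0 z0" using cross_eq_0[OF _ affine_point_nonzero] by blast
    have "meval F Q = c ^ n * meval F (pnt t0 z0)"
      by (rule trans[OF arg_cong[OF c, of "meval F"] meval_scale[OF hom_F]])
    then show False using F_Q v(1) by simp
  qed
  then have "cross (grad F (pnt t0 z0)) (vline t0) = 0"
    using dot_grad[OF hom_F, of "pnt t0 z0"] v
    by (intro perp_pair_parallel[of "pnt t0 z0" Q]) (simp_all only: vline_dots mult_zero_right not_False_eq_True)
  then show ?thesis using pline_eq_iff[OF s(2) vline_nonzero] by blast
qed

text \<open>A branch tangent through \<open>Q\<close> touches at a smooth point, because
  \<open>Q\<close> avoids the tangents at nodes, and it is the vertical line through a special
  point. Conversely \<open>smooth_tangent_exists\<close> supplies a branch over each smooth special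
  point.\<close>

lemma card_Tang:
  "card (fst ` Tang) = card {l. abs_proj Q \<in> l \<and> (\<exists>q\<in>M. branch_tangent M \<phi> q l)}"
proof -
  have im: "{l. abs_proj Q \<in> l \<and> (\<exists>q\<in>M. branch_tangent M \<phi> q l)} = (\<lambda>t0. pline (vline t0)) ` fst ` Tang"
  proof (intro Set.set_eqI iffI)
    fix l
    assume "l \<in> {l. abs_proj Q \<in> l \<and> (\<exists>q\<in>M. branch_tangent M \<phi> q l)}"
    then obtain q where q: "abs_proj Q \<in> l" "q \<in> M" "branch_tangent M \<phi> q l" by blast
    obtain v where v: "hcoords v (\<phi> q)" using hcoords_exists by blast
    have Fv: "meval F v = 0" using vanishes_on_image[of "\<phi> q"] q(2) vanishes_at_iff[OF hom_F v] by blast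
    have g: "grad F v \<noteq> 0"
    proof
      assume "grad F v = 0"
      then show False using node_tangent[OF singular_node[OF v Fv] q(2) refl q(3)] q(1) by blast
    qed
    have tl: "l = pline (grad F w)" if w: "hcoords w (\<phi> q)" "grad F w \<noteq> 0" for w
      by (rule smooth_tangent(1)[OF regular q(2) w(1) hom_F vanishes_on_image w(2) q(3)])
    have "dot Q (grad F v) = 0" using q(1) pline_iff[OF Q_hcoords] tl[OF v g] dot_commute by metis
    then have "special Q v" using Fv hcoords_nz[OF v] unfolding special_def by blast
    then obtain t0 z0 where p: "hcoords (pnt t0 z0) (\<phi> q)" "special Q (pnt t0 z0)" using special_at_finite[OF v] by blast
    obtain c where c: "c \<noteq> 0" "pnt t0 z0 = c *s v" using hcoords_unique[OF v p(1)] by blast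
    have g': "grad F (pnt t0 z0) \<noteq> 0" using g c(1) unfolding c(2) grad_scale[OF hom_F] by simp
    have T: "(t0, z0) \<in> Tang" unfolding Tang_def using p(2) g' by blast
    have "l = pline (vline t0)" using tl[OF p(1) g'] tangent_vertical[OF T] by simp
    then show "l \<in> (\<lambda>t0. pline (vline t0)) ` fst ` Tang" using T by force
  next
    fix l
    assume "l \<in> (\<lambda>t0. pline (vline t0)) ` fst ` Tang"
    then obtain t0 z0 where T: "(t0, z0) \<in> Tang" "l = pline (vline t0)" by force
    have s: "special Q (pnt t0 z0)" "grad F (pnt t0 z0) \<noteq> 0" using T(1) unfolding Tang_def by blast+
    obtain \<Gamma> where "local_curve F n C M \<phi> cst t e1 e2 Q \<Gamma> t0" by (rule local_curve_exists)
    then interpret local_curve F n C M \<phi> cst t e1 e2 Q \<Gamma> t0 .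
    have "poly (spec t0 f) z0 = 0" using s(1) special_pnt by blast
    then obtain z where z: "z \<in> Z" "res z = z0" using spec_root by blast
    have "\<exists>q\<in>M. branch_tangent M \<phi> q (pline (grad F (pnt t0 z0)))"
      by (rule smooth_tangent_exists[OF special_degree[OF s(1) F_Q] z s(2)])
    then have "\<exists>q\<in>M. branch_tangent M \<phi> q l" unfolding tangent_vertical[OF T(1)] T(2) .
    moreover have "abs_proj Q \<in> l" unfolding T(2) pline_iff[OF Q_hcoords] by (rule vline_dots(3))
    ultimately show "l \<in> {l. abs_proj Q \<in> l \<and> (\<exists>q\<in>M. branch_tangent M \<phi> q l)}" by blast
  qed
  have inj: "inj_on (\<lambda>t0. pline (vline t0)) A" for A
  proof (rule inj_onI)
    fix t0 t1
    assume "pline (vline t0) = pline (vline t1)"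
    then obtain c where c: "vline t1 = c *s vline t0" using pline_eq[OF _ vline_nonzero] by blast
    have "c = 1" using arg_cong[OF c, of "\<lambda>a. dot a e2"] unfolding dot_scale vline_dots by simp
    then show "t0 = t1" using arg_cong[OF c, of "\<lambda>a. dot a e1"] unfolding dot_scale vline_dots by simp
  qed
  show ?thesis unfolding im card_image[OF inj] ..
qed

theorem class_formula:
  "n * (n - 1) = card {l. abs_proj Q \<in> l \<and> (\<exists>q\<in>M. branch_tangent M \<phi> q l)} + 2 * card {p \<in> C. node M \<phi> p}"
proof -
  have R: "{x. poly delta x = 0} = fst ` Sing \<union> fst ` Tang"
  proof (intro Set.set_eqI iffI)
    fix t0
    assume "t0 \<in> {x. poly delta x = 0}"
    then have "order t0 delta \<noteq> 0" using order_root[of delta t0] delta_nonzero by simp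
    then have "\<exists>z0. special Q (pnt t0 z0)" by (rule contrapos_np) (blast intro: order_delta_0)
    then show "t0 \<in> fst ` Sing \<union> fst ` Tang" unfolding Sing_def Tang_def by force
  next
    fix t0
    assume "t0 \<in> fst ` Sing \<union> fst ` Tang"
    then obtain z0 where "special Q (pnt t0 z0)" unfolding Sing_def Tang_def by force
    then have "order t0 delta \<noteq> 0" using order_delta_special by auto
    then show "t0 \<in> {x. poly delta x = 0}" using order_root[of delta t0] by simp
  qed
  have disj: "fst ` Sing \<inter> fst ` Tang = {}"
  proof (rule equals0I)
    fix t0
    assume "t0 \<in> fst ` Sing \<inter> fst ` Tang"
    then obtain z0 z1 where "(t0, z0) \<in> Sing" "(t0, z1) \<in> Tang" by force
    then show False using special_unique[of t0 z0 z1] unfolding Sing_def Tang_def by auto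
  qed
  have "finite {x. poly delta x = 0}" by (rule poly_roots_finite[OF delta_nonzero])
  then have fin: "finite (fst ` Sing)" "finite (fst ` Tang)" unfolding R by simp_all
  have "n * (n - 1) = (\<Sum>x | poly delta x = 0. order x delta)"
    using sum_order_roots[OF delta_nonzero] degree_delta by simp
  also have "\<dots> = (\<Sum>x\<in>fst ` Sing. order x delta) + (\<Sum>x\<in>fst ` Tang. order x delta)"
    unfolding R by (rule sum.union_disjoint[OF fin disj])
  also have "(\<Sum>x\<in>fst ` Sing. order x delta) = (\<Sum>x\<in>fst ` Sing. 2)"
    by (intro sum.cong refl) (use order_delta_special in \<open>auto simp: Sing_def\<close>)
  also have "(\<Sum>x\<in>fst ` Tang. order x delta) = (\<Sum>x\<in>fst ` Tang. 1)"
    by (intro sum.cong refl) (use order_delta_special in \<open>auto simp: Tang_def\<close>)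
  finally show ?thesis using card_Sing card_Tang by simp
qed

end

section \<open>Choosing a generic point\<close>

lemma avoid_hyperplanes:
  fixes A :: "('a::field_char_0 ^ 3) set"
  assumes "finite A" "0 \<notin> A" "R \<noteq> 0"
  obtains v where "meval R v \<noteq> 0" "\<And>a. a \<in> A \<Longrightarrow> dot a v \<noteq> 0"
proof -
  have "(\<Prod>a\<in>A. linform a) \<noteq> 0" using assms(1,2) linform_nonzero by (metis prod_zero_iff)
  then have "R * (\<Prod>a\<in>A. linform a) \<noteq> 0" using assms(3) by simp
  then obtain v where v: "meval (R * (\<Prod>a\<in>A. linform a)) v \<noteq> 0" using mpoly3_eq_0 by metis
  then have nz: "meval R v \<noteq> 0" "(\<Prod>a\<in>A. dot a v) \<noteq> 0" by (simp_all add: mev.mult mev.prod meval_linform)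
  have "dot a v \<noteq> 0" if "a \<in> A" for a using nz(2) assms(1) that by (metis prod_zero)
  then show ?thesis using that[OF nz(1)] by blast
qed

definition rep :: "('a::field, 'n::finite) proj \<Rightarrow> 'a ^ 'n" where
  "rep x = (SOME v. hcoords v x)"

lemma hcoords_rep: "hcoords (rep x) x"
  unfolding rep_def by (rule someI_ex) (rule hcoords_exists)

context modelled_curve
begin

lemma finite_node_tangents:
  assumes fin: "finite {p \<in> C. node M \<phi> p}"
  shows "finite {l. \<exists>q\<in>M. node M \<phi> (\<phi> q) \<and> branch_tangent M \<phi> q l}"
proof (rule finite_subset)
  show "{l. \<exists>q\<in>M. node M \<phi> (\<phi> q) \<and> branch_tangent M \<phi> q l}
      \<subseteq> (\<Union>p\<in>{p \<in> C. node M \<phi> p}. {l. \<exists>q\<in>M. \<phi> q = p \<and> branch_tangent M \<phi> q l})"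
    using image by blast
  show "finite (\<Union>p\<in>{p \<in> C. node M \<phi> p}. {l. \<exists>q\<in>M. \<phi> q = p \<and> branch_tangent M \<phi> q l})"
  proof (rule finite_UN_I[OF fin])
    fix p
    assume "p \<in> {p \<in> C. node M \<phi> p}"
    then obtain q1 q2 l1 l2 where q: "{q \<in> M. \<phi> q = p} = {q1, q2}" "nonsingular_branch M \<phi> q1" "nonsingular_branch M \<phi> q2"
      "branch_tangent M \<phi> q1 l1" "branch_tangent M \<phi> q2 l2"
      unfolding node_def by blast
    have "l \<in> {l1, l2}" if l: "q \<in> M" "\<phi> q = p" "branch_tangent M \<phi> q l" for q l
    proof -
      have "q = q1 \<or> q = q2" using q(1) l(1,2) by blast
      then show ?thesis
        using nonsingular_branch_tangent_unique[OF regular l(1) _ l(3)] q(2-5) by blast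
    qed
    then have "{l. \<exists>q\<in>M. \<phi> q = p \<and> branch_tangent M \<phi> q l} \<subseteq> {l1, l2}" by blast
    then show "finite {l. \<exists>q\<in>M. \<phi> q = p \<and> branch_tangent M \<phi> q l}" by (rule finite_subset) simp
  qed
qed

text \<open>\<open>Bad\<close> collects the zeros of the Hessian, the points on the polar of a node
  (where smooth, their tangent passes through that node), and the exceptional points of the
  biduality argument. On a line the Hessian vanishes identically, hence the guards
  \<open>n \<ge> 2\<close>, which \<open>special_degree\<close> provides at special points.\<close>

lemma bad_points:
  assumes fin: "finite {p \<in> C. node M \<phi> p}"
  obtains Bad where "finite Bad"
    "\<forall>x. n \<ge> 2 \<longrightarrow> vanishes_at F x \<longrightarrow> vanishes_at (hessdet F) x \<longrightarrow> x \<in> Bad"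
    "\<forall>p x. n \<ge> 2 \<longrightarrow> node M \<phi> p \<longrightarrow> vanishes_at F x \<longrightarrow> vanishes_at (dirderiv (rep p) F) x \<longrightarrow> x \<in> Bad"
    "\<forall>v v'. n \<ge> 2 \<longrightarrow> v \<noteq> 0 \<longrightarrow> v' \<noteq> 0 \<longrightarrow> meval F v = 0 \<longrightarrow> meval F v' = 0 \<longrightarrow> abs_proj v \<notin> Bad \<longrightarrow> abs_proj v' \<notin> Bad \<longrightarrow>
       det (hess F v) \<noteq> 0 \<longrightarrow> det (hess F v') \<noteq> 0 \<longrightarrow> cross (grad F v) (grad F v') = 0 \<longrightarrow> cross v v' = 0"
proof (cases "n \<ge> 2")
  case n2: True
  obtain B where B: "finite B" "\<forall>v v'. v \<noteq> 0 \<and> v' \<noteq> 0 \<and> meval F v = 0 \<and> meval F v' = 0 \<and> abs_proj v \<notin> B \<and> abs_proj v' \<notin> B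
     \<and> det (hess F v) \<noteq> 0 \<and> det (hess F v') \<noteq> 0 \<and> cross (grad F v) (grad F v') = 0 \<longrightarrow> cross v v' = 0"
    using finite_multitangent[OF n2] by (elim exE conjE)
  define X1 where "X1 = {x. vanishes_at F x \<and> vanishes_at (hessdet F) x}"
  define X2 where "X2 = (\<Union>p\<in>{p \<in> C. node M \<phi> p}. {x. vanishes_at F x \<and> vanishes_at (dirderiv (rep p) F) x})"
  have "finite X1" unfolding X1_def by (rule finite_hessian_zeros[OF n2])
  moreover have "finite X2" unfolding X2_def
    by (intro finite_UN_I fin finite_common_zeros[OF homogeneous_dirderiv[OF hom_F]] polar_nonzero[OF n2]
        hcoords_nz[OF hcoords_rep])
  ultimately have "finite (B \<union> X1 \<union> X2)" using B(1) by simp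
  then show ?thesis
  proof (rule that; intro allI impI)
    show "x \<in> B \<union> X1 \<union> X2" if "vanishes_at F x" "vanishes_at (hessdet F) x" for x
      using that unfolding X1_def by blast
    show "x \<in> B \<union> X1 \<union> X2" if "node M \<phi> p" "vanishes_at F x" "vanishes_at (dirderiv (rep p) F) x" for p x
      using that node_on_curve unfolding X2_def by blast
    show "cross v v' = 0" if "v \<noteq> 0" "v' \<noteq> 0" "meval F v = 0" "meval F v' = 0" "abs_proj v \<notin> B \<union> X1 \<union> X2" "abs_proj v' \<notin> B \<union> X1 \<union> X2"
      "det (hess F v) \<noteq> 0" "det (hess F v') \<noteq> 0" "cross (grad F v) (grad F v') = 0" for v v'
      using B(2) that by blast
  qed
next
  case False
  then show ?thesis using that[of "{}"] by blast
qed

lemma generic_point: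
  assumes U: "zopen U" "U \<noteq> {}" and fin: "finite {p \<in> C. node M \<phi> p}"
    and sing: "\<And>v p. hcoords v p \<Longrightarrow> meval F v = 0 \<Longrightarrow> grad F v = 0 \<Longrightarrow> node M \<phi> p"
  obtains Q where "meval F Q = 1" "abs_proj Q \<in> U"
    "\<forall>v. special Q v \<longrightarrow> grad F v \<noteq> 0 \<longrightarrow> det (hess F v) \<noteq> 0"
    "\<forall>v v'. special Q v \<longrightarrow> special Q v' \<longrightarrow> dot (cross Q v) v' = 0 \<longrightarrow> cross v v' = 0"
    "\<forall>q l. node M \<phi> (\<phi> q) \<longrightarrow> q \<in> M \<longrightarrow> branch_tangent M \<phi> q l \<longrightarrow> abs_proj Q \<notin> l"
proof -
  obtain x0 where x0: "x0 \<in> U" using U(2) by blast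
  obtain u e where u: "homogeneous e u" "\<not> vanishes_at u x0" "\<And>x. x \<notin> U \<Longrightarrow> vanishes_at u x"
    using zopen_form[OF U(1) x0] by blast
  have "u \<noteq> 0" using u(2) by (auto simp: vanishes_at_def mev.zero)
  obtain Bad where Bad_all: "finite Bad"
    "\<forall>x. n \<ge> 2 \<longrightarrow> vanishes_at F x \<longrightarrow> vanishes_at (hessdet F) x \<longrightarrow> x \<in> Bad"
    "\<forall>p x. n \<ge> 2 \<longrightarrow> node M \<phi> p \<longrightarrow> vanishes_at F x \<longrightarrow> vanishes_at (dirderiv (rep p) F) x \<longrightarrow> x \<in> Bad"
    "\<forall>v v'. n \<ge> 2 \<longrightarrow> v \<noteq> 0 \<longrightarrow> v' \<noteq> 0 \<longrightarrow> meval F v = 0 \<longrightarrow> meval F v' = 0 \<longrightarrow> abs_proj v \<notin> Bad \<longrightarrow> abs_proj v' \<notin> Bad \<longrightarrow>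
       det (hess F v) \<noteq> 0 \<longrightarrow> det (hess F v') \<noteq> 0 \<longrightarrow> cross (grad F v) (grad F v') = 0 \<longrightarrow> cross v v' = 0"
    by (rule bad_points[OF fin])
  note Bad = Bad_all[rule_format]
  define N where "N = {p \<in> C. node M \<phi> p}"
  define T where "T = {l. \<exists>q\<in>M. node M \<phi> (\<phi> q) \<and> branch_tangent M \<phi> q l}"
  define eqn where "eqn l = (SOME a. a \<noteq> 0 \<and> l = pline a)" for l :: "('a, 3) proj set"
  have eqn: "eqn l \<noteq> 0" "l = pline (eqn l)" if "l \<in> T" for l
  proof -
    have "\<exists>a. a \<noteq> 0 \<and> l = pline a" using that unfolding T_def branch_tangent_def is_line_def by blast
    then show "eqn l \<noteq> 0" "l = pline (eqn l)" unfolding eqn_def by (metis (mono_tags, lifting) someI_ex)+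
  qed
  \<comment> \<open>The lines that \<open>Q\<close> has to avoid: tangents at bad points, lines
    joining two nodes, and branch tangents at nodes. The zero vectors that are removed come from
    singular bad points and from a node paired with itself.\<close>
  define A where "A = ((\<lambda>x. grad F (rep x)) ` Bad - {0}) \<union> ((\<lambda>(p, p'). cross (rep p) (rep p')) ` (N \<times> N) - {0}) \<union> eqn ` T"
  have "finite A" unfolding A_def N_def T_def using Bad(1) fin finite_node_tangents[OF fin] by simp
  moreover have "0 \<notin> A" unfolding A_def using eqn(1) by auto
  moreover have "F * u \<noteq> 0" using nz \<open>u \<noteq> 0\<close> by simp
  ultimately obtain w where w: "meval (F * u) w \<noteq> 0" "\<And>a. a \<in> A \<Longrightarrow> dot a w \<noteq> 0" using avoid_hyperplanes by metis
  have Fw: "meval F w \<noteq> 0" and uw: "meval u w \<noteq> 0" using w(1) by (simp_all add: mev.mult)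
  obtain c where c: "c \<noteq> 0" "meval F (c *s w) = 1" using normalise_point[OF Fw] by blast
  define Q where "Q = c *s w"
  have FQ: "meval F Q = 1" using c(2) unfolding Q_def .
  have AQ: "dot a Q \<noteq> 0" if "a \<in> A" for a using w(2)[OF that] c(1) unfolding Q_def dot_scale by simp
  have Q0: "Q \<noteq> 0"
  proof
    assume "Q = 0"
    then have "Q = 0 *s w" by simp
    then show False using FQ meval_scale[OF hom_F, of 0 w] n0 by (simp add: power_0_left)
  qed
  have hQ: "hcoords Q (abs_proj Q)" by (rule hcoords_abs[OF Q0])
  have UQ: "abs_proj Q \<in> U"
  proof (rule ccontr)
    assume "abs_proj Q \<notin> U"
    then have "meval u Q = 0" using u(3) vanishes_at_iff[OF u(1) hQ] by blast
    then show False using uw c(1) unfolding Q_def meval_scale[OF u(1)] by simp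
  qed
  have bad: False if s: "special Q v" and g: "grad F v \<noteq> 0" and x: "abs_proj v \<in> Bad" for v
  proof -
    have v0: "v \<noteq> 0" using s unfolding special_def by blast
    obtain b where b: "b \<noteq> 0" "rep (abs_proj v) = b *s v" using hcoords_unique[OF hcoords_abs[OF v0] hcoords_rep] by blast
    have gb: "grad F (rep (abs_proj v)) = b ^ (n - 1) *s grad F v" unfolding b(2) by (rule grad_scale[OF hom_F])
    then have "grad F (rep (abs_proj v)) \<noteq> 0" using g b(1) by simp
    then have "grad F (rep (abs_proj v)) \<in> A" unfolding A_def using x by blast
    then have "dot (grad F (rep (abs_proj v))) Q \<noteq> 0" by (rule AQ)
    then show False using s unfolding gb dot_scale special_def by (simp add: dot_commute)
  qed
  have Fs: "vanishes_at F (abs_proj v)" if "special Q v" for v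
    using that vanishes_at_iff[OF hom_F hcoords_abs] unfolding special_def by blast
  have hes: "det (hess F v) \<noteq> 0" if s: "special Q v" and g: "grad F v \<noteq> 0" for v
  proof
    assume "det (hess F v) = 0"
    moreover have "hcoords v (abs_proj v)" using s hcoords_abs unfolding special_def by blast
    ultimately have "vanishes_at (hessdet F) (abs_proj v)"
      using vanishes_at_iff[OF homogeneous_hessdet[OF hom_F]] by (simp add: meval_hessdet)
    then show False using bad[OF s g] Bad(2)[OF special_degree[OF s FQ] Fs[OF s]] by blast
  qed
  have node_rep: "\<exists>p b. p \<in> N \<and> b \<noteq> 0 \<and> rep p = b *s v" if s: "special Q v" and g: "grad F v = 0" for v
  proof -
    have h: "hcoords v (abs_proj v)" using s hcoords_abs unfolding special_def by blast
    then have "node M \<phi> (abs_proj v)" using sing g s unfolding special_def by blast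
    then have "abs_proj v \<in> N" unfolding N_def using node_on_curve by blast
    then show ?thesis using hcoords_unique[OF h hcoords_rep] by blast
  qed
  have Qv: "cross Q v \<noteq> 0" if s: "special Q v" for v
  proof
    assume "cross Q v = 0"
    then obtain b where "v = b *s Q" using cross_eq_0 Q0 by blast
    moreover have "b \<noteq> 0" using calculation s unfolding special_def by auto
    ultimately show False using s FQ meval_scale[OF hom_F, of b Q] unfolding special_def by simp
  qed
  have gradQ: "dot (grad F v) Q = 0" "dot (grad F v) v = 0" if s: "special Q v" for v
    using s dot_grad[OF hom_F, of v] dot_commute[of Q] unfolding special_def by auto
  have mixed: False if s: "special Q v" "special Q v'" and g: "grad F v \<noteq> 0" "grad F v' = 0" and d: "dot (cross Q v) v' = 0" for v v'
  proof -
    obtain p b where p: "p \<in> N" "b \<noteq> 0" "rep p = b *s v'" using node_rep[OF s(2) g(2)] by blast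
    obtain \<alpha> where \<alpha>: "grad F v = \<alpha> *s cross Q v" using perp_pair[OF Qv[OF s(1)] gradQ[OF s(1)]] by blast
    have "meval (dirderiv (rep p) F) v = 0"
      unfolding meval_dirderiv p(3) \<alpha> dot_scale using d by (simp add: dot_commute)
    moreover have "hcoords v (abs_proj v)" using s hcoords_abs unfolding special_def by blast
    ultimately have "vanishes_at (dirderiv (rep p) F) (abs_proj v)"
      using vanishes_at_iff[OF homogeneous_dirderiv[OF hom_F]] by blast
    then have "abs_proj v \<in> Bad" using Bad(3)[OF special_degree[OF s(1) FQ] _ Fs[OF s(1)]] p(1) unfolding N_def by blast
    then show False using bad[OF s(1) g(1)] by blast
  qed
  have flip: "dot (cross Q v') v = 0" if "dot (cross Q v) v' = 0" for v v'
    using that by (simp add: dot_3 cross_simps algebra_simps)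
  \<comment> \<open>Two special points on a line through \<open>Q\<close>: if both are smooth, they
    share a tangent, excluded by biduality; one smooth and one singular give a tangent through a
    node; two singular ones give a line joining nodes.\<close>
  have col: "cross v v' = 0" if s: "special Q v" "special Q v'" and d: "dot (cross Q v) v' = 0" for v v'
  proof (cases "grad F v = 0")
    case gv: True
    show ?thesis
    proof (cases "grad F v' = 0")
      case True
      show ?thesis
      proof (rule ccontr)
        assume ne: "cross v v' \<noteq> 0"
        obtain p b where p: "p \<in> N" "b \<noteq> 0" "rep p = b *s v" using node_rep[OF s(1) gv] by blast
        obtain p' b' where p': "p' \<in> N" "b' \<noteq> 0" "rep p' = b' *s v'" using node_rep[OF s(2) True] by blast
        have e: "cross (rep p) (rep p') = (b * b') *s cross v v'" unfolding p(3) p'(3) cross_scale by simp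
        then have "cross (rep p) (rep p') \<noteq> 0" using ne p(2) p'(2) by simp
        then have "cross (rep p) (rep p') \<in> A" unfolding A_def using p(1) p'(1) by force
        then have "dot (cross (rep p) (rep p')) Q \<noteq> 0" by (rule AQ)
        then have "dot (cross v v') Q \<noteq> 0" unfolding e dot_scale by simp
        then show False using d by (simp add: dot_3 cross_simps algebra_simps)
      qed
    next
      case False
      then show ?thesis using mixed[OF s(2,1) False gv flip[OF d]] by blast
    qed
  next
    case gv: False
    show ?thesis
    proof (cases "grad F v' = 0")
      case True
      then show ?thesis using mixed[OF s gv True d] by blast
    next
      case gv': False
      have "dot (grad F v') v = 0"
      proof -
        obtain \<alpha> where "grad F v' = \<alpha> *s cross Q v'" using perp_pair[OF Qv[OF s(2)] gradQ[OF s(2)]] by blast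
        then show ?thesis using flip[OF d] by (simp add: dot_scale)
      qed
      then have "cross (grad F v) (grad F v') = 0"
        by (intro perp_pair_parallel[OF Qv[OF s(1)] gradQ[OF s(1)] gradQ(1)[OF s(2)]])
      then show ?thesis
        using Bad(4)[OF special_degree[OF s(1) FQ], of v v'] bad[OF s(1) gv] bad[OF s(2) gv'] hes[OF s(1) gv] hes[OF s(2) gv'] s
        unfolding special_def by blast
    qed
  qed
  have tan: "abs_proj Q \<notin> l" if "node M \<phi> (\<phi> q)" "q \<in> M" "branch_tangent M \<phi> q l" for q l
  proof -
    have l: "l \<in> T" unfolding T_def using that by blast
    then have "eqn l \<in> A" unfolding A_def by blast
    then have "dot (eqn l) Q \<noteq> 0" by (rule AQ)
    then show ?thesis using eqn(2)[OF l] pline_iff[OF hQ, of "eqn l"] by simp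
  qed
  show ?thesis by (rule that[OF FQ UQ]) (use hes col tan in blast)+
qed

lemma generic_frame:
  assumes U: "zopen U" "U \<noteq> {}" and fin: "finite {p \<in> C. node M \<phi> p}"
    and sing: "\<And>v p. hcoords v p \<Longrightarrow> meval F v = 0 \<Longrightarrow> grad F v = 0 \<Longrightarrow> node M \<phi> p"
  shows "\<exists>e1 e2 Q. generic_curve F n C M \<phi> (ratcst :: 'a \<Rightarrow> _) ratvar e1 e2 Q \<and> abs_proj Q \<in> U"
proof -
  obtain Q where Q: "meval F Q = 1" "abs_proj Q \<in> U"
    "\<forall>v. special Q v \<longrightarrow> grad F v \<noteq> 0 \<longrightarrow> det (hess F v) \<noteq> 0"
    "\<forall>v v'. special Q v \<longrightarrow> special Q v' \<longrightarrow> dot (cross Q v) v' = 0 \<longrightarrow> cross v v' = 0"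
    "\<forall>q l. node M \<phi> (\<phi> q) \<longrightarrow> q \<in> M \<longrightarrow> branch_tangent M \<phi> q l \<longrightarrow> abs_proj Q \<notin> l"
    by (rule generic_point[OF assms])
  have hD: "homogeneous (n - 1) (dirderiv Q F)" by (rule homogeneous_dirderiv[OF hom_F])
  have "\<not> F dvd dirderiv Q F"
  proof
    assume "F dvd dirderiv Q F"
    then have "dirderiv Q F = 0" using dvd_small[OF hD] n0 by simp
    then have "dot Q (grad F Q) = 0" unfolding meval_dirderiv[symmetric] by (simp add: mev.zero)
    then show False using dot_grad[OF hom_F, of Q] Q(1) n0 by (simp add: dot_commute)
  qed
  then have finS: "finite {x. vanishes_at F x \<and> vanishes_at (dirderiv Q F) x}"
    by (rule finite_common_zeros[OF hD])
  define S where "S = {x. vanishes_at F x \<and> vanishes_at (dirderiv Q F) x}"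
  \<comment> \<open>The first family keeps special points off the line joining \<open>Q\<close> and
    \<open>e2\<close>; the second keeps \<open>e2\<close> from being proportional to
    \<open>Q\<close>.\<close>
  define A where "A = (\<lambda>x. cross Q (rep x)) ` S \<union> (range (\<lambda>k. cross Q (axis k 1)) - {0})"
  have Q0: "Q \<noteq> 0"
  proof
    assume "Q = 0"
    then have "Q = 0 *s Q" by simp
    then have "meval F Q = 0 ^ n * meval F Q" using meval_scale[OF hom_F, of 0 Q] by metis
    then show False using Q(1) n0 by (simp add: power_0_left)
  qed
  have "finite A" unfolding A_def S_def using finS by simp
  moreover have "0 \<notin> A"
  proof
    assume "0 \<in> A"
    then obtain x where x: "x \<in> S" "cross Q (rep x) = 0" unfolding A_def by auto
    obtain c where "rep x = c *s Q" using cross_eq_0[OF x(2) Q0] by blast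
    moreover have "meval F (rep x) = 0" using x(1) hcoords_rep unfolding S_def vanishes_at_def by blast
    moreover have "c \<noteq> 0" using calculation(1) hcoords_nz[OF hcoords_rep, of x] by auto
    ultimately show False using meval_scale[OF hom_F, of c Q] Q(1) by simp
  qed
  ultimately obtain e2 where e2: "\<And>a. a \<in> A \<Longrightarrow> dot a e2 \<noteq> 0"
    using avoid_hyperplanes[of A F] nz by metis
  have c2: "cross e2 Q \<noteq> 0"
  proof
    assume "cross e2 Q = 0"
    then have "cross Q e2 = 0" using cross_skew[of Q e2] by simp
    then obtain c where c: "e2 = c *s Q" using cross_eq_0 Q0 by blast
    obtain k where "cross Q (axis k 1) \<noteq> 0"
    proof (rule ccontr)
      assume "\<not> thesis"
      then have "cross Q (axis k 1) = 0" for k using that by blast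
      from this[of 1] this[of 2] show False using Q0 by (simp add: vec3_eq_iff cross_simps axis_def)
    qed
    then have "cross Q (axis k 1) \<in> A" unfolding A_def by blast
    then have "dot (cross Q (axis k 1)) e2 \<noteq> 0" by (rule e2)
    then show False unfolding c dot_scale using dot_cross(1)[of Q] by (simp add: dot_commute)
  qed
  obtain e1 where e1: "dot (cross e2 Q) e1 = 1" by (rule frame_complete[OF c2])
  have inf: "\<not> special Q (e2 + z0 *s Q)" for z0
  proof
    assume s: "special Q (e2 + z0 *s Q)"
    define v where "v = e2 + z0 *s Q"
    have v: "v \<noteq> 0" "meval F v = 0" "dot Q (grad F v) = 0" using s unfolding v_def special_def by blast+
    have h: "hcoords v (abs_proj v)" by (rule hcoords_abs[OF v(1)])
    have "abs_proj v \<in> S"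
      unfolding S_def using vanishes_at_iff[OF hom_F h] vanishes_at_iff[OF hD h] v(2,3) by (simp add: meval_dirderiv)
    then have "dot (cross Q (rep (abs_proj v))) e2 \<noteq> 0" by (intro e2) (simp add: A_def)
    moreover obtain c where "rep (abs_proj v) = c *s v" using hcoords_unique[OF h hcoords_rep] by blast
    ultimately have "dot (cross Q v) e2 \<noteq> 0" by (auto simp: cross_scale dot_scale)
    then show False unfolding v_def by (simp add: dot_3 cross_simps algebra_simps)
  qed
  have "framed_curve F n (ratcst :: 'a \<Rightarrow> _) ratvar e1 e2 Q"
    by (intro framed_curve.intro framed_curve_axioms.intro curve_axioms funfield_ratcst Q(1) e1)
  then have "generic_curve F n C M \<phi> (ratcst :: 'a \<Rightarrow> _) ratvar e1 e2 Q"
    using Q(3,4,5) sing inf by (intro generic_curve.intro generic_curve_axioms.intro modelled_curve_axioms) blast+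
  then show ?thesis using Q(2) by blast
qed

end

section \<open>The class formula\<close>

text \<open>The forms that define \<open>C\<close> are multiples of \<open>F\<close>, so
  \<open>C\<close> is the zero set of \<open>F\<close>. If \<open>F\<close> divides
  \<open>G * H\<close>, the zeros of \<open>G\<close> and of \<open>H\<close> cover
  \<open>C\<close>, and irreducibility of \<open>C\<close> gives primeness.\<close>

lemma curve_order_equation:
  fixes C :: "('a::{alg_closed_field, field_char_0}, 3) proj set"
  assumes C: "projective_curve C" and D: "nonsingular_model D \<phi> C" and n: "curve_order C n"
  obtains F where "modelled_curve F n C D \<phi>"
proof -
  obtain F where F: "F \<noteq> 0" "homogeneous n F" "vanishing_ideal C = {G. F dvd G}"
    using n unfolding curve_order_def by blast
  have irr: "irreducible_closed C" using C unfolding projective_curve_def by blast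
  then have cl: "zclosed C" and ne: "C \<noteq> {}" unfolding irreducible_closed_def by blast+
  obtain S where S: "\<forall>f\<in>S. \<exists>e. homogeneous e f" "C = {x. \<forall>f\<in>S. vanishes_at f x}"
    using cl unfolding zclosed_def by blast
  have Cv: "vanishes_at G x" if "x \<in> C" "F dvd G" for x G
  proof -
    have "G \<in> vanishing_ideal C" unfolding F(3) using that(2) by blast
    then show ?thesis using that(1) unfolding vanishing_ideal_def by blast
  qed
  have vC: "x \<in> C" if x: "vanishes_at F x" for x
  proof -
    have "vanishes_at f x" if f: "f \<in> S" for f
    proof -
      have "f \<in> vanishing_ideal C" using f unfolding vanishing_ideal_def S(2) by simp
      then obtain h where h: "f = F * h" unfolding F(3) by (auto simp: dvd_def)
      show ?thesis using x unfolding h vanishes_at_def by (simp add: mev.mult)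
    qed
    then show ?thesis unfolding S(2) by simp
  qed
  have n0: "n > 0"
  proof (rule ccontr)
    assume "\<not> n > 0"
    then obtain c where c: "F = mconst c" using F(2) homogeneous_0_const by auto
    obtain x where x: "x \<in> C" using ne by blast
    obtain v where v: "hcoords v x" using hcoords_exists by blast
    have "meval F v = 0" using Cv[OF x dvd_refl] v unfolding vanishes_at_def by blast
    then have "c = 0" unfolding c by simp
    then show False using F(1) c by (simp add: mconst_simps)
  qed
  have prime: "F dvd G \<or> F dvd H" if G: "homogeneous d G" and H: "homogeneous d' H" and GH: "F dvd G * H" for d G d' H
  proof -
    define A where "A = {x \<in> C. vanishes_at G x}"
    define B where "B = {x \<in> C. vanishes_at H x}"
    have "zclosed A" "zclosed B" unfolding A_def B_def
      by (rule zclosed_insert_form[OF cl G], rule zclosed_insert_form[OF cl H])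
    moreover have "C = A \<union> B"
    proof -
      have "vanishes_at G x \<or> vanishes_at H x" if x: "x \<in> C" for x
      proof -
        obtain v where v: "hcoords v x" using hcoords_exists by blast
        have "meval (G * H) v = 0" using Cv[OF x GH] v unfolding vanishes_at_def by blast
        then show ?thesis using vanishes_at_iff[OF G v] vanishes_at_iff[OF H v] by (simp add: mev.mult)
      qed
      then show ?thesis unfolding A_def B_def by blast
    qed
    ultimately have "C = A \<or> C = B" using irr unfolding irreducible_closed_def by blast
    then have "G \<in> vanishing_ideal C \<or> H \<in> vanishing_ideal C" unfolding A_def B_def vanishing_ideal_def by blast
    then show ?thesis unfolding F(3) by simp
  qed
  have "modelled_curve F n C D \<phi>"
  proof (intro modelled_curve.intro curve.intro modelled_curve_axioms.intro)
    show "zclosed D" using D unfolding nonsingular_model_def projective_curve_def irreducible_closed_def by blast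
    show "x \<in> C \<longleftrightarrow> vanishes_at F x" for x using Cv[of x F] vC[of x] by auto
    show "nonsingular_at D q" if "q \<in> D" for q using D that unfolding nonsingular_model_def by blast
    show "birational_morphism D \<phi> C" using D unfolding nonsingular_model_def by blast
  qed (use F n0 prime in blast)+
  then show ?thesis by (rule that)
qed

text \<open>All elements of the ideal are multiples of \<open>F\<close>, so their gradients vanish
  at \<open>v\<close> and the tangent space of the cone is the whole three-dimensional
  space.\<close>

lemma (in modelled_curve) singular_point:
  assumes v: "hcoords v p" and F: "meval F v = 0" and g: "grad F v = 0"
  shows "\<not> nonsingular_at C p"
proof
  have d: "meval (mderiv i F) v = 0" for i using arg_cong[OF g, of "\<lambda>a. a $ i"] by (simp add: grad_def)
  have "(\<Sum>i\<in>UNIV. meval (mderiv i f) v * w $ i) = 0" if f: "f \<in> vanishing_ideal C" for f w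
  proof -
    obtain h where h: "f = F * h" using f unfolding IC by (auto simp: dvd_def)
    show ?thesis unfolding h mderiv_mult mev.add mev.mult by (simp add: d F)
  qed
  then have W: "{w :: 'a ^ 3. \<forall>f\<in>vanishing_ideal C. (\<Sum>i\<in>UNIV. meval (mderiv i f) v * w $ i) = 0} = UNIV" by blast
  assume "nonsingular_at C p"
  then have "vec.dim {w :: 'a ^ 3. \<forall>f\<in>vanishing_ideal C. (\<Sum>i\<in>UNIV. meval (mderiv i f) v * w $ i) = 0} = 2"
    using v unfolding nonsingular_at_def by simp
  then have "vec.dim (UNIV :: ('a ^ 3) set) = 2" unfolding W .
  then show False unfolding vec_dim_card by simp
qed

theorem theorem4p3:
  fixes C :: "('a::{alg_closed_field, field_char_0}, 3) proj set"
    and D :: "('a, 'n::finite) proj set"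
    and \<phi> :: "('a, 'n) proj \<Rightarrow> ('a, 3) proj"
    and n m d :: nat
  assumes "projective_curve C"
    and "nonsingular_model D \<phi> C"
    and "curve_order C n"
    and "curve_class D \<phi> m"
    and "finite {p \<in> C. node D \<phi> p}"
    and "card {p \<in> C. node D \<phi> p} = d"
    and "\<forall>p\<in>C. \<not> nonsingular_at C p \<longrightarrow> node D \<phi> p"
  shows "n + m + 2 * d = n ^ 2"
proof -
  obtain F where "modelled_curve F n C D \<phi>" by (rule curve_order_equation[OF assms(1-3)])
  then interpret modelled_curve F n C D \<phi> .
  obtain U where U: "zopen U" "U \<noteq> {}"
    "\<forall>Q\<in>U. finite {l. Q \<in> l \<and> (\<exists>q\<in>D. branch_tangent D \<phi> q l)} \<and> card {l. Q \<in> l \<and> (\<exists>q\<in>D. branch_tangent D \<phi> q l)} = m"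
    using assms(4) unfolding curve_class_def by (elim exE conjE)
  have sing: "node D \<phi> p" if v: "hcoords v p" "meval F v = 0" "grad F v = 0" for v p
  proof -
    have "p \<in> C" using C_iff vanishes_at_iff[OF hom_F v(1)] v(2) by blast
    then show ?thesis using assms(7) singular_point[OF v] by blast
  qed
  \<comment> \<open>One generic centre inside \<open>U\<close> is enough, since every point of
    \<open>U\<close> lies on exactly \<open>m\<close> tangents.\<close>
  have "\<exists>e1 e2 Q. generic_curve F n C D \<phi> (ratcst :: 'a \<Rightarrow> _) ratvar e1 e2 Q \<and> abs_proj Q \<in> U"
    by (rule generic_frame[OF U(1,2) assms(5) sing])
  then obtain e1 e2 Q where G: "generic_curve F n C D \<phi> (ratcst :: 'a \<Rightarrow> _) ratvar e1 e2 Q" and QU: "abs_proj Q \<in> U"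
    by blast
  have "card {l. abs_proj Q \<in> l \<and> (\<exists>q\<in>D. branch_tangent D \<phi> q l)} = m"
    using bspec[OF U(3) QU] by (rule conjunct2)
  then have "n * (n - 1) = m + 2 * d" using generic_curve.class_formula[OF G] assms(6) by simp
  moreover have "n ^ 2 = n + n * (n - 1)" using n0 by (cases n) (simp_all add: power2_eq_square)
  ultimately show ?thesis by simp
qed

end
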